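(* Let $\widehat S=(\widehat S_n)_{n\ge 0}$ be the two-dimensional simple random walk conditioned on not hitting the origin, and let $M_n=\inf_{m\ge n}|\widehat S_m|$, $n\ge 0$, be its future minima process. Independently of the starting point of $\widehat S$ in $\mathbb{Z}^2\setminus\{0\}$, the two following results hold. (1) For every $g:\mathbb{R}_+\to\mathbb{R}_+$ non-increasing such that $t\mapsto(\ln t)\,g(\ln\ln t)$ is non-decreasing, $$\mathbb{P}\big[M_n\le e^{(\ln n)\,g(\ln\ln n)}\ \text{for infinitely many } n\big]=0\ \text{ or }\ 1\quad\text{according to}\quad \int^\infty g(u)\,du<\infty\ \text{ or }\ =\infty .$$ (2) The quantity $$K=\limsup_{n\to\infty}\frac{M_n}{\sqrt{n\,\ln\ln\ln n}}$$ is almost surely constant and non-degenerate: $0<K<\infty$.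
   Context: $|\cdot|$ is the Euclidean norm. Let $S=(S_n)_{n\ge 0}$ be the simple (nearest-neighbour, symmetric) random walk on $\mathbb{Z}^2$, and let $$a(x)=\sum_{n\ge 0}\big(\mathbb{P}_0[S_n=0]-\mathbb{P}_0[S_n=x]\big),\qquad x\in\mathbb{Z}^2,$$ be its potential kernel, where $\mathbb{P}_x$ denotes the law of the walk started at $x$. It satisfies $a(0)=0$, $a>0$ and $a$ is harmonic on $\mathbb{Z}^2\setminus\{0\}$. The simple random walk on $\mathbb{Z}^2$ conditioned on not hitting the origin, $\widehat S$, is the Markov chain on $\mathbb{Z}^2\setminus\{0\}$ with transition probabilities $p_{x,y}=\frac{a(y)}{4a(x)}\mathbf{1}_{|x-y|=1}$ (the Doob $h$-transform of $S$ with respect to $a$). $\mathbb{R}_+=[0,\infty)$. The function $t\mapsto(\ln t)g(\ln\ln t)$ is considered for those $t$ for which it makes sense ($t>e$). The notation $\int^\infty g(u)\,du$ refers to convergence or divergence of the integral at $+\infty$. The $\limsup$ is over $n$ large enough for $\ln\ln\ln n$ to be defined and positive. *)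

theory Defs
  imports "HOL-Probability.Probability"
begin

type_synonym site = "int \<times> int"

text \<open>The norm of the product type \<^typ>\<open>real \<times> real\<close> is the Euclidean one.\<close>

definition enorm :: "site \<Rightarrow> real" where
  "enorm x = norm (real_of_int (fst x), real_of_int (snd x))"

definition srw_step :: "site pmf" where
  "srw_step = pmf_of_set {(1, 0), (-1, 0), (0, 1), (0, -1)}"

text \<open>The law of \<open>S\<^sub>n\<close> under \<open>P\<^sub>0\<close>.\<close>

primrec srw :: "nat \<Rightarrow> site pmf" where
  "srw 0 = return_pmf 0"
| "srw (Suc n) = bind_pmf (srw n) (\<lambda>x. map_pmf (\<lambda>e. x + e) srw_step)"

text \<open>For \<open>x\<close> of odd parity the series converges only conditionally, so it has to be read as
  the limit of its partial sums (\<^const>\<open>suminf\<close>), not as an unordered sum.\<close>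

definition potential_kernel :: "site \<Rightarrow> real" where
  "potential_kernel x = (\<Sum>n. pmf (srw n) 0 - pmf (srw n) x)"

definition cond_trans :: "site \<Rightarrow> site \<Rightarrow> real" where
  "cond_trans x y =
     (if enorm (x - y) = 1 then potential_kernel y / (4 * potential_kernel x) else 0)"

text \<open>A time-homogeneous Markov chain with state space \<open>E\<close>, transition probabilities \<open>p\<close> and
  starting point \<open>x\<^sub>0\<close>, on an arbitrary probability space. The Markov property is written in
  product form, so that no conditioning on null events occurs.\<close>

definition markov_chain_from ::
  "'s set \<Rightarrow> ('s \<Rightarrow> 's \<Rightarrow> real) \<Rightarrow> 's \<Rightarrow> 'w measure \<Rightarrow> (nat \<Rightarrow> 'w \<Rightarrow> 's) \<Rightarrow> bool" where
  "markov_chain_from E p x\<^sub>0 M X \<longleftrightarrow>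
     prob_space M \<and>
     (\<forall>n. X n \<in> measurable M (count_space E)) \<and>
     (AE \<omega> in M. X 0 \<omega> = x\<^sub>0) \<and>
     (\<forall>n. \<forall>s :: nat \<Rightarrow> 's. (\<forall>i. s i \<in> E) \<longrightarrow>
        \<P>(\<omega> in M. \<forall>i\<le>Suc n. X i \<omega> = s i) =
        \<P>(\<omega> in M. \<forall>i\<le>n. X i \<omega> = s i) * p (s n) (s (Suc n)))"

definition conditioned_walk_from ::
  "site \<Rightarrow> 'w measure \<Rightarrow> (nat \<Rightarrow> 'w \<Rightarrow> site) \<Rightarrow> bool" where
  "conditioned_walk_from x\<^sub>0 M S \<longleftrightarrow> markov_chain_from (- {0}) cond_trans x\<^sub>0 M S"

definition future_min :: "(nat \<Rightarrow> 'w \<Rightarrow> site) \<Rightarrow> nat \<Rightarrow> 'w \<Rightarrow> real" where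
  "future_min S n \<omega> = (INF m\<in>{n..}. enorm (S m \<omega>))"

text \<open>Convergence and divergence at \<open>+\<infinity>\<close> of the integral of a function that is nonnegative on
  \<open>[0, \<infinity>)\<close>.\<close>

definition integral_converges_at_top :: "(real \<Rightarrow> real) \<Rightarrow> bool" where
  "integral_converges_at_top g \<longleftrightarrow>
     (\<exists>A\<ge>0. (\<integral>\<^sup>+ u. ennreal (g u) * indicator {A..} u \<partial>lborel) < \<infinity>)"

definition integral_diverges_at_top :: "(real \<Rightarrow> real) \<Rightarrow> bool" where
  "integral_diverges_at_top g \<longleftrightarrow>
     (\<forall>A\<ge>0. (\<integral>\<^sup>+ u. ennreal (g u) * indicator {A..} u \<partial>lborel) = \<infinity>)"

end

(*
  Write a for the potential kernel and S for the conditioned walk. In the rotated coordinates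
  x1 + x2, x1 - x2 the simple walk is a pair of independent one-dimensional walks, so binomial
  estimates give a(x) = kap * ln |x| + O(1). Since S is the h-transform with respect to a, 1/a is a
  martingale for S off the neighbours of the origin: from x the ball of radius r is hit with
  probability about ln r / ln |x|, and a ball is never revisited from its outside with probability
  about 1 - ln r / ln |x|.

  (1) At time n the walk is at distance sqrt n up to factors that do not matter on the logarithmic
  scale, so M_n <= exp (ln n * g (ln ln n)) has probability about g (ln ln n). Convergence is the
  Borel-Cantelli lemma along n = exp (exp k); divergence uses that excursions between the spheres of
  radii exp (4^k) are independent up to constants.

  (2) The upper bound: staying beyond s * sqrt n from time n on costs exp (-s^2/8) for the distance,
  times 1 / ln n for never returning, which is summable along n = 2^k for s^2 of order ln ln ln n.
  The lower bound: on leaving the ball of radius rho_k = (J + 2)^(2k) the walk may make J fast moves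
  outwards (which costs exp (-O(J))) and then never come back (which costs 1 / (k ln J)). With each fast
  move weighted by the inverse of its probability, the second moment of the number of successful scales
  is comparable to the square of the first, so that with probability bounded below some scale k up to
  exp (exp (O(J))) succeeds. Both bounds hold on the same deterministic scale, and the limsup is
  invariant under time shifts, hence constant by a zero-one law: a shift-invariant event that is almost
  decided by a finite path is, unless null, nearly certain from some far point, and every far point is
  hit with probability bounded below.
*)

theory Submission
  imports Defs "HOL-Real_Asymp.Real_Asymp"
begin

subsection \<open>Transition probabilities of the simple random walk\<close>

text \<open>The statement allows any probability space, but the Markov arguments and the zero-one
  law compare all starting points. So everything is proved for one family of laws
  \<open>PP x\<close> on path space and carried back by \<open>walk_law\<close>. The origin needs
  care throughout: the simple walk may cross it, the conditioned walk may not, so expectations for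
  the two are related by inequalities, with the visits to 0 as error. The obstacle in (2) is that a
  fast move has a probability depending on the position, and the product over J moves is
  exponentially small. The inverse weights give scale k a first moment of order 1/(k ln J), at the
  price of weights up to 64^J. Scales j < k have mixed moments of order 1/(j (k - j) (ln J)^2),
  whose double sum is of the order of the squared first moment; the diagonal is absorbed once the
  harmonic sum exceeds \<open>64 ^ J * lbase J\<close>. So about exp
  (\<open>64 ^ J * lbase J\<close>) scales are used, and at the corresponding times ln ln ln n is at
  most of order J, while J fast moves gain a factor of order sqrt J over the diffusive
  distance.\<close>

definition avg :: "(site \<Rightarrow> real) \<Rightarrow> site \<Rightarrow> real" where
  "avg f x = (f (x + (1,0)) + f (x + (-1,0)) + f (x + (0,1)) + f (x + (0,-1))) / 4"

definition srw_prob :: "nat \<Rightarrow> site \<Rightarrow> real" where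
  "srw_prob n x = pmf (srw n) x"

lemma srw_prob_0: "srw_prob 0 x = (if x = 0 then 1 else 0)"
  by (simp add: srw_prob_def pmf_return)

text \<open>The definition appends the last step; commuting the two binds conditions on that step,
  and the symmetry of the step set turns x - e into x + e.\<close>

lemma srw_prob_Suc: "srw_prob (Suc n) x = avg (srw_prob n) x"
proof -
  have "srw (Suc n) = bind_pmf srw_step (\<lambda>e. map_pmf (\<lambda>x. x + e) (srw n))"
    by (simp add: map_pmf_def bind_commute_pmf[of "srw n"])
  moreover have "pmf (map_pmf (\<lambda>x. x + e) (srw n)) x = pmf (srw n) (x - e)" for e
  proof -
    have "pmf (map_pmf (\<lambda>x. x + e) (srw n)) ((\<lambda>x. x + e) (x - e)) = pmf (srw n) (x - e)"
      by (rule pmf_map_inj') (auto simp: inj_def)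
    then show ?thesis by simp
  qed
  ultimately have "pmf (srw (Suc n)) x = (\<Sum>e\<in>{(1, 0), (-1, 0), (0, 1), (0, -1)}. pmf (srw n) (x - e)) / 4"
    by (simp add: pmf_bind srw_step_def integral_pmf_of_set del: srw.simps)
  moreover have "x - (1,0) = x + (-1,0)" "x - (-1,0) = x + (1,0)" 
    "x - (0,1) = x + (0,-1)" "x - (0,-1) = x + (0,1)"
    by (cases x; simp)+
  ultimately show ?thesis
    by (simp add: srw_prob_def avg_def del: srw.simps)
qed

lemma srw_prob_nonneg: "srw_prob n x \<ge> 0" by (simp add: srw_prob_def)
lemma srw_prob_le_1: "srw_prob n x \<le> 1" by (simp add: srw_prob_def pmf_le_1)

section \<open>The one-dimensional walk: central binomial probabilities and Gaussian bounds\<close>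

primrec bw :: "nat \<Rightarrow> int \<Rightarrow> real" where
  "bw 0 u = (if u = 0 then 1 else 0)"
| "bw (Suc n) u = (bw n (u - 1) + bw n (u + 1)) / 2"

text \<open>In the rotated coordinates \<open>x\<^sub>1 + x\<^sub>2\<close> and \<open>x\<^sub>1 - x\<^sub>2\<close> the walk consists of two independent
  one-dimensional walks.\<close>

lemma srw_prob_eq_bw: "srw_prob n x = bw n (fst x + snd x) * bw n (fst x - snd x)"
proof (induction n arbitrary: x)
  case 0
  then show ?case by (auto simp: srw_prob_0 prod_eq_iff)
next
  case (Suc n)
  show ?case by (simp add: srw_prob_Suc avg_def Suc algebra_simps)
qed

lemma bw_nonneg: "bw n u \<ge> 0"
  by (induction n arbitrary: u) auto

lemma bw_uminus: "bw n (- u) = bw n u"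
proof (induction n arbitrary: u)
  case (Suc n)
  have "- u - 1 = - (u + 1)" "- u + 1 = - (u - 1)" by auto
  then show ?case by (simp only: bw.simps Suc add.commute)
qed auto

lemma bw_outside: "\<bar>u\<bar> > int n \<Longrightarrow> bw n u = 0"
  by (induction n arbitrary: u) auto

lemma bw_parity: "odd (int n + u) \<Longrightarrow> bw n u = 0"
  by (induction n arbitrary: u) auto

lemma bw_choose: "bw n (2 * int k - int n) = real (n choose k) / 2 ^ n"
proof (induction n arbitrary: k)
  case 0
  then show ?case by (cases k) auto
next
  case (Suc n)
  show ?case
  proof (cases k)
    case 0
    have "bw n (- int n - 2) = 0" by (rule bw_outside) auto
    moreover have "bw n (- int n) = 1 / 2 ^ n" using Suc[of 0] by simp
    ultimately show ?thesis using 0 by (simp add: algebra_simps)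
  next
    case (Suc j)
    have "2 * int k - int (Suc n) - 1 = 2 * int j - int n" 
      "2 * int k - int (Suc n) + 1 = 2 * int k - int n" using Suc by auto
    then have "bw (Suc n) (2 * int k - int (Suc n)) = (bw n (2 * int j - int n) + bw n (2 * int k - int n)) / 2"
      by (simp only: bw.simps)
    also have "\<dots> = (real (n choose j) / 2 ^ n + real (n choose k) / 2 ^ n) / 2"
      by (simp add: Suc.IH)
    finally show ?thesis using Suc by (simp add: field_simps)
  qed
qed

text \<open>Consecutive binomial coefficients have ratio (m - k)/(m + k + 1). Without division the
  identity also covers k \<ge> m, where both sides vanish.\<close>

lemma bw_ratio: "bw (2*m) (2 * int (Suc k)) * real (m + k + 1) = bw (2*m) (2 * int k) * (real m - real k)"
proof (cases "k < m")
  case True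
  have e: "bw (2*m) (2 * int j) = real ((2*m) choose (m + j)) / 2 ^ (2*m)" for j
    using bw_choose[of "2*m" "m+j"] by simp
  have "(m + k + 1) * ((2*m) choose (m + k + 1)) = (m - k) * ((2*m) choose (m + k))"
    using binomial_absorb_comp[of "2*m" "m+k"] binomial_absorption[of "m+k" "2*m"] True
    by (simp add: algebra_simps) 
  then have "real (m + k + 1) * real ((2*m) choose (m + k + 1)) = (real m - real k) * real ((2*m) choose (m + k))"
    using True by (metis of_nat_mult of_nat_diff less_imp_le)
  then show ?thesis unfolding e by (simp add: field_simps)
next
  case False
  have "bw (2*m) (2 * int (Suc k)) = 0" by (rule bw_outside) (use False in auto)
  moreover have "k = m \<or> bw (2*m) (2 * int k) = 0" using False by (auto intro: bw_outside)
  ultimately show ?thesis by auto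
qed

text \<open>This is (2m choose m)/4^m; its square is the return probability of the planar walk at
  time 2m.\<close>

definition cbw :: "nat \<Rightarrow> real" where "cbw m = bw (2*m) 0"

lemma cbw_0: "cbw 0 = 1" by (simp add: cbw_def)

lemma cbw_pos: "cbw m > 0"
  using bw_choose[of "2*m" m] by (simp add: cbw_def)

lemma cbw_Suc: "cbw (Suc m) = cbw m * (real (2*m+1) / real (2*m+2))"
proof -
  have r: "bw (2*m) 2 * real (m+1) = cbw m * real m"
    using bw_ratio[of m 0] by (simp add: cbw_def)
  have "cbw (Suc m) = (bw (2*m) (-2) + 2 * bw (2*m) 0 + bw (2*m) 2) / 4"
    by (simp add: cbw_def field_simps)
  also have "\<dots> = (cbw m + bw (2*m) 2) / 2" using bw_uminus[of "2*m" 2] by (simp add: cbw_def)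
  also have "bw (2*m) 2 = cbw m * real m / real (m+1)"
    using r by (simp add: field_simps)
  finally show ?thesis by (simp add: field_simps)
qed

text \<open>The ratio of neighbouring terms is 1 - (2k+1)/(m+k+1), at most exp (-(2k+1)/(2m)) for k
  < m, and the first k odd numbers add up to k^2.\<close>

lemma bw_gauss_upper: "m \<ge> 1 \<Longrightarrow> bw (2*m) (2 * int k) \<le> cbw m * exp (- (real k)\<^sup>2 / (2 * real m))"
proof (induction k)
  case 0
  then show ?case by (simp add: cbw_def)
next
  case (Suc k)
  show ?case
  proof (cases "k < m")
    case True
    have "bw (2*m) (2 * int (Suc k)) = bw (2*m) (2 * int k) * ((real m - real k) / real (m + k + 1))"
      using bw_ratio[of m k] by (simp add: field_simps)
    also have "\<dots> \<le> (cbw m * exp (- (real k)\<^sup>2 / (2 * real m))) * exp (- (2 * real k + 1) / (2 * real m))"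
    proof (rule mult_mono[OF Suc.IH[OF Suc.prems]])
      have "(real m - real k) / real (m + k + 1) = 1 + (- ((2 * real k + 1) / real (m + k + 1)))"
        by (simp add: field_simps)
      also have "\<dots> \<le> exp (- ((2 * real k + 1) / real (m + k + 1)))" by (rule exp_ge_add_one_self)
      also have "\<dots> \<le> exp (- (2 * real k + 1) / (2 * real m))"
        using True unfolding minus_divide_left[symmetric] exp_le_cancel_iff neg_le_iff_le
          by (intro divide_left_mono) auto
      finally show "(real m - real k) / real (m + k + 1) \<le> exp (- (2 * real k + 1) / (2 * real m))" .
    qed (use True cbw_pos[of m] in \<open>auto intro: less_imp_le\<close>)
    also have "\<dots> = cbw m * exp (- (real k)\<^sup>2 / (2 * real m) + - (2 * real k + 1) / (2 * real m))"
      by (simp only: exp_add mult.assoc)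
    also have "- (real k)\<^sup>2 / (2 * real m) + - (2 * real k + 1) / (2 * real m) = - (real (Suc k))\<^sup>2 / (2 * real m)"
      by (simp add: add_divide_distrib[symmetric] power2_eq_square algebra_simps)
    finally show ?thesis .
  next
    case False
    then have "bw (2*m) (2 * int (Suc k)) = 0" by (intro bw_outside) auto
    then show ?thesis using cbw_pos[of m] by simp
  qed
qed

text \<open>The same product, now with (1-s)(1-t) \<ge> 1-s-t. A linear loss k^2/m suffices: with a
  prefactor of order 1/m it makes differences of the planar heat kernel of order |x|^2/m^2, which is
  summable.\<close>

lemma bw_gauss_lower: "m \<ge> 1 \<Longrightarrow> bw (2*m) (2 * int k) \<ge> cbw m * (1 - (real k)\<^sup>2 / real m)"
proof (induction k)
  case 0
  then show ?case by (simp add: cbw_def)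
next
  case (Suc k)
  show ?case
  proof (cases "(real (Suc k))\<^sup>2 < real m")
    case True
    have km: "k < m"
    proof -
      have "0 \<le> real k * real k" "0 \<le> real k" by simp_all
      then have "0 < 1 + (real k + real k * real k)" by linarith
      then have "real k < (real (Suc k))\<^sup>2" by (simp add: power2_eq_square algebra_simps)
      then show ?thesis using True by linarith
    qed
    have k2: "(real k)\<^sup>2 \<le> real m" using True
      by (smt (verit) power_mono of_nat_0_le_iff of_nat_Suc)
    define s where "s = (real k)\<^sup>2 / real m"
    have s: "0 \<le> s" "s \<le> 1" using k2 Suc.prems by (auto simp: s_def field_simps)
    define t where "t = (2 * real k + 1) / real (m + k + 1)"
    have t: "0 \<le> t" "t \<le> 1" using km by (auto simp: t_def field_simps)
    have tt: "t \<le> (2 * real k + 1) / real m"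
      unfolding t_def using Suc.prems by (intro divide_left_mono) auto
    have "1 - (real (Suc k))\<^sup>2 / real m = 1 - s - (2 * real k + 1) / real m"
      by (simp add: s_def add_divide_distrib[symmetric] power2_eq_square algebra_simps)
    also have "\<dots> \<le> 1 - s - t" using tt by simp
    also have "\<dots> \<le> (1 - s) * (1 - t)" using s t by (simp add: algebra_simps)
    finally have "cbw m * (1 - (real (Suc k))\<^sup>2 / real m) \<le> (cbw m * (1 - s)) * (1 - t)"
      using cbw_pos[of m] by (simp add: mult.assoc)
    also have "\<dots> \<le> bw (2*m) (2 * int k) * (1 - t)"
      using Suc.IH[OF Suc.prems] t by (intro mult_right_mono) (auto simp: s_def)
    also have "\<dots> = bw (2*m) (2 * int (Suc k))"
      using bw_ratio[of m k] by (simp add: t_def field_simps)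
    finally show ?thesis .
  next
    case False
    then have "1 - (real (Suc k))\<^sup>2 / real m \<le> 0" using Suc.prems by (simp add: field_simps)
    then have "cbw m * (1 - (real (Suc k))\<^sup>2 / real m) \<le> 0"
      using cbw_pos[of m] by (simp add: mult_le_0_iff)
    then show ?thesis using bw_nonneg[of "2*m" "2 * int (Suc k)"] by linarith
  qed
qed

text \<open>By the ratio in \<open>cbw_Suc\<close>, m times the square of \<open>cbw m\<close>
  increases, while (m + 1/2) times it decreases and stays above. The supremum of the first sequence
  separates the two.\<close>

lemma wallis_bounds:
  obtains L :: real where "L > 0" "L \<le> 1" "\<And>m. real m * (cbw m)\<^sup>2 \<le> L" "\<And>m. L \<le> (real m + 1/2) * (cbw m)\<^sup>2"
proof -
  define u where "u m = real m * (cbw m)\<^sup>2" for m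
  define v where "v m = (real m + 1/2) * (cbw m)\<^sup>2" for m
  have u: "u m \<le> u (Suc m)" for m
  proof -
    have "real m * (real (2*m+2))\<^sup>2 \<le> (real m + 1) * (real (2*m+1))\<^sup>2"
      by (simp add: algebra_simps power2_eq_square)
    then have "real m \<le> (real m + 1) * (real (2*m+1) / real (2*m+2))\<^sup>2"
      by (simp add: power_divide pos_le_divide_eq)
    then have "real m * (cbw m)\<^sup>2 \<le> (real m + 1) * (real (2*m+1) / real (2*m+2))\<^sup>2 * (cbw m)\<^sup>2"
      by (rule mult_right_mono) simp
    then show ?thesis unfolding u_def cbw_Suc power_mult_distrib by (simp add: mult_ac add_ac)
  qed
  have v: "v (Suc m) \<le> v m" for m
  proof -
    have "(real m + 1 + 1/2) * (real (2*m+1))\<^sup>2 \<le> (real m + 1/2) * (real (2*m+2))\<^sup>2"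
      by (simp add: algebra_simps power2_eq_square)
    then have "(real m + 1 + 1/2) * (real (2*m+1) / real (2*m+2))\<^sup>2 \<le> real m + 1/2"
      by (simp add: power_divide pos_divide_le_eq)
    then have "(real m + 1 + 1/2) * (real (2*m+1) / real (2*m+2))\<^sup>2 * (cbw m)\<^sup>2 \<le> (real m + 1/2) * (cbw m)\<^sup>2"
      by (rule mult_right_mono) simp
    then show ?thesis unfolding v_def cbw_Suc power_mult_distrib by (simp add: mult_ac add_ac)
  qed
  have uv: "u m \<le> v m" for m by (simp add: u_def v_def algebra_simps)
  have um: "m \<le> n \<Longrightarrow> u m \<le> u n" for m n by (rule lift_Suc_mono_le[of u]) (auto intro: u)
  have vm: "m \<le> n \<Longrightarrow> v n \<le> v m" for m n by (rule lift_Suc_antimono_le[of v]) (auto intro: v)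
  have all: "u m \<le> v n" for m n
    using um[of m "max m n"] uv[of "max m n"] vm[of n "max m n"] by simp
  define L where "L = (SUP m. u m)"
  have bdd: "bdd_above (range u)" by (rule bdd_aboveI[of _ "v 0"]) (auto intro: all)
  have uL: "u m \<le> L" for m unfolding L_def by (rule cSUP_upper[OF _ bdd]) simp
  have vL: "L \<le> v n" for n unfolding L_def by (rule cSUP_least) (auto intro: all)
  have "0 < u 1" using cbw_pos[of 1] by (simp add: u_def)
  then have "L > 0" using uL[of 1] by linarith
  moreover have "L \<le> 1" using vL[of 0] by (simp add: v_def cbw_0)
  ultimately show ?thesis using uL vL by (intro that[of L]) (auto simp: u_def v_def)
qed

section \<open>Averages over the four neighbours and the Euclidean norm on the lattice\<close>

definition steps :: "site set" where "steps = {(1,0), (-1,0), (0,1), (0,-1)}"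

lemma finite_steps [simp]: "finite steps" by (simp add: steps_def)

lemma avg_eq_sum: "avg f x = (\<Sum>e\<in>steps. f (x + e)) / 4"
  by (simp add: avg_def steps_def)

lemma avg_mono: "(\<And>e. e \<in> steps \<Longrightarrow> f (x + e) \<le> g (x + e)) \<Longrightarrow> avg f x \<le> avg g x"
  unfolding avg_eq_sum by (intro divide_right_mono sum_mono) auto

lemma avg_cong: "(\<And>e. e \<in> steps \<Longrightarrow> f (x + e) = g (x + e)) \<Longrightarrow> avg f x = avg g x"
  unfolding avg_eq_sum by simp

lemma avg_const [simp]: "avg (\<lambda>_. c) x = c" by (simp add: avg_def)

lemma avg_diff: "avg (\<lambda>y. f y - g y) x = avg f x - avg g x" by (simp add: avg_def algebra_simps add_divide_distrib diff_divide_distrib)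
lemma avg_add: "avg (\<lambda>y. f y + g y) x = avg f x + avg g x" by (simp add: avg_def algebra_simps add_divide_distrib diff_divide_distrib)
lemma avg_mult: "avg (\<lambda>y. c * f y) x = c * avg f x" by (simp add: avg_def algebra_simps)

lemma tendsto_avg:
  assumes "\<And>e. e \<in> steps \<Longrightarrow> (\<lambda>N. F N (x + e)) \<longlonglongrightarrow> f (x + e)"
  shows "(\<lambda>N. avg (F N) x) \<longlonglongrightarrow> avg f x"
  unfolding avg_eq_sum by (rule tendsto_divide[OF tendsto_sum[OF assms] tendsto_const]) auto

lemma enorm_sq: "(enorm x)\<^sup>2 = (real_of_int (fst x))\<^sup>2 + (real_of_int (snd x))\<^sup>2"
  by (simp add: enorm_def norm_Pair)

lemma enorm_nonneg [simp]: "enorm x \<ge> 0" by (simp add: enorm_def)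

lemma enorm_zero [simp]: "enorm 0 = 0" by (simp add: enorm_def)

lemma enorm_eq_0 [simp]: "enorm x = 0 \<longleftrightarrow> x = 0"
  by (auto simp: enorm_def zero_prod_def prod_eq_iff)

lemma enorm_triangle: "enorm (x + y) \<le> enorm x + enorm y"
  unfolding enorm_def using norm_triangle_ineq[of "(real_of_int (fst x), real_of_int (snd x))" "(real_of_int (fst y), real_of_int (snd y))"]
  by simp

lemma enorm_uminus: "enorm (- x) = enorm x"
  by (simp add: enorm_def norm_Pair)

lemma enorm_minus_commute: "enorm (x - y) = enorm (y - x)"
  using enorm_uminus[of "x - y"] by simp

lemma enorm_sq_int: "(enorm x)\<^sup>2 = real_of_int ((fst x)\<^sup>2 + (snd x)\<^sup>2)"
  by (simp add: enorm_sq)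

lemma enorm_ge_1: "x \<noteq> 0 \<Longrightarrow> enorm x \<ge> 1"
proof -
  assume "x \<noteq> 0"
  then have "(fst x)\<^sup>2 + (snd x)\<^sup>2 \<noteq> 0" by (auto simp: prod_eq_iff)
  then have "(fst x)\<^sup>2 + (snd x)\<^sup>2 \<ge> 1"
    by (smt (verit) zero_le_power2)
  then have "(enorm x)\<^sup>2 \<ge> 1" unfolding enorm_sq_int by linarith
  then show ?thesis using enorm_nonneg power2_le_imp_le[of 1 "enorm x"] by simp
qed

lemma enorm_step [simp]: "e \<in> steps \<Longrightarrow> enorm e = 1"
  by (auto simp: steps_def enorm_def norm_Pair)

lemma enorm_eq_1_iff: "enorm z = 1 \<longleftrightarrow> z \<in> steps"
proof
  assume "enorm z = 1"
  then have "real_of_int ((fst z)\<^sup>2 + (snd z)\<^sup>2) = 1" using enorm_sq_int[of z] by simp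
  then have *: "(fst z)\<^sup>2 + (snd z)\<^sup>2 = 1" using of_int_eq_1_iff by blast
  then have "(fst z)\<^sup>2 \<le> 1" "(snd z)\<^sup>2 \<le> 1" by (smt (verit) zero_le_power2)+
  then have "\<bar>fst z\<bar> \<le> 1" "\<bar>snd z\<bar> \<le> 1" by (auto simp: abs_square_le_1)
  then have "fst z \<in> {-1,0,1}" "snd z \<in> {-1,0,1}" by auto
  then show "z \<in> steps" using * by (cases z) (auto simp: steps_def)
qed simp

lemma enorm_step_le: "e \<in> steps \<Longrightarrow> enorm (x + e) \<le> enorm x + 1"
  using enorm_triangle[of x e] by simp

lemma enorm_step_ge: "e \<in> steps \<Longrightarrow> enorm (x + e) \<ge> enorm x - 1"
  using enorm_triangle[of "x + e" "- e"] by (simp add: enorm_uminus)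

subsection \<open>Logarithmic growth of the potential kernel\<close>

abbreviation "even_site x \<equiv> even (fst x + snd x)"

lemma even_site_step: "e \<in> steps \<Longrightarrow> even_site (x + e) \<longleftrightarrow> \<not> even_site x"
  by (auto simp: steps_def)

text \<open>At even sites both rotated coordinates are even, and by symmetry they may be taken as 2k
  and 2l with natural k, l, the form used by the binomial bounds. The rotation scales the norm by
  sqrt 2.\<close>

lemma even_site_coords:
  assumes "even_site x"
  obtains k l where "\<And>m. srw_prob (2*m) x = bw (2*m) (2 * int k) * bw (2*m) (2 * int l)"
    "(enorm x)\<^sup>2 = 2 * ((real k)\<^sup>2 + (real l)\<^sup>2)"
proof -
  obtain s where s: "fst x + snd x = 2 * s" using assms by blast
  have t: "fst x - snd x = 2 * (s - snd x)" using s by simp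
  define t where "t = s - snd x"
  have b: "bw (2*m) (2 * u) = bw (2*m) (2 * int (nat \<bar>u\<bar>))" for m u
    using bw_uminus[of "2*m" "2*u"] by (cases "u \<ge> 0") auto
  have x12: "real_of_int (fst x) = real_of_int s + real_of_int t" "real_of_int (snd x) = real_of_int s - real_of_int t"
    using s by (auto simp: t_def simp flip: of_int_add)
  have "(enorm x)\<^sup>2 = 2 * ((real_of_int s)\<^sup>2 + (real_of_int t)\<^sup>2)"
    unfolding enorm_sq x12 by (simp add: power2_eq_square algebra_simps)
  moreover have "srw_prob (2*m) x = bw (2*m) (2 * int (nat \<bar>s\<bar>)) * bw (2*m) (2 * int (nat \<bar>t\<bar>))" for m
    unfolding srw_prob_eq_bw s t t_def[symmetric] by (rule arg_cong2[where f = "(*)", OF b b])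
  moreover have "(real (nat \<bar>u\<bar>))\<^sup>2 = (real_of_int u)\<^sup>2" for u by simp
  ultimately show ?thesis by (intro that[of "nat \<bar>s\<bar>" "nat \<bar>t\<bar>"]) simp_all
qed

lemma srw_prob_parity: "odd (int n + fst x + snd x) \<Longrightarrow> srw_prob n x = 0"
  unfolding srw_prob_eq_bw using bw_parity[of n "fst x + snd x"] by (simp add: add.assoc)

lemma srw_prob_0_cbw: "srw_prob (2*m) 0 = (cbw m)\<^sup>2"
  by (simp add: srw_prob_eq_bw cbw_def power2_eq_square)

text \<open>The Wallis constant is a parameter here; \<open>kap\<close> later fixes one choice, so
  that all bounds speak of the same constant.\<close>

locale wallis =
  fixes L :: real
  assumes L_pos: "L > 0" and L_le_1: "L \<le> 1"
    and upper: "real m * (cbw m)\<^sup>2 \<le> L" and lower: "L \<le> (real m + 1/2) * (cbw m)\<^sup>2"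
begin

lemma cbw_sq_le: "m \<ge> 1 \<Longrightarrow> (cbw m)\<^sup>2 \<le> L / real m"
  using upper[of m] by (simp add: field_simps)

lemma cbw_sq_ge: "(cbw m)\<^sup>2 \<ge> L / (real m + 1)"
proof -
  have "(real m + 1/2) * (cbw m)\<^sup>2 \<le> (real m + 1) * (cbw m)\<^sup>2" by (intro mult_right_mono) auto
  then have "L \<le> (real m + 1) * (cbw m)\<^sup>2" using lower[of m] by linarith
  then show ?thesis by (simp add: pos_divide_le_eq mult.commute)
qed

lemma srw_prob_even_le:
  assumes "even_site x" "m \<ge> 1"
  shows "srw_prob (2*m) x \<le> L / real m * exp (- (enorm x)\<^sup>2 / (4 * real m))"
proof -
  obtain k l where kl: "srw_prob (2*m) x = bw (2*m) (2 * int k) * bw (2*m) (2 * int l)"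
    "(enorm x)\<^sup>2 = 2 * ((real k)\<^sup>2 + (real l)\<^sup>2)" using even_site_coords[OF assms(1)] by metis
  have "srw_prob (2*m) x \<le> (cbw m * exp (- (real k)\<^sup>2 / (2 * real m))) * (cbw m * exp (- (real l)\<^sup>2 / (2 * real m)))"
    unfolding kl using assms cbw_pos[of m]
    by (intro mult_mono bw_gauss_upper) (auto intro: less_imp_le bw_nonneg)
  also have "\<dots> = (cbw m)\<^sup>2 * exp (- (real k)\<^sup>2 / (2 * real m) + - (real l)\<^sup>2 / (2 * real m))"
    unfolding exp_add by (simp add: power2_eq_square mult_ac)
  also have "- (real k)\<^sup>2 / (2 * real m) + - (real l)\<^sup>2 / (2 * real m) = - (enorm x)\<^sup>2 / (4 * real m)"
    using assms by (simp add: kl field_simps)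
  also have "(cbw m)\<^sup>2 * exp (- (enorm x)\<^sup>2 / (4 * real m)) \<le> L / real m * exp (- (enorm x)\<^sup>2 / (4 * real m))"
    by (rule mult_right_mono[OF cbw_sq_le[OF assms(2)]]) simp
  finally show ?thesis .
qed

text \<open>The leading term of order 1/m cancels in the difference; what remains is of order
  |x|^2/m^2 and can be summed over m.\<close>

lemma srw_prob_even_diff:
  assumes "even_site x" "m \<ge> 1"
  shows "0 \<le> srw_prob (2*m) 0 - srw_prob (2*m) x"
    and "srw_prob (2*m) 0 - srw_prob (2*m) x \<le> L * ((enorm x)\<^sup>2 / 2) / (real m)\<^sup>2"
proof -
  obtain k l where kl: "srw_prob (2*m) x = bw (2*m) (2 * int k) * bw (2*m) (2 * int l)"
    "(enorm x)\<^sup>2 = 2 * ((real k)\<^sup>2 + (real l)\<^sup>2)" using even_site_coords[OF assms(1)] by metis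
  have le: "bw (2*m) (2 * int j) \<le> cbw m" for j
  proof -
    have "bw (2*m) (2 * int j) \<le> cbw m * exp (- (real j)\<^sup>2 / (2 * real m))"
      by (rule bw_gauss_upper[OF assms(2)])
    also have "\<dots> \<le> cbw m * 1" using cbw_pos[of m] by (intro mult_left_mono) auto
    finally show ?thesis by simp
  qed
  show "0 \<le> srw_prob (2*m) 0 - srw_prob (2*m) x"
    unfolding kl srw_prob_0_cbw power2_eq_square
    using mult_mono[OF le[of k] le[of l]] bw_nonneg cbw_pos[of m] by (simp add: less_imp_le)
  define s t where "s = (real k)\<^sup>2 / real m" and "t = (real l)\<^sup>2 / real m"
  have st: "s \<ge> 0" "t \<ge> 0" by (auto simp: s_def t_def)
  have "(cbw m)\<^sup>2 * (1 - s - t) \<le> srw_prob (2*m) x"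
  \<comment> \<open>Outside this range a factor 1 - s or 1 - t is negative and the two lower bounds
    cannot be multiplied, but there 1 - s - t is negative as well.\<close>
  proof (cases "s \<le> 1 \<and> t \<le> 1")
    case True
    have "(cbw m)\<^sup>2 * (1 - s - t) \<le> (cbw m)\<^sup>2 * ((1 - s) * (1 - t))"
      using st by (intro mult_left_mono) (auto simp: algebra_simps)
    also have "\<dots> = (cbw m * (1 - s)) * (cbw m * (1 - t))" by (simp add: power2_eq_square)
    also have "\<dots> \<le> srw_prob (2*m) x" unfolding kl
      using bw_gauss_lower[OF assms(2)] True cbw_pos[of m] bw_nonneg
      by (intro mult_mono) (auto simp: s_def t_def less_imp_le)
    finally show ?thesis .
  next
    case False
    then have "(cbw m)\<^sup>2 * (1 - s - t) \<le> 0" using st by (intro mult_nonneg_nonpos) auto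
    then show ?thesis using srw_prob_nonneg[of "2*m" x] by linarith
  qed
  then have "srw_prob (2*m) 0 - srw_prob (2*m) x \<le> (cbw m)\<^sup>2 * (s + t)"
    unfolding srw_prob_0_cbw by (simp add: algebra_simps)
  also have "\<dots> \<le> (L / real m) * (s + t)" using st by (intro mult_right_mono cbw_sq_le assms) auto
  also have "\<dots> = L * ((enorm x)\<^sup>2 / 2) / (real m)\<^sup>2"
    unfolding s_def t_def kl(2) using assms(2) by (simp add: power2_eq_square field_simps)
  finally show "srw_prob (2*m) 0 - srw_prob (2*m) x \<le> L * ((enorm x)\<^sup>2 / 2) / (real m)\<^sup>2" .
qed

lemma sum_cbw_upper: "q \<ge> 1 \<Longrightarrow> (\<Sum>m<Suc q. (cbw m)\<^sup>2) \<le> 1 + L * (1 + ln (real q))"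
proof (induction q rule: nat_induct_at_least)
  case base
  then show ?case using cbw_sq_le[of 1] by (simp add: cbw_0)
next
  case (Suc q)
  have "ln (real q / real (Suc q)) \<le> real q / real (Suc q) - 1"
    using Suc by (intro ln_le_minus_one) auto
  then have "1 / real (Suc q) \<le> ln (real (Suc q)) - ln (real q)"
    using Suc by (simp add: ln_div field_simps)
  then have "L * (1 / real (Suc q)) \<le> L * (ln (real (Suc q)) - ln (real q))"
    using L_pos by (intro mult_left_mono) auto
  then have "(cbw (Suc q))\<^sup>2 \<le> L * (ln (real (Suc q)) - ln (real q))"
    using cbw_sq_le[of "Suc q"] by simp
  then show ?case using Suc by (simp add: algebra_simps)
qed

lemma sum_cbw_lower: "(\<Sum>m<M. (cbw m)\<^sup>2) \<ge> L * ln (real (Suc M))"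
proof (induction M)
  case (Suc M)
  have "ln (real (Suc (Suc M)) / real (Suc M)) \<le> real (Suc (Suc M)) / real (Suc M) - 1"
    by (intro ln_le_minus_one) auto
  then have "ln (real (Suc (Suc M))) - ln (real (Suc M)) \<le> 1 / real (Suc M)"
    by (simp add: ln_div field_simps)
  then have "L * (ln (real (Suc (Suc M))) - ln (real (Suc M))) \<le> L * (1 / real (Suc M))"
    using L_pos by (intro mult_left_mono) auto
  also have "\<dots> \<le> (cbw M)\<^sup>2" using cbw_sq_ge[of M] by (simp add: add.commute)
  finally show ?case using Suc by (simp add: algebra_simps)
qed simp

text \<open>The series is cut at m = q = |x|^2/2. Up to q the terms are return probabilities, with
  sum L ln q + O(1), minus q terms of size at most 2L/q; beyond q the bound L q/m^2 adds at most L.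
  The bound by 1 is the term n = 0 alone.\<close>

lemma kernel_even:
  assumes x: "even_site x" "x \<noteq> 0"
  shows "summable (\<lambda>n. srw_prob n 0 - srw_prob n x)"
    and "\<bar>potential_kernel x - 2 * L * ln (enorm x)\<bar> \<le> 4"
    and "potential_kernel x \<ge> 1"
proof -
  obtain k l where kl: "(enorm x)\<^sup>2 = 2 * ((real k)\<^sup>2 + (real l)\<^sup>2)" using even_site_coords[OF x(1)] by metis
  define q where "q = k\<^sup>2 + l\<^sup>2"
  have q: "(enorm x)\<^sup>2 = 2 * real q" by (simp add: q_def kl)
  have q1: "q \<ge> 1" using x(2) q by (cases q) auto
  define f where "f n = srw_prob n 0 - srw_prob n x" for n
  define g where "g m = f (2*m)" for m
  have f_odd: "f n = 0" if "odd n" for n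
    using that x(1) srw_prob_parity[of n 0] srw_prob_parity[of n x] by (auto simp: f_def)
  have g0: "g 0 = 1" using x by (simp add: g_def f_def srw_prob_0)
  have g_nonneg: "g m \<ge> 0" for m
    using g0 srw_prob_even_diff(1)[OF x(1), of m] by (cases "m = 0") (auto simp: g_def f_def)
  have f_nonneg: "f n \<ge> 0" for n
    using g_nonneg f_odd by (cases "even n") (auto simp: g_def elim!: evenE)
  have g_le: "g m \<le> L * real q / (real m)\<^sup>2" if "m \<ge> 1" for m
    using srw_prob_even_diff(2)[OF x(1) that] q by (simp add: g_def f_def)
  have pairs: "(\<Sum>n<2*M. f n) = (\<Sum>m<M. g m)" for M
    by (induction M) (auto simp: g_def f_odd)
  have bound: "(\<Sum>m<Suc q+j. g m) \<le> 1 + L * (1 + ln (real q)) + L * real q * (1 / real q - 1 / real (q + j))" for j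
  proof (induction j)
    case 0
    have "(\<Sum>m<Suc q. g m) \<le> (\<Sum>m<Suc q. (cbw m)\<^sup>2)"
      by (rule sum_mono) (auto simp: g_def f_def srw_prob_0_cbw srw_prob_nonneg)
    also note sum_cbw_upper[OF q1]
    finally show ?case by simp
  next
    case (Suc j)
    have "g (Suc q + j) \<le> L * real q / (real (Suc q + j))\<^sup>2" by (rule g_le) simp
    also have "\<dots> = L * real q * (1 / (real (Suc q + j))\<^sup>2)" by simp
    also have "1 / (real (Suc q + j))\<^sup>2 \<le> 1 / real (q + j) - 1 / real (q + Suc j)"
    proof -
      have "1 / (real (Suc q + j))\<^sup>2 \<le> 1 / (real (q + j) * real (q + Suc j))"
        using q1 by (intro divide_left_mono) (auto simp: power2_eq_square intro!: mult_mono mult_pos_pos)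
      also have "\<dots> = 1 / real (q + j) - 1 / real (q + Suc j)"
        using q1 by (simp add: field_simps)
      finally show ?thesis .
    qed
    finally have "g (Suc q + j) \<le> L * real q * (1 / real (q + j) - 1 / real (q + Suc j))"
      using L_pos by (simp add: mult_left_mono)
    then show ?case using Suc by (simp add: algebra_simps)
  qed
  have bound': "(\<Sum>n<N. f n) \<le> 1 + L * (1 + ln (real q)) + L" for N
  proof -
    have "(\<Sum>n<N. f n) \<le> (\<Sum>n<2*(Suc q + N). f n)"
      by (rule sum_mono2) (auto intro: f_nonneg)
    also have "\<dots> = (\<Sum>m<Suc q+N. g m)" by (rule pairs)
    also note bound[of N]
    also have "L * real q * (1 / real q - 1 / real (q + N)) \<le> L * real q * (1 / real q)"
      using L_pos by (intro mult_left_mono) auto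
    also have "\<dots> = L" using q1 by simp
    finally show ?thesis by simp
  qed
  show sm: "summable (\<lambda>n. srw_prob n 0 - srw_prob n x)"
    using summableI_nonneg_bounded[of f, OF f_nonneg bound'] unfolding f_def .
  have sm': "summable f" using sm by (simp add: f_def[abs_def])
  have a: "potential_kernel x = suminf f"
    by (simp add: potential_kernel_def f_def[abs_def] srw_prob_def)
  have up: "potential_kernel x \<le> 1 + L * (1 + ln (real q)) + L"
    unfolding a by (rule suminf_le_const[OF sm' bound'])
  \<comment> \<open>Time is eliminated from the heat kernel bound: exp (-t) \<le> 1/t trades the
    factor 1/m for 1/q.\<close>
  have small: "srw_prob (2*m) x \<le> 2 * L / real q" for m
  proof (cases "m = 0")
    case True
    then show ?thesis using x L_pos by (simp add: srw_prob_0)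
  next
    case False
    define t where "t = real q / (2 * real m)"
    have t: "t > 0" using q1 False by (simp add: t_def)
    have "t \<le> exp t" using exp_ge_add_one_self[of t] by linarith
    then have "exp (-t) \<le> 1 / t" using t by (simp add: exp_minus field_simps)
    moreover have "srw_prob (2*m) x \<le> L / real m * exp (- t)"
      using srw_prob_even_le[OF x(1), of m] False by (simp add: q t_def)
    moreover have "L / real m \<ge> 0" using L_pos by simp
    ultimately have "srw_prob (2*m) x \<le> L / real m * (1 / t)"
      by (meson mult_left_mono order_trans)
    then show ?thesis using False by (simp add: t_def mult.commute)
  qed
  have "L * ln (real q) \<le> L * ln (real (Suc (Suc q)))" using L_pos q1 by simp
  also have "\<dots> \<le> (\<Sum>m<Suc q. (cbw m)\<^sup>2)" by (rule sum_cbw_lower)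
  also have "\<dots> = (\<Sum>m<Suc q. g m + srw_prob (2*m) x)"
    by (simp add: g_def f_def srw_prob_0_cbw)
  also have "\<dots> = (\<Sum>m<Suc q. g m) + (\<Sum>m<Suc q. srw_prob (2*m) x)" by (rule sum.distrib)
  also have "(\<Sum>m<Suc q. srw_prob (2*m) x) \<le> (\<Sum>m<Suc q. if m = 0 then 0 else 2 * L / real q)"
    using small x by (intro sum_mono) (auto simp: srw_prob_0)
  also have "\<dots> = real q * (2 * L / real q)" by (subst sum.lessThan_Suc_shift) simp
  also have "\<dots> = 2 * L" using q1 by simp
  also have "(\<Sum>m<Suc q. g m) \<le> potential_kernel x"
    unfolding pairs[symmetric] a by (rule sum_le_suminf[OF sm']) (auto intro: f_nonneg)
  finally have lo: "L * ln (real q) \<le> potential_kernel x + 2 * L" by simp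
  have "ln (real q) = 2 * ln (enorm x) - ln 2"
  proof -
    have "2 * ln (enorm x) = ln ((enorm x)\<^sup>2)" using enorm_ge_1[OF x(2)] by (simp add: ln_realpow)
    then show ?thesis using q q1 by (simp add: ln_mult)
  qed
  then have "L * ln (real q) = 2 * L * ln (enorm x) - L * ln 2" by (simp add: right_diff_distrib)
  moreover have "0 \<le> L * ln 2" using L_pos by simp
  moreover have "L * ln 2 \<le> 1 * 1" using L_pos L_le_1 ln_le_minus_one[of 2] by (intro mult_mono) auto
  ultimately show "\<bar>potential_kernel x - 2 * L * ln (enorm x)\<bar> \<le> 4"
    using up lo L_pos L_le_1 distrib_left[of L 1 "ln (real q)"] by linarith
  have "f 0 \<le> suminf f" using sum_le_suminf[OF sm', of "{0}"] f_nonneg by simp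
  then show "potential_kernel x \<ge> 1" using g0 by (simp add: a g_def)
qed

lemma srw_prob_le: "srw_prob n x \<le> 4 / (real n + 1)"
proof -
  have even: "srw_prob (2*m) x \<le> 1 / real m" if "m \<ge> 1" for m x
  proof (cases "even_site x")
    case True
    have "srw_prob (2*m) x \<le> L / real m * exp (- (enorm x)\<^sup>2 / (4 * real m))"
      using srw_prob_even_le True that by blast
    also have "\<dots> \<le> 1 / real m * 1" using L_pos L_le_1
      by (intro mult_mono divide_right_mono) auto
    finally show ?thesis by simp
  next
    case False
    then show ?thesis using srw_prob_parity[of "2*m" x] by auto
  qed
  obtain m where m: "n = 2 * m \<or> n = Suc (2 * m)" by (metis evenE oddE Suc_eq_plus1)
  show ?thesis
  proof (cases "m = 0")
    case True
    have "1 \<le> 4 / (real n + 1)" using m True by auto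
    then show ?thesis using srw_prob_le_1[of n x] by linarith
  next
    case False
    then have m1: "m \<ge> 1" by simp
    have "srw_prob n x \<le> 1 / real m"
      using m
    proof
      assume n: "n = Suc (2 * m)"
      have "avg (srw_prob (2*m)) x \<le> avg (\<lambda>_. 1 / real m) x"
        by (rule avg_mono) (rule even[OF m1])
      then show ?thesis by (simp only: n srw_prob_Suc avg_const)
    qed (use even[OF m1] in simp)
    also have "\<dots> \<le> 4 / (real n + 1)" using m m1 by (auto simp: field_simps)
    finally show ?thesis .
  qed
qed

text \<open>The heat kernel bound maximised over time. Odd times are one average away from even
  ones: for |x| \<ge> 2 the neighbours are at distance at least |x|/2, which costs a factor 4, and
  for smaller |x| the right side exceeds 1.\<close>

lemma srw_prob_le_norm:
  assumes "x \<noteq> 0"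
  shows "srw_prob n x \<le> 16 / (enorm x)\<^sup>2"
proof -
  have even: "srw_prob (2*m) x \<le> 4 / (enorm x)\<^sup>2" if "x \<noteq> 0" for m x
  proof (cases "even_site x \<and> m \<ge> 1")
    case True
    define t where "t = (enorm x)\<^sup>2 / (4 * real m)"
    have t: "t > 0" using that True by (simp add: t_def)
    have "t \<le> exp t" using exp_ge_add_one_self[of t] by linarith
    then have "exp (-t) \<le> 1 / t" using t by (simp add: exp_minus field_simps)
    moreover have "L / real m \<le> 1 / real m" using L_le_1 by (intro divide_right_mono) auto
    moreover have "srw_prob (2*m) x \<le> L / real m * exp (- t)"
      using srw_prob_even_le[of x m] True by (simp add: t_def)
    moreover have "L / real m * exp (-t) \<le> 1 / real m * (1 / t)"
      using calculation by (intro mult_mono) auto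
    ultimately have "srw_prob (2*m) x \<le> 1 / real m * (1 / t)" by linarith
    then show ?thesis using True by (simp add: t_def)
  next
    case False
    have "srw_prob (2*m) x = 0"
    proof (cases "m = 0")
      case True
      then show ?thesis using that by (simp add: srw_prob_0)
    next
      case m: False
      then have "odd (int (2*m) + fst x + snd x)" using False by auto
      then show ?thesis by (rule srw_prob_parity)
    qed
    then show ?thesis by simp
  qed
  have e1: "enorm x \<ge> 1" by (rule enorm_ge_1[OF assms])
  obtain m where "n = 2 * m \<or> n = Suc (2 * m)" by (metis evenE oddE Suc_eq_plus1)
  then show ?thesis
  proof
    assume "n = 2 * m"
    have "4 / (enorm x)\<^sup>2 \<le> 16 / (enorm x)\<^sup>2" by (simp add: divide_right_mono)
    then show ?thesis using even[OF assms, of m] \<open>n = 2 * m\<close> by simp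
  next
    assume n: "n = Suc (2 * m)"
    show ?thesis
    proof (cases "enorm x \<ge> 2")
      case True
      have "avg (srw_prob (2*m)) x \<le> avg (\<lambda>_. 16 / (enorm x)\<^sup>2) x"
      proof (rule avg_mono)
        fix e assume e: "e \<in> steps"
        have ge: "enorm (x + e) \<ge> enorm x / 2" using enorm_step_ge[OF e, of x] True by simp
        then have ne: "x + e \<noteq> 0" using e1 by (metis enorm_zero half_gt_zero_iff not_le order_less_le_trans zero_less_one)
        then have "srw_prob (2*m) (x + e) \<le> 4 / (enorm (x + e))\<^sup>2" by (rule even)
        also have "\<dots> \<le> 4 / (enorm x / 2)\<^sup>2"
        proof (rule divide_left_mono)
          show "(enorm x / 2)\<^sup>2 \<le> (enorm (x + e))\<^sup>2" using ge e1 by (intro power_mono) auto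
          then show "0 < (enorm (x + e))\<^sup>2 * (enorm x / 2)\<^sup>2" using assms ne by simp
        qed simp
        finally show "srw_prob (2*m) (x + e) \<le> 16 / (enorm x)\<^sup>2" by (simp add: power_divide)
      qed
      then show ?thesis by (simp only: n srw_prob_Suc avg_const)
    next
      case False
      then have "(enorm x)\<^sup>2 \<le> 2\<^sup>2" by (intro power_mono) auto
      moreover have "(enorm x)\<^sup>2 > 0" using assms by simp
      ultimately have "1 \<le> 16 / (enorm x)\<^sup>2" by (simp add: pos_le_divide_eq)
      then show ?thesis using srw_prob_le_1[of n x] by linarith
    qed
  qed
qed

text \<open>One step of the walk inside the partial sums. The limit gives harmonicity off the origin
  and, for odd x, the convergence itself, because all neighbours of x are even.\<close>

lemma partial_kernel_Suc:
  "(\<Sum>n<Suc N. srw_prob n 0 - srw_prob n x)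
    = avg (\<lambda>y. \<Sum>n<N. srw_prob n 0 - srw_prob n y) x + srw_prob N 0 - (if x = 0 then 1 else 0)"
proof (induction N)
  case 0
  then show ?case by (simp add: srw_prob_0 avg_def)
next
  case (Suc N)
  have "avg (\<lambda>y. \<Sum>n<Suc N. srw_prob n 0 - srw_prob n y) x
      = avg (\<lambda>y. (\<Sum>n<N. srw_prob n 0 - srw_prob n y) + (srw_prob N 0 - srw_prob N y)) x"
    by (simp only: sum.lessThan_Suc)
  also have "\<dots> = avg (\<lambda>y. \<Sum>n<N. srw_prob n 0 - srw_prob n y) x + avg (\<lambda>y. srw_prob N 0 - srw_prob N y) x"
    by (rule avg_add)
  also have "avg (\<lambda>y. srw_prob N 0 - srw_prob N y) x = srw_prob N 0 - srw_prob (Suc N) x"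
    unfolding avg_def srw_prob_Suc by argo
  finally have 1: "avg (\<lambda>y. \<Sum>n<Suc N. srw_prob n 0 - srw_prob n y) x = avg (\<lambda>y. \<Sum>n<N. srw_prob n 0 - srw_prob n y) x + (srw_prob N 0 - srw_prob (Suc N) x)" .
  have "(\<Sum>n<Suc (Suc N). srw_prob n 0 - srw_prob n x)
      = (\<Sum>n<Suc N. srw_prob n 0 - srw_prob n x) + (srw_prob (Suc N) 0 - srw_prob (Suc N) x)"
    by (rule sum.lessThan_Suc)
  then show ?case using Suc 1 by linarith
qed

lemma kernel_even_sums:
  "even_site x \<Longrightarrow> (\<lambda>N. \<Sum>n<N. srw_prob n 0 - srw_prob n x) \<longlonglongrightarrow> potential_kernel x"
  using summable_LIMSEQ[OF kernel_even(1)[of x]]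
  by (cases "x = 0") (simp_all add: potential_kernel_def srw_prob_def)

lemma srw_prob_0_tendsto: "(\<lambda>n. srw_prob n x) \<longlonglongrightarrow> 0"
proof (rule tendsto_sandwich[OF _ _ tendsto_const])
  show "(\<lambda>n. 4 / (real n + 1)) \<longlonglongrightarrow> 0" by real_asymp
qed (auto simp: srw_prob_nonneg srw_prob_le)

lemma kernel_sums: "(\<lambda>N. \<Sum>n<N. srw_prob n 0 - srw_prob n x) \<longlonglongrightarrow> potential_kernel x"
proof (cases "even_site x")
  case False
  have "(\<lambda>N. avg (\<lambda>y. \<Sum>n<N. srw_prob n 0 - srw_prob n y) x + srw_prob N 0 - (if x = 0 then 1 else 0))
    \<longlonglongrightarrow> avg potential_kernel x + 0 - (if x = 0 then 1 else 0)"
    by (intro tendsto_diff tendsto_add tendsto_avg tendsto_const srw_prob_0_tendsto kernel_even_sums)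
      (use False even_site_step in blast)
  then have "(\<lambda>N. \<Sum>n<Suc N. srw_prob n 0 - srw_prob n x) \<longlonglongrightarrow> avg potential_kernel x + 0 - (if x = 0 then 1 else 0)"
    by (simp only: partial_kernel_Suc)
  then have *: "(\<lambda>N. \<Sum>n<N. srw_prob n 0 - srw_prob n x) \<longlonglongrightarrow> avg potential_kernel x + 0 - (if x = 0 then 1 else 0)"
    by (rule LIMSEQ_imp_Suc)
  then have "(\<lambda>n. srw_prob n 0 - srw_prob n x) sums (avg potential_kernel x + 0 - (if x = 0 then 1 else 0))"
    by (simp add: sums_def)
  then have "potential_kernel x = avg potential_kernel x + 0 - (if x = 0 then 1 else 0)"
    unfolding potential_kernel_def srw_prob_def[symmetric] by (rule sums_unique[symmetric])
  then show ?thesis using * by simp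
qed (rule kernel_even_sums)

lemma kernel_avg: "avg potential_kernel x = potential_kernel x + (if x = 0 then 1 else 0)"
proof -
  have "(\<lambda>N. avg (\<lambda>y. \<Sum>n<N. srw_prob n 0 - srw_prob n y) x + srw_prob N 0 - (if x = 0 then 1 else 0))
    \<longlonglongrightarrow> avg potential_kernel x + 0 - (if x = 0 then 1 else 0)"
    by (intro tendsto_diff tendsto_add tendsto_avg tendsto_const srw_prob_0_tendsto kernel_sums)
  moreover have "(\<lambda>N. \<Sum>n<Suc N. srw_prob n 0 - srw_prob n x) \<longlonglongrightarrow> potential_kernel x"
    by (rule LIMSEQ_Suc[OF kernel_sums])
  ultimately show ?thesis by (auto simp only: partial_kernel_Suc dest: LIMSEQ_unique)
qed

lemma kernel_zero: "potential_kernel 0 = 0"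
  by (simp add: potential_kernel_def)

text \<open>An odd site takes the average over its four even neighbours, of which at most one is the
  origin; the other three contribute at least 1 each.\<close>

lemma kernel_ge: "x \<noteq> 0 \<Longrightarrow> potential_kernel x \<ge> 3/4"
proof (cases "even_site x")
  case False
  assume "x \<noteq> 0"
  have e: "even_site (x + e)" if "e \<in> steps" for e using even_site_step[OF that, of x] False by simp
  have k: "potential_kernel (x + e) \<ge> 1 - (if e = - x then 1 else 0)" if "e \<in> steps" for e

  proof (cases "e = - x")
    case True
    then show ?thesis by (simp add: kernel_zero)
  next
    case False
    then have "x + e \<noteq> 0" by (metis minus_unique)
    then show ?thesis using kernel_even(3)[OF e[OF that]] False by simp
  qed
  have "(\<Sum>e\<in>steps. 1 - (if e = - x then 1 else 0)) \<le> (\<Sum>e\<in>steps. potential_kernel (x + e))"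
    by (rule sum_mono) (rule k)
  moreover have "(\<Sum>e\<in>steps. 1 - (if e = - x then 1 else 0)) \<ge> (3::real)"
    by (auto simp: sum_subtractf sum.delta steps_def)
  ultimately show ?thesis using kernel_avg[of x] \<open>x \<noteq> 0\<close> by (simp add: avg_eq_sum)
qed (use kernel_even(3)[of x] in auto)

text \<open>A step changes ln |x| by at most ln 2 \<le> 1 and the main term by at most 2, so the
  error 4 at the even neighbours becomes 6 at an odd site. The neighbour 0 occurs only for |x| = 1,
  where the main term is 0.\<close>

lemma kernel_asymp:
  assumes "x \<noteq> 0"
  shows "\<bar>potential_kernel x - 2 * L * ln (enorm x)\<bar> \<le> 6"
proof (cases "even_site x")
  case False
  have bd: "\<bar>potential_kernel (x + e) - 2 * L * ln (enorm x)\<bar> \<le> 6" if "e \<in> steps" for e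
  proof (cases "x + e = 0")
    case True
    then have "x = - e" by (simp add: eq_neg_iff_add_eq_0)
    then have "enorm x = 1" using that by (simp add: enorm_uminus)
    then show ?thesis using True kernel_zero by simp
  next
    case ne: False
    have e: "even_site (x + e)" using even_site_step[OF that, of x] False by simp
    have k: "\<bar>potential_kernel (x + e) - 2 * L * ln (enorm (x + e))\<bar> \<le> 4" by (rule kernel_even(2)[OF e ne])
    have "enorm (x + e) \<ge> 1" "enorm x \<ge> 1" using enorm_ge_1 ne assms by auto
    moreover have "enorm (x + e) \<le> 2 * enorm x" "enorm x \<le> 2 * enorm (x + e)"
      using enorm_step_le[OF that, of x] enorm_step_ge[OF that, of x] calculation by auto
    ultimately have "ln (enorm (x+e)) \<le> ln 2 + ln (enorm x)" "ln (enorm x) \<le> ln 2 + ln (enorm (x + e))"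
      by (auto simp flip: ln_mult_pos)
    then have "\<bar>ln (enorm (x+e)) - ln (enorm x)\<bar> \<le> 1" using ln_le_minus_one[of 2] by auto
    then have "2 * L * \<bar>ln (enorm (x+e)) - ln (enorm x)\<bar> \<le> 2 * 1 * 1"
      using L_pos L_le_1 by (intro mult_mono) auto
    then have "\<bar>2 * L * ln (enorm (x+e)) - 2 * L * ln (enorm x)\<bar> \<le> 2"
      using L_pos by (simp add: abs_mult flip: right_diff_distrib)
    then show ?thesis using k by linarith
  qed
  have "avg potential_kernel x \<le> avg (\<lambda>_. 2 * L * ln (enorm x) + 6) x"
    by (rule avg_mono) (use bd in \<open>simp add: abs_le_iff algebra_simps\<close>)
  moreover have "avg (\<lambda>_. 2 * L * ln (enorm x) - 6) x \<le> avg potential_kernel x"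
    by (rule avg_mono) (use bd in \<open>simp add: abs_le_iff algebra_simps\<close>)
  ultimately show ?thesis using kernel_avg[of x] assms by (simp add: abs_le_iff)
qed (use kernel_even(2)[of x] assms in auto)

end

lemma wallis_exists: "\<exists>L. wallis L"
proof -
  obtain L where "L > 0" "L \<le> 1" "\<And>m. real m * (cbw m)\<^sup>2 \<le> L" "\<And>m. L \<le> (real m + 1/2) * (cbw m)\<^sup>2"
    using wallis_bounds by metis
  then have "wallis L" by unfold_locales auto
  then show ?thesis ..
qed

text \<open>The value is \<open>2/\<pi>\<close>, but only its positivity matters.\<close>

definition kap :: real where "kap = 2 * (SOME L. wallis L)"

lemma wallis_kap: "wallis (kap / 2)"
  using someI_ex[OF wallis_exists] by (simp add: kap_def)

lemma kap_pos: "kap > 0" using wallis.L_pos[OF wallis_kap] by simp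

lemmas srw_prob_le = wallis.srw_prob_le[OF wallis_kap]
lemmas srw_prob_le_norm = wallis.srw_prob_le_norm[OF wallis_kap]
lemmas kernel_avg = wallis.kernel_avg[OF wallis_kap]
lemmas kernel_zero [simp] = wallis.kernel_zero[OF wallis_kap]
lemmas kernel_ge = wallis.kernel_ge[OF wallis_kap]

lemma kernel_bounds:
  assumes "x \<noteq> 0"
  shows "potential_kernel x \<le> kap * ln (enorm x) + 6" "potential_kernel x \<ge> kap * ln (enorm x) - 6"
  using wallis.kernel_asymp[OF wallis_kap assms] by auto

lemma kernel_pos: "x \<noteq> 0 \<Longrightarrow> potential_kernel x > 0" using kernel_ge[of x] by simp

lemma kernel_nonneg: "potential_kernel x \<ge> 0" using kernel_pos[of x] by (cases "x = 0") auto

section \<open>One step of the conditioned walk\<close>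

lemma cond_trans_nonneg: "cond_trans x y \<ge> 0"
  by (simp add: cond_trans_def kernel_nonneg)

lemma cond_trans_step: "e \<in> steps \<Longrightarrow> cond_trans x (x + e) = potential_kernel (x + e) / (4 * potential_kernel x)"
  by (simp add: cond_trans_def enorm_uminus)

lemma cond_trans_non_step: "y - x \<notin> steps \<Longrightarrow> cond_trans x y = 0"
  using enorm_eq_1_iff[of "y - x"] by (simp add: cond_trans_def enorm_minus_commute[of x y])

lemma cond_trans_zero [simp]: "cond_trans x 0 = 0"
  by (simp add: cond_trans_def)

text \<open>Reduces every superharmonicity check for the conditioned walk to a neighbour average for
  the simple walk, in which kernels in the denominator of \<open>f\<close> cancel.\<close>

lemma cond_trans_sum: "(\<Sum>e\<in>steps. cond_trans x (x + e) * f (x + e)) = avg (\<lambda>y. potential_kernel y * f y) x / potential_kernel x"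
proof -
  have "(\<Sum>e\<in>steps. cond_trans x (x + e) * f (x + e)) = (\<Sum>e\<in>steps. potential_kernel (x + e) * f (x + e) / (4 * potential_kernel x))"
    by (intro sum.cong) (auto simp: cond_trans_step)
  then show ?thesis by (simp add: avg_eq_sum sum_divide_distrib)
qed

lemma cond_trans_sum_1: "x \<noteq> 0 \<Longrightarrow> (\<Sum>e\<in>steps. cond_trans x (x + e)) = 1"
  using cond_trans_sum[of x "\<lambda>_. 1"] kernel_avg[of x] kernel_pos[of x] by simp

subsection \<open>The law of the conditioned walk on path space\<close>

text \<open>The chain is driven by independent uniform variables. At the origin, where \<^const>\<open>cond_trans\<close> is a
  division by zero, the step is the junk value \<open>(0, -1)\<close>.\<close>

definition unif :: "real measure" where "unif = uniform_measure lborel {0..<1}"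

definition next_site :: "site \<Rightarrow> real \<Rightarrow> site" where
  "next_site x u = x +
    (if u < cond_trans x (x + (1,0)) then (1,0)
     else if u < cond_trans x (x + (1,0)) + cond_trans x (x + (-1,0)) then (-1,0)
     else if u < cond_trans x (x + (1,0)) + cond_trans x (x + (-1,0)) + cond_trans x (x + (0,1)) then (0,1)
     else (0,-1))"

lemma prob_space_unif: "prob_space unif"
  unfolding unif_def by (rule prob_space_uniform_measure) auto

lemma sets_unif [measurable_cong]: "sets unif = sets borel" by (simp add: unif_def)
lemma measurable_next_site [measurable]: "next_site x \<in> measurable unif (count_space UNIV)"
  unfolding next_site_def by measurable

lemma nn_integral_next_site:
  fixes g :: "site \<Rightarrow> ennreal"
  assumes "x \<noteq> 0"
  shows "(\<integral>\<^sup>+u. g (next_site x u) \<partial>unif) = (\<Sum>e\<in>steps. ennreal (cond_trans x (x + e)) * g (x + e))"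
proof -
  define a b c d where "a = cond_trans x (x + (1,0))" and "b = a + cond_trans x (x + (-1,0))"
    and "c = b + cond_trans x (x + (0,1))" and "d = c + cond_trans x (x + (0,-1))"
  note defs = a_def b_def c_def d_def
  have ord: "0 \<le> a" "a \<le> b" "b \<le> c" "c \<le> d" by (auto simp: defs cond_trans_nonneg)
  have "d = 1" using cond_trans_sum_1[OF assms] by (simp add: defs steps_def)
  have "(\<integral>\<^sup>+u. g (next_site x u) \<partial>unif) = (\<integral>\<^sup>+u. g (next_site x u) * indicator {0..<1} u \<partial>lborel)"
  proof -
    have [measurable]: "next_site x \<in> measurable lborel (count_space UNIV)"
      using measurable_next_site[of x] by (simp cong: measurable_cong_sets add: sets_unif)
    show ?thesis unfolding unif_def
      by (subst nn_integral_uniform_measure) (simp_all add: divide_ennreal_def)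
  qed
  also have "\<dots> = (\<integral>\<^sup>+u. (g (x + (1,0)) * indicator {0..<a} u + g (x + (-1,0)) * indicator {a..<b} u)
      + (g (x + (0,1)) * indicator {b..<c} u + g (x + (0,-1)) * indicator {c..<d} u) \<partial>lborel)"
  proof (rule nn_integral_cong)
    fix u
    have ns: "next_site x u = x + (if u < a then (1,0) else if u < b then (-1,0) else if u < c then (0,1) else (0,-1))"
      by (simp add: next_site_def a_def b_def c_def)
    show "g (next_site x u) * indicator {0..<1} u = (g (x + (1,0)) * indicator {0..<a} u + g (x + (-1,0)) * indicator {a..<b} u)
      + (g (x + (0,1)) * indicator {b..<c} u + g (x + (0,-1)) * indicator {c..<d} u)"
      unfolding ns using ord \<open>d = 1\<close> by (auto simp: indicator_def)
  qed
  also have "\<dots> = (g (x + (1,0)) * ennreal (a - 0) + g (x + (-1,0)) * ennreal (b - a))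
      + (g (x + (0,1)) * ennreal (c - b) + g (x + (0,-1)) * ennreal (d - c))"
    using ord by (simp add: nn_integral_add nn_integral_cmult_indicator)
  also have "\<dots> = (\<Sum>e\<in>steps. ennreal (cond_trans x (x + e)) * g (x + e))"
    by (simp add: defs steps_def mult.commute add_ac)
  finally show ?thesis .
qed

primcorec run :: "site \<Rightarrow> real stream \<Rightarrow> site stream" where
  "run x \<omega> = x ## run (next_site x (shd \<omega>)) (stl \<omega>)"

abbreviation SS :: "site stream measure" where "SS \<equiv> stream_space (count_space UNIV)"

lemma measurable_run [measurable]: "run x \<in> measurable (stream_space unif) SS"
proof (rule measurable_stream_space2)
  fix n show "(\<lambda>\<omega>. run x \<omega> !! n) \<in> measurable (stream_space unif) (count_space UNIV)"
  proof (induction n arbitrary: x)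
    case 0
    then show ?case by simp
  next
    case (Suc n)
    have [measurable]: "(\<lambda>\<omega>. run y \<omega> !! n) \<in> measurable (stream_space unif) (count_space UNIV)" for y by (rule Suc)
    have "(\<lambda>\<omega>. (\<lambda>y \<omega>. run y (stl \<omega>) !! n) (next_site x (shd \<omega>)) \<omega>) \<in> measurable (stream_space unif) (count_space UNIV)"
      by (rule measurable_compose_countable) measurable
    then show ?case by simp
  qed
qed

definition PP :: "site \<Rightarrow> site stream measure" where
  "PP x = distr (stream_space unif) SS (run x)"

lemma sets_PP [simp, measurable_cong]: "sets (PP x) = sets SS" by (simp add: PP_def)
lemma space_SS [simp]: "space SS = UNIV" by (simp add: space_stream_space)
lemma UNIV_SS [simp]: "UNIV \<in> sets SS" using sets.top[of SS] by simp
lemma space_PP [simp]: "space (PP x) = UNIV" by (simp add: PP_def)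

lemma prob_space_PP: "prob_space (PP x)"
  unfolding PP_def
  by (rule prob_space.prob_space_distr) (auto intro: prob_space.prob_space_stream_space prob_space_unif)

interpretation PP: prob_space "PP x" for x by (rule prob_space_PP)

lemma nn_integral_PP_step:
  assumes [measurable]: "f \<in> borel_measurable SS" and "x \<noteq> 0"
  shows "(\<integral>\<^sup>+\<omega>. f \<omega> \<partial>PP x) = (\<Sum>e\<in>steps. ennreal (cond_trans x (x + e)) * (\<integral>\<^sup>+\<omega>. f (x ## \<omega>) \<partial>PP (x + e)))"
proof -
  have "(\<integral>\<^sup>+\<omega>. f \<omega> \<partial>PP x) = (\<integral>\<^sup>+\<omega>. f (run x \<omega>) \<partial>stream_space unif)"
    unfolding PP_def by (rule nn_integral_distr) measurable
  also have "\<dots> = (\<integral>\<^sup>+u. (\<integral>\<^sup>+\<omega>. f (run x (u ## \<omega>)) \<partial>stream_space unif) \<partial>unif)"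
    by (rule prob_space.nn_integral_stream_space[OF prob_space_unif]) measurable
  also have "\<dots> = (\<integral>\<^sup>+u. (\<lambda>y. \<integral>\<^sup>+\<omega>. f (x ## run y \<omega>) \<partial>stream_space unif) (next_site x u) \<partial>unif)"
    by (subst run.code) simp
  also have "\<dots> = (\<Sum>e\<in>steps. ennreal (cond_trans x (x + e)) * (\<integral>\<^sup>+\<omega>. f (x ## run (x + e) \<omega>) \<partial>stream_space unif))"
    by (rule nn_integral_next_site[OF assms(2)])
  also have "\<dots> = (\<Sum>e\<in>steps. ennreal (cond_trans x (x + e)) * (\<integral>\<^sup>+\<omega>. f (x ## \<omega>) \<partial>PP (x + e)))"
    unfolding PP_def by (subst nn_integral_distr) measurable
  finally show ?thesis .
qed

abbreviation PR :: "site \<Rightarrow> (site stream \<Rightarrow> bool) \<Rightarrow> real" where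
  "PR x E \<equiv> measure (PP x) {\<omega>. E \<omega>}"

lemma sets_Collect_SS [measurable (raw)]: "Measurable.pred SS E \<Longrightarrow> {\<omega>. E \<omega>} \<in> sets SS"
  by (auto simp: pred_def)

lemma PR_eq_nn_integral:
  assumes "Measurable.pred SS E"
  shows "ennreal (PR x E) = (\<integral>\<^sup>+\<omega>. indicator {\<omega>. E \<omega>} \<omega> \<partial>PP x)"
  using sets_Collect_SS[OF assms] by (simp add: PP.emeasure_eq_measure)

lemma PR_step:
  assumes [measurable]: "Measurable.pred SS E" and "x \<noteq> 0"
  shows "PR x E = (\<Sum>e\<in>steps. cond_trans x (x + e) * PR (x + e) (\<lambda>\<omega>. E (x ## \<omega>)))"
proof -
  have "ennreal (PR x E) = (\<Sum>e\<in>steps. ennreal (cond_trans x (x + e)) * (\<integral>\<^sup>+\<omega>. indicator {\<omega>. E \<omega>} (x ## \<omega>) \<partial>PP (x + e)))"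
    unfolding PR_eq_nn_integral[OF assms(1)] by (rule nn_integral_PP_step) (use assms(2) in measurable)
  also have "\<dots> = (\<Sum>e\<in>steps. ennreal (cond_trans x (x + e)) * ennreal (PR (x + e) (\<lambda>\<omega>. E (x ## \<omega>))))"
  proof (rule sum.cong[OF refl])
    fix e
    have "(\<integral>\<^sup>+\<omega>. indicator {\<omega>. E \<omega>} (x ## \<omega>) \<partial>PP (x + e)) = (\<integral>\<^sup>+\<omega>. indicator {\<omega>. E (x ## \<omega>)} \<omega> \<partial>PP (x + e))"
      by (rule nn_integral_cong) (simp add: indicator_def)
    also have "\<dots> = ennreal (PR (x + e) (\<lambda>\<omega>. E (x ## \<omega>)))"
      by (rule PR_eq_nn_integral[symmetric]) measurable
    finally show "ennreal (cond_trans x (x + e)) * (\<integral>\<^sup>+\<omega>. indicator {\<omega>. E \<omega>} (x ## \<omega>) \<partial>PP (x + e))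
      = ennreal (cond_trans x (x + e)) * ennreal (PR (x + e) (\<lambda>\<omega>. E (x ## \<omega>)))" by simp
  qed
  also have "\<dots> = ennreal (\<Sum>e\<in>steps. cond_trans x (x + e) * PR (x + e) (\<lambda>\<omega>. E (x ## \<omega>)))"
    by (simp add: cond_trans_nonneg flip: ennreal_mult)
  finally show ?thesis by (simp add: sum_nonneg cond_trans_nonneg)
qed

lemma AE_PP_shd: "AE \<omega> in PP x. shd \<omega> = x"
  unfolding PP_def by (subst AE_distr_iff) auto

lemma AE_PP_step:
  assumes [measurable]: "Measurable.pred SS E" and "x \<noteq> 0"
    and "\<And>e. e \<in> steps \<Longrightarrow> x + e \<noteq> 0 \<Longrightarrow> AE \<omega> in PP (x + e). E (x ## \<omega>)"
  shows "AE \<omega> in PP x. E \<omega>"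
proof -
  have "(\<integral>\<^sup>+\<omega>. indicator {\<omega>. \<not> E \<omega>} \<omega> \<partial>PP x) =
      (\<Sum>e\<in>steps. ennreal (cond_trans x (x + e)) * (\<integral>\<^sup>+\<omega>. indicator {\<omega>. \<not> E \<omega>} (x ## \<omega>) \<partial>PP (x + e)))"
    by (rule nn_integral_PP_step) (use assms(2) in measurable)
  also have "\<dots> = 0"
  proof (rule sum.neutral, safe)
    fix a b assume e: "(a,b) \<in> steps"
    show "ennreal (cond_trans x (x + (a,b))) * (\<integral>\<^sup>+\<omega>. indicator {\<omega>. \<not> E \<omega>} (x ## \<omega>) \<partial>PP (x + (a,b))) = 0"
    proof (cases "x + (a,b) = 0")
      case False
      have "AE \<omega> in PP (x + (a,b)). indicator {\<omega>. \<not> E \<omega>} (x ## \<omega>) = (0::ennreal)"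
        using assms(3)[OF e False] by eventually_elim (auto simp: indicator_def)
      then have "(\<integral>\<^sup>+\<omega>. indicator {\<omega>. \<not> E \<omega>} (x ## \<omega>) \<partial>PP (x + (a,b))) = 0"
        by (subst nn_integral_0_iff_AE) (auto simp: indicator_def)
      then show ?thesis by simp
    qed simp
  qed
  finally have "AE \<omega> in PP x. indicator {\<omega>. \<not> E \<omega>} \<omega> = (0::ennreal)"
    by (subst (asm) nn_integral_0_iff_AE) auto
  then show ?thesis by eventually_elim (auto simp: indicator_def split: if_splits)
qed

definition good :: "site stream \<Rightarrow> bool" where
  "good \<omega> \<longleftrightarrow> (\<forall>n. \<omega> !! n \<noteq> 0 \<and> \<omega> !! Suc n - \<omega> !! n \<in> steps)"

lemma AE_PP_good: "x \<noteq> 0 \<Longrightarrow> AE \<omega> in PP x. good \<omega>"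
  unfolding good_def AE_all_countable
proof
  fix n
  show "x \<noteq> 0 \<Longrightarrow> AE \<omega> in PP x. \<omega> !! n \<noteq> 0 \<and> \<omega> !! Suc n - \<omega> !! n \<in> steps"
  proof (induction n arbitrary: x)
    case 0
    show ?case
    proof (rule AE_PP_step[OF _ 0])
      fix e assume "e \<in> steps"
      then show "AE \<omega> in PP (x + e). (x ## \<omega>) !! 0 \<noteq> 0 \<and> (x ## \<omega>) !! Suc 0 - (x ## \<omega>) !! 0 \<in> steps"
        using AE_PP_shd[of "x + e"] 0 by (auto elim!: eventually_mono)
    qed measurable
  next
    case (Suc n)
    show ?case
    proof (rule AE_PP_step[OF _ Suc.prems])
      fix e assume "e \<in> steps" "x + e \<noteq> 0"
      then show "AE \<omega> in PP (x + e). (x ## \<omega>) !! Suc n \<noteq> 0 \<and> (x ## \<omega>) !! Suc (Suc n) - (x ## \<omega>) !! Suc n \<in> steps"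
        using Suc.IH by simp
    qed measurable
  qed
qed

text \<open>Prefixes live in a countable discrete space, so \<open>f\<close> may be any function of
  the prefix; the induction peels off the first step by passing to \<open>f\<close> with the
  starting site prepended.\<close>

lemma nn_integral_markov:
  assumes [measurable]: "F \<in> borel_measurable SS"
  shows "x \<noteq> 0 \<Longrightarrow> (\<integral>\<^sup>+\<omega>. f (stake n \<omega>) * F (sdrop n \<omega>) \<partial>PP x)
    = (\<integral>\<^sup>+\<omega>. f (stake n \<omega>) * (\<integral>\<^sup>+\<omega>'. F \<omega>' \<partial>PP (\<omega> !! n)) \<partial>PP x)"
proof (induction n arbitrary: x f)
  case 0
  have "(\<integral>\<^sup>+\<omega>. f (stake 0 \<omega>) * (\<integral>\<^sup>+\<omega>'. F \<omega>' \<partial>PP (\<omega> !! 0)) \<partial>PP x) = (\<integral>\<^sup>+\<omega>. f [] * (\<integral>\<^sup>+\<omega>'. F \<omega>' \<partial>PP x) \<partial>PP x)"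
    by (rule nn_integral_cong_AE) (use AE_PP_shd[of x] in \<open>auto elim!: eventually_mono\<close>)
  then show ?case by (simp add: nn_integral_cmult PP.emeasure_space_1[simplified])
next
  case (Suc n)
  have fm[measurable]: "(\<lambda>\<omega>. f (stake k \<omega>)) \<in> borel_measurable SS" for k
    by (rule measurable_compose[OF measurable_stake]) simp
  have gm[measurable]: "(\<lambda>\<omega>. \<integral>\<^sup>+\<omega>'. F \<omega>' \<partial>PP (\<omega> !! k)) \<in> borel_measurable SS" for k
    by (rule measurable_compose[OF measurable_snth]) simp
  have "(\<integral>\<^sup>+\<omega>. f (stake (Suc n) \<omega>) * F (sdrop (Suc n) \<omega>) \<partial>PP x)
    = (\<Sum>e\<in>steps. ennreal (cond_trans x (x + e)) * (\<integral>\<^sup>+\<omega>. f (x # stake n \<omega>) * F (sdrop n \<omega>) \<partial>PP (x + e)))"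
    by (subst nn_integral_PP_step[OF _ Suc.prems])
      (simp_all del: stake.simps(2) sdrop.simps(2) snth.simps(2) add: borel_measurable_times_ennreal fm gm measurable_compose[OF measurable_sdrop assms], simp)
  also have "\<dots> = (\<Sum>e\<in>steps. ennreal (cond_trans x (x + e)) * (\<integral>\<^sup>+\<omega>. f (x # stake n \<omega>) * (\<integral>\<^sup>+\<omega>'. F \<omega>' \<partial>PP (\<omega> !! n)) \<partial>PP (x + e)))"
  proof (rule sum.cong, goal_cases)
    case (2 e)
    show ?case using Suc.IH[of "x + e" "\<lambda>l. f (x # l)"] by (cases "x + e = 0") auto
  qed simp
  also have "\<dots> = (\<integral>\<^sup>+\<omega>. f (stake (Suc n) \<omega>) * (\<integral>\<^sup>+\<omega>'. F \<omega>' \<partial>PP (\<omega> !! Suc n)) \<partial>PP x)"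
    by (subst nn_integral_PP_step[OF _ Suc.prems])
      (simp_all del: stake.simps(2) sdrop.simps(2) snth.simps(2) add: borel_measurable_times_ennreal fm gm measurable_compose[OF measurable_sdrop assms], simp)
  finally show ?case .
qed

lemma PR_path:
  "x \<noteq> 0 \<Longrightarrow> (\<And>i. s i \<noteq> 0) \<Longrightarrow> PR x (\<lambda>\<omega>. \<forall>i\<le>n. \<omega> !! i = s i) = (if s 0 = x then \<Prod>i<n. cond_trans (s i) (s (Suc i)) else 0)"
proof (induction n arbitrary: x s)
  case 0
  have "PR x (\<lambda>\<omega>. \<forall>i\<le>0. \<omega> !! i = s i) = PR x (\<lambda>\<omega>. s 0 = x)"
    by (rule PP.finite_measure_eq_AE)
      (use AE_PP_shd[of x] in \<open>auto elim!: eventually_mono intro!: sets_Collect_SS\<close>)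
  then show ?case using PP.prob_space[of x] by auto
next
  case (Suc n)
  have m[measurable]: "Measurable.pred SS (\<lambda>\<omega>. \<forall>i\<le>k. \<omega> !! i = s i)" for k s by measurable
  have "PR x (\<lambda>\<omega>. \<forall>i\<le>Suc n. \<omega> !! i = s i) = (\<Sum>e\<in>steps. cond_trans x (x + e) * PR (x + e) (\<lambda>\<omega>. \<forall>i\<le>Suc n. (x ## \<omega>) !! i = s i))"
    by (rule PR_step[OF m Suc.prems(1)])
  also have "\<dots> = (\<Sum>e\<in>steps. if e = s 1 - s 0 then (if s 0 = x then \<Prod>i<Suc n. cond_trans (s i) (s (Suc i)) else 0) else 0)"
  proof (rule sum.cong, goal_cases)
    case (2 e)
    have "{\<omega>. \<forall>i\<le>Suc n. (x ## \<omega>) !! i = s i} = {\<omega>. s 0 = x \<and> (\<forall>i\<le>n. \<omega> !! i = s (Suc i))}"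
      by (auto simp: Stream_snth All_less_Suc2 less_Suc_eq_le[symmetric] split: nat.splits)
    then have "PR (x + e) (\<lambda>\<omega>. \<forall>i\<le>Suc n. (x ## \<omega>) !! i = s i) = (if s 0 = x then PR (x + e) (\<lambda>\<omega>. \<forall>i\<le>n. \<omega> !! i = s (Suc i)) else 0)"
      by simp
    moreover have "PR (x + e) (\<lambda>\<omega>. \<forall>i\<le>n. \<omega> !! i = s (Suc i)) = (if s 1 = x + e then \<Prod>i<n. cond_trans (s (Suc i)) (s (Suc (Suc i))) else 0)" if "x + e \<noteq> 0"
      using Suc.IH[OF that, of "\<lambda>i. s (Suc i)"] Suc.prems(2) by simp
    ultimately show ?case
      by (cases "x + e = 0") (use Suc.prems(2)[of 1] in \<open>auto simp: prod.lessThan_Suc_shift simp del: prod.lessThan_Suc\<close>)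
  qed simp
  also have "\<dots> = (if s 0 = x then \<Prod>i<Suc n. cond_trans (s i) (s (Suc i)) else 0)"
    using cond_trans_non_step[of "s 1" "s 0"] by (auto simp: sum.delta prod.lessThan_Suc_shift simp del: prod.lessThan_Suc)
  finally show ?case .
qed

text \<open>Cylinders determine a law on path space. The chain hypothesis prescribes the
  probabilities of those avoiding 0; a cylinder through 0 is empty for the given chain, whose states
  are nonzero, and null under \<open>PP\<close> by \<open>AE_PP_good\<close>.\<close>

theorem walk_law:
  assumes walk: "conditioned_walk_from x\<^sub>0 M S" and x0: "x\<^sub>0 \<noteq> 0"
  shows "distr M SS (\<lambda>\<omega>. to_stream (\<lambda>n. S n \<omega>)) = PP x\<^sub>0"
    and "(\<lambda>\<omega>. to_stream (\<lambda>n. S n \<omega>)) \<in> measurable M SS"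
    and "prob_space M"
proof -
  interpret prob_space M using walk by (simp add: conditioned_walk_from_def markov_chain_from_def)
  show "prob_space M" by (rule prob_space_axioms)
  have S0[measurable]: "S n \<in> measurable M (count_space (- {0}))" for n
    using walk by (simp add: conditioned_walk_from_def markov_chain_from_def)
  have S[measurable]: "S n \<in> measurable M (count_space UNIV)" for n
    by (rule measurable_compose[OF S0]) simp
  show T[measurable]: "(\<lambda>\<omega>. to_stream (\<lambda>n. S n \<omega>)) \<in> measurable M SS"
    by (rule measurable_stream_space2) (simp add: to_stream_def)
  have pathM: "\<P>(\<omega> in M. \<forall>i\<le>n. S i \<omega> = s i) = (if s 0 = x\<^sub>0 then \<Prod>i<n. cond_trans (s i) (s (Suc i)) else 0)"
    if s: "\<And>i. s i \<noteq> 0" for n and s :: "nat \<Rightarrow> site"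
  proof (induction n)
    case 0
    have ae: "AE \<omega> in M. S 0 \<omega> = x\<^sub>0" using walk by (simp add: conditioned_walk_from_def markov_chain_from_def)
    have "\<P>(\<omega> in M. \<forall>i\<le>0. S i \<omega> = s i) = \<P>(\<omega> in M. s 0 = x\<^sub>0)"
      by (rule finite_measure_eq_AE) (use ae in \<open>auto elim!: eventually_mono\<close>)
    then show ?case by (auto simp: prob_space)
  next
    case (Suc n)
    have "\<P>(\<omega> in M. \<forall>i\<le>Suc n. S i \<omega> = s i) = \<P>(\<omega> in M. \<forall>i\<le>n. S i \<omega> = s i) * cond_trans (s n) (s (Suc n))"
      using walk s by (simp add: conditioned_walk_from_def markov_chain_from_def)
    then show ?case using Suc by simp
  qed
  show "distr M SS (\<lambda>\<omega>. to_stream (\<lambda>n. S n \<omega>)) = PP x\<^sub>0"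
  proof (rule stream_space_eq_sstart[where S = UNIV])
    show "prob_space (distr M SS (\<lambda>\<omega>. to_stream (\<lambda>n. S n \<omega>)))" by (rule prob_space_distr) simp
    fix xs :: "site list" assume xs: "xs \<noteq> []" "xs \<in> lists UNIV"
    have ss: "sstart UNIV xs = {\<omega>. \<forall>i<length xs. \<omega> !! i = xs ! i}" by (auto simp: sstart_eq)
    have tr: "to_stream (\<lambda>n. S n \<omega>) !! i = S i \<omega>" for i \<omega> by (simp add: to_stream_def)
    have m: "Measurable.pred SS (\<lambda>\<omega>. \<forall>i<length xs. \<omega> !! i = xs ! i)" by measurable
    have L: "emeasure (distr M SS (\<lambda>\<omega>. to_stream (\<lambda>n. S n \<omega>))) (sstart UNIV xs)
        = emeasure M {\<omega>\<in>space M. \<forall>i<length xs. S i \<omega> = xs ! i}"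
      unfolding ss by (subst emeasure_distr) (auto simp: tr intro!: arg_cong[where f="emeasure M"] sets_Collect_SS[OF m])
    show "emeasure (distr M SS (\<lambda>\<omega>. to_stream (\<lambda>n. S n \<omega>))) (sstart UNIV xs) = emeasure (PP x\<^sub>0) (sstart UNIV xs)"
    proof (cases "0 \<in> set xs")
      case True
      then obtain j where j: "j < length xs" "xs ! j = 0" by (auto simp: in_set_conv_nth)
      have "S j \<omega> \<noteq> 0" if "\<omega> \<in> space M" for \<omega> using measurable_space[OF S0 that] by simp
      then have "{\<omega>\<in>space M. \<forall>i<length xs. S i \<omega> = xs ! i} = {}" using j by auto
      moreover have "AE \<omega> in PP x\<^sub>0. \<omega> \<notin> {\<omega>. \<forall>i<length xs. \<omega> !! i = xs ! i}"
        using AE_PP_good[OF x0] by eventually_elim (use j in \<open>auto simp: good_def\<close>)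
      then have "emeasure (PP x\<^sub>0) {\<omega>. \<forall>i<length xs. \<omega> !! i = xs ! i} = 0"
        using emeasure_eq_0_AE[of "\<lambda>\<omega>. \<forall>i<length xs. \<omega> !! i = xs ! i" "PP x\<^sub>0"] by simp
      ultimately show ?thesis unfolding L unfolding ss by (simp only: emeasure_empty)
    next
      case False
      \<comment> \<open>The chain property is stated for total sequences in the state space, so the
        list is continued by an arbitrary nonzero site.\<close>
      define s where "s i = (if i < length xs then xs ! i else (1,0))" for i
      have s: "s i \<noteq> 0" for i using False by (auto simp: s_def in_set_conv_nth zero_prod_def)
      obtain n where n: "length xs = Suc n" using xs by (cases xs) auto
      have "{\<omega>\<in>space M. \<forall>i<length xs. S i \<omega> = xs ! i} = {\<omega>\<in>space M. \<forall>i\<le>n. S i \<omega> = s i}"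
        by (auto simp: s_def n)
      moreover have "{\<omega>. \<forall>i<length xs. \<omega> !! i = xs ! i} = {\<omega>. \<forall>i\<le>n. \<omega> !! i = s i}"
        by (auto simp: s_def n)
      ultimately show ?thesis
        unfolding L unfolding ss by (simp add: emeasure_eq_measure PP.emeasure_eq_measure pathM[OF s] PR_path[OF x0 s])
    qed
  qed (auto simp: streams_UNIV prob_space_PP)
qed

text \<open>\<open>Sn n f x\<close> is the expectation of \<open>f\<close> at time \<open>n\<close> for the simple random walk from \<open>x\<close>.\<close>

primrec Sn :: "nat \<Rightarrow> (site \<Rightarrow> real) \<Rightarrow> site \<Rightarrow> real" where
  "Sn 0 f x = f x"
| "Sn (Suc n) f x = avg (Sn n f) x"

lemma Sn_mono: "(\<And>y. f y \<le> g y) \<Longrightarrow> Sn n f x \<le> Sn n g x"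
  by (induction n arbitrary: x) (auto intro: avg_mono)

lemma Sn_const [simp]: "Sn n (\<lambda>_. c) x = c"
  by (induction n arbitrary: x) (auto simp: avg_def)

lemma Sn_add: "Sn n (\<lambda>y. f y + g y) x = Sn n f x + Sn n g x"
  by (induction n arbitrary: x) (auto simp: avg_def add_divide_distrib)

lemma Sn_mult: "Sn n (\<lambda>y. c * f y) x = c * Sn n f x"
  by (induction n arbitrary: x) (auto simp: avg_def algebra_simps)

lemma Sn_diff: "Sn n (\<lambda>y. f y - g y) x = Sn n f x - Sn n g x"
  by (induction n arbitrary: x) (auto simp: avg_def diff_divide_distrib add_divide_distrib)

lemma Sn_sum: "finite B \<Longrightarrow> Sn n (\<lambda>y. \<Sum>w\<in>B. f w y) x = (\<Sum>w\<in>B. Sn n (f w) x)"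
  by (induction B rule: finite_induct) (auto simp: Sn_add)

lemma Sn_nonneg: "(\<And>y. 0 \<le> f y) \<Longrightarrow> 0 \<le> Sn n f x"
  using Sn_mono[of "\<lambda>_. 0" f n x] by simp

lemma Sn_Suc_right: "Sn (Suc n) f x = Sn n (avg f) x"
proof (induction n arbitrary: x)
  case (Suc n)
  have "Sn (Suc (Suc n)) f x = avg (Sn (Suc n) f) x" by simp
  also have "\<dots> = avg (Sn n (avg f)) x" by (intro avg_cong) (rule Suc)
  finally show ?case by simp
qed (simp add: avg_def)

lemma avg_reflect: "avg (\<lambda>y. f (c - y)) x = avg f (c - x)"
proof -
  have "c - (x + (1,0)) = c - x + (-1,0)" "c - (x + (-1,0)) = c - x + (1,0)" 
    "c - (x + (0,1)) = c - x + (0,-1)" "c - (x + (0,-1)) = c - x + (0,1)"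
    by (cases x; cases c; simp)+
  then show ?thesis by (simp only: avg_def) argo
qed

lemma Sn_reflect: "Sn n (\<lambda>y. f (c - y)) x = Sn n f (c - x)"
proof (induction n arbitrary: x)
  case (Suc n)
  have "Sn (Suc n) (\<lambda>y. f (c - y)) x = avg (\<lambda>y. Sn n f (c - y)) x"
    unfolding Sn.simps by (rule avg_cong) (rule Suc)
  then show ?case by (simp only: avg_reflect Sn.simps)
qed simp

lemma Sn_delta: "Sn n (\<lambda>z. if z = w then 1 else 0) x = srw_prob n (x - w)"
proof (induction n arbitrary: x)
  case 0
  then show ?case by (simp add: srw_prob_0)
next
  case (Suc n)
  have "x + e - w = x - w + e" for e by simp
  then show ?case by (simp only: Sn.simps srw_prob_Suc avg_def Suc)
qed

lemma Sn_finite: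
  assumes "finite B"
  shows "Sn n (\<lambda>z. of_bool (z \<in> B)) x = (\<Sum>w\<in>B. srw_prob n (x - w))"
proof -
  have eq: "(\<lambda>z. of_bool (z \<in> B) :: real) = (\<lambda>z. \<Sum>w\<in>B. if z = w then 1 else 0)"
    using assms by (auto simp: sum.delta)
  show ?thesis unfolding eq Sn_sum[OF assms] Sn_delta ..
qed

text \<open>The kernel is harmonic except for an excess 1 at the origin, so its mean grows by the
  expected number of visits to 0.\<close>

lemma Sn_kernel: "Sn n potential_kernel x = potential_kernel x + (\<Sum>j<n. srw_prob j x)"
proof (induction n)
  case (Suc n)
  have "Sn (Suc n) potential_kernel x = Sn n (avg potential_kernel) x" by (rule Sn_Suc_right)
  also have "avg potential_kernel = (\<lambda>y. potential_kernel y + (if y = 0 then 1 else 0))"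
    by (auto simp: kernel_avg)
  finally show ?case using Suc by (simp add: Sn_add Sn_delta)
qed simp

lemma finite_ball_site [simp]: "finite {z. enorm z \<le> r}"
  and card_ball_site: "r \<ge> 1 \<Longrightarrow> real (card {z. enorm z \<le> r}) \<le> 9 * r\<^sup>2"
proof -
  let ?I = "{- \<lfloor>r\<rfloor>..\<lfloor>r\<rfloor>}"
  have sub: "{z. enorm z \<le> r} \<subseteq> ?I \<times> ?I"
  proof
    fix z assume "z \<in> {z. enorm z \<le> r}"
    moreover have "\<bar>real_of_int (fst z)\<bar> \<le> enorm z" "\<bar>real_of_int (snd z)\<bar> \<le> enorm z"
      by (rule power2_le_imp_le; simp add: enorm_sq)+
    ultimately have "\<bar>fst z\<bar> \<le> \<lfloor>r\<rfloor>" "\<bar>snd z\<bar> \<le> \<lfloor>r\<rfloor>" by (auto simp: le_floor_iff)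
    then show "z \<in> ?I \<times> ?I" by (cases z) auto
  qed
  show "finite {z. enorm z \<le> r}" by (rule finite_subset[OF sub]) simp
  assume r: "r \<ge> 1"
  have "card {z. enorm z \<le> r} \<le> card (?I \<times> ?I)" by (rule card_mono[OF _ sub]) simp
  also have "\<dots> = (nat (2 * \<lfloor>r\<rfloor> + 1))\<^sup>2" by (simp add: card_cartesian_product power2_eq_square)
  finally have "real (card {z. enorm z \<le> r}) \<le> real ((nat (2 * \<lfloor>r\<rfloor> + 1))\<^sup>2)" by (simp only: of_nat_le_iff)
  also have "\<dots> = (2 * real_of_int \<lfloor>r\<rfloor> + 1)\<^sup>2" using r by simp
  also have "\<dots> \<le> (3 * r)\<^sup>2" using r by (intro power_mono) linarith+
  finally show "real (card {z. enorm z \<le> r}) \<le> 9 * r\<^sup>2" by (simp add: power2_eq_square)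
qed

text \<open>The conditioned walk is the h-transform of the simple walk killed at 0.
  \<open>Sn\<close> does not kill, so paths through 0 are counted on the right as well and only an
  inequality remains.\<close>

lemma nn_marginal_le:
  assumes "\<And>z. 0 \<le> f z"
  shows "x \<noteq> 0 \<Longrightarrow> (\<integral>\<^sup>+\<omega>. ennreal (f (\<omega> !! n)) \<partial>PP x) \<le> ennreal (Sn n (\<lambda>z. potential_kernel z * f z) x / potential_kernel x)"
proof (induction n arbitrary: x)
  case 0
  have "(\<integral>\<^sup>+\<omega>. ennreal (f (\<omega> !! 0)) \<partial>PP x) = (\<integral>\<^sup>+\<omega>. ennreal (f x) \<partial>PP x)"
    by (rule nn_integral_cong_AE) (use AE_PP_shd[of x] in \<open>auto elim!: eventually_mono\<close>)
  then show ?case using kernel_pos[OF 0] PP.emeasure_space_1[of x] by simp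
next
  case (Suc n)
  let ?g = "\<lambda>z. potential_kernel z * f z"
  have gn: "0 \<le> Sn n ?g y" for y by (rule Sn_nonneg) (simp add: assms kernel_nonneg)
  have m: "(\<lambda>\<omega>. ennreal (f (\<omega> !! k))) \<in> borel_measurable SS" for k
    by (rule measurable_compose[OF measurable_snth]) simp
  have "(\<integral>\<^sup>+\<omega>. ennreal (f (\<omega> !! Suc n)) \<partial>PP x) = (\<Sum>e\<in>steps. ennreal (cond_trans x (x + e)) * (\<integral>\<^sup>+\<omega>. ennreal (f (\<omega> !! n)) \<partial>PP (x + e)))"
    by (subst nn_integral_PP_step[OF m Suc.prems]) simp
  also have "\<dots> \<le> (\<Sum>e\<in>steps. ennreal (cond_trans x (x + e)) * ennreal (Sn n ?g (x + e) / potential_kernel (x + e)))"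
  proof (rule sum_mono)
    fix e assume "e \<in> steps"
    show "ennreal (cond_trans x (x + e)) * (\<integral>\<^sup>+\<omega>. ennreal (f (\<omega> !! n)) \<partial>PP (x + e)) \<le> ennreal (cond_trans x (x + e)) * ennreal (Sn n ?g (x + e) / potential_kernel (x + e))"
      by (cases "x + e = 0") (auto intro: mult_left_mono Suc.IH)
  qed
  also have "\<dots> = ennreal (\<Sum>e\<in>steps. cond_trans x (x + e) * (Sn n ?g (x + e) / potential_kernel (x + e)))"
    by (simp add: cond_trans_nonneg gn kernel_nonneg flip: ennreal_mult)
  also have "\<dots> \<le> ennreal (Sn (Suc n) ?g x / potential_kernel x)"
  proof (rule ennreal_leI)
    have "(\<Sum>e\<in>steps. cond_trans x (x + e) * (Sn n ?g (x + e) / potential_kernel (x + e)))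
       = avg (\<lambda>y. potential_kernel y * (Sn n ?g y / potential_kernel y)) x / potential_kernel x"
      by (rule cond_trans_sum)
    also have "\<dots> \<le> avg (Sn n ?g) x / potential_kernel x"
      using gn kernel_nonneg by (intro divide_right_mono avg_mono) auto
    finally show "(\<Sum>e\<in>steps. cond_trans x (x + e) * (Sn n ?g (x + e) / potential_kernel (x + e))) \<le> Sn (Suc n) ?g x / potential_kernel x"
      by simp
  qed
  finally show ?case .
qed

lemma marginal_le:
  assumes "x \<noteq> 0"
  shows "PR x (\<lambda>\<omega>. \<omega> !! n \<in> B) \<le> Sn n (\<lambda>z. potential_kernel z * of_bool (z \<in> B)) x / potential_kernel x"
proof -
  have "ennreal (PR x (\<lambda>\<omega>. \<omega> !! n \<in> B)) = (\<integral>\<^sup>+\<omega>. ennreal (of_bool (\<omega> !! n \<in> B)) \<partial>PP x)"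
    by (subst PR_eq_nn_integral, measurable, rule nn_integral_cong) (simp add: indicator_def)
  also have "\<dots> \<le> ennreal (Sn n (\<lambda>z. potential_kernel z * of_bool (z \<in> B)) x / potential_kernel x)"
    by (rule nn_marginal_le[OF _ assms]) simp
  finally show ?thesis
    by (subst (asm) ennreal_le_iff) (auto intro!: divide_nonneg_nonneg Sn_nonneg kernel_nonneg)
qed

lemma PR_not: "Measurable.pred SS E \<Longrightarrow> PR x (\<lambda>\<omega>. \<not> E \<omega>) = 1 - PR x E"
  using PP.prob_neg[of x E] by (simp add: sets_Collect_SS)

text \<open>The upper bound applied to the complement of \<open>B\<close>. By
  \<open>Sn_kernel\<close> the total mass exceeds the kernel at x by the expected visits to 0, and
  this excess is what the lower bound loses.\<close>

lemma marginal_ge: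
  assumes "x \<noteq> 0"
  shows "PR x (\<lambda>\<omega>. \<omega> !! n \<in> B)
    \<ge> (Sn n (\<lambda>z. potential_kernel z * of_bool (z \<in> B)) x - (\<Sum>j<n. srw_prob j x)) / potential_kernel x"
proof -
  have eq: "potential_kernel z * of_bool (z \<in> - B) = potential_kernel z - potential_kernel z * of_bool (z \<in> B)" for z by simp
  have 1: "PR x (\<lambda>\<omega>. \<not> \<omega> !! n \<in> B) = 1 - PR x (\<lambda>\<omega>. \<omega> !! n \<in> B)" by (rule PR_not) measurable
  have "PR x (\<lambda>\<omega>. \<not> \<omega> !! n \<in> B) \<le> Sn n (\<lambda>z. potential_kernel z * of_bool (z \<in> - B)) x / potential_kernel x"
    using marginal_le[OF assms, of n "-B"] by simp
  also have "Sn n (\<lambda>z. potential_kernel z * of_bool (z \<in> - B)) x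
     = potential_kernel x + (\<Sum>j<n. srw_prob j x) - Sn n (\<lambda>z. potential_kernel z * of_bool (z \<in> B)) x"
    unfolding eq Sn_diff Sn_kernel ..
  finally have "1 - PR x (\<lambda>\<omega>. \<omega> !! n \<in> B) \<le> (potential_kernel x + (\<Sum>j<n. srw_prob j x) - Sn n (\<lambda>z. potential_kernel z * of_bool (z \<in> B)) x) / potential_kernel x"
    unfolding 1 .
  also have "\<dots> = 1 - (Sn n (\<lambda>z. potential_kernel z * of_bool (z \<in> B)) x - (\<Sum>j<n. srw_prob j x)) / potential_kernel x"
    using kernel_pos[OF assms] by (simp add: field_simps)
  finally show ?thesis by linarith
qed

lemma kernel_le_ball: "r \<ge> 1 \<Longrightarrow> enorm z \<le> r \<Longrightarrow> potential_kernel z \<le> kap * ln r + 6"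
proof (cases "z = 0")
  case False
  assume r: "r \<ge> 1" "enorm z \<le> r"
  have "ln (enorm z) \<le> ln r" using r enorm_ge_1[OF False] by simp
  then have "kap * ln (enorm z) \<le> kap * ln r" using kap_pos by simp
  then show ?thesis using kernel_bounds(1)[OF False] by linarith
qed (use kap_pos in simp)

lemma kernel_ge_outside: "r > 0 \<Longrightarrow> enorm z \<ge> r \<Longrightarrow> potential_kernel z \<ge> kap * ln r - 6"
proof -
  assume r: "r > 0" "enorm z \<ge> r"
  then have nz: "z \<noteq> 0" by auto
  have "ln r \<le> ln (enorm z)" using r by simp
  then have "kap * ln r \<le> kap * ln (enorm z)" using kap_pos by simp
  then show ?thesis using kernel_bounds(2)[OF nz] by linarith
qed

lemma marginal_ball_le:
  assumes x: "x \<noteq> 0" and r: "r \<ge> 1"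
  shows "PR x (\<lambda>\<omega>. enorm (\<omega> !! n) \<le> r) \<le> (kap * ln r + 6) / potential_kernel x * (36 * r\<^sup>2 / (real n + 1))"
proof -
  let ?B = "{z. enorm z \<le> r}"
  have c: "kap * ln r + 6 \<ge> 0" using kap_pos r by simp
  have "Sn n (\<lambda>z. potential_kernel z * of_bool (z \<in> ?B)) x \<le> Sn n (\<lambda>z. (kap * ln r + 6) * of_bool (z \<in> ?B)) x"
    using kernel_le_ball[OF r] by (intro Sn_mono) auto
  also have "\<dots> = (kap * ln r + 6) * (\<Sum>w\<in>?B. srw_prob n (x - w))"
    by (simp only: Sn_mult Sn_finite[OF finite_ball_site])
  also have "(\<Sum>w\<in>?B. srw_prob n (x - w)) \<le> (\<Sum>w\<in>?B. 4 / (real n + 1))"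
    by (intro sum_mono srw_prob_le)
  also have "\<dots> = real (card ?B) * (4 / (real n + 1))" by simp
  also have "\<dots> \<le> (9 * r\<^sup>2) * (4 / (real n + 1))" by (intro mult_right_mono card_ball_site r) auto
  also have "\<dots> = 36 * r\<^sup>2 / (real n + 1)" by simp
  finally have "Sn n (\<lambda>z. potential_kernel z * of_bool (z \<in> ?B)) x \<le> (kap * ln r + 6) * (36 * r\<^sup>2 / (real n + 1))"
    using c by (simp add: mult_left_mono)
  then have "Sn n (\<lambda>z. potential_kernel z * of_bool (z \<in> ?B)) x / potential_kernel x \<le> (kap * ln r + 6) * (36 * r\<^sup>2 / (real n + 1)) / potential_kernel x"
    by (rule divide_right_mono) (rule kernel_nonneg)
  then show ?thesis using marginal_le[OF x, of n ?B] by (simp add: mult.commute)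
qed

subsection \<open>Harmonic majorants\<close>

lemma PR_mono: "Measurable.pred SS F \<Longrightarrow> (\<And>\<omega>. E \<omega> \<Longrightarrow> F \<omega>) \<Longrightarrow> PR x E \<le> PR x F"
  by (rule PP.finite_measure_mono) (auto intro: sets_Collect_SS)

lemma PR_mono_AE: "Measurable.pred SS F \<Longrightarrow> AE \<omega> in PP x. E \<omega> \<longrightarrow> F \<omega> \<Longrightarrow> PR x E \<le> PR x F"
  by (rule PP.finite_measure_mono_AE) (auto intro: sets_Collect_SS)

lemma PR_cong_start:
  assumes "Measurable.pred SS E" "Measurable.pred SS F" "\<And>\<omega>. good \<omega> \<Longrightarrow> \<omega> !! 0 = x \<Longrightarrow> E \<omega> = F \<omega>" "x \<noteq> 0"
  shows "PR x E = PR x F"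
proof (rule PP.finite_measure_eq_AE)
  show "AE \<omega> in PP x. (\<omega> \<in> {\<omega>. E \<omega>}) = (\<omega> \<in> {\<omega>. F \<omega>})"
    using AE_PP_good[OF assms(4)] AE_PP_shd[of x] by eventually_elim (simp add: assms(3))
qed (use assms in \<open>auto intro: sets_Collect_SS\<close>)

lemma PR_le_1 [simp]: "PR x E \<le> 1" by (rule PP.prob_le_1)

lemma PR_Ex_le:
  assumes [measurable]: "\<And>n. Measurable.pred SS (E n)"
    and mono: "\<And>n \<omega>. E n \<omega> \<Longrightarrow> E (Suc n) \<omega>" and le: "\<And>n. PR x (E n) \<le> c"
  shows "PR x (\<lambda>\<omega>. \<exists>n. E n \<omega>) \<le> c"
proof -
  have "incseq (\<lambda>n. {\<omega>. E n \<omega>})" by (rule incseq_SucI) (auto intro: mono)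
  then have "(\<lambda>n. PR x (E n)) \<longlonglongrightarrow> measure (PP x) (\<Union>n. {\<omega>. E n \<omega>})"
    by (intro PP.finite_Lim_measure_incseq) (auto intro: sets_Collect_SS)
  moreover have "(\<Union>n. {\<omega>. E n \<omega>}) = {\<omega>. \<exists>n. E n \<omega>}" by auto
  ultimately show ?thesis using le by (auto intro: LIMSEQ_le_const2)
qed

lemma until_step:
  assumes x: "x \<noteq> 0" "x \<in> D" "x \<notin> B"
  shows "PR x (\<lambda>\<omega>. \<exists>k\<le>Suc n. \<omega> !! k \<in> B \<and> (\<forall>i<k. \<omega> !! i \<in> D))
     = (\<Sum>e\<in>steps. cond_trans x (x + e) * PR (x + e) (\<lambda>\<omega>. \<exists>k\<le>n. \<omega> !! k \<in> B \<and> (\<forall>i<k. \<omega> !! i \<in> D)))"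
proof -
  have "(\<exists>k\<le>Suc n. (x ## \<omega>) !! k \<in> B \<and> (\<forall>i<k. (x ## \<omega>) !! i \<in> D)) \<longleftrightarrow> (\<exists>k\<le>n. \<omega> !! k \<in> B \<and> (\<forall>i<k. \<omega> !! i \<in> D))" for \<omega>
  proof
    assume "\<exists>k\<le>Suc n. (x ## \<omega>) !! k \<in> B \<and> (\<forall>i<k. (x ## \<omega>) !! i \<in> D)"
    then obtain k where k: "k \<le> Suc n" "(x ## \<omega>) !! k \<in> B" "\<And>i. i < k \<Longrightarrow> (x ## \<omega>) !! i \<in> D" by blast
    then obtain j where j: "k = Suc j" using x by (cases k) auto
    have "\<omega> !! i \<in> D" if "i < j" for i using k(3)[of "Suc i"] that j by simp
    then show "\<exists>k\<le>n. \<omega> !! k \<in> B \<and> (\<forall>i<k. \<omega> !! i \<in> D)" using k j by auto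
  next
    assume "\<exists>k\<le>n. \<omega> !! k \<in> B \<and> (\<forall>i<k. \<omega> !! i \<in> D)"
    then obtain j where j: "j \<le> n" "\<omega> !! j \<in> B" "\<And>i. i < j \<Longrightarrow> \<omega> !! i \<in> D" by blast
    have "(x ## \<omega>) !! i \<in> D" if "i < Suc j" for i using that j(3) x by (cases i) auto
    then show "\<exists>k\<le>Suc n. (x ## \<omega>) !! k \<in> B \<and> (\<forall>i<k. (x ## \<omega>) !! i \<in> D)"
      using j by (intro exI[of _ "Suc j"]) auto
  qed
  then show ?thesis by (subst PR_step) (use x in auto)
qed

lemma stay_step:
  assumes x: "x \<noteq> 0" "x \<in> D"
  shows "PR x (\<lambda>\<omega>. \<forall>i\<le>Suc n. \<omega> !! i \<in> D)
     = (\<Sum>e\<in>steps. cond_trans x (x + e) * PR (x + e) (\<lambda>\<omega>. \<forall>i\<le>n. \<omega> !! i \<in> D))"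
proof -
  have "(\<forall>i\<le>Suc n. (x ## \<omega>) !! i \<in> D) \<longleftrightarrow> (\<forall>i\<le>n. \<omega> !! i \<in> D)" for \<omega>
  proof
    assume h: "\<forall>i\<le>Suc n. (x ## \<omega>) !! i \<in> D"
    show "\<forall>i\<le>n. \<omega> !! i \<in> D"
    proof safe
      fix i assume "i \<le> n" then show "\<omega> !! i \<in> D" using h[rule_format, of "Suc i"] by simp
    qed
  next
    assume h: "\<forall>i\<le>n. \<omega> !! i \<in> D"
    show "\<forall>i\<le>Suc n. (x ## \<omega>) !! i \<in> D"
    proof safe
      fix i assume "i \<le> Suc n" then show "(x ## \<omega>) !! i \<in> D" using h x by (cases i) auto
    qed
  qed
  then show ?thesis by (subst PR_step) (use x in auto)
qed

text \<open>Optional stopping for a superharmonic \<open>f\<close> in finite time: \<open>B\<close> is the target, \<open>D\<close> the region to which the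
  walk is confined, and the error term accounts for the walk still being undecided at time \<open>n\<close>.\<close>

lemma until_le:
  assumes c: "c \<ge> 0" and lb: "\<And>z. z \<noteq> 0 \<Longrightarrow> - c \<le> f z" and B: "\<And>z. z \<noteq> 0 \<Longrightarrow> z \<in> B \<Longrightarrow> 1 \<le> f z"
    and out: "\<And>z. z \<noteq> 0 \<Longrightarrow> z \<notin> B \<Longrightarrow> z \<notin> D \<Longrightarrow> 0 \<le> f z"
    and sup: "\<And>z. z \<noteq> 0 \<Longrightarrow> z \<in> D \<Longrightarrow> z \<notin> B \<Longrightarrow> (\<Sum>e\<in>steps. cond_trans z (z + e) * f (z + e)) \<le> f z"
  shows "x \<noteq> 0 \<Longrightarrow> PR x (\<lambda>\<omega>. \<exists>k\<le>n. \<omega> !! k \<in> B \<and> (\<forall>i<k. \<omega> !! i \<in> D)) \<le> f x + c * PR x (\<lambda>\<omega>. \<forall>i\<le>n. \<omega> !! i \<in> D - B)"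
proof (induction n arbitrary: x)
  case (0 x)
  have "PR x (\<lambda>\<omega>. \<exists>k\<le>0. \<omega> !! k \<in> B \<and> (\<forall>i<k. \<omega> !! i \<in> D)) = PR x (\<lambda>_. x \<in> B)"
    using 0 by (intro PR_cong_start) auto
  moreover have "PR x (\<lambda>\<omega>. \<forall>i\<le>0. \<omega> !! i \<in> D - B) = PR x (\<lambda>_. x \<in> D - B)"
    using 0 by (intro PR_cong_start) auto
  moreover have "PR x (\<lambda>_. True) = 1" using PP.prob_space[of x] by simp
  ultimately show ?case using B[OF 0] out[OF 0] lb[OF 0] c by (cases "x \<in> B"; cases "x \<in> D") auto
next
  case (Suc n x)
  have s0: "0 \<le> c * PR x (\<lambda>\<omega>. \<forall>i\<le>Suc n. \<omega> !! i \<in> D - B)" using c by simp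
  consider "x \<in> B" | "x \<notin> B" "x \<notin> D" | "x \<notin> B" "x \<in> D" by blast
  then show ?case
  proof cases
    case 1
    then show ?thesis using B[OF Suc.prems] s0 PR_le_1 by (meson add_increasing2 order_trans)
  next
    case 2
    have "PR x (\<lambda>\<omega>. \<exists>k\<le>Suc n. \<omega> !! k \<in> B \<and> (\<forall>i<k. \<omega> !! i \<in> D)) = PR x (\<lambda>_. False)"
    proof (rule PR_cong_start[OF _ _ _ Suc.prems])
      fix \<omega> :: "site stream" assume w: "\<omega> !! 0 = x"
      have "\<not> (\<omega> !! k \<in> B \<and> (\<forall>i<k. \<omega> !! i \<in> D))" for k
        using w 2 by (cases k) auto
      then show "(\<exists>k\<le>Suc n. \<omega> !! k \<in> B \<and> (\<forall>i<k. \<omega> !! i \<in> D)) = False" by blast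
    qed auto
    then show ?thesis using out[OF Suc.prems] 2 s0 by simp
  next
    case 3
    have "PR x (\<lambda>\<omega>. \<exists>k\<le>Suc n. \<omega> !! k \<in> B \<and> (\<forall>i<k. \<omega> !! i \<in> D))
      = (\<Sum>e\<in>steps. cond_trans x (x + e) * PR (x + e) (\<lambda>\<omega>. \<exists>k\<le>n. \<omega> !! k \<in> B \<and> (\<forall>i<k. \<omega> !! i \<in> D)))"
      using 3 Suc.prems by (intro until_step)
    also have "\<dots> \<le> (\<Sum>e\<in>steps. cond_trans x (x + e) * f (x + e) + c * (cond_trans x (x + e) * PR (x + e) (\<lambda>\<omega>. \<forall>i\<le>n. \<omega> !! i \<in> D - B)))"
    proof (rule sum_mono)
      fix e assume "e \<in> steps"
      show "cond_trans x (x + e) * PR (x + e) (\<lambda>\<omega>. \<exists>k\<le>n. \<omega> !! k \<in> B \<and> (\<forall>i<k. \<omega> !! i \<in> D))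
        \<le> cond_trans x (x + e) * f (x + e) + c * (cond_trans x (x + e) * PR (x + e) (\<lambda>\<omega>. \<forall>i\<le>n. \<omega> !! i \<in> D - B))"
      proof (cases "x + e = 0")
        case False
        show ?thesis using mult_left_mono[OF Suc.IH[OF False] cond_trans_nonneg[of x "x + e"]]
          by (simp add: algebra_simps)
      qed simp
    qed
    also have "\<dots> = (\<Sum>e\<in>steps. cond_trans x (x + e) * f (x + e)) + c * (\<Sum>e\<in>steps. cond_trans x (x + e) * PR (x + e) (\<lambda>\<omega>. \<forall>i\<le>n. \<omega> !! i \<in> D - B))"
      by (simp only: sum.distrib sum_distrib_left)
    also have "(\<Sum>e\<in>steps. cond_trans x (x + e) * PR (x + e) (\<lambda>\<omega>. \<forall>i\<le>n. \<omega> !! i \<in> D - B)) = PR x (\<lambda>\<omega>. \<forall>i\<le>Suc n. \<omega> !! i \<in> D - B)"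
      using 3 Suc.prems by (intro stay_step[symmetric]) auto
    finally show ?thesis using sup[OF Suc.prems] 3 by simp
  qed
qed

lemma until_le_0:
  assumes lb: "\<And>z. z \<noteq> 0 \<Longrightarrow> 0 \<le> f z" and B: "\<And>z. z \<noteq> 0 \<Longrightarrow> z \<in> B \<Longrightarrow> 1 \<le> f z"
    and sup: "\<And>z. z \<noteq> 0 \<Longrightarrow> z \<in> D \<Longrightarrow> z \<notin> B \<Longrightarrow> (\<Sum>e\<in>steps. cond_trans z (z + e) * f (z + e)) \<le> f z"
    and x: "x \<noteq> 0"
  shows "PR x (\<lambda>\<omega>. \<exists>k. \<omega> !! k \<in> B \<and> (\<forall>i<k. \<omega> !! i \<in> D)) \<le> f x"
proof -
  have "PR x (\<lambda>\<omega>. \<exists>n. \<exists>k\<le>n. \<omega> !! k \<in> B \<and> (\<forall>i<k. \<omega> !! i \<in> D)) \<le> f x"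
  proof (rule PR_Ex_le)
    fix n
    show "PR x (\<lambda>\<omega>. \<exists>k\<le>n. \<omega> !! k \<in> B \<and> (\<forall>i<k. \<omega> !! i \<in> D)) \<le> f x"
      using until_le[of 0 f B D x n] lb B sup x by simp
  qed (auto intro: le_SucI)
  moreover have "(\<exists>n. \<exists>k\<le>n. \<omega> !! k \<in> B \<and> (\<forall>i<k. \<omega> !! i \<in> D)) \<longleftrightarrow> (\<exists>k. \<omega> !! k \<in> B \<and> (\<forall>i<k. \<omega> !! i \<in> D))" for \<omega> :: "site stream"
    by auto
  ultimately show ?thesis by simp
qed

text \<open>The majorant is a multiple of 1/a, scaled to be at least 1 on the ball. The product of a
  with it is constant except at 0, where it vanishes, hence superharmonicity even next to the
  origin.\<close>

lemma hit_ball_le: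
  assumes x: "x \<noteq> 0" and r: "r \<ge> 1"
  shows "PR x (\<lambda>\<omega>. \<exists>k. enorm (\<omega> !! k) \<le> r) \<le> (kap * ln r + 6) / potential_kernel x"
proof -
  let ?b = "kap * ln r + 6"
  have b: "?b \<ge> 0" using kap_pos r by simp
  have "PR x (\<lambda>\<omega>. \<exists>k. \<omega> !! k \<in> {z. enorm z \<le> r} \<and> (\<forall>i<k. \<omega> !! i \<in> UNIV)) \<le> ?b / potential_kernel x"
  proof (rule until_le_0[where f = "\<lambda>z. ?b / potential_kernel z"])
    fix z :: site assume z: "z \<noteq> 0"
    show "0 \<le> ?b / potential_kernel z" using b kernel_nonneg by simp
    show "1 \<le> ?b / potential_kernel z" if "z \<in> {z. enorm z \<le> r}"
      using kernel_le_ball[OF r, of z] that kernel_pos[OF z] by (simp add: field_simps)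
    have "(\<Sum>e\<in>steps. cond_trans z (z + e) * (?b / potential_kernel (z + e)))
        = avg (\<lambda>y. potential_kernel y * (?b / potential_kernel y)) z / potential_kernel z"
      by (rule cond_trans_sum)
    also have "\<dots> \<le> avg (\<lambda>_. ?b) z / potential_kernel z"
      using b by (intro divide_right_mono avg_mono kernel_nonneg) auto
    finally show "(\<Sum>e\<in>steps. cond_trans z (z + e) * (?b / potential_kernel (z + e))) \<le> ?b / potential_kernel z" by simp
  qed (rule x)
  then show ?thesis by simp
qed

text \<open>Gambler's ruin for the martingale 1/a, normalised to be nonnegative where the kernel is
  at least \<alpha> and at least 1 where it is at least \<beta>. The margin r - 1 accounts for the
  last step, which may carry the walk from outside the radius r down to r - 1.\<close>

lemma reach_before_le:
  assumes r: "r \<ge> 1" "r < \<rho>" and ab: "0 < \<alpha>" "\<alpha> < \<beta>"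
    and \<alpha>: "\<And>z. z \<noteq> 0 \<Longrightarrow> enorm z > r - 1 \<Longrightarrow> \<alpha> \<le> potential_kernel z"
    and \<beta>: "\<And>z. enorm z \<ge> \<rho> \<Longrightarrow> \<beta> \<le> potential_kernel z"
    and x: "enorm x > r"
  shows "PR x (\<lambda>\<omega>. \<exists>k. enorm (\<omega> !! k) \<ge> \<rho> \<and> (\<forall>i<k. enorm (\<omega> !! i) > r))
     \<le> (potential_kernel x - \<alpha>) / potential_kernel x * (\<beta> / (\<beta> - \<alpha>))"
proof -
  define d where "d = 1 / \<alpha> - 1 / \<beta>"
  have d: "d > 0" using ab by (simp add: d_def field_simps)
  \<comment> \<open>The formula must hold at all neighbours of sites beyond r, for the average to be
    exact; further inside it could be negative and is replaced by 0.\<close>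
  define f where "f z = (if enorm z > r - 1 \<and> z \<noteq> 0 then (1 / \<alpha> - 1 / potential_kernel z) / d else 0)" for z
  have x0: "x \<noteq> 0" using x r by auto
  have "PR x (\<lambda>\<omega>. \<exists>k. \<omega> !! k \<in> {z. enorm z \<ge> \<rho>} \<and> (\<forall>i<k. \<omega> !! i \<in> {z. enorm z > r})) \<le> f x"
  proof (rule until_le_0)
    fix z :: site assume z: "z \<noteq> 0"
    have "1 / potential_kernel z \<le> 1 / \<alpha>" if "enorm z > r - 1"
      using \<alpha>[OF z that] ab by (intro divide_left_mono) auto
    then show "0 \<le> f z" using d by (auto simp: f_def)
    show "1 \<le> f z" if "z \<in> {z. enorm z \<ge> \<rho>}"
    proof -
      have "1 / potential_kernel z \<le> 1 / \<beta>" using \<beta>[of z] that ab by (intro divide_left_mono) auto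
      then show ?thesis using d that r z by (simp add: f_def d_def)
    qed
    assume zD: "z \<in> {z. enorm z > r}"
    have nb: "z + e \<noteq> 0 \<and> enorm (z + e) > r - 1" if "e \<in> steps" for e
    proof -
      have g: "enorm (z + e) > r - 1" using enorm_step_ge[OF that, of z] zD by simp
      then have "enorm (z + e) > 0" using r by simp
      then show ?thesis using g by auto
    qed
    have "(\<Sum>e\<in>steps. cond_trans z (z + e) * f (z + e)) = (\<Sum>e\<in>steps. cond_trans z (z + e) * ((1 / \<alpha> - 1 / potential_kernel (z + e)) / d))"
      using nb by (intro sum.cong) (auto simp: f_def)
    also have "\<dots> = avg (\<lambda>y. potential_kernel y * ((1 / \<alpha> - 1 / potential_kernel y) / d)) z / potential_kernel z"
      by (rule cond_trans_sum)
    also have "avg (\<lambda>y. potential_kernel y * ((1 / \<alpha> - 1 / potential_kernel y) / d)) z = avg (\<lambda>y. 1 / (\<alpha> * d) * potential_kernel y - 1 / d) z"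
    proof (rule avg_cong)
      fix e assume "e \<in> steps"
      then have "potential_kernel (z + e) > 0" using nb kernel_pos by blast
      then show "potential_kernel (z + e) * ((1 / \<alpha> - 1 / potential_kernel (z + e)) / d) = 1 / (\<alpha> * d) * potential_kernel (z + e) - 1 / d"
        using d ab by (simp add: field_simps)
    qed
    also have "\<dots> = 1 / (\<alpha> * d) * potential_kernel z - 1 / d"
      unfolding avg_diff avg_mult avg_const kernel_avg using z by simp
    also have "(1 / (\<alpha> * d) * potential_kernel z - 1 / d) / potential_kernel z = f z"
      using zD z d ab kernel_pos[OF z] by (simp add: f_def field_simps)
    finally show "(\<Sum>e\<in>steps. cond_trans z (z + e) * f (z + e)) \<le> f z" by simp
  qed (rule x0)
  also have "f x = (potential_kernel x - \<alpha>) / potential_kernel x * (\<beta> / (\<beta> - \<alpha>))"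
  proof -
    have d': "d = (\<beta> - \<alpha>) / (\<alpha> * \<beta>)" using ab by (simp add: d_def field_simps)
    have "f x = (1 / \<alpha> - 1 / potential_kernel x) / ((\<beta> - \<alpha>) / (\<alpha> * \<beta>))"
      using x x0 by (simp add: f_def d')
    also have "\<dots> = (potential_kernel x - \<alpha>) / potential_kernel x * (\<beta> / (\<beta> - \<alpha>))"
      using ab kernel_pos[OF x0] by (simp add: divide_simps)
    finally show ?thesis .
  qed
  finally show ?thesis by simp
qed

lemma stay_tendsto:
  assumes x: "x \<noteq> 0"
  shows "(\<lambda>n. PR x (\<lambda>\<omega>. \<forall>i\<le>n. enorm (\<omega> !! i) < \<rho>)) \<longlonglongrightarrow> 0"
proof (rule tendsto_sandwich[OF _ _ tendsto_const])
  let ?r = "max \<rho> 1"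
  let ?c = "(kap * ln ?r + 6) / potential_kernel x"
  show "\<forall>\<^sub>F n in sequentially. PR x (\<lambda>\<omega>. \<forall>i\<le>n. enorm (\<omega> !! i) < \<rho>) \<le> ?c * (36 * ?r\<^sup>2 / (real n + 1))"
  proof (rule always_eventually, rule allI)
    fix n
    have "PR x (\<lambda>\<omega>. \<forall>i\<le>n. enorm (\<omega> !! i) < \<rho>) \<le> PR x (\<lambda>\<omega>. enorm (\<omega> !! n) \<le> ?r)"
      by (rule PR_mono) (measurable, auto simp: le_max_iff_disj intro: less_imp_le)
    also have "\<dots> \<le> ?c * (36 * ?r\<^sup>2 / (real n + 1))" by (rule marginal_ball_le[OF x]) simp
    finally show "PR x (\<lambda>\<omega>. \<forall>i\<le>n. enorm (\<omega> !! i) < \<rho>) \<le> ?c * (36 * ?r\<^sup>2 / (real n + 1))" .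
  qed
  have "(\<lambda>n. ?c * (36 * ?r\<^sup>2 / (real n + 1))) \<longlonglongrightarrow> ?c * 0"
    by (intro tendsto_mult tendsto_const) real_asymp
  then show "(\<lambda>n. ?c * (36 * ?r\<^sup>2 / (real n + 1))) \<longlonglongrightarrow> 0" by simp
qed auto

lemma AE_exit:
  assumes x: "x \<noteq> 0"
  shows "AE \<omega> in PP x. \<exists>n. enorm (\<omega> !! n) \<ge> \<rho>"
proof -
  have "PR x (\<lambda>\<omega>. \<forall>n. enorm (\<omega> !! n) < \<rho>) \<le> 0"
  proof (rule LIMSEQ_le_const[OF stay_tendsto[OF x]], intro exI allI impI)
    fix n show "PR x (\<lambda>\<omega>. \<forall>n. enorm (\<omega> !! n) < \<rho>) \<le> PR x (\<lambda>\<omega>. \<forall>i\<le>n. enorm (\<omega> !! i) < \<rho>)"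
      by (rule PR_mono) auto
  qed
  then have "PR x (\<lambda>\<omega>. \<forall>n. enorm (\<omega> !! n) < \<rho>) = 0" using measure_nonneg by (rule antisym)
  then have "AE \<omega> in PP x. \<omega> \<notin> {\<omega>. \<forall>n. enorm (\<omega> !! n) < \<rho>}"
    by (subst (asm) PP.prob_eq_0) (auto intro!: sets_Collect_SS)
  then show ?thesis by eventually_elim (auto simp: not_less)
qed

text \<open>The outer radius in \<open>reach_before_le\<close> is sent to infinity, where
  \<beta>/(\<beta> - \<alpha>) tends to 1; the walk does reach every radius.\<close>

lemma never_return_le:
  assumes r: "r \<ge> 1" and a: "0 < \<alpha>"
    and \<alpha>: "\<And>z. z \<noteq> 0 \<Longrightarrow> enorm z > r - 1 \<Longrightarrow> \<alpha> \<le> potential_kernel z"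
    and x: "enorm x > r"
  shows "PR x (\<lambda>\<omega>. \<forall>i. enorm (\<omega> !! i) > r) \<le> (potential_kernel x - \<alpha>) / potential_kernel x"
proof -
  let ?c = "(potential_kernel x - \<alpha>) / potential_kernel x"
  have x0: "x \<noteq> 0" using x r by auto
  have lim: "((\<lambda>\<rho>. ?c * ((kap * ln \<rho> - 6) / ((kap * ln \<rho> - 6) - \<alpha>))) \<longlongrightarrow> ?c * 1) at_top"
    by (intro tendsto_mult tendsto_const) (use kap_pos in real_asymp)
  have big: "\<forall>\<^sub>F \<rho> in at_top. kap * ln \<rho> - 6 > \<alpha>"
    using kap_pos by real_asymp
  have "\<forall>\<^sub>F \<rho> in at_top. PR x (\<lambda>\<omega>. \<forall>i. enorm (\<omega> !! i) > r) \<le> ?c * ((kap * ln \<rho> - 6) / ((kap * ln \<rho> - 6) - \<alpha>))"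
    using big eventually_gt_at_top[of r]
  proof eventually_elim
    case (elim \<rho>)
    have "PR x (\<lambda>\<omega>. \<forall>i. enorm (\<omega> !! i) > r) \<le> PR x (\<lambda>\<omega>. \<exists>k. enorm (\<omega> !! k) \<ge> \<rho> \<and> (\<forall>i<k. enorm (\<omega> !! i) > r))"
      by (rule PR_mono_AE) (use AE_exit[OF x0, of \<rho>] in \<open>auto elim!: eventually_mono\<close>)
    also have "\<dots> \<le> ?c * ((kap * ln \<rho> - 6) / ((kap * ln \<rho> - 6) - \<alpha>))"
      by (rule reach_before_le[OF r _ a]) (use elim \<alpha> x r kernel_ge_outside in auto)
    finally show ?case .
  qed
  from tendsto_lowerbound[OF lim this] show ?thesis by simp
qed

subsection \<open>A lower bound for the speed\<close>

lemma avg_quad: "avg (\<lambda>w. (p * real_of_int (fst w) + q * real_of_int (snd w) - c)\<^sup>2) w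
   = (p * real_of_int (fst w) + q * real_of_int (snd w) - c)\<^sup>2 + (p\<^sup>2 + q\<^sup>2) / 2"
proof -
  define X where "X = p * real_of_int (fst w) + q * real_of_int (snd w) - c"
  have "avg (\<lambda>w. (p * real_of_int (fst w) + q * real_of_int (snd w) - c)\<^sup>2) w
    = ((X + p)\<^sup>2 + (X - p)\<^sup>2 + (X + q)\<^sup>2 + (X - q)\<^sup>2) / 4"
    by (simp add: avg_def X_def algebra_simps)
  also have "\<dots> = X\<^sup>2 + (p\<^sup>2 + q\<^sup>2) / 2"
    by (simp add: power2_eq_square field_simps)
  finally show ?thesis by (simp add: X_def)
qed

lemma avg_quart: "avg (\<lambda>w. (p * real_of_int (fst w) + q * real_of_int (snd w) - c) ^ 4) w
   = (p * real_of_int (fst w) + q * real_of_int (snd w) - c) ^ 4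
     + 3 * (p\<^sup>2 + q\<^sup>2) * (p * real_of_int (fst w) + q * real_of_int (snd w) - c)\<^sup>2 + (p ^ 4 + q ^ 4) / 2"
proof -
  define X where "X = p * real_of_int (fst w) + q * real_of_int (snd w) - c"
  have "avg (\<lambda>w. (p * real_of_int (fst w) + q * real_of_int (snd w) - c) ^ 4) w
    = ((X + p) ^ 4 + (X - p) ^ 4 + (X + q) ^ 4 + (X - q) ^ 4) / 4"
    by (simp add: avg_def X_def algebra_simps)
  also have "\<dots> = X ^ 4 + 3 * (p\<^sup>2 + q\<^sup>2) * X\<^sup>2 + (p ^ 4 + q ^ 4) / 2"
    by (simp add: power4_eq_xxxx power2_eq_square field_simps)
  finally show ?thesis by (simp add: X_def)
qed

text \<open>Paley--Zygmund for the displacement in the direction of \<open>z\<close>, with the second and fourth moments.\<close>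

lemma srw_far:
  assumes z: "z \<noteq> 0" and n: "n \<ge> 1"
  shows "Sn n (\<lambda>w. of_bool (enorm w \<ge> enorm z + sqrt (real n) / 2)) z \<ge> 1 / 32"
proof -
  define p q where "p = real_of_int (fst z) / enorm z" and "q = real_of_int (snd z) / enorm z"
  have ez: "enorm z > 0" using z by (simp add: order_less_le)
  have pq: "p\<^sup>2 + q\<^sup>2 = 1" using z
    by (simp add: p_def q_def power_divide enorm_sq[symmetric] flip: add_divide_distrib)
  define X where "X w = p * real_of_int (fst w) + q * real_of_int (snd w) - enorm z" for w :: site
  have pz: "p * real_of_int (fst z) + q * real_of_int (snd z) = enorm z"
  proof -
    have "p * real_of_int (fst z) + q * real_of_int (snd z) = ((real_of_int (fst z))\<^sup>2 + (real_of_int (snd z))\<^sup>2) / enorm z"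
      by (simp add: p_def q_def power2_eq_square add_divide_distrib)
    then show ?thesis using ez unfolding enorm_sq[symmetric] by (simp add: power2_eq_square)
  qed
  have Xz: "X z = 0" using pz by (simp add: X_def)
  have aX2: "avg (\<lambda>w. (X w)\<^sup>2) = (\<lambda>w. (X w)\<^sup>2 + 1 / 2)"
    using avg_quad[of p q "enorm z"] pq by (auto simp: X_def)
  have aX4: "avg (\<lambda>w. (X w) ^ 4) w \<le> (X w) ^ 4 + (3 * (X w)\<^sup>2 + 1 / 2)" for w
  proof -
    have "(p\<^sup>2 + q\<^sup>2)\<^sup>2 = p ^ 4 + q ^ 4 + 2 * (p\<^sup>2 * q\<^sup>2)"
      by (simp add: power4_eq_xxxx power2_eq_square algebra_simps)
    moreover have "0 \<le> p\<^sup>2 * q\<^sup>2" by simp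
    ultimately have "p ^ 4 + q ^ 4 \<le> 1" unfolding pq one_power2 by linarith
    then show ?thesis using avg_quart[of p q "enorm z" w] pq by (simp add: X_def)
  qed
  have m2: "Sn k (\<lambda>w. (X w)\<^sup>2) z = real k / 2" for k
  proof (induction k)
    case (Suc k)
    then show ?case unfolding Sn_Suc_right aX2 Sn_add by simp
  qed (simp add: Xz)
  have m4: "Sn k (\<lambda>w. (X w) ^ 4) z \<le> (real k)\<^sup>2" for k
  proof (induction k)
    case (Suc k)
    have "Sn (Suc k) (\<lambda>w. (X w) ^ 4) z \<le> Sn k (\<lambda>w. (X w) ^ 4 + (3 * (X w)\<^sup>2 + 1 / 2)) z"
      unfolding Sn_Suc_right by (rule Sn_mono) (rule aX4)
    also have "\<dots> = Sn k (\<lambda>w. (X w) ^ 4) z + (3 * (real k / 2) + 1 / 2)"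
      unfolding Sn_add Sn_mult m2 by simp
    finally show ?case using Suc by (simp add: power2_eq_square algebra_simps)
  qed (simp add: Xz)
  define s where "s = sqrt (real n) / 2"
  have s2: "s\<^sup>2 = real n / 4" by (simp add: s_def power_divide)
  have s0: "s > 0" using n by (simp add: s_def)
  \<comment> \<open>With Z = X^2/n the left side is Z/2 - 1/8 - Z^2/16, which is at most 0 for Z <
    1/4 and at most 1 always. The moment bounds give it mean at least 1/4 - 1/8 - 1/16 =
    1/16.\<close>
  have pt: "(1 / (2 * real n)) * (X w)\<^sup>2 - 1 / 8 - (1 / (16 * (real n)\<^sup>2)) * (X w) ^ 4
      \<le> of_bool (X w \<ge> s) + of_bool (- X w \<ge> s)" for w
  proof -
    define Z where "Z = (X w)\<^sup>2 / real n"
    have Z0: "Z \<ge> 0" by (simp add: Z_def)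
    have eq: "(1 / (2 * real n)) * (X w)\<^sup>2 - 1 / 8 - (1 / (16 * (real n)\<^sup>2)) * (X w) ^ 4 = Z / 2 - 1 / 8 - Z\<^sup>2 / 16"
      by (simp add: Z_def power4_eq_xxxx power2_eq_square)
    show ?thesis
    proof (cases "Z \<ge> 1 / 4")
      case True
      have "Z / 2 - 1 / 8 - Z\<^sup>2 / 16 \<le> 1"
        using zero_le_power2[of "Z - 4"] by (simp add: power2_eq_square algebra_simps)
      moreover have "\<bar>X w\<bar> \<ge> s"
      proof (rule power2_le_imp_le)
        show "s\<^sup>2 \<le> \<bar>X w\<bar>\<^sup>2" using True n by (simp add: Z_def s2 field_simps)
      qed simp
      then have "(1::real) \<le> of_bool (X w \<ge> s) + of_bool (- X w \<ge> s)" by (auto simp: abs_if split: if_splits)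
      ultimately show ?thesis unfolding eq by linarith
    next
      case False
      then have "Z / 2 - 1 / 8 - Z\<^sup>2 / 16 \<le> 0" using zero_le_power2[of Z] by linarith
      then show ?thesis unfolding eq by (rule order_trans) simp
    qed
  qed
  have "Sn n (\<lambda>w. (1 / (2 * real n)) * (X w)\<^sup>2 - 1 / 8 - (1 / (16 * (real n)\<^sup>2)) * (X w) ^ 4) z
     \<le> Sn n (\<lambda>w. of_bool (X w \<ge> s) + of_bool (- X w \<ge> s)) z"
    by (rule Sn_mono) (rule pt)
  moreover have "Sn n (\<lambda>w. (1 / (2 * real n)) * (X w)\<^sup>2 - 1 / 8 - (1 / (16 * (real n)\<^sup>2)) * (X w) ^ 4) z
     = 1 / 4 - 1 / 8 - (1 / (16 * (real n)\<^sup>2)) * Sn n (\<lambda>w. (X w) ^ 4) z"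
    unfolding Sn_diff Sn_mult m2 using n by simp
  moreover have "(1 / (16 * (real n)\<^sup>2)) * Sn n (\<lambda>w. (X w) ^ 4) z \<le> (1 / (16 * (real n)\<^sup>2)) * (real n)\<^sup>2"
    by (rule mult_left_mono[OF m4]) simp
  moreover have "(1 / (16 * (real n)\<^sup>2)) * (real n)\<^sup>2 = 1 / 16" using n by simp
  moreover have "Sn n (\<lambda>w. of_bool (X w \<ge> s) + of_bool (- X w \<ge> s)) z = 2 * Sn n (\<lambda>w. of_bool (X w \<ge> s)) z"
  proof -
    \<comment> \<open>Reflection of the walk at its starting point z exchanges X and -X, so half of
      the probability 1/16 belongs to the outward direction.\<close>
    have "- X w = X (z + z - w)" for w using pz by (simp add: X_def algebra_simps)
    then have "(\<lambda>w. of_bool (- X w \<ge> s)) = (\<lambda>w. of_bool (X (z + z - w) \<ge> s) :: real)" by simp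
    then have "Sn n (\<lambda>w. of_bool (- X w \<ge> s)) z = Sn n (\<lambda>w. of_bool (X w \<ge> s)) z"
      using Sn_reflect[of n "\<lambda>w. of_bool (X w \<ge> s)" "z + z" z] by (simp only: add_diff_cancel_right')
    then show ?thesis by (simp add: Sn_add)
  qed
  ultimately have "1 / 32 \<le> Sn n (\<lambda>w. of_bool (X w \<ge> s)) z" by linarith
  also have "\<dots> \<le> Sn n (\<lambda>w. of_bool (enorm w \<ge> enorm z + sqrt (real n) / 2)) z"
  proof (rule Sn_mono)
    fix w :: site
    have "p * real_of_int (fst w) + q * real_of_int (snd w) \<le> enorm w"
    proof (rule power2_le_imp_le)
      have "(p * real_of_int (fst w) + q * real_of_int (snd w))\<^sup>2 + (p * real_of_int (snd w) - q * real_of_int (fst w))\<^sup>2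
        = (p\<^sup>2 + q\<^sup>2) * (enorm w)\<^sup>2" unfolding enorm_sq by (simp add: power2_eq_square algebra_simps)
      then show "(p * real_of_int (fst w) + q * real_of_int (snd w))\<^sup>2 \<le> (enorm w)\<^sup>2"
        unfolding pq using zero_le_power2[of "p * real_of_int (snd w) - q * real_of_int (fst w)"] by linarith
    qed simp
    then show "of_bool (s \<le> X w) \<le> (of_bool (enorm z + sqrt (real n) / 2 \<le> enorm w) :: real)"
      by (simp add: X_def s_def)
  qed
  finally show ?thesis .
qed

text \<open>The kernel does not lose on outward moves, and up to time |z|^2 the expected visits to 0
  are at most 16. With k for kap ln |z|, the requirement is (k - 6)/32 - 16 \<ge> (k + 6)/64, which
  k \<ge> 1100 ensures.\<close>

lemma escape_ge:
  assumes z: "kap * ln (enorm z) \<ge> 1100" "z \<noteq> 0" and n: "n \<ge> 1" "real n \<le> (enorm z)\<^sup>2"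
  shows "PR z (\<lambda>\<omega>. enorm (\<omega> !! n) \<ge> enorm z + sqrt (real n) / 2) \<ge> 1 / 64"
proof -
  let ?B = "{w. enorm w \<ge> enorm z + sqrt (real n) / 2}"
  let ?k = "kap * ln (enorm z)"
  have e1: "enorm z \<ge> 1" by (rule enorm_ge_1[OF z(2)])
  have ap: "potential_kernel z > 0" by (rule kernel_pos[OF z(2)])
  have "(?k - 6) * (1 / 32) \<le> (?k - 6) * Sn n (\<lambda>w. of_bool (w \<in> ?B)) z"
    using srw_far[OF z(2) n(1)] z(1) by (intro mult_left_mono) auto
  also have "\<dots> = Sn n (\<lambda>w. (?k - 6) * of_bool (w \<in> ?B)) z" by (simp only: Sn_mult)
  also have "\<dots> \<le> Sn n (\<lambda>w. potential_kernel w * of_bool (w \<in> ?B)) z"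
  proof (rule Sn_mono)
    fix w
    show "(?k - 6) * of_bool (w \<in> ?B) \<le> potential_kernel w * of_bool (w \<in> ?B)"
    proof (cases "w \<in> ?B")
      case True
      then have "enorm z \<le> enorm w" using real_sqrt_ge_zero[of "real n"]
        unfolding mem_Collect_eq by linarith
      then show ?thesis using kernel_ge_outside[of "enorm z" w] e1 True by simp
    qed simp
  qed
  finally have 1: "(?k - 6) * (1 / 32) \<le> Sn n (\<lambda>w. potential_kernel w * of_bool (w \<in> ?B)) z" .
  have "(\<Sum>j<n. srw_prob j z) \<le> (\<Sum>j<n. 16 / (enorm z)\<^sup>2)"
    by (intro sum_mono srw_prob_le_norm z)
  also have "\<dots> = 16 * (real n / (enorm z)\<^sup>2)" by simp
  also have "\<dots> \<le> 16 * 1" using n e1 by (intro mult_left_mono) (auto simp: divide_le_eq_1)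
  finally have 2: "(\<Sum>j<n. srw_prob j z) \<le> 16" by simp
  have "1 / 64 * potential_kernel z \<le> 1 / 64 * (?k + 6)"
    using kernel_bounds(1)[OF z(2)] by simp
  also have "\<dots> \<le> (?k - 6) * (1 / 32) - 16" using z(1) by simp
  also have "\<dots> \<le> Sn n (\<lambda>w. potential_kernel w * of_bool (w \<in> ?B)) z - (\<Sum>j<n. srw_prob j z)"
    using 1 2 by linarith
  finally have "1 / 64 \<le> (Sn n (\<lambda>w. potential_kernel w * of_bool (w \<in> ?B)) z - (\<Sum>j<n. srw_prob j z)) / potential_kernel z"
    using ap by (simp add: pos_le_divide_eq)
  also have "\<dots> \<le> PR z (\<lambda>\<omega>. \<omega> !! n \<in> ?B)" by (rule marginal_ge[OF z(2)])
  finally show ?thesis by simp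
qed

subsection \<open>The strong Markov property at exit times\<close>

text \<open>Time 0 counts: a path that starts outside the ball exits at once.\<close>

definition exits :: "real \<Rightarrow> nat \<Rightarrow> site stream \<Rightarrow> bool" where
  "exits R n \<omega> \<longleftrightarrow> (\<forall>i<n. enorm (\<omega> !! i) < R) \<and> enorm (\<omega> !! n) \<ge> R"

lemma exits_unique: "exits R n \<omega> \<Longrightarrow> exits R m \<omega> \<Longrightarrow> n = m"
  unfolding exits_def by (metis not_less_iff_gr_or_eq not_le)

lemma exits_Ex: "exits R n \<omega> \<Longrightarrow> (\<exists>m. exits R m \<omega> \<and> P m) \<longleftrightarrow> P n"
  by (metis exits_unique)

lemma exits_exists: "enorm (\<omega> !! k) \<ge> R \<Longrightarrow> \<exists>n\<le>k. exits R n \<omega>"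
proof -
  assume k: "enorm (\<omega> !! k) \<ge> R"
  define n where "n = (LEAST n. enorm (\<omega> !! n) \<ge> R)"
  have "enorm (\<omega> !! n) \<ge> R" unfolding n_def using k by (rule LeastI)
  moreover have "n \<le> k" unfolding n_def using k by (rule Least_le)
  moreover have "enorm (\<omega> !! i) < R" if "i < n" for i using not_less_Least[OF that[unfolded n_def]] by simp
  ultimately show ?thesis by (auto simp: exits_def)
qed

lemma measurable_exits [measurable]: "Measurable.pred SS (exits R n)"
  unfolding exits_def by measurable

text \<open>\<open>F\<close> of the path after the first exit from the ball of radius \<open>R\<close>, restricted to those paths whose
  prefix before the exit satisfies \<open>A\<close>; it is \<open>0\<close> if there is no exit.\<close>

definition at_exit :: "(site list \<Rightarrow> bool) \<Rightarrow> real \<Rightarrow> (site stream \<Rightarrow> ennreal) \<Rightarrow> site stream \<Rightarrow> ennreal" where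
  "at_exit A R F \<omega> = (\<Sum>n. of_bool (exits R n \<omega> \<and> A (stake n \<omega>)) * F (sdrop n \<omega>))"

lemma at_exit_eq: "exits R n \<omega> \<Longrightarrow> at_exit A R F \<omega> = of_bool (A (stake n \<omega>)) * F (sdrop n \<omega>)"
proof -
  assume n: "exits R n \<omega>"
  have "at_exit A R F \<omega> = (\<Sum>m\<in>{n}. of_bool (exits R m \<omega> \<and> A (stake m \<omega>)) * F (sdrop m \<omega>))"
    unfolding at_exit_def by (rule suminf_finite) (auto dest: exits_unique[OF n])
  then show ?thesis using n by simp
qed

lemma at_exit_eq_0: "(\<And>n. \<not> exits R n \<omega>) \<Longrightarrow> at_exit A R F \<omega> = 0"
  by (simp add: at_exit_def)

lemma measurable_stake_pred [measurable]: "Measurable.pred SS (\<lambda>\<omega>. A (stake n \<omega>))"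
  by (rule measurable_compose[OF measurable_stake]) simp

lemma measurable_at_exit [measurable]:
  assumes [measurable]: "F \<in> borel_measurable SS"
  shows "at_exit A R F \<in> borel_measurable SS"
proof -
  have [measurable]: "(\<lambda>\<omega>. F (sdrop n \<omega>)) \<in> borel_measurable SS" for n
    by (rule measurable_compose[OF measurable_sdrop assms])
  show ?thesis unfolding at_exit_def[abs_def] by measurable
qed

lemma measurable_start [measurable]: "(\<lambda>\<omega>. h (shd \<omega>)) \<in> borel_measurable SS" for h :: "site \<Rightarrow> ennreal"
  by (rule measurable_compose[OF measurable_shd]) simp

text \<open>The exit time is summed over its values n and the Markov property is applied at each
  fixed n.\<close>

lemma strong_markov:
  assumes [measurable]: "F \<in> borel_measurable SS" and x: "x \<noteq> 0"
  shows "(\<integral>\<^sup>+\<omega>. at_exit A R F \<omega> \<partial>PP x) = (\<integral>\<^sup>+\<omega>. at_exit A R (\<lambda>\<omega>. \<integral>\<^sup>+\<omega>'. F \<omega>' \<partial>PP (shd \<omega>)) \<omega> \<partial>PP x)"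
proof -
  define f :: "site list \<Rightarrow> ennreal" where "f l = of_bool ((\<forall>z\<in>set l. enorm z < R) \<and> A l)" for l
  have set_stake: "set (stake n \<omega>) = {\<omega> !! i | i. i < n}" for n and \<omega> :: "site stream"
    unfolding set_conv_nth length_stake by (metis (no_types, lifting) stake_nth)
  have all: "(\<forall>z\<in>set (stake n \<omega>). enorm z < R) \<longleftrightarrow> (\<forall>i<n. enorm (\<omega> !! i) < R)" for n and \<omega> :: "site stream"
    unfolding set_stake by blast
  \<comment> \<open>\<open>stake n\<close> stops before the site at time n, so the condition that
    this site lies outside the ball is not a property of the prefix; it is moved into the functional
    of the shifted path.\<close>
  have split: "of_bool (exits R n \<omega> \<and> A (stake n \<omega>)) * G (sdrop n \<omega>)
    = f (stake n \<omega>) * (of_bool (enorm (shd (sdrop n \<omega>)) \<ge> R) * G (sdrop n \<omega>))" for G :: "site stream \<Rightarrow> ennreal" and n \<omega>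
    unfolding exits_def f_def all sdrop_simps(1) of_bool_conj by (simp only: mult_ac)
  have shd_b[measurable]: "(\<lambda>\<omega>. of_bool (enorm (shd \<omega>) \<ge> R) :: ennreal) \<in> borel_measurable SS"
    by (rule measurable_start)
  have e: "(\<integral>\<^sup>+\<omega>. of_bool (exits R n \<omega> \<and> A (stake n \<omega>)) * F (sdrop n \<omega>) \<partial>PP x)
     = (\<integral>\<^sup>+\<omega>. of_bool (exits R n \<omega> \<and> A (stake n \<omega>)) * (\<integral>\<^sup>+\<omega>'. F \<omega>' \<partial>PP (shd (sdrop n \<omega>))) \<partial>PP x)" for n
  proof -
    have "(\<integral>\<^sup>+\<omega>. of_bool (exits R n \<omega> \<and> A (stake n \<omega>)) * F (sdrop n \<omega>) \<partial>PP x)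
      = (\<integral>\<^sup>+\<omega>. f (stake n \<omega>) * (of_bool (enorm (shd (sdrop n \<omega>)) \<ge> R) * F (sdrop n \<omega>)) \<partial>PP x)"
      unfolding split ..
    also have "\<dots> = (\<integral>\<^sup>+\<omega>. f (stake n \<omega>) * (\<integral>\<^sup>+\<omega>'. of_bool (enorm (shd \<omega>') \<ge> R) * F \<omega>' \<partial>PP (\<omega> !! n)) \<partial>PP x)"
      by (rule nn_integral_markov[of "\<lambda>\<omega>. of_bool (enorm (shd \<omega>) \<ge> R) * F \<omega>", OF _ x]) measurable
    also have "\<dots> = (\<integral>\<^sup>+\<omega>. f (stake n \<omega>) * (of_bool (enorm (shd (sdrop n \<omega>)) \<ge> R) * (\<integral>\<^sup>+\<omega>'. F \<omega>' \<partial>PP (shd (sdrop n \<omega>)))) \<partial>PP x)"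
    proof (rule nn_integral_cong)
      fix \<omega>
      have "(\<integral>\<^sup>+\<omega>'. of_bool (enorm (shd \<omega>') \<ge> R) * F \<omega>' \<partial>PP (\<omega> !! n)) = (\<integral>\<^sup>+\<omega>'. of_bool (enorm (\<omega> !! n) \<ge> R) * F \<omega>' \<partial>PP (\<omega> !! n))"
        by (rule nn_integral_cong_AE) (use AE_PP_shd[of "\<omega> !! n"] in \<open>auto elim!: eventually_mono\<close>)
      also have "\<dots> = of_bool (enorm (\<omega> !! n) \<ge> R) * (\<integral>\<^sup>+\<omega>'. F \<omega>' \<partial>PP (\<omega> !! n))"
        by (rule nn_integral_cmult) measurable
      finally show "f (stake n \<omega>) * (\<integral>\<^sup>+\<omega>'. of_bool (enorm (shd \<omega>') \<ge> R) * F \<omega>' \<partial>PP (\<omega> !! n))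
        = f (stake n \<omega>) * (of_bool (enorm (shd (sdrop n \<omega>)) \<ge> R) * (\<integral>\<^sup>+\<omega>'. F \<omega>' \<partial>PP (shd (sdrop n \<omega>))))"
        by simp
    qed
    finally show ?thesis unfolding split[of _ _ "\<lambda>\<omega>. \<integral>\<^sup>+\<omega>'. F \<omega>' \<partial>PP (shd \<omega>)"] .
  qed
  have [measurable]: "(\<lambda>\<omega>. F (sdrop n \<omega>)) \<in> borel_measurable SS" for n
    by (rule measurable_compose[OF measurable_sdrop assms(1)])
  have [measurable]: "(\<lambda>\<omega>. \<integral>\<^sup>+\<omega>'. F \<omega>' \<partial>PP (shd (sdrop n \<omega>))) \<in> borel_measurable SS" for n
    by (rule measurable_compose[OF measurable_sdrop measurable_start[of "\<lambda>y. \<integral>\<^sup>+\<omega>'. F \<omega>' \<partial>PP y"]])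
  show ?thesis unfolding at_exit_def
    by (subst (1 2) nn_integral_suminf) (measurable, simp only: e)
qed

text \<open>Steps have length 1, so the sphere is overshot by less than 1. This is the origin of the
  shells R \<le> |y| < R + 1 in the exit lemmas.\<close>

lemma exits_shell:
  assumes "good \<omega>" "exits R n \<omega>" "enorm (\<omega> !! 0) < R + 1"
  shows "R \<le> enorm (\<omega> !! n)" "enorm (\<omega> !! n) < R + 1"
proof -
  show "R \<le> enorm (\<omega> !! n)" using assms by (simp add: exits_def)
  show "enorm (\<omega> !! n) < R + 1"
  proof (cases n)
    case (Suc m)
    have "enorm (\<omega> !! m) < R" using assms(2) Suc by (auto simp: exits_def)
    moreover have "enorm (\<omega> !! m + (\<omega> !! Suc m - \<omega> !! m)) \<le> enorm (\<omega> !! m) + 1"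
      by (rule enorm_step_le) (use assms(1) in \<open>auto simp: good_def\<close>)
    ultimately show ?thesis using Suc by simp
  qed (use assms in simp)
qed

lemma at_exit_1_integral:
  "(\<integral>\<^sup>+\<omega>. at_exit A R (\<lambda>_. 1) \<omega> \<partial>PP x) = ennreal (PR x (\<lambda>\<omega>. \<exists>n. exits R n \<omega> \<and> A (stake n \<omega>)))"
proof -
  have "at_exit A R (\<lambda>_. 1) \<omega> = indicator {\<omega>. \<exists>n. exits R n \<omega> \<and> A (stake n \<omega>)} \<omega>" for \<omega>
  proof (cases "\<exists>n. exits R n \<omega>")
    case True
    then obtain n where n: "exits R n \<omega>" by blast
    then show ?thesis by (simp add: at_exit_eq[OF n] exits_Ex[OF n] indicator_def)
  qed (auto simp: at_exit_eq_0 indicator_def)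
  moreover have "Measurable.pred SS (\<lambda>\<omega>. \<exists>n. exits R n \<omega> \<and> A (stake n \<omega>))" by measurable
  ultimately show ?thesis by (simp add: PR_eq_nn_integral)
qed

lemma at_exit_integral_le:
  assumes F: "F \<in> borel_measurable SS" and x: "x \<noteq> 0" "enorm x < R + 1"
    and c: "\<And>y. y \<noteq> 0 \<Longrightarrow> R \<le> enorm y \<Longrightarrow> enorm y < R + 1 \<Longrightarrow> (\<integral>\<^sup>+\<omega>. F \<omega> \<partial>PP y) \<le> c"
  shows "(\<integral>\<^sup>+\<omega>. at_exit A R F \<omega> \<partial>PP x) \<le> c * ennreal (PR x (\<lambda>\<omega>. \<exists>n. exits R n \<omega> \<and> A (stake n \<omega>)))"
proof -
  have "(\<integral>\<^sup>+\<omega>. at_exit A R F \<omega> \<partial>PP x) \<le> (\<integral>\<^sup>+\<omega>. c * at_exit A R (\<lambda>_. 1) \<omega> \<partial>PP x)"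
    unfolding strong_markov[OF F x(1)]
  proof (rule nn_integral_mono_AE)
    show "AE \<omega> in PP x. at_exit A R (\<lambda>\<omega>. \<integral>\<^sup>+\<omega>'. F \<omega>' \<partial>PP (shd \<omega>)) \<omega> \<le> c * at_exit A R (\<lambda>_. 1) \<omega>"
      using AE_PP_good[OF x(1)] AE_PP_shd[of x]
    proof eventually_elim
      case (elim \<omega>)
      show ?case
      proof (cases "\<exists>n. exits R n \<omega>")
        case True
        then obtain n where n: "exits R n \<omega>" by blast
        have "(\<integral>\<^sup>+\<omega>'. F \<omega>' \<partial>PP (\<omega> !! n)) \<le> c"
          using exits_shell[OF elim(1) n] elim x by (intro c) (auto simp: good_def)
        then show ?thesis by (simp add: at_exit_eq[OF n])
      qed (simp add: at_exit_eq_0)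
    qed
  qed
  also have "\<dots> = c * (\<integral>\<^sup>+\<omega>. at_exit A R (\<lambda>_. 1) \<omega> \<partial>PP x)" by (rule nn_integral_cmult) measurable
  finally show ?thesis by (simp only: at_exit_1_integral)
qed

lemma at_exit_integral_ge:
  assumes F: "F \<in> borel_measurable SS" and x: "x \<noteq> 0" "enorm x < R + 1"
    and c: "\<And>y. y \<noteq> 0 \<Longrightarrow> R \<le> enorm y \<Longrightarrow> enorm y < R + 1 \<Longrightarrow> (\<integral>\<^sup>+\<omega>. F \<omega> \<partial>PP y) \<ge> c"
  shows "(\<integral>\<^sup>+\<omega>. at_exit A R F \<omega> \<partial>PP x) \<ge> c * ennreal (PR x (\<lambda>\<omega>. \<exists>n. exits R n \<omega> \<and> A (stake n \<omega>)))"
proof -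
  have "c * (\<integral>\<^sup>+\<omega>. at_exit A R (\<lambda>_. 1) \<omega> \<partial>PP x) = (\<integral>\<^sup>+\<omega>. c * at_exit A R (\<lambda>_. 1) \<omega> \<partial>PP x)"
    by (rule nn_integral_cmult[symmetric]) measurable
  also have "\<dots> \<le> (\<integral>\<^sup>+\<omega>. at_exit A R F \<omega> \<partial>PP x)"
    unfolding strong_markov[OF F x(1)]
  proof (rule nn_integral_mono_AE)
    show "AE \<omega> in PP x. c * at_exit A R (\<lambda>_. 1) \<omega> \<le> at_exit A R (\<lambda>\<omega>. \<integral>\<^sup>+\<omega>'. F \<omega>' \<partial>PP (shd \<omega>)) \<omega>"
      using AE_PP_good[OF x(1)] AE_PP_shd[of x]
    proof eventually_elim
      case (elim \<omega>)
      show ?case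
      proof (cases "\<exists>n. exits R n \<omega>")
        case True
        then obtain n where n: "exits R n \<omega>" by blast
        have "(\<integral>\<^sup>+\<omega>'. F \<omega>' \<partial>PP (\<omega> !! n)) \<ge> c"
          using exits_shell[OF elim(1) n] elim x by (intro c) (auto simp: good_def)
        then show ?thesis by (simp add: at_exit_eq[OF n])
      qed (simp add: at_exit_eq_0)
    qed
  qed
  finally show ?thesis by (simp only: at_exit_1_integral)
qed

lemma at_exit_indicator:
  "at_exit A R (indicator {\<omega>. E \<omega>}) \<omega> = indicator {\<omega>. \<exists>n. exits R n \<omega> \<and> A (stake n \<omega>) \<and> E (sdrop n \<omega>)} \<omega>"
proof (cases "\<exists>n. exits R n \<omega>")
  case True
  then obtain n where n: "exits R n \<omega>" by blast
  then show ?thesis by (simp add: at_exit_eq[OF n] exits_Ex[OF n] indicator_def)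
qed (auto simp: at_exit_eq_0 indicator_def)

lemma measurable_exit_event [measurable]:
  assumes [measurable]: "Measurable.pred SS E"
  shows "Measurable.pred SS (\<lambda>\<omega>. \<exists>n. exits R n \<omega> \<and> A (stake n \<omega>) \<and> E (sdrop n \<omega>))"
proof -
  have [measurable]: "Measurable.pred SS (\<lambda>\<omega>. E (sdrop n \<omega>))" for n
    by (rule measurable_compose[OF measurable_sdrop assms])
  show ?thesis by measurable
qed

lemma PR_exit_le:
  assumes [measurable]: "Measurable.pred SS E" and x: "x \<noteq> 0" "enorm x < R + 1" and "c \<ge> 0"
    and c: "\<And>y. y \<noteq> 0 \<Longrightarrow> R \<le> enorm y \<Longrightarrow> enorm y < R + 1 \<Longrightarrow> PR y E \<le> c"
  shows "PR x (\<lambda>\<omega>. \<exists>n. exits R n \<omega> \<and> A (stake n \<omega>) \<and> E (sdrop n \<omega>)) \<le> c * PR x (\<lambda>\<omega>. \<exists>n. exits R n \<omega> \<and> A (stake n \<omega>))"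
proof -
  have m: "{\<omega>. E \<omega>} \<in> sets SS" by measurable
  have "ennreal (PR x (\<lambda>\<omega>. \<exists>n. exits R n \<omega> \<and> A (stake n \<omega>) \<and> E (sdrop n \<omega>))) = (\<integral>\<^sup>+\<omega>. at_exit A R (indicator {\<omega>. E \<omega>}) \<omega> \<partial>PP x)"
    unfolding at_exit_indicator by (rule PR_eq_nn_integral) measurable
  also have "\<dots> \<le> ennreal c * ennreal (PR x (\<lambda>\<omega>. \<exists>n. exits R n \<omega> \<and> A (stake n \<omega>)))"
  proof (rule at_exit_integral_le[OF _ x])
    fix y :: site assume "y \<noteq> 0" "R \<le> enorm y" "enorm y < R + 1"
    then have "ennreal (PR y E) \<le> ennreal c" by (intro ennreal_leI c)
    then show "(\<integral>\<^sup>+\<omega>. indicator {\<omega>. E \<omega>} \<omega> \<partial>PP y) \<le> ennreal c" by (simp only: PR_eq_nn_integral[OF assms(1)])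
  qed (use m in measurable)
  finally show ?thesis using \<open>c \<ge> 0\<close> by (simp flip: ennreal_mult)
qed

lemma PR_exit_ge:
  assumes [measurable]: "Measurable.pred SS E" and x: "x \<noteq> 0" "enorm x < R + 1" and "c \<ge> 0"
    and c: "\<And>y. y \<noteq> 0 \<Longrightarrow> R \<le> enorm y \<Longrightarrow> enorm y < R + 1 \<Longrightarrow> PR y E \<ge> c"
  shows "PR x (\<lambda>\<omega>. \<exists>n. exits R n \<omega> \<and> A (stake n \<omega>) \<and> E (sdrop n \<omega>)) \<ge> c * PR x (\<lambda>\<omega>. \<exists>n. exits R n \<omega> \<and> A (stake n \<omega>))"
proof -
  have m: "{\<omega>. E \<omega>} \<in> sets SS" by measurable
  have "ennreal c * ennreal (PR x (\<lambda>\<omega>. \<exists>n. exits R n \<omega> \<and> A (stake n \<omega>))) \<le> (\<integral>\<^sup>+\<omega>. at_exit A R (indicator {\<omega>. E \<omega>}) \<omega> \<partial>PP x)"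
  proof (rule at_exit_integral_ge[OF _ x])
    fix y :: site assume "y \<noteq> 0" "R \<le> enorm y" "enorm y < R + 1"
    then have "ennreal c \<le> ennreal (PR y E)" by (intro ennreal_leI c)
    then show "ennreal c \<le> (\<integral>\<^sup>+\<omega>. indicator {\<omega>. E \<omega>} \<omega> \<partial>PP y)" by (simp only: PR_eq_nn_integral[OF assms(1)])
  qed (use m in measurable)
  also have "\<dots> = ennreal (PR x (\<lambda>\<omega>. \<exists>n. exits R n \<omega> \<and> A (stake n \<omega>) \<and> E (sdrop n \<omega>)))"
    unfolding at_exit_indicator by (rule PR_eq_nn_integral[symmetric]) measurable
  finally show ?thesis using \<open>c \<ge> 0\<close> by (simp flip: ennreal_mult)
qed

section \<open>The Markov property at fixed times, and the exit time of a ball\<close>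

lemma PR_markov_prefix:
  assumes [measurable]: "Measurable.pred SS E" and x: "x \<noteq> 0"
  shows "ennreal (PR x (\<lambda>\<omega>. \<phi> (stake n \<omega>) \<and> E (sdrop n \<omega>))) = (\<integral>\<^sup>+\<omega>. of_bool (\<phi> (stake n \<omega>)) * ennreal (PR (\<omega> !! n) E) \<partial>PP x)"
proof -
  have [measurable]: "Measurable.pred SS (\<lambda>\<omega>. E (sdrop n \<omega>))"
    by (rule measurable_compose[OF measurable_sdrop assms(1)])
  have m: "Measurable.pred SS (\<lambda>\<omega>. \<phi> (stake n \<omega>) \<and> E (sdrop n \<omega>))" by measurable
  have m': "indicator {\<omega>. E \<omega>} \<in> borel_measurable SS"
    using sets_Collect_SS[OF assms(1)] by measurable
  have "ennreal (PR x (\<lambda>\<omega>. \<phi> (stake n \<omega>) \<and> E (sdrop n \<omega>))) = (\<integral>\<^sup>+\<omega>. (\<lambda>l. of_bool (\<phi> l)) (stake n \<omega>) * indicator {\<omega>. E \<omega>} (sdrop n \<omega>) \<partial>PP x)"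
    unfolding PR_eq_nn_integral[OF m] by (rule nn_integral_cong) (simp add: indicator_def)
  also have "\<dots> = (\<integral>\<^sup>+\<omega>. (\<lambda>l. of_bool (\<phi> l)) (stake n \<omega>) * (\<integral>\<^sup>+\<omega>'. indicator {\<omega>. E \<omega>} \<omega>' \<partial>PP (\<omega> !! n)) \<partial>PP x)"
    by (rule nn_integral_markov[OF m' x])
  finally show ?thesis by (simp only: PR_eq_nn_integral[OF assms(1)])
qed

lemma PR_markov_prefix_le:
  assumes E: "Measurable.pred SS E" and x: "x \<noteq> 0" and "c \<ge> 0"
    and c: "\<And>y. y \<noteq> 0 \<Longrightarrow> y \<in> B \<Longrightarrow> PR y E \<le> c"
  shows "PR x (\<lambda>\<omega>. \<phi> (stake n \<omega>) \<and> \<omega> !! n \<in> B \<and> E (sdrop n \<omega>)) \<le> c * PR x (\<lambda>\<omega>. \<phi> (stake n \<omega>))"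
proof -
  have [measurable]: "Measurable.pred SS E" by fact
  have m: "Measurable.pred SS (\<lambda>\<omega>. shd \<omega> \<in> B \<and> E \<omega>)" by measurable
  have mp: "Measurable.pred SS (\<lambda>\<omega>. \<phi> (stake n \<omega>))" by measurable
  have "ennreal (PR x (\<lambda>\<omega>. \<phi> (stake n \<omega>) \<and> shd (sdrop n \<omega>) \<in> B \<and> E (sdrop n \<omega>)))
    = (\<integral>\<^sup>+\<omega>. of_bool (\<phi> (stake n \<omega>)) * ennreal (PR (\<omega> !! n) (\<lambda>\<omega>. shd \<omega> \<in> B \<and> E \<omega>)) \<partial>PP x)"
    by (rule PR_markov_prefix[OF m x])
  also have "\<dots> \<le> (\<integral>\<^sup>+\<omega>. ennreal c * indicator {\<omega>. \<phi> (stake n \<omega>)} \<omega> \<partial>PP x)"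
  proof (rule nn_integral_mono_AE)
    show "AE \<omega> in PP x. of_bool (\<phi> (stake n \<omega>)) * ennreal (PR (\<omega> !! n) (\<lambda>\<omega>. shd \<omega> \<in> B \<and> E \<omega>)) \<le> ennreal c * indicator {\<omega>. \<phi> (stake n \<omega>)} \<omega>"
      using AE_PP_good[OF x]
    proof eventually_elim
      case (elim \<omega>)
      let ?y = "\<omega> !! n"
      have y: "?y \<noteq> 0" using elim by (auto simp: good_def)
      have "PR ?y (\<lambda>\<omega>. shd \<omega> \<in> B \<and> E \<omega>) = PR ?y (\<lambda>\<omega>. ?y \<in> B \<and> E \<omega>)"
        by (rule PR_cong_start[OF _ _ _ y]) auto
      also have "\<dots> \<le> c" using c[OF y] \<open>c \<ge> 0\<close> by (cases "?y \<in> B"; simp)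
      finally have "ennreal (PR ?y (\<lambda>\<omega>. shd \<omega> \<in> B \<and> E \<omega>)) \<le> ennreal c" by (rule ennreal_leI)
      then show ?case by (simp add: indicator_def)
    qed
  qed
  also have "\<dots> = ennreal c * ennreal (PR x (\<lambda>\<omega>. \<phi> (stake n \<omega>)))"
    by (subst nn_integral_cmult) (use sets_Collect_SS[OF mp] in \<open>auto simp: PR_eq_nn_integral[OF mp]\<close>)
  finally show ?thesis using \<open>c \<ge> 0\<close> by (simp flip: ennreal_mult)
qed

lemma PR_markov_le:
  assumes "Measurable.pred SS E" "x \<noteq> 0" "c \<ge> 0" "\<And>y. y \<noteq> 0 \<Longrightarrow> y \<in> B \<Longrightarrow> PR y E \<le> c"
  shows "PR x (\<lambda>\<omega>. \<omega> !! n \<in> B \<and> E (sdrop n \<omega>)) \<le> c"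
  using PR_markov_prefix_le[OF assms, where \<phi> = "\<lambda>_. True" and n = n] PP.prob_space[of x] by simp

lemma PR_Un_le:
  assumes "Measurable.pred SS F" "Measurable.pred SS G" "\<And>\<omega>. E \<omega> \<Longrightarrow> F \<omega> \<or> G \<omega>"
  shows "PR x E \<le> PR x F + PR x G"
proof -
  have "PR x E \<le> measure (PP x) ({\<omega>. F \<omega>} \<union> {\<omega>. G \<omega>})"
    by (rule PP.finite_measure_mono) (use assms in \<open>auto intro: sets_Collect_SS\<close>)
  also have "\<dots> \<le> PR x F + PR x G"
    by (rule measure_Un_le) (use assms in \<open>auto intro: sets_Collect_SS\<close>)
  finally show ?thesis .
qed

text \<open>From a fixed x, \<open>marginal_ball_le\<close> carries a factor ln \<rho>, so time
  \<rho>^2 is out of reach in one go. Half of the time takes the walk to radius sqrt \<rho>, where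
  the gain \<rho>/\<rho>^2 beats the logarithm; from there the kernel is comparable to ln \<rho>
  (ratio at most 3, as kap ln \<rho> \<ge> 48), and 3 * 36/432 = 1/4.\<close>

lemma exit_time_le:
  assumes x: "x \<noteq> 0"
  shows "\<exists>\<rho>\<^sub>0. \<forall>\<rho>\<ge>\<rho>\<^sub>0. \<forall>n. real n \<ge> 1000 * \<rho>\<^sup>2 \<longrightarrow> PR x (\<lambda>\<omega>. \<exists>k\<le>n. enorm (\<omega> !! k) \<ge> \<rho>) \<ge> 1 / 2"
proof -
  let ?a = "potential_kernel x"
  have ap: "?a > 0" by (rule kernel_pos[OF x])
  have "\<forall>\<^sub>F \<rho> in at_top. (kap * ln (sqrt \<rho>) + 6) / ?a * (36 * (sqrt \<rho>)\<^sup>2 / (432 * \<rho>\<^sup>2)) \<le> 1 / 4"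
    using kap_pos ap by real_asymp
  moreover have "\<forall>\<^sub>F \<rho> in at_top. kap * ln \<rho> \<ge> 48" using kap_pos by real_asymp
  moreover have "\<forall>\<^sub>F \<rho> in at_top. enorm x < sqrt \<rho> + 1" by real_asymp
  ultimately have "\<forall>\<^sub>F \<rho> in at_top. \<forall>n. real n \<ge> 1000 * \<rho>\<^sup>2 \<longrightarrow> PR x (\<lambda>\<omega>. \<exists>k\<le>n. enorm (\<omega> !! k) \<ge> \<rho>) \<ge> 1 / 2"
    using eventually_ge_at_top[of 1]
  proof eventually_elim
    case (elim \<rho>)
    show ?case
    proof (intro allI impI)
      fix N assume N: "real N \<ge> 1000 * \<rho>\<^sup>2"
      define n where "n = N div 2"
      have r1: "\<rho> \<ge> 1" "sqrt \<rho> \<ge> 1" "\<rho>\<^sup>2 \<ge> 1" using elim by auto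
      have n: "real n \<ge> 432 * \<rho>\<^sup>2"
      proof -
        have "real N \<le> 2 * real n + 1" unfolding n_def by linarith
        then show ?thesis using N r1 by linarith
      qed
      have nN: "n + n \<le> N" by (simp add: n_def)
      have lnsq: "ln (sqrt \<rho>) = ln \<rho> / 2" using elim by (simp add: ln_sqrt)
      have frac: "36 * t / (real n + 1) \<le> 36 * t / (432 * \<rho>\<^sup>2)" if "t \<ge> 0" for t
        using n r1 that by (intro divide_left_mono) auto
      have 1: "PR x (\<lambda>\<omega>. enorm (\<omega> !! n) \<le> sqrt \<rho>) \<le> 1 / 4"
      proof -
        have "PR x (\<lambda>\<omega>. enorm (\<omega> !! n) \<le> sqrt \<rho>) \<le> (kap * ln (sqrt \<rho>) + 6) / ?a * (36 * (sqrt \<rho>)\<^sup>2 / (real n + 1))"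
          by (rule marginal_ball_le[OF x r1(2)])
        also have "\<dots> \<le> (kap * ln (sqrt \<rho>) + 6) / ?a * (36 * (sqrt \<rho>)\<^sup>2 / (432 * \<rho>\<^sup>2))"
        proof (rule mult_left_mono)
          show "36 * (sqrt \<rho>)\<^sup>2 / (real n + 1) \<le> 36 * (sqrt \<rho>)\<^sup>2 / (432 * \<rho>\<^sup>2)" by (rule frac) simp
          have "kap * ln (sqrt \<rho>) + 6 \<ge> 0" using elim unfolding lnsq by linarith
          then show "0 \<le> (kap * ln (sqrt \<rho>) + 6) / ?a" using ap by simp
        qed
        finally show ?thesis using elim by linarith
      qed
      have 2: "PR x (\<lambda>\<omega>. \<exists>k. exits (sqrt \<rho>) k \<omega> \<and> True \<and> enorm (sdrop k \<omega> !! n) \<le> \<rho>) \<le> 1 / 4 * 1"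
      proof (rule order_trans[OF PR_exit_le[where c = "1/4" and A = "\<lambda>_. True"]])
        fix y :: site assume y: "y \<noteq> 0" "sqrt \<rho> \<le> enorm y"
        have "potential_kernel y \<ge> kap * ln (sqrt \<rho>) - 6" using y r1 by (intro kernel_ge_outside) auto
        then have ay: "kap * ln \<rho> + 6 \<le> 3 * potential_kernel y" using elim unfolding lnsq by linarith
        have "PR y (\<lambda>\<omega>. enorm (\<omega> !! n) \<le> \<rho>) \<le> (kap * ln \<rho> + 6) / potential_kernel y * (36 * \<rho>\<^sup>2 / (real n + 1))"
          by (rule marginal_ball_le[OF y(1) r1(1)])
        also have "\<dots> \<le> 3 * (36 * \<rho>\<^sup>2 / (432 * \<rho>\<^sup>2))"
          using ay kernel_pos[OF y(1)] frac[of "\<rho>\<^sup>2"] by (intro mult_mono) (auto simp: pos_divide_le_eq)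
        also have "\<dots> = 1 / 4" using r1 by simp
        finally show "PR y (\<lambda>\<omega>. enorm (\<omega> !! n) \<le> \<rho>) \<le> 1 / 4" .
      qed (use x elim in auto)
      have "PR x (\<lambda>\<omega>. \<not> (\<exists>k\<le>N. enorm (\<omega> !! k) \<ge> \<rho>)) \<le> PR x (\<lambda>\<omega>. enorm (\<omega> !! n) \<le> sqrt \<rho>)
         + PR x (\<lambda>\<omega>. \<exists>k. exits (sqrt \<rho>) k \<omega> \<and> True \<and> enorm (sdrop k \<omega> !! n) \<le> \<rho>)"
      proof (rule PR_Un_le)
        show "Measurable.pred SS (\<lambda>\<omega>. \<exists>k. exits (sqrt \<rho>) k \<omega> \<and> True \<and> enorm (sdrop k \<omega> !! n) \<le> \<rho>)"
          by (rule measurable_exit_event) measurable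
        fix \<omega> :: "site stream" assume h: "\<not> (\<exists>k\<le>N. enorm (\<omega> !! k) \<ge> \<rho>)"
        show "enorm (\<omega> !! n) \<le> sqrt \<rho> \<or> (\<exists>k. exits (sqrt \<rho>) k \<omega> \<and> True \<and> enorm (sdrop k \<omega> !! n) \<le> \<rho>)"
        proof (cases "enorm (\<omega> !! n) \<le> sqrt \<rho>")
          case False
          then obtain k where k: "k \<le> n" "exits (sqrt \<rho>) k \<omega>" using exits_exists[of "sqrt \<rho>" \<omega> n] by auto
          then have "n + k \<le> N" using nN by simp
          then have "enorm (\<omega> !! (n + k)) < \<rho>" using h not_less by blast
          then show ?thesis using k(2) by (auto simp: sdrop_snth add.commute less_imp_le)
        qed simp
      qed measurable
      moreover have "PR x (\<lambda>\<omega>. \<not> (\<exists>k\<le>N. enorm (\<omega> !! k) \<ge> \<rho>)) = 1 - PR x (\<lambda>\<omega>. \<exists>k\<le>N. enorm (\<omega> !! k) \<ge> \<rho>)"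
        by (rule PR_not) measurable
      ultimately show "PR x (\<lambda>\<omega>. \<exists>k\<le>N. enorm (\<omega> !! k) \<ge> \<rho>) \<ge> 1 / 2" using 1 2 by linarith
    qed
  qed
  then show ?thesis by (simp add: eventually_at_top_linorder)
qed

section \<open>The future minima on path space\<close>

definition fmin :: "nat \<Rightarrow> site stream \<Rightarrow> real" where
  "fmin n \<omega> = (INF m\<in>{n..}. enorm (\<omega> !! m))"

lemma bdd_below_enorm: "bdd_below ((\<lambda>m. enorm (\<omega> !! m)) ` A)"
  by (rule bdd_belowI[of _ 0]) auto

lemma fmin_ge: "(\<And>m. m \<ge> n \<Longrightarrow> r \<le> enorm (\<omega> !! m)) \<Longrightarrow> r \<le> fmin n \<omega>"
  unfolding fmin_def by (rule cINF_greatest) auto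

lemma fmin_le: "m \<ge> n \<Longrightarrow> fmin n \<omega> \<le> enorm (\<omega> !! m)"
  unfolding fmin_def by (rule cINF_lower[OF bdd_below_enorm]) simp

lemma fmin_mono: "n \<le> m \<Longrightarrow> fmin n \<omega> \<le> fmin m \<omega>"
  by (rule fmin_ge) (auto intro: fmin_le)

lemma fmin_less: "fmin n \<omega> < r \<Longrightarrow> \<exists>m\<ge>n. enorm (\<omega> !! m) < r"
  by (rule ccontr) (use fmin_ge[of n r \<omega>] in force)

lemma measurable_fmin [measurable]: "fmin n \<in> borel_measurable SS"
proof -
  have "(\<lambda>\<omega>. INF m\<in>{n..}. enorm (\<omega> !! m)) \<in> borel_measurable SS"
  proof (rule borel_measurable_cINF)
    fix m
    show "(\<lambda>\<omega>. enorm (\<omega> !! m)) \<in> borel_measurable SS"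
      by (rule measurable_compose[OF measurable_snth]) simp
  qed (auto intro: bdd_below_enorm)
  then show ?thesis by (simp add: fmin_def[abs_def])
qed

lemma fmin_sdrop: "fmin n (sdrop k \<omega>) = fmin (n + k) \<omega>"
proof (rule antisym)
  show "fmin n (sdrop k \<omega>) \<le> fmin (n + k) \<omega>"
  proof (rule fmin_ge)
    fix m assume "m \<ge> n + k"
    then show "fmin n (sdrop k \<omega>) \<le> enorm (\<omega> !! m)"
      using fmin_le[of n "m - k" "sdrop k \<omega>"] by (simp add: sdrop_snth)
  qed
  show "fmin (n + k) \<omega> \<le> fmin n (sdrop k \<omega>)"
    by (rule fmin_ge) (simp add: sdrop_snth fmin_le)
qed

subsection \<open>Integrals of monotone functions as sums\<close>

text \<open>Integral test with step functions below \<open>g\<close>, taking on each unit interval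
  the value at its right end. At each point at most one step contributes, which is what the
  induction on the number of steps tracks.\<close>

lemma summable_of_integral:
  fixes g :: "real \<Rightarrow> real"
  assumes g0: "\<And>u. u \<ge> 0 \<Longrightarrow> g u \<ge> 0" and anti: "antimono_on {0..} g"
    and conv: "integral_converges_at_top g"
  shows "summable (\<lambda>k. g (real k))"
proof -
  obtain A where A: "A \<ge> 0" "(\<integral>\<^sup>+ u. ennreal (g u) * indicator {A..} u \<partial>lborel) < \<infinity>"
    using conv by (auto simp: integral_converges_at_top_def)
  define K where "K = nat \<lceil>A\<rceil>"
  have K: "A \<le> real K" using A(1) by (simp add: K_def)
  let ?I = "\<lambda>k. {real (K + k)..<real (K + Suc k)}"
  have pt: "(\<Sum>k<n. ennreal (g (real (K + Suc k))) * indicator (?I k) u) \<le> ennreal (g u) * indicator {real K..<real (K + n)} u" for n u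
  proof (induction n)
    case (Suc n)
    consider "u < real (K + n)" | "u \<in> ?I n" | "u \<ge> real (K + Suc n)" by fastforce
    then show ?case
    proof cases
      case 1
      then show ?thesis using Suc by (simp add: indicator_def)
    next
      case 2
      then have "(\<Sum>k<n. ennreal (g (real (K + Suc k))) * indicator (?I k) u) \<le> 0" using Suc by (simp add: indicator_def)
      then have S0: "(\<Sum>k<n. ennreal (g (real (K + Suc k))) * indicator (?I k) u) = 0" by simp
      have "g (real (K + Suc n)) \<le> g u" using 2 by (intro monotone_onD[OF anti]) auto
      then have "ennreal (g (real (K + Suc n))) * indicator (?I n) u \<le> ennreal (g u) * indicator {real K..<real (K + Suc n)} u"
        using 2 by (simp add: ennreal_leI)
      then show ?thesis unfolding sum.lessThan_Suc S0 add_0 .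
    next
      case 3
      have S0: "(\<Sum>k<Suc n. ennreal (g (real (K + Suc k))) * indicator (?I k) u) = 0"
        using 3 by (intro sum.neutral) (auto simp: indicator_def)
      show ?thesis unfolding S0 by (rule zero_le)
    qed
  qed simp
  have "(\<Sum>k<n. g (real (K + Suc k))) \<le> enn2real (\<integral>\<^sup>+ u. ennreal (g u) * indicator {A..} u \<partial>lborel)" for n
  proof -
    have "ennreal (\<Sum>k<n. g (real (K + Suc k))) = (\<Sum>k<n. ennreal (g (real (K + Suc k))) * emeasure lborel (?I k))"
      using g0 by (simp add: sum_nonneg)
    also have "\<dots> = (\<integral>\<^sup>+ u. (\<Sum>k<n. ennreal (g (real (K + Suc k))) * indicator (?I k) u) \<partial>lborel)"
      by (subst nn_integral_sum) (auto simp: nn_integral_cmult_indicator)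
    also have "\<dots> \<le> (\<integral>\<^sup>+ u. ennreal (g u) * indicator {A..} u \<partial>lborel)"
    proof (rule nn_integral_mono)
      fix u :: real
      note pt[where n = n and u = u]
      also have "ennreal (g u) * indicator {real K..<real (K + n)} u \<le> ennreal (g u) * indicator {A..} u"
        using K by (intro mult_left_mono) (auto simp: indicator_def)
      finally show "(\<Sum>k<n. ennreal (g (real (K + Suc k))) * indicator (?I k) u) \<le> ennreal (g u) * indicator {A..} u" .
    qed
    finally have "enn2real (ennreal (\<Sum>k<n. g (real (K + Suc k)))) \<le> enn2real (\<integral>\<^sup>+ u. ennreal (g u) * indicator {A..} u \<partial>lborel)"
      using A(2) by (intro enn2real_mono) auto
    then show ?thesis using g0 by (simp add: sum_nonneg)
  qed
  then have "summable (\<lambda>k. g (real (K + Suc k)))"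
    by (intro summableI_nonneg_bounded) (auto simp: g0)
  then have "summable (\<lambda>k. g (real (k + Suc K)))" by (simp add: add_ac)
  then show ?thesis by (subst (asm) summable_iff_shift[of "\<lambda>k. g (real k)"])
qed

text \<open>Step functions above \<open>g\<close>. Offset and mesh are free because the radii exp
  (4^k) used for the divergent case correspond to the points ln 2 + j ln 4.\<close>

lemma not_summable_of_integral:
  fixes g :: "real \<Rightarrow> real"
  assumes g0: "\<And>u. u \<ge> 0 \<Longrightarrow> g u \<ge> 0" and anti: "antimono_on {0..} g"
    and div: "integral_diverges_at_top g" and A: "A \<ge> 0" and d: "d > 0"
  shows "\<not> summable (\<lambda>k. g (A + real k * d))"
proof
  assume sm: "summable (\<lambda>k. g (A + real k * d))"
  let ?I = "\<lambda>k::nat. {A + real k * d..<A + real (Suc k) * d}"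
  have "(\<integral>\<^sup>+ u. ennreal (g u) * indicator {A..} u \<partial>lborel) \<le> (\<integral>\<^sup>+ u. (\<Sum>k. ennreal (g (A + real k * d)) * indicator (?I k) u) \<partial>lborel)"
  proof (rule nn_integral_mono)
    fix u :: real
    show "ennreal (g u) * indicator {A..} u \<le> (\<Sum>k. ennreal (g (A + real k * d)) * indicator (?I k) u)"
    proof (cases "u \<ge> A")
      case True
      define k where "k = nat \<lfloor>(u - A) / d\<rfloor>"
      have nn: "(u - A) / d \<ge> 0" using True d by simp
      have rk: "real k = of_int \<lfloor>(u - A) / d\<rfloor>" using nn by (simp add: k_def)
      have "real k \<le> (u - A) / d" "(u - A) / d < real k + 1" unfolding rk by linarith+
      then have u: "u \<in> ?I k" using d by (simp add: field_simps)
      have "g u \<le> g (A + real k * d)" using u A d True by (intro monotone_onD[OF anti]) auto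
      then have "ennreal (g u) * indicator {A..} u \<le> ennreal (g (A + real k * d)) * indicator (?I k) u"
        using u True by (simp add: ennreal_leI)
      moreover define F where "F k = ennreal (g (A + real k * d)) * indicator (?I k) u" for k
      have "(\<Sum>j\<in>{k}. F j) \<le> suminf F" by (rule sum_le_suminf) auto
      then have "F k \<le> suminf F" by simp
      ultimately show ?thesis unfolding F_def[abs_def] by (rule order_trans)
    qed simp
  qed
  also have "\<dots> = (\<Sum>k. ennreal (g (A + real k * d)) * emeasure lborel (?I k))"
    by (subst nn_integral_suminf) (auto simp: nn_integral_cmult_indicator)
  also have "\<dots> = (\<Sum>k. ennreal (g (A + real k * d) * d))"
    using d A g0 by (intro suminf_cong) (simp add: algebra_simps ennreal_mult)
  also have "\<dots> < \<infinity>"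
  proof -
    have "summable (\<lambda>k. g (A + real k * d) * d)" by (rule summable_mult2[OF sm])
    then have "(\<Sum>k. ennreal (g (A + real k * d) * d)) = ennreal (\<Sum>k. g (A + real k * d) * d)"
      using g0 A d by (intro suminf_ennreal2) auto
    then show ?thesis by simp
  qed
  finally show False using div A by (simp add: integral_diverges_at_top_def)
qed

text \<open>Places n between exp (exp j) and exp (exp (j + 1)), the blocks on which the
  Borel-Cantelli argument runs.\<close>

lemma ln_ln_bracket:
  assumes "real n \<ge> exp 1"
  shows "exp (exp (of_int \<lfloor>ln (ln (real n))\<rfloor>)) \<le> real n" "ln (real n) \<le> exp (of_int \<lfloor>ln (ln (real n))\<rfloor> + 1)"
proof -
  have n0: "real n > 0" using assms exp_gt_zero[of 1] by linarith
  have "ln (exp 1) \<le> ln (real n)" using assms n0 by (subst ln_le_cancel_iff) auto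
  then have l1: "ln (real n) \<ge> 1" by simp
  have "exp (of_int \<lfloor>ln (ln (real n))\<rfloor>) \<le> exp (ln (ln (real n)))" by simp
  also have "\<dots> = ln (real n)" using l1 by simp
  finally have "exp (exp (of_int \<lfloor>ln (ln (real n))\<rfloor>)) \<le> exp (ln (real n))" by simp
  then show "exp (exp (of_int \<lfloor>ln (ln (real n))\<rfloor>)) \<le> real n" using n0 by simp
  have "ln (real n) = exp (ln (ln (real n)))" using l1 by simp
  also have "\<dots> \<le> exp (of_int \<lfloor>ln (ln (real n))\<rfloor> + 1)" unfolding exp_le_cancel_iff by linarith
  finally show "ln (real n) \<le> exp (of_int \<lfloor>ln (ln (real n))\<rfloor> + 1)" .
qed

subsection \<open>Small values of the future minima\<close>

theorem future_min_rarely_small: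
  fixes g :: "real \<Rightarrow> real"
  assumes x: "x \<noteq> 0" and g0: "\<And>u. u \<ge> 0 \<Longrightarrow> g u \<ge> 0" and anti: "antimono_on {0..} g"
    and conv: "integral_converges_at_top g"
  shows "AE \<omega> in PP x. \<not> (\<exists>\<^sub>\<infinity>n. fmin n \<omega> \<le> exp (ln (real n) * g (ln (ln (real n)))))"
proof -
  let ?a = "potential_kernel x"
  have ap: "?a > 0" by (rule kernel_pos[OF x])
  define N where "N k = nat \<lceil>exp (exp (real k))\<rceil>" for k
  define E where "E k = exp (real k)" for k :: nat
  \<comment> \<open>Dominates the threshold for all n in the k-th block, where ln n \<le> exp (k +
    1) and g (ln ln n) \<le> g k; the factor 2 makes the final comparison strict.\<close>
  define R where "R k = 2 * exp (exp (real k + 1) * g (real k))" for k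
  have N: "real (N k) \<ge> exp (E k)" for k by (simp add: N_def E_def real_nat_ceiling_ge)
  \<comment> \<open>\<open>u\<close> bounds the probability of being within exp (E k / 4), about the
    fourth root of the time; \<open>v\<close> bounds the return to radius \<open>R k\<close> from
    farther out. In \<open>v\<close> the ratio of logarithms leaves the main term 8 e g(k).\<close>
  define u where "u k = (kap * (E k / 4) + 6) / ?a * (36 * (exp (E k / 4))\<^sup>2 / exp (E k))" for k
  define v where "v k = 8 * exp 1 * g (real k) + (kap * ln 2 + 6) * 8 / kap * exp (- real k)" for k
  have R1: "R k \<ge> 1" for k
  proof -
    have "exp (exp (real k + 1) * g (real k)) \<ge> 1" using g0[of "real k"] by simp
    then show ?thesis unfolding R_def by linarith
  qed
  have bound: "PR x (\<lambda>\<omega>. fmin (N k) \<omega> < R k) \<le> u k + v k" if k: "kap * E k \<ge> 48" for k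
  proof -
    let ?s = "exp (E k / 4)"
    have s1: "?s \<ge> 1" by (simp add: E_def)
    have "PR x (\<lambda>\<omega>. fmin (N k) \<omega> < R k) \<le> PR x (\<lambda>\<omega>. enorm (\<omega> !! N k) \<le> ?s)
       + PR x (\<lambda>\<omega>. \<omega> !! N k \<in> {z. enorm z > ?s} \<and> (\<exists>m. enorm (sdrop (N k) \<omega> !! m) \<le> R k))"
    proof (rule PR_Un_le)
      fix \<omega> assume "fmin (N k) \<omega> < R k"
      from fmin_less[OF this] obtain m where m: "m \<ge> N k" "enorm (\<omega> !! m) < R k" by blast
      then have "enorm (sdrop (N k) \<omega> !! (m - N k)) \<le> R k" by (simp add: sdrop_snth)
      then have "\<exists>m. enorm (sdrop (N k) \<omega> !! m) \<le> R k" ..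
      then show "enorm (\<omega> !! N k) \<le> ?s \<or> (\<omega> !! N k \<in> {z. enorm z > ?s} \<and> (\<exists>m. enorm (sdrop (N k) \<omega> !! m) \<le> R k))" by auto
    qed measurable
    moreover have "PR x (\<lambda>\<omega>. enorm (\<omega> !! N k) \<le> ?s) \<le> u k"
    proof -
      have "PR x (\<lambda>\<omega>. enorm (\<omega> !! N k) \<le> ?s) \<le> (kap * ln ?s + 6) / ?a * (36 * ?s\<^sup>2 / (real (N k) + 1))"
        by (rule marginal_ball_le[OF x s1])
      also have "\<dots> \<le> (kap * ln ?s + 6) / ?a * (36 * ?s\<^sup>2 / exp (E k))"
        using ap kap_pos N[of k] by (intro mult_left_mono divide_left_mono) (auto simp: E_def)
      finally show ?thesis by (simp add: u_def)
    qed
    moreover have "PR x (\<lambda>\<omega>. \<omega> !! N k \<in> {z. enorm z > ?s} \<and> (\<exists>m. enorm (sdrop (N k) \<omega> !! m) \<le> R k)) \<le> v k"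
    proof (rule PR_markov_le[OF _ x])
      show v0: "0 \<le> v k" using g0 kap_pos by (simp add: v_def)
      fix y :: site assume y: "y \<noteq> 0" "y \<in> {z. enorm z > ?s}"
      have "potential_kernel y \<ge> kap * ln ?s - 6" using y by (intro kernel_ge_outside) auto
      then have ay: "potential_kernel y \<ge> kap * E k / 8" using k by simp
      have lnR: "ln (R k) = ln 2 + exp 1 * E k * g (real k)"
        by (simp add: R_def ln_mult E_def exp_add mult_ac)
      have "PR y (\<lambda>\<omega>. \<exists>m. enorm (\<omega> !! m) \<le> R k) \<le> (kap * ln (R k) + 6) / potential_kernel y"
        by (rule hit_ball_le[OF y(1) R1])
      also have "\<dots> \<le> (kap * ln (R k) + 6) / (kap * E k / 8)"
        using ay R1[of k] kap_pos kernel_pos[OF y(1)] by (intro divide_left_mono mult_pos_pos) (auto simp: E_def)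
      also have "\<dots> = v k"
      proof -
        have em: "exp (- real k) = 1 / E k" by (simp add: E_def exp_minus field_simps)
        have "E k > 0" by (simp add: E_def)
        then show ?thesis using kap_pos unfolding v_def lnR em by (simp add: field_simps)
      qed
      finally show "PR y (\<lambda>\<omega>. \<exists>m. enorm (\<omega> !! m) \<le> R k) \<le> v k" .
    qed measurable
    ultimately show ?thesis by linarith
  qed
  have geo: "summable (\<lambda>k. exp (- real k))"
  proof -
    have "summable (\<lambda>k. exp (-1 :: real) ^ k)" by (rule summable_geometric) simp
    then show ?thesis by (simp add: exp_of_nat_mult[symmetric])
  qed
  have sv: "summable v" unfolding v_def[abs_def]
    by (intro summable_add summable_mult geo summable_of_integral[OF g0 anti conv])
  have su: "summable u"
  proof (rule summable_comparison_test_ev[OF _ geo])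
    have "\<forall>\<^sub>F k in sequentially. u k \<le> exp (- real k)" unfolding u_def E_def
      using kap_pos ap by real_asymp
    moreover have "u k \<ge> 0" for k using kap_pos ap by (simp add: u_def E_def)
    ultimately show "\<forall>\<^sub>F k in sequentially. norm (u k) \<le> exp (- real k)" by simp
  qed
  have "AE \<omega> in PP x. eventually (\<lambda>k. \<omega> \<in> space (PP x) - {\<omega>. fmin (N k) \<omega> < R k}) sequentially"
  proof (rule borel_cantelli_AE1)
    have big: "\<forall>\<^sub>F k in sequentially. kap * E k \<ge> 48" unfolding E_def using kap_pos by real_asymp
    show "summable (\<lambda>k. PR x (\<lambda>\<omega>. fmin (N k) \<omega> < R k))"
      by (rule summable_comparison_test_ev[OF _ summable_add[OF su sv]])
        (use big in \<open>eventually_elim, simp add: bound\<close>)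
  qed (auto intro!: sets_Collect_SS simp: PP.emeasure_eq_measure)
  then show ?thesis
  proof eventually_elim
    case (elim \<omega>)
    then obtain K where K: "\<And>k. k \<ge> K \<Longrightarrow> fmin (N k) \<omega> \<ge> R k"
      unfolding eventually_sequentially by (auto simp: not_less)
    have "\<not> fmin n \<omega> \<le> exp (ln (real n) * g (ln (ln (real n))))" if n: "real n \<ge> exp (exp (real K))" for n
    proof -
      define j where "j = \<lfloor>ln (ln (real n))\<rfloor>"
      have "exp 1 \<le> exp (exp (real K))" by simp
      then have n1: "real n \<ge> exp 1" using n by linarith
      have n0: "real n > 0" using n1 exp_gt_zero[of 1] by linarith
      have lnn: "ln (real n) \<ge> exp (real K)" using n n0 by (simp add: ln_ge_iff)
      then have lln: "ln (ln (real n)) \<ge> real K" by (subst ln_ge_iff) (auto intro: less_le_trans[OF exp_gt_zero])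
      then have j: "j \<ge> int K" by (simp add: j_def le_floor_iff)
      define k where "k = nat j"
      have k: "k \<ge> K" "real k = of_int j" using j by (auto simp: k_def)
      have br: "exp (exp (real k)) \<le> real n" "ln (real n) \<le> exp (real k + 1)"
        using ln_ln_bracket[OF n1] by (simp_all add: k(2) j_def)
      have "N k \<le> n" using br(1) by (simp add: N_def nat_le_iff ceiling_le_iff)
      then have "R k \<le> fmin n \<omega>" using K[OF k(1)] fmin_mono order_trans by blast
      moreover have "ln (real n) * g (ln (ln (real n))) \<le> exp (real k + 1) * g (real k)"
      proof (rule mult_mono)
        show "g (ln (ln (real n))) \<le> g (real k)"
          by (rule monotone_onD[OF anti]) (use lln k in \<open>auto simp: j_def\<close>)
        show "0 \<le> g (ln (ln (real n)))" using lln by (intro g0) linarith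
      qed (use br in auto)
      then have "exp (ln (real n) * g (ln (ln (real n)))) < R k"
        unfolding R_def by (smt (verit) exp_le_cancel_iff exp_gt_zero)
      ultimately show ?thesis by linarith
    qed
    moreover have "\<forall>\<^sub>F n in sequentially. real n \<ge> exp (exp (real K))" by real_asymp
    ultimately have "\<forall>\<^sub>F n in sequentially. \<not> fmin n \<omega> \<le> exp (ln (real n) * g (ln (ln (real n))))"
      by (auto elim!: eventually_mono)
    then show ?case by (simp add: frequently_def cofinite_eq_sequentially)
  qed
qed

text \<open>\<open>kernel_bounds\<close> says nothing near the origin, where its lower bound is
  negative. Combined with \<open>kernel_ge\<close> it gives a positive bound at every nonzero site,
  needed because the target radius may be as small as 1; the 1 next to the logarithm absorbs the
  passage from r - 1 to r.\<close>

lemma kernel_log_lower: "\<exists>c>0. c \<le> kap \<and> (\<forall>z. z \<noteq> 0 \<longrightarrow> potential_kernel z \<ge> c * (1 + ln (enorm z)))"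
proof -
  define c where "c = min (kap / 4) (3 / 4 / (12 / kap + 2))"
  have c: "c > 0" "c \<le> kap / 4" "c \<le> 3 / 4 / (12 / kap + 2)" using kap_pos by (auto simp: c_def add_pos_pos)
  have "potential_kernel z \<ge> c * (1 + ln (enorm z))" if z: "z \<noteq> 0" for z
  proof -
    define l where "l = ln (enorm z)"
    have l: "l \<ge> 0" using enorm_ge_1[OF z] by (simp add: l_def)
    show ?thesis
    proof (cases "l \<ge> 12 / kap + 1")
      case True
      have "12 / kap \<ge> 0" using kap_pos by simp
      then have l1: "l \<ge> 1" using True by linarith
      have "l \<ge> 12 / kap" using True by linarith
      then have kl: "kap * l \<ge> 12" using kap_pos by (simp add: field_simps)
      have "c * (1 + l) \<le> kap / 4 * (2 * l)" using c l1 kap_pos by (intro mult_mono) auto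
      also have "\<dots> \<le> kap * l - 6" using kl by simp
      also have "\<dots> \<le> potential_kernel z" using kernel_bounds(2)[OF z] by (simp add: l_def)
      finally show ?thesis by (simp add: l_def)
    next
      case False
      have p: "12 / kap + 2 > 0" using kap_pos by (intro add_pos_pos) auto
      have "c * (1 + l) \<le> 3 / 4 / (12 / kap + 2) * (12 / kap + 2)"
        using c l False p by (intro mult_mono) auto
      also have "\<dots> = 3 / 4" using p by (simp only: nonzero_eq_divide_eq[symmetric] less_imp_neq[THEN not_sym, OF p] not_False_eq_True)
      finally show ?thesis using kernel_ge[OF z] by (simp add: l_def)
    qed
  qed
  then show ?thesis using c kap_pos by (intro exI[of _ c]) auto
qed

lemma exits_sdrop:
  assumes "exits R n \<omega>" "exits R' n' \<omega>" "R \<le> R'"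
  shows "n \<le> n'" "exits R' (n' - n) (sdrop n \<omega>)"
proof -
  show le: "n \<le> n'" using assms unfolding exits_def by (metis dual_order.trans linorder_not_less)
  show "exits R' (n' - n) (sdrop n \<omega>)" using assms(2) le by (auto simp: exits_def sdrop_snth)
qed

lemma exits_sdrop_back:
  assumes "exits R n \<omega>" "exits R' i (sdrop n \<omega>)" "R \<le> R'"
  shows "exits R' (n + i) \<omega>"
proof -
  have "enorm (\<omega> !! j) < R'" if "j < n + i" for j
  proof (cases "j < n")
    case True
    then show ?thesis using assms(1,3) by (auto simp: exits_def)
  next
    case False
    then have "enorm (sdrop n \<omega> !! (j - n)) < R'" using assms(2) that by (auto simp: exits_def)
    then show ?thesis using False by (simp add: sdrop_snth)
  qed
  then show ?thesis using assms(2) by (simp add: exits_def sdrop_snth add.commute)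
qed

lemma set_stake_conv: "set (stake n \<omega>) = {\<omega> !! i | i. i < n}"
  unfolding set_conv_nth length_stake by (metis (no_types, lifting) stake_nth)

text \<open>Simplifies the bound of \<open>reach_before_le\<close> when the kernel at the outer
  sphere is at least twice the kernel at the starting point.\<close>

lemma ratio_bound:
  fixes a \<alpha> \<beta> :: real
  assumes "0 < \<alpha>" "\<alpha> \<le> a" "2 * a \<le> \<beta>"
  shows "(a - \<alpha>) / a * (\<beta> / (\<beta> - \<alpha>)) \<le> 1 - \<alpha> / (2 * a)"
proof -
  have "0 \<le> a * (\<alpha> * (\<beta> - 2 * a) + \<alpha> * \<alpha>)" using assms by simp
  then have *: "(a - \<alpha>) * \<beta> * (2 * a) \<le> (2 * a - \<alpha>) * (a * (\<beta> - \<alpha>))"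
    by (simp add: algebra_simps)
  have pos: "0 < a * (\<beta> - \<alpha>)" "0 < 2 * a" using assms by auto
  have "(a - \<alpha>) * \<beta> / (a * (\<beta> - \<alpha>)) \<le> (2 * a - \<alpha>) / (2 * a)"
    unfolding pos_divide_le_eq[OF pos(1)] times_divide_eq_left pos_le_divide_eq[OF pos(2)] by (rule *)
  moreover have "(2 * a - \<alpha>) / (2 * a) = 1 - \<alpha> / (2 * a)" using pos by (simp add: field_simps)
  ultimately show ?thesis by simp
qed

text \<open>The logarithm grows by a factor 4 per sphere, so from some k on the kernel at least
  doubles from one sphere to the next, as \<open>ratio_bound\<close> asks.\<close>

definition rad :: "nat \<Rightarrow> real" where "rad k = exp (4 ^ k)"

lemma rad_mono: "j \<le> k \<Longrightarrow> rad j \<le> rad k"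
  by (simp add: rad_def)

text \<open>Gambler's ruin between the small ball and the next sphere: the logarithms of the ball
  radius and of the starting radius have ratio h/2, and the probability of a visit to the ball is at
  least a constant times h.\<close>

lemma hit_between:
  "\<exists>c k\<^sub>0. c > 0 \<and> c \<le> 1 \<and> (\<forall>k\<ge>k\<^sub>0. \<forall>h y. 0 \<le> h \<longrightarrow> h \<le> 1 / 4 \<longrightarrow> rad k \<le> enorm y \<longrightarrow> enorm y < rad k + 1 \<longrightarrow>
     PR y (\<lambda>\<omega>. \<exists>n. exits (rad (Suc k)) n \<omega> \<and> (\<forall>z\<in>set (stake n \<omega>). enorm z > exp (4 ^ k / 2 * h))) \<le> 1 - c * h)"
proof -
  obtain c\<^sub>0 where c0: "c\<^sub>0 > 0" "c\<^sub>0 \<le> kap" "\<And>z. z \<noteq> 0 \<Longrightarrow> potential_kernel z \<ge> c\<^sub>0 * (1 + ln (enorm z))"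
    using kernel_log_lower by blast
  define c where "c = c\<^sub>0 / (8 * kap)"
  have c: "c > 0" "c \<le> 1" using c0 kap_pos by (auto simp: c_def divide_le_eq_1)
  have "\<forall>\<^sub>F k in sequentially. kap * 4 ^ k \<ge> kap + 9" using kap_pos by real_asymp
  then obtain k\<^sub>0 where k0: "\<And>k. k \<ge> k\<^sub>0 \<Longrightarrow> kap * 4 ^ k \<ge> kap + 9" unfolding eventually_sequentially by blast
  have "PR y (\<lambda>\<omega>. \<exists>n. exits (rad (Suc k)) n \<omega> \<and> (\<forall>z\<in>set (stake n \<omega>). enorm z > exp (4 ^ k / 2 * h))) \<le> 1 - c * h"
    if k: "k \<ge> k\<^sub>0" and h: "0 \<le> h" "h \<le> 1 / 4" and y: "rad k \<le> enorm y" "enorm y < rad k + 1" for k h y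
  proof -
    let ?r = "exp (4 ^ k / 2 * h)" and ?a = "potential_kernel y"
    define \<beta> where "\<beta> = kap * 4 ^ Suc k - 6"
    \<comment> \<open>The maximum with 1 keeps \<alpha> positive when h = 0.\<close>
    define \<alpha> where "\<alpha> = c\<^sub>0 * max 1 (4 ^ k / 2 * h)"
    have r1: "?r \<ge> 1" using h by simp
    have "4 ^ k / 2 * h \<le> (4 ^ k / 2) * 1" using h by (intro mult_left_mono) auto
    also have "\<dots> < (4::real) ^ k" by simp
    finally have rk: "?r < rad k" by (simp add: rad_def)
    have rk': "rad k < rad (Suc k)" by (simp add: rad_def)
    have y0: "y \<noteq> 0" using y by (auto simp: rad_def)
    have a_up: "?a \<le> kap * 4 ^ k + kap + 6"
    proof -
      have "rad k + 1 \<le> exp 1 * rad k"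
      proof -
        have "exp 1 \<ge> (2::real)" using exp_ge_add_one_self[of 1] by simp
        then have "2 * rad k \<le> exp 1 * rad k" by (intro mult_right_mono) (auto simp: rad_def)
        moreover have "rad k \<ge> 1" by (simp add: rad_def)
        ultimately show ?thesis by linarith
      qed
      then have "enorm y \<le> exp (1 + 4 ^ k)" using y unfolding exp_add rad_def by linarith
      then have "?a \<le> kap * ln (exp (1 + 4 ^ k)) + 6" by (intro kernel_le_ball) auto
      then show ?thesis by (simp add: algebra_simps)
    qed
    have ab: "2 * ?a \<le> \<beta>" using a_up k0[OF k] by (simp add: \<beta>_def)
    have \<alpha>0: "\<alpha> > 0" using c0 by (simp add: \<alpha>_def)
    have low: "\<alpha> \<le> potential_kernel z" if z: "z \<noteq> 0" "enorm z > ?r - 1" for z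
    proof -
      have z1: "enorm z \<ge> 1" by (rule enorm_ge_1[OF z(1)])
      have e2: "exp 1 \<ge> (2::real)" using exp_ge_add_one_self[of 1] by simp
      have "?r \<le> 2 * enorm z" using z z1 by linarith
      also have "\<dots> \<le> exp 1 * enorm z" using e2 by (intro mult_right_mono) auto
      finally have "?r \<le> exp (1 + ln (enorm z))" using z1 unfolding exp_add by simp
      then have "4 ^ k / 2 * h \<le> 1 + ln (enorm z)" unfolding exp_le_cancel_iff .
      then have "max 1 (4 ^ k / 2 * h) \<le> 1 + ln (enorm z)" using z1 by simp
      then have "\<alpha> \<le> c\<^sub>0 * (1 + ln (enorm z))" using c0 by (simp add: \<alpha>_def)
      then show ?thesis using c0(3)[OF z(1)] by linarith
    qed
    have \<alpha>a: "\<alpha> \<le> ?a" using y rk y0 by (intro low) auto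
    have "PR y (\<lambda>\<omega>. \<exists>n. exits (rad (Suc k)) n \<omega> \<and> (\<forall>z\<in>set (stake n \<omega>). enorm z > ?r))
      \<le> PR y (\<lambda>\<omega>. \<exists>n. enorm (\<omega> !! n) \<ge> rad (Suc k) \<and> (\<forall>i<n. enorm (\<omega> !! i) > ?r))"
    proof (rule PR_mono)
      fix \<omega> assume "\<exists>n. exits (rad (Suc k)) n \<omega> \<and> (\<forall>z\<in>set (stake n \<omega>). enorm z > ?r)"
      then obtain n where n: "exits (rad (Suc k)) n \<omega>" "\<forall>z\<in>set (stake n \<omega>). enorm z > ?r" by blast
      have "enorm (\<omega> !! i) > ?r" if "i < n" for i using n(2) that unfolding set_stake_conv by blast
      then show "\<exists>n. enorm (\<omega> !! n) \<ge> rad (Suc k) \<and> (\<forall>i<n. enorm (\<omega> !! i) > ?r)"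
        using n(1) by (auto simp: exits_def)
    qed measurable
    also have "\<dots> \<le> (?a - \<alpha>) / ?a * (\<beta> / (\<beta> - \<alpha>))"
    proof (rule reach_before_le[OF r1 _ \<alpha>0])
      show "?r < rad (Suc k)" using rk rk' by linarith
      show "\<alpha> < \<beta>" using \<alpha>a ab \<alpha>0 by linarith
      show "?r < enorm y" using rk y by linarith
      show "\<beta> \<le> potential_kernel z" if "enorm z \<ge> rad (Suc k)" for z
        using kernel_ge_outside[OF _ that] by (simp add: \<beta>_def rad_def)
    qed (rule low)
    also have "\<dots> \<le> 1 - \<alpha> / (2 * ?a)" by (rule ratio_bound[OF \<alpha>0 \<alpha>a ab])
    also have "\<dots> \<le> 1 - c * h"
    proof -
      have a0: "?a > 0" using \<alpha>0 \<alpha>a by linarith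
      have "c * h = (c\<^sub>0 * (4 ^ k / 2 * h)) / (2 * (2 * kap * 4 ^ k))" using kap_pos by (simp add: c_def)
      also have "\<dots> \<le> \<alpha> / (2 * ?a)"
        using a_up k0[OF k] c0 h a0 by (intro frac_le) (auto simp: \<alpha>_def)
      finally show ?thesis by simp
    qed
    finally show ?thesis .
  qed
  then show ?thesis using c by blast
qed

text \<open>The time is bounded only by the trivial speed: n steps cover distance at most n, so the
  exit from radius exp (4^j) happens after time exp (4^j / 2). Monotonicity of
  \<open>ln t * g (ln (ln t))\<close> then moves the threshold from that time to the actual
  one.\<close>

theorem future_min_often_small:
  fixes g :: "real \<Rightarrow> real"
  assumes x: "x \<noteq> 0" and g0: "\<And>u. u \<ge> 0 \<Longrightarrow> g u \<ge> 0" and anti: "antimono_on {0..} g"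
    and mono: "mono_on {exp 1<..} (\<lambda>t. ln t * g (ln (ln t)))"
    and div: "integral_diverges_at_top g"
  shows "AE \<omega> in PP x. \<exists>\<^sub>\<infinity>n. fmin n \<omega> \<le> exp (ln (real n) * g (ln (ln (real n))))"
proof -
  obtain c k\<^sub>0 where c: "c > 0" "c \<le> 1" and hb: "\<And>k h y. k \<ge> k\<^sub>0 \<Longrightarrow> 0 \<le> h \<Longrightarrow> h \<le> 1 / 4 \<Longrightarrow> rad k \<le> enorm y \<Longrightarrow> enorm y < rad k + 1 \<Longrightarrow>
     PR y (\<lambda>\<omega>. \<exists>n. exits (rad (Suc k)) n \<omega> \<and> (\<forall>z\<in>set (stake n \<omega>). enorm z > exp (4 ^ k / 2 * h))) \<le> 1 - c * h"
    using hit_between by blast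
  \<comment> \<open>The cap keeps the ball inside the sphere and the factors 1 - c h nonnegative. It
    does not affect divergence: were \<open>h\<close> summable, it would tend to 0 and the cap would
    be inactive from some k on.\<close>
  define h where "h k = min (g (ln (4 ^ k / 2))) (1 / 4)" for k :: nat
  define r where "r k = exp (4 ^ k / 2 * h k)" for k
  have ln4: "ln (4 ^ Suc j / 2) = ln 2 + real j * ln 4" for j :: nat
  proof -
    have "(4::real) ^ Suc j / 2 = 2 * 4 ^ j" by simp
    then show ?thesis by (simp only: ln_mult_pos zero_less_numeral zero_less_power ln_realpow)
  qed
  have hnn: "0 \<le> h k" if "k \<ge> 1" for k
  proof -
    obtain j where j: "k = Suc j" using \<open>k \<ge> 1\<close> by (cases k) auto
    have "ln (4 ^ k / 2) \<ge> (0::real)" unfolding j ln4 by simp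
    then show ?thesis using g0 by (simp add: h_def)
  qed
  have h4: "h k \<le> 1 / 4" for k by (simp add: h_def)
  have nsum: "\<not> summable h"
  proof
    assume s: "summable h"
    then have "h \<longlonglongrightarrow> 0" by (rule summable_LIMSEQ_zero)
    then have "\<forall>\<^sub>F k in sequentially. h k < 1 / 4" by (rule order_tendstoD) simp
    then have "\<forall>\<^sub>F k in sequentially. h k = g (ln (4 ^ k / 2))"
      by eventually_elim (auto simp: h_def min_def split: if_splits)
    then have "summable h \<longleftrightarrow> summable (\<lambda>k::nat. g (ln (4 ^ k / 2)))" by (rule summable_cong)
    then have "summable (\<lambda>k::nat. g (ln (4 ^ k / 2)))" using s by simp
    then have "summable (\<lambda>j. g (ln (4 ^ Suc j / 2)))" by (subst summable_Suc_iff)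
    then have "summable (\<lambda>j. g (ln 2 + real j * ln 4))" by (simp only: ln4)
    then show False using not_summable_of_integral[OF g0 anti div, of "ln 2" "ln 4"] by simp
  qed
  \<comment> \<open>Failure at all scales from k to L - 1: after the exit of sphere j the ball of
    radius \<open>r j\<close> is never visited.\<close>
  define G where "G k L \<omega> \<longleftrightarrow> (\<forall>j. k \<le> j \<and> j < L \<longrightarrow> \<not> (\<exists>n. exits (rad j) n \<omega> \<and> (\<exists>m\<ge>n. enorm (\<omega> !! m) \<le> r j)))" for k L \<omega>
  have Gm[measurable]: "Measurable.pred SS (G k L)" for k L unfolding G_def by measurable
  have PG: "PR y (G k L) \<le> (\<Prod>j\<in>{k..<L}. 1 - c * h j)"
    if "L = k + d" "k \<ge> k\<^sub>0" "k \<ge> 1" "y \<noteq> 0" "enorm y < rad k + 1" for k L d y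
    using that
  proof (induction d arbitrary: k y)
    case (Suc d)
    let ?P = "\<Prod>j\<in>{Suc k..<L}. 1 - c * h j"
    define A where "A l \<longleftrightarrow> (\<forall>z\<in>set l. enorm z > r k)" for l
    \<comment> \<open>Of the failure at scale k only the part before the exit of sphere k + 1 is
      kept. The strong Markov property at that exit then splits off one factor 1 - c h k.\<close>
    define E1 where "E1 \<omega> \<longleftrightarrow> (\<exists>n. exits (rad (Suc k)) n \<omega> \<and> A (stake n \<omega>) \<and> G (Suc k) L (sdrop n \<omega>))" for \<omega>
    have E1m[measurable]: "Measurable.pred SS E1" unfolding E1_def by (rule measurable_exit_event) measurable
    have ch: "0 \<le> 1 - c * h j" "j \<ge> 1 \<Longrightarrow> 1 - c * h j \<le> 1" for j
    proof -
      have "c * h j \<le> c * (1 / 4)" using c h4 by (intro mult_left_mono) auto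
      then show "0 \<le> 1 - c * h j" using c by linarith
      show "1 - c * h j \<le> 1" if "j \<ge> 1" using hnn[OF that] c by simp
    qed
    have P0: "0 \<le> ?P" by (rule prod_nonneg) (use ch in auto)
    have "PR y (G k L) \<le> PR y (\<lambda>\<omega>. \<exists>n. exits (rad k) n \<omega> \<and> (\<lambda>_. True) (stake n \<omega>) \<and> E1 (sdrop n \<omega>))"
    proof (rule PR_mono_AE)
      show "AE \<omega> in PP y. G k L \<omega> \<longrightarrow> (\<exists>n. exits (rad k) n \<omega> \<and> True \<and> E1 (sdrop n \<omega>))"
        using AE_exit[OF Suc.prems(4), of "rad (Suc k)"]
      proof eventually_elim
        case (elim \<omega>)
        show ?case
        proof
          assume GG: "G k L \<omega>"
          obtain n' where n': "exits (rad (Suc k)) n' \<omega>" using elim exits_exists by blast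
          have "enorm (\<omega> !! n') \<ge> rad k" using n' rad_mono[of k "Suc k"] unfolding exits_def by linarith
          then obtain n where n: "exits (rad k) n \<omega>" using exits_exists by blast
          have le: "n \<le> n'" "exits (rad (Suc k)) (n' - n) (sdrop n \<omega>)"
            using exits_sdrop[OF n n'] rad_mono[of k "Suc k"] by auto
          have nr: "enorm (\<omega> !! m) > r k" if "m \<ge> n" for m
          proof -
            have "k \<le> k \<and> k < L" using Suc.prems(1) by simp
            then have "\<not> (\<exists>n. exits (rad k) n \<omega> \<and> (\<exists>m\<ge>n. enorm (\<omega> !! m) \<le> r k))"
              using GG unfolding G_def by blast
            then show ?thesis using n that not_le by blast
          qed
          have "A (stake (n' - n) (sdrop n \<omega>))"
            unfolding A_def set_stake_conv by (auto simp: sdrop_snth nr)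
          moreover have "G (Suc k) L (sdrop n' \<omega>)"
            unfolding G_def
          proof (intro allI impI notI)
            fix j assume j: "Suc k \<le> j \<and> j < L" "\<exists>i. exits (rad j) i (sdrop n' \<omega>) \<and> (\<exists>m\<ge>i. enorm (sdrop n' \<omega> !! m) \<le> r j)"
            then obtain i m where i: "exits (rad j) i (sdrop n' \<omega>)" "m \<ge> i" "enorm (sdrop n' \<omega> !! m) \<le> r j" by blast
            have "exits (rad j) (n' + i) \<omega>"
              by (rule exits_sdrop_back[OF n' i(1)]) (use j rad_mono in blast)
            moreover have "enorm (\<omega> !! (n' + m)) \<le> r j" using i by (simp add: sdrop_snth add.commute)
            ultimately show False using GG j(1) i(2) unfolding G_def by (meson Suc_leD add_left_mono)
          qed
          ultimately have "E1 (sdrop n \<omega>)" unfolding E1_def using le by (intro exI[of _ "n' - n"]) (simp add: sdrop_add)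
          then show "\<exists>n. exits (rad k) n \<omega> \<and> True \<and> E1 (sdrop n \<omega>)" using n by blast
        qed
      qed
    qed (rule measurable_exit_event[OF E1m])
    also have "\<dots> \<le> (?P * (1 - c * h k)) * PR y (\<lambda>\<omega>. \<exists>n. exits (rad k) n \<omega> \<and> (\<lambda>_. True) (stake n \<omega>))"
    proof (rule PR_exit_le[OF E1m Suc.prems(4,5)])
      fix z :: site assume z: "z \<noteq> 0" "rad k \<le> enorm z" "enorm z < rad k + 1"
      have "PR z E1 \<le> ?P * PR z (\<lambda>\<omega>. \<exists>n. exits (rad (Suc k)) n \<omega> \<and> A (stake n \<omega>))"
        unfolding E1_def
      proof (rule PR_exit_le[OF Gm z(1) _ P0])
        show "enorm z < rad (Suc k) + 1" using z rad_mono[of k "Suc k"] by simp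
        fix w :: site assume "w \<noteq> 0" "rad (Suc k) \<le> enorm w" "enorm w < rad (Suc k) + 1"
        then show "PR w (G (Suc k) L) \<le> ?P" using Suc.prems by (intro Suc.IH) auto
      qed
      also have "PR z (\<lambda>\<omega>. \<exists>n. exits (rad (Suc k)) n \<omega> \<and> A (stake n \<omega>)) \<le> 1 - c * h k"
        unfolding A_def r_def by (rule hb) (use Suc.prems z h4 hnn in auto)
      finally show "PR z E1 \<le> ?P * (1 - c * h k)" using P0 by (simp add: mult_left_mono)
    qed (use P0 ch in simp)
    also have "\<dots> \<le> (?P * (1 - c * h k)) * 1" using P0 ch by (intro mult_left_mono) auto
    also have "\<dots> = (\<Prod>j\<in>{k..<L}. 1 - c * h j)"
      using Suc.prems(1) by (subst prod.atLeast_Suc_lessThan[of k L]) auto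
    finally show ?case .
  qed simp
  have zero: "PR x (\<lambda>\<omega>. \<forall>L. G k L \<omega>) = 0" if k: "k \<ge> k\<^sub>0" "k \<ge> 1" "enorm x < rad k + 1" for k
  proof (rule ccontr)
    let ?p = "PR x (\<lambda>\<omega>. \<forall>L. G k L \<omega>)"
    assume "?p \<noteq> 0"
    then have p: "?p > 0" by (simp add: order_less_le)
    \<comment> \<open>Since 1 - t \<le> exp (-t), a positive probability of failing for ever would
      bound the partial sums of \<open>h\<close>, against \<open>nsum\<close>.\<close>
    have "(\<Sum>j<d. h (j + k)) \<le> - ln ?p / c" for d
    proof -
      have "?p \<le> PR x (G k (k + d))" by (rule PR_mono) auto
      also have "\<dots> \<le> (\<Prod>j\<in>{k..<k + d}. 1 - c * h j)" by (rule PG[OF refl k(1,2) x k(3)])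
      also have "\<dots> \<le> (\<Prod>j\<in>{k..<k + d}. exp (- (c * h j)))"
      proof (rule prod_mono)
        fix j assume "j \<in> {k..<k + d}"
        have "c * h j \<le> c * (1 / 4)" using c h4 by (intro mult_left_mono) auto
        then show "0 \<le> 1 - c * h j \<and> 1 - c * h j \<le> exp (- (c * h j))"
          using c exp_ge_add_one_self[of "- (c * h j)"] by (intro conjI; linarith)
      qed
      also have "\<dots> = exp (- (c * (\<Sum>j\<in>{k..<k + d}. h j)))"
        by (simp add: exp_sum sum_negf sum_distrib_left flip: exp_sum)
      finally have "ln ?p \<le> ln (exp (- (c * (\<Sum>j\<in>{k..<k + d}. h j))))"
        using p by (subst ln_le_cancel_iff) auto
      then have "ln ?p \<le> - (c * (\<Sum>j\<in>{k..<k + d}. h j))" by simp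
      moreover have "(\<Sum>j\<in>{k..<k + d}. h j) = (\<Sum>j<d. h (j + k))"
        using sum.shift_bounds_nat_ivl[of h 0 k d] by (simp add: add.commute lessThan_atLeast0)
      ultimately show ?thesis using c by (simp add: field_simps)
    qed
    then have "summable (\<lambda>j. h (j + k))"
      by (intro summableI_nonneg_bounded) (use hnn k in auto)
    then show False using nsum by (simp add: summable_iff_shift)
  qed
  have "\<forall>\<^sub>F k in sequentially. enorm x < rad k + 1" unfolding rad_def by real_asymp
  moreover have "\<forall>\<^sub>F k in sequentially. rad k - enorm x \<ge> exp (4 ^ k / 2)" unfolding rad_def by real_asymp
  ultimately have "\<forall>\<^sub>F k in sequentially. k \<ge> k\<^sub>0 \<and> k \<ge> 1 \<and> enorm x < rad k + 1 \<and> rad k - enorm x \<ge> exp (4 ^ k / 2)"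
    by (intro eventually_conj eventually_ge_at_top)
  then obtain k\<^sub>1 where k1: "\<And>k. k \<ge> k\<^sub>1 \<Longrightarrow> k \<ge> k\<^sub>0 \<and> k \<ge> 1 \<and> enorm x < rad k + 1 \<and> rad k - enorm x \<ge> exp (4 ^ k / 2)"
    unfolding eventually_sequentially by blast
  have "AE \<omega> in PP x. \<forall>k. k \<ge> k\<^sub>1 \<longrightarrow> \<not> (\<forall>L. G k L \<omega>)"
    unfolding AE_all_countable
  proof
    fix k
    show "AE \<omega> in PP x. k \<ge> k\<^sub>1 \<longrightarrow> \<not> (\<forall>L. G k L \<omega>)"
    proof (cases "k \<ge> k\<^sub>1")
      case True
      then have "PR x (\<lambda>\<omega>. \<forall>L. G k L \<omega>) = 0" using k1 zero by blast
      moreover have "{\<omega>. \<forall>L. G k L \<omega>} \<in> sets SS" by measurable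
      ultimately have "AE \<omega> in PP x. \<omega> \<notin> {\<omega>. \<forall>L. G k L \<omega>}"
        by (subst (asm) PP.prob_eq_0) auto
      then show ?thesis by eventually_elim simp
    qed simp
  qed
  then show ?thesis using AE_PP_good[OF x] AE_PP_shd[of x]
  proof eventually_elim
    case (elim \<omega>)
    have grow: "enorm (\<omega> !! n) \<le> enorm x + real n" for n
    proof (induction n)
      case (Suc n)
      have "\<omega> !! Suc n - \<omega> !! n \<in> steps" using elim(2) unfolding good_def by blast
      then have "enorm (\<omega> !! n + (\<omega> !! Suc n - \<omega> !! n)) \<le> enorm (\<omega> !! n) + 1" by (rule enorm_step_le)
      then show ?case using Suc by simp
    qed (use elim in simp)
    show ?case
      unfolding INFM_nat_le
    proof
      fix N :: nat
      have "\<forall>\<^sub>F k in sequentially. exp (4 ^ k / 2) \<ge> real N" by real_asymp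
      then obtain k\<^sub>2 where k2: "\<And>k. k \<ge> k\<^sub>2 \<Longrightarrow> exp (4 ^ k / 2) \<ge> real N" unfolding eventually_sequentially by blast
      define k where "k = max k\<^sub>1 k\<^sub>2"
      then have "\<not> (\<forall>L. G k L \<omega>)" using elim(1) by simp
      then obtain j n m where j: "k \<le> j" "exits (rad j) n \<omega>" "m \<ge> n" "enorm (\<omega> !! m) \<le> r j"
        unfolding G_def by blast
      have jk: "j \<ge> k\<^sub>1" "j \<ge> k\<^sub>2" using j by (auto simp: k_def)
      let ?t = "exp (4 ^ j / 2 :: real)"
      have "rad j \<le> enorm (\<omega> !! n)" using j(2) by (simp add: exits_def)
      then have tn: "?t \<le> real n" using grow[of n] k1[OF jk(1)] by linarith
      have "(4::real) ^ 1 \<le> 4 ^ j" using k1[OF jk(1)] by (intro power_increasing) auto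
      then have t1: "?t > exp 1" by simp
      have "fmin n \<omega> \<le> r j" using fmin_le[OF j(3), of \<omega>] j(4) by linarith
      also have "\<dots> \<le> exp (ln ?t * g (ln (ln ?t)))"
        by (simp add: r_def h_def mult_left_mono)
      also have "\<dots> \<le> exp (ln (real n) * g (ln (ln (real n))))"
        using monotone_onD[OF mono, of ?t "real n"] t1 tn by (simp del: ln_exp)
      finally show "\<exists>n\<ge>N. fmin n \<omega> \<le> exp (ln (real n) * g (ln (ln (real n))))"
        using tn k2[OF jk(2)] by (intro exI[of _ n]) auto
    qed
  qed
qed

subsection \<open>Hitting a distant site\<close>

lemma srw_prob_uminus: "srw_prob n (- x) = srw_prob n x"
proof -
  have "fst (- x) + snd (- x) = - (fst x + snd x)" "fst (- x) - snd (- x) = - (fst x - snd x)" by simp_all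
  then show ?thesis by (simp only: srw_prob_eq_bw bw_uminus)
qed

lemma kernel_uminus: "potential_kernel (- x) = potential_kernel x"
  using srw_prob_uminus[of _ x] by (simp add: potential_kernel_def srw_prob_def)

lemma avg_shift: "avg (\<lambda>w. f (w - y)) w = avg f (w - y)"
proof -
  have "w + e - y = w - y + e" for e by simp
  then show ?thesis by (simp only: avg_def)
qed

text \<open>The function \<open>\<psi> z = (a z + a y - a (z - y)) / (2 a z)\<close> is harmonic for the conditioned walk off \<open>y\<close>, equals
  \<open>1\<close> at \<open>y\<close> and vanishes at infinity.\<close>

lemma hit_site_ge:
  assumes y: "y \<noteq> 0" and z: "z \<noteq> 0" and \<eta>: "\<eta> > 0"
  shows "PR z (\<lambda>\<omega>. \<exists>n. \<omega> !! n = y)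
    \<ge> (potential_kernel z + potential_kernel y - potential_kernel (z - y)) / (2 * potential_kernel z) - \<eta>"
proof -
  let ?a = potential_kernel
  define \<psi> where "\<psi> w = (?a w + ?a y - ?a (w - y)) / (2 * ?a w)" for w
  have "((\<lambda>\<rho>. (?a y + kap * ln 2 + 12) * (1 / (2 * (kap * ln \<rho> - 6)))) \<longlongrightarrow> (?a y + kap * ln 2 + 12) * 0) at_top"
    by (intro tendsto_mult tendsto_const) (use kap_pos in real_asymp)
  then have "((\<lambda>\<rho>. (?a y + kap * ln 2 + 12) / (2 * (kap * ln \<rho> - 6))) \<longlongrightarrow> 0) at_top" by simp
  then have "\<forall>\<^sub>F \<rho> in at_top. (?a y + kap * ln 2 + 12) / (2 * (kap * ln \<rho> - 6)) < \<eta>"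
    using \<eta> by (rule order_tendstoD)
  moreover have "\<forall>\<^sub>F \<rho> in at_top. kap * ln \<rho> - 6 > 0" using kap_pos by real_asymp
  ultimately have "\<forall>\<^sub>F \<rho> in at_top. (?a y + kap * ln 2 + 12) / (2 * (kap * ln \<rho> - 6)) \<le> \<eta> \<and> kap * ln \<rho> - 6 > 0
       \<and> \<rho> \<ge> 2 * enorm y + 1"
    using eventually_ge_at_top[of "2 * enorm y + 1"] by eventually_elim auto
  then obtain \<rho> where \<rho>: "(?a y + kap * ln 2 + 12) / (2 * (kap * ln \<rho> - 6)) \<le> \<eta>" "kap * ln \<rho> - 6 > 0" "\<rho> \<ge> 2 * enorm y + 1"
    by (auto simp: eventually_at_top_linorder)
  have far: "\<psi> w \<le> \<eta>" if w: "enorm w \<ge> \<rho>" for w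
  proof -
    have wy: "enorm (w - y) \<ge> enorm w / 2"
      using enorm_triangle[of "w - y" y] w \<rho>(3) by simp
    have e: "enorm w > 0" using w \<rho>(3) enorm_nonneg[of y] by linarith
    have w0: "w \<noteq> 0" using e by auto
    have "?a (w - y) \<ge> kap * ln (enorm w / 2) - 6" using wy e by (intro kernel_ge_outside) auto
    moreover have "?a w \<le> kap * ln (enorm w) + 6" by (rule kernel_bounds(1)[OF w0])
    moreover have "kap * ln (enorm w / 2) = kap * ln (enorm w) - kap * ln 2" using w0 by (simp add: ln_div right_diff_distrib)
    ultimately have 1: "?a w + ?a y - ?a (w - y) \<le> ?a y + kap * ln 2 + 12" by linarith
    have 2: "?a w \<ge> kap * ln \<rho> - 6" using w \<rho>(3) by (intro kernel_ge_outside) (use enorm_nonneg[of y] in linarith)+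
    have "\<psi> w \<le> (?a y + kap * ln 2 + 12) / (2 * ?a w)"
      unfolding \<psi>_def using 1 kernel_nonneg[of w] by (intro divide_right_mono) auto
    also have "\<dots> \<le> (?a y + kap * ln 2 + 12) / (2 * (kap * ln \<rho> - 6))"
      using 2 \<rho>(2) kap_pos kernel_nonneg[of y] by (intro divide_left_mono) (auto intro!: mult_pos_pos add_nonneg_nonneg)
    finally show ?thesis using \<rho>(1) by linarith
  qed
  have "bdd_above (\<psi> ` {w. enorm w \<le> \<rho>})" by (rule bdd_above_finite) simp
  then obtain c\<^sub>1 where c1: "\<And>w. enorm w \<le> \<rho> \<Longrightarrow> \<psi> w \<le> c\<^sub>1" by (auto simp: bdd_above_def)
  define c where "c = \<bar>c\<^sub>1\<bar>"
  \<comment> \<open>A majorant for leaving the ball of radius \<rho> before visiting y: at least 1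
    outside the ball, where \<psi> \<le> \<eta>, and equal to \<eta> at y. Its finite lower bound
    \<open>- c\<close> inside suffices, as the weight of staying inside tends to 0.\<close>
  define f where "f w = 1 + \<eta> - \<psi> w" for w
  define B where "B = {w. enorm w \<ge> \<rho>}"
  define D where "D = {w. w \<noteq> y}"
  have bound: "PR z (\<lambda>\<omega>. \<exists>k\<le>n. \<omega> !! k \<in> B \<and> (\<forall>i<k. \<omega> !! i \<in> D)) \<le> f z + c * PR z (\<lambda>\<omega>. \<forall>i\<le>n. \<omega> !! i \<in> D - B)" for n
  proof (rule until_le[OF _ _ _ _ _ z])
    fix w :: site assume w: "w \<noteq> 0"
    show "- c \<le> f w" using far[of w] c1[of w] \<eta> by (cases "enorm w \<ge> \<rho>") (auto simp: f_def c_def)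
    show "1 \<le> f w" if "w \<in> B" using far[of w] that by (simp add: f_def B_def)
    show "0 \<le> f w" if "w \<notin> D"
    proof -
      have "w = y" using that by (simp add: D_def)
      then have "\<psi> w = 1" using kernel_pos[OF y] by (simp add: \<psi>_def)
      then show ?thesis using \<eta> by (simp add: f_def)
    qed
    assume wD: "w \<in> D"
    have "(\<Sum>e\<in>steps. cond_trans w (w + e) * f (w + e)) = avg (\<lambda>v. ?a v * f v) w / ?a w" by (rule cond_trans_sum)
    also have "avg (\<lambda>v. ?a v * f v) w = avg (\<lambda>v. (1 + \<eta>) * ?a v - (1 / 2) * ((?a v + ?a y) - ?a (v - y))) w"
    proof (rule avg_cong)
      fix e assume "e \<in> steps"
      show "?a (w + e) * f (w + e) = (1 + \<eta>) * ?a (w + e) - (1 / 2) * ((?a (w + e) + ?a y) - ?a (w + e - y))"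
      \<comment> \<open>At the origin \<open>f\<close> contains a division by zero, but the identity
        still holds: the left side has the factor a(0) = 0 and on the right a(y) cancels against
        a(-y).\<close>
      proof (cases "w + e = 0")
        case True
        then show ?thesis by (simp add: kernel_uminus)
      next
        case False
        then show ?thesis using kernel_pos[OF False] by (simp add: f_def \<psi>_def field_simps)
      qed
    qed
    also have "\<dots> = (1 + \<eta>) * ?a w - (1 / 2) * ((?a w + ?a y) - ?a (w - y))"
      unfolding avg_diff avg_mult avg_add avg_const avg_shift kernel_avg using w wD by (simp add: D_def)
    also have "((1 + \<eta>) * ?a w - (1 / 2) * ((?a w + ?a y) - ?a (w - y))) / ?a w = f w"
      using kernel_pos[OF w] by (simp add: f_def \<psi>_def field_simps)
    finally show "(\<Sum>e\<in>steps. cond_trans w (w + e) * f (w + e)) \<le> f w" by simp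
  qed (simp add: c_def)
  have lim: "PR z (\<lambda>\<omega>. \<exists>k\<le>n. \<omega> !! k \<in> B \<and> (\<forall>i<k. \<omega> !! i \<in> D)) \<le> f z" for n
  proof -
    have "(\<lambda>m. f z + c * PR z (\<lambda>\<omega>. \<forall>i\<le>m. enorm (\<omega> !! i) < \<rho>)) \<longlonglongrightarrow> f z + c * 0"
      by (intro tendsto_intros stay_tendsto z)
    moreover have "\<forall>m\<ge>n. PR z (\<lambda>\<omega>. \<exists>k\<le>n. \<omega> !! k \<in> B \<and> (\<forall>i<k. \<omega> !! i \<in> D)) \<le> f z + c * PR z (\<lambda>\<omega>. \<forall>i\<le>m. enorm (\<omega> !! i) < \<rho>)"
    proof (intro allI impI)
      fix m assume m: "m \<ge> n"
      have "PR z (\<lambda>\<omega>. \<exists>k\<le>n. \<omega> !! k \<in> B \<and> (\<forall>i<k. \<omega> !! i \<in> D)) \<le> PR z (\<lambda>\<omega>. \<exists>k\<le>m. \<omega> !! k \<in> B \<and> (\<forall>i<k. \<omega> !! i \<in> D))"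
        by (rule PR_mono, measurable) (use m in \<open>blast intro: order_trans\<close>)
      also note bound[of m]
      also have "PR z (\<lambda>\<omega>. \<forall>i\<le>m. \<omega> !! i \<in> D - B) \<le> PR z (\<lambda>\<omega>. \<forall>i\<le>m. enorm (\<omega> !! i) < \<rho>)"
        by (rule PR_mono, measurable) (auto simp: B_def not_le)
      finally show "PR z (\<lambda>\<omega>. \<exists>k\<le>n. \<omega> !! k \<in> B \<and> (\<forall>i<k. \<omega> !! i \<in> D)) \<le> f z + c * PR z (\<lambda>\<omega>. \<forall>i\<le>m. enorm (\<omega> !! i) < \<rho>)"
        by (simp add: c_def mult_left_mono)
    qed
    ultimately show ?thesis using LIMSEQ_le_const[of _ "f z + c * 0"] by auto
  qed
  have "PR z (\<lambda>\<omega>. \<not> (\<exists>n. \<omega> !! n = y)) \<le> PR z (\<lambda>\<omega>. \<exists>n. \<exists>k\<le>n. \<omega> !! k \<in> B \<and> (\<forall>i<k. \<omega> !! i \<in> D))"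
    by (rule PR_mono_AE, measurable) (use AE_exit[OF z, of \<rho>] in \<open>auto elim!: eventually_mono simp: B_def D_def\<close>)
  also have "\<dots> \<le> f z" by (rule PR_Ex_le, measurable) (auto intro: lim le_SucI)
  finally have "PR z (\<lambda>\<omega>. \<not> (\<exists>n. \<omega> !! n = y)) \<le> 1 + \<eta> - \<psi> z" by (simp add: f_def)
  moreover have "PR z (\<lambda>\<omega>. \<not> (\<exists>n. \<omega> !! n = y)) = 1 - PR z (\<lambda>\<omega>. \<exists>n. \<omega> !! n = y)"
    by (rule PR_not) measurable
  ultimately show ?thesis unfolding \<psi>_def by linarith
qed

lemma AE_exits: "x \<noteq> 0 \<Longrightarrow> AE \<omega> in PP x. \<exists>k. exits R k \<omega>"
  using AE_exit[of x R] by (auto elim!: eventually_mono dest!: exits_exists)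

lemma PR_exits: "x \<noteq> 0 \<Longrightarrow> PR x (\<lambda>\<omega>. \<exists>k. exits R k \<omega>) = 1"
  using AE_exits[of x R] by (subst PP.prob_eq_1) (auto intro!: sets_Collect_SS)

text \<open>The walk first goes to radius |y|/2. There z - y has norm at most 3|y|, so a(y) - a(z -
  y) is at least -(kap ln 3 + 12) and the function \<psi> is at least 1/2 - 3/8 = 1/8; the slack
  \<eta> = 1/16 leaves 1/16.\<close>

lemma hit_far_site:
  "\<exists>Y. \<forall>x y. x \<noteq> 0 \<longrightarrow> enorm y \<ge> Y \<longrightarrow> enorm y \<ge> 2 * enorm x \<longrightarrow> PR x (\<lambda>\<omega>. \<exists>n. \<omega> !! n = y) \<ge> 1 / 16"
proof -
  have "\<forall>\<^sub>F t in at_top. (kap * ln 3 + 12) / (2 * (kap * ln (t / 2) - 6)) \<le> 3 / 8" using kap_pos by real_asymp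
  moreover have "\<forall>\<^sub>F t in at_top. kap * ln (t / 2) - 6 > 0" using kap_pos by real_asymp
  ultimately have "\<forall>\<^sub>F t in at_top. (kap * ln 3 + 12) / (2 * (kap * ln (t / 2) - 6)) \<le> 3 / 8 \<and> kap * ln (t / 2) - 6 > 0 \<and> t \<ge> 2"
    using eventually_ge_at_top[of "2::real"] by eventually_elim auto
  then obtain Y where Y: "\<And>t. t \<ge> Y \<Longrightarrow> (kap * ln 3 + 12) / (2 * (kap * ln (t / 2) - 6)) \<le> 3 / 8 \<and> kap * ln (t / 2) - 6 > 0 \<and> t \<ge> 2"
    unfolding eventually_at_top_linorder by blast
  have "PR x (\<lambda>\<omega>. \<exists>n. \<omega> !! n = y) \<ge> 1 / 16" if x: "x \<noteq> 0" and y: "enorm y \<ge> Y" "enorm y \<ge> 2 * enorm x" for x y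
  proof -
    let ?a = potential_kernel
    note t = Y[OF y(1)]
    have y0: "y \<noteq> 0" using t by auto
    have site: "PR z (\<lambda>\<omega>. \<exists>n. \<omega> !! n = y) \<ge> 1 / 16"
      if z: "z \<noteq> 0" "enorm y / 2 \<le> enorm z" "enorm z < enorm y / 2 + 1" for z
    proof -
      have az: "?a z \<ge> kap * ln (enorm y / 2) - 6" using z t by (intro kernel_ge_outside) auto
      have "enorm (z - y) \<le> enorm z + enorm y" using enorm_triangle[of z "- y"] by (simp add: enorm_uminus)
      then have "enorm (z - y) \<le> 3 * enorm y" using z t by simp
      then have "?a (z - y) \<le> kap * ln (3 * enorm y) + 6" using t by (intro kernel_le_ball) auto
      moreover have "kap * ln (3 * enorm y) = kap * ln 3 + kap * ln (enorm y)" using y0 by (simp add: ln_mult distrib_left)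
      moreover have "?a y \<ge> kap * ln (enorm y) - 6" by (rule kernel_bounds(2)[OF y0])
      ultimately have "?a z + ?a y - ?a (z - y) \<ge> ?a z - (kap * ln 3 + 12)" by linarith
      then have "(?a z + ?a y - ?a (z - y)) / (2 * ?a z) \<ge> (?a z - (kap * ln 3 + 12)) / (2 * ?a z)"
        using kernel_nonneg by (intro divide_right_mono) auto
      also have "(?a z - (kap * ln 3 + 12)) / (2 * ?a z) = 1 / 2 - (kap * ln 3 + 12) / (2 * ?a z)"
        using kernel_pos[OF z(1)] by (simp add: diff_divide_distrib)
      finally have 1: "(?a z + ?a y - ?a (z - y)) / (2 * ?a z) \<ge> 1 / 2 - (kap * ln 3 + 12) / (2 * ?a z)" .
      have "(kap * ln 3 + 12) / (2 * ?a z) \<le> (kap * ln 3 + 12) / (2 * (kap * ln (enorm y / 2) - 6))"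
        using az t kap_pos by (intro divide_left_mono) (auto intro!: mult_pos_pos add_nonneg_nonneg)
      then have "(kap * ln 3 + 12) / (2 * ?a z) \<le> 3 / 8" using t by linarith
      moreover have "(?a z + ?a y - ?a (z - y)) / (2 * ?a z) - 1 / 16 \<le> PR z (\<lambda>\<omega>. \<exists>n. \<omega> !! n = y)"
        by (rule hit_site_ge[OF y0 z(1)]) simp
      ultimately show ?thesis using 1 by linarith
    qed
    have "1 / 16 \<le> 1 / 16 * PR x (\<lambda>\<omega>. \<exists>k. exits (enorm y / 2) k \<omega> \<and> (\<lambda>_. True) (stake k \<omega>))"
      using PR_exits[OF x, of "enorm y / 2"] by simp
    also have "\<dots> \<le> PR x (\<lambda>\<omega>. \<exists>k. exits (enorm y / 2) k \<omega> \<and> (\<lambda>_. True) (stake k \<omega>) \<and> (\<exists>n. sdrop k \<omega> !! n = y))"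
      by (rule PR_exit_ge) (use x y site in auto)
    also have "\<dots> \<le> PR x (\<lambda>\<omega>. \<exists>n. \<omega> !! n = y)"
      by (rule PR_mono) (auto simp: sdrop_snth)
    finally show ?thesis .
  qed
  then show ?thesis by blast
qed

subsection \<open>The zero-one law for shift-invariant events\<close>

lemma PR_markov_at:
  assumes E: "Measurable.pred SS E" and x: "x \<noteq> 0"
  shows "PR x (\<lambda>\<omega>. \<phi> (stake n \<omega>) \<and> \<omega> !! n = y \<and> E (sdrop n \<omega>)) = PR x (\<lambda>\<omega>. \<phi> (stake n \<omega>) \<and> \<omega> !! n = y) * PR y E"
proof -
  have [measurable]: "Measurable.pred SS E" by fact
  have m: "Measurable.pred SS (\<lambda>\<omega>. shd \<omega> = y \<and> E \<omega>)" by measurable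
  have mp: "Measurable.pred SS (\<lambda>\<omega>. \<phi> (stake n \<omega>) \<and> \<omega> !! n = y)" by measurable
  have "ennreal (PR x (\<lambda>\<omega>. \<phi> (stake n \<omega>) \<and> shd (sdrop n \<omega>) = y \<and> E (sdrop n \<omega>)))
    = (\<integral>\<^sup>+\<omega>. of_bool (\<phi> (stake n \<omega>)) * ennreal (PR (\<omega> !! n) (\<lambda>\<omega>. shd \<omega> = y \<and> E \<omega>)) \<partial>PP x)"
    by (rule PR_markov_prefix[OF m x])
  also have "\<dots> = (\<integral>\<^sup>+\<omega>. indicator {\<omega>. \<phi> (stake n \<omega>) \<and> \<omega> !! n = y} \<omega> * ennreal (PR y E) \<partial>PP x)"
  proof (rule nn_integral_cong_AE)
    show "AE \<omega> in PP x. of_bool (\<phi> (stake n \<omega>)) * ennreal (PR (\<omega> !! n) (\<lambda>\<omega>. shd \<omega> = y \<and> E \<omega>)) = indicator {\<omega>. \<phi> (stake n \<omega>) \<and> \<omega> !! n = y} \<omega> * ennreal (PR y E)"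
      using AE_PP_good[OF x]
    proof eventually_elim
      case (elim \<omega>)
      let ?z = "\<omega> !! n"
      have z: "?z \<noteq> 0" using elim by (auto simp: good_def)
      have "PR ?z (\<lambda>\<omega>. shd \<omega> = y \<and> E \<omega>) = PR ?z (\<lambda>\<omega>. ?z = y \<and> E \<omega>)"
        by (rule PR_cong_start[OF _ _ _ z]) auto
      then show ?case by (auto simp: indicator_def)
    qed
  qed
  also have "\<dots> = ennreal (PR x (\<lambda>\<omega>. \<phi> (stake n \<omega>) \<and> \<omega> !! n = y)) * ennreal (PR y E)"
    by (subst nn_integral_multc) (use sets_Collect_SS[OF mp] in \<open>auto simp: PR_eq_nn_integral[OF mp]\<close>)
  finally show ?thesis by (simp flip: ennreal_mult)
qed

text \<open>The first visit to y splits the event into disjoint pieces; invariance allows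
  \<open>E\<close> to be read after that visit.\<close>

lemma hit_then_ge:
  assumes E: "Measurable.pred SS E" and x: "x \<noteq> 0" and inv: "\<And>n \<omega>. E (sdrop n \<omega>) \<longleftrightarrow> E \<omega>"
  shows "PR x E \<ge> PR x (\<lambda>\<omega>. \<exists>n. \<omega> !! n = y) * PR y E"
proof -
  have [measurable]: "Measurable.pred SS E" by fact
  define F where "F n \<omega> \<longleftrightarrow> y \<notin> set (stake n \<omega>) \<and> \<omega> !! n = y" for n \<omega>
  have Fm[measurable]: "Measurable.pred SS (F n)" for n unfolding F_def by measurable
  have Funiq: "n = m" if "F n \<omega>" "F m \<omega>" for n m \<omega>
  proof (rule ccontr)
    assume "n \<noteq> m"
    then consider "n < m" | "m < n" by linarith
    then show False using that unfolding F_def set_stake_conv by cases auto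
  qed
  have Fex: "(\<exists>n. F n \<omega>) \<longleftrightarrow> (\<exists>n. \<omega> !! n = y)" for \<omega>
  proof
    assume "\<exists>n. \<omega> !! n = y"
    define n where "n = (LEAST n. \<omega> !! n = y)"
    have n: "\<omega> !! n = y" unfolding n_def using \<open>\<exists>n. \<omega> !! n = y\<close> by (rule LeastI_ex)
    have "y \<notin> set (stake n \<omega>)"
    proof
      assume "y \<in> set (stake n \<omega>)"
      then obtain i where i: "i < n" "\<omega> !! i = y" unfolding set_stake_conv by auto
      show False using not_less_Least[of i "\<lambda>n. \<omega> !! n = y"] i by (simp add: n_def)
    qed
    then show "\<exists>n. F n \<omega>" unfolding F_def using n by blast
  qed (auto simp: F_def)
  have s1: "(\<lambda>n. PR x (F n)) sums PR x (\<lambda>\<omega>. \<exists>n. \<omega> !! n = y)"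
  proof -
    have "(\<lambda>n. PR x (F n)) sums measure (PP x) (\<Union>n. {\<omega>. F n \<omega>})"
    proof (rule PP.finite_measure_UNION)
      show "disjoint_family (\<lambda>n. {\<omega>. F n \<omega>})" unfolding disjoint_family_on_def using Funiq by blast
      show "range (\<lambda>n. {\<omega>. F n \<omega>}) \<subseteq> sets (PP x)" using sets_Collect_SS[OF Fm] by auto
    qed
    moreover have "(\<Union>n. {\<omega>. F n \<omega>}) = {\<omega>. \<exists>n. \<omega> !! n = y}" using Fex by auto
    ultimately show ?thesis by simp
  qed
  have s2: "(\<lambda>n. PR x (\<lambda>\<omega>. F n \<omega> \<and> E \<omega>)) sums PR x (\<lambda>\<omega>. (\<exists>n. \<omega> !! n = y) \<and> E \<omega>)"
  proof -
    have "(\<lambda>n. PR x (\<lambda>\<omega>. F n \<omega> \<and> E \<omega>)) sums measure (PP x) (\<Union>n. {\<omega>. F n \<omega> \<and> E \<omega>})"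
    proof (rule PP.finite_measure_UNION)
      show "disjoint_family (\<lambda>n. {\<omega>. F n \<omega> \<and> E \<omega>})" unfolding disjoint_family_on_def using Funiq by blast
      have "Measurable.pred SS (\<lambda>\<omega>. F n \<omega> \<and> E \<omega>)" for n by measurable
      from sets_Collect_SS[OF this] show "range (\<lambda>n. {\<omega>. F n \<omega> \<and> E \<omega>}) \<subseteq> sets (PP x)" by auto
    qed
    moreover have "(\<Union>n. {\<omega>. F n \<omega> \<and> E \<omega>}) = {\<omega>. (\<exists>n. \<omega> !! n = y) \<and> E \<omega>}" using Fex by auto
    ultimately show ?thesis by simp
  qed
  have eq: "PR x (\<lambda>\<omega>. F n \<omega> \<and> E \<omega>) = PR x (F n) * PR y E" for n
    using PR_markov_at[OF E x, of "\<lambda>l. y \<notin> set l" n y] by (simp add: F_def inv conj_assoc)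
  have "PR x (\<lambda>\<omega>. (\<exists>n. \<omega> !! n = y) \<and> E \<omega>) = PR x (\<lambda>\<omega>. \<exists>n. \<omega> !! n = y) * PR y E"
    using sums_unique2[OF s2[unfolded eq] sums_mult2[OF s1]] .
  moreover have "PR x (\<lambda>\<omega>. (\<exists>n. \<omega> !! n = y) \<and> E \<omega>) \<le> PR x E" by (rule PR_mono) auto
  ultimately show ?thesis by linarith
qed

text \<open>Events that are decided by a finite piece of the path up to small probability.\<close>

definition approx :: "site \<Rightarrow> site stream set \<Rightarrow> bool" where
  "approx x A \<longleftrightarrow> A \<in> sets SS \<and> (\<forall>\<epsilon>>0. \<exists>n \<phi>. PR x (\<lambda>\<omega>. (\<omega> \<in> A) \<noteq> \<phi> (stake n \<omega>)) < \<epsilon>)"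

lemma approx_Un:
  assumes A: "approx x A" and B: "approx x B"
  shows "approx x (A \<union> B)"
  unfolding approx_def
proof (intro conjI allI impI)
  have [measurable]: "A \<in> sets SS" "B \<in> sets SS" using A B by (auto simp: approx_def)
  show "A \<union> B \<in> sets SS" by measurable
  fix \<epsilon> :: real assume "\<epsilon> > 0"
  then obtain n \<phi> m \<psi> where a: "PR x (\<lambda>\<omega>. (\<omega> \<in> A) \<noteq> \<phi> (stake n \<omega>)) < \<epsilon> / 2" "PR x (\<lambda>\<omega>. (\<omega> \<in> B) \<noteq> \<psi> (stake m \<omega>)) < \<epsilon> / 2"
    using A B unfolding approx_def by (meson half_gt_zero)
  have t: "take n (stake (max n m) \<omega>) = stake n \<omega>" "take m (stake (max n m) \<omega>) = stake m \<omega>" for \<omega> :: "site stream"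
    by (auto simp: take_stake min_def max_def)
  have "PR x (\<lambda>\<omega>. (\<omega> \<in> A \<union> B) \<noteq> (\<lambda>l. \<phi> (take n l) \<or> \<psi> (take m l)) (stake (max n m) \<omega>)) \<le> PR x (\<lambda>\<omega>. (\<omega> \<in> A) \<noteq> \<phi> (stake n \<omega>)) + PR x (\<lambda>\<omega>. (\<omega> \<in> B) \<noteq> \<psi> (stake m \<omega>))"
    by (rule PR_Un_le, measurable) (auto simp: t)
  then show "\<exists>n \<phi>. PR x (\<lambda>\<omega>. (\<omega> \<in> A \<union> B) \<noteq> \<phi> (stake n \<omega>)) < \<epsilon>"
    using a by (intro exI[of _ "max n m"] exI[of _ "\<lambda>l. \<phi> (take n l) \<or> \<psi> (take m l)"]) linarith
qed

text \<open>Approximable events form a sigma-algebra containing the cylinders; countable unions are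
  first cut to finite ones.\<close>

lemma approx_sets:
  assumes "A \<in> sets SS"
  shows "approx x A"
proof -
  let ?G = "sstart UNIV ` lists (UNIV :: site set) \<union> {{}}"
  have "sets SS = sets (sigma (streams (UNIV :: site set)) ?G)" by (rule sets_stream_space_sstart) simp
  also have "\<dots> = sigma_sets UNIV ?G" by (subst sets_measure_of) (auto simp: streams_UNIV)
  finally have "A \<in> sigma_sets UNIV ?G" using assms by simp
  then show ?thesis
  proof (induction rule: sigma_sets.induct)
    case (Basic a)
    show ?case
    proof (cases "a = {}")
      case True
      then show ?thesis by (auto simp: approx_def intro!: exI[of _ 0] exI[of _ "\<lambda>_. False"])
    next
      case False
      then obtain xs where a: "a = sstart UNIV xs" using Basic by auto
      have "(\<omega> \<in> a) = (stake (length xs) \<omega> = xs)" for \<omega>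
        unfolding a by (auto simp: sstart_eq list_eq_iff_nth_eq)
      then have z: "PR x (\<lambda>\<omega>. (\<omega> \<in> a) \<noteq> (\<lambda>l. l = xs) (stake (length xs) \<omega>)) = 0" by simp
      show ?thesis unfolding approx_def
      proof (intro conjI allI impI exI)
        show "a \<in> sets SS" unfolding a by (rule sets_sstart)
        show "PR x (\<lambda>\<omega>. (\<omega> \<in> a) \<noteq> (\<lambda>l. l = xs) (stake (length xs) \<omega>)) < \<epsilon>" if "\<epsilon> > 0" for \<epsilon>
          unfolding z by (rule that)
      qed
    qed
  next
    case Empty
    then show ?case by (auto simp: approx_def intro!: exI[of _ 0] exI[of _ "\<lambda>_. False"])
  next
    case (Compl a)
    show ?case unfolding approx_def
    proof (intro conjI allI impI)
      show "UNIV - a \<in> sets SS" using Compl by (auto simp: approx_def intro: sets.Diff)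
      fix \<epsilon> :: real assume "\<epsilon> > 0"
      then obtain n \<phi> where "PR x (\<lambda>\<omega>. (\<omega> \<in> a) \<noteq> \<phi> (stake n \<omega>)) < \<epsilon>" using Compl by (auto simp: approx_def)
      then show "\<exists>n \<phi>. PR x (\<lambda>\<omega>. (\<omega> \<in> UNIV - a) \<noteq> \<phi> (stake n \<omega>)) < \<epsilon>"
        by (intro exI[of _ n] exI[of _ "\<lambda>l. \<not> \<phi> l"]) simp
    qed
  next
    case (Union a)
    have [measurable]: "a i \<in> sets SS" for i using Union by (auto simp: approx_def)
    have fin: "approx x (\<Union>i<N. a i)" for N :: nat
    proof (induction N)
      case 0
      then show ?case by (auto simp: approx_def intro!: exI[of _ 0] exI[of _ "\<lambda>_. False"])
    next
      case (Suc N)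
      then show ?case using approx_Un[OF Suc Union.IH[of N]] by (simp add: lessThan_Suc Un_commute)
    qed
    show ?case unfolding approx_def
    proof (intro conjI allI impI)
      show Um: "\<Union> (range a) \<in> sets SS" by measurable
      fix \<epsilon> :: real assume e: "\<epsilon> > 0"
      have "(\<lambda>N. measure (PP x) (\<Union>i<N. a i)) \<longlonglongrightarrow> measure (PP x) (\<Union>N. \<Union>i<N. a i)"
      proof (rule PP.finite_Lim_measure_incseq)
        show "range (\<lambda>N. \<Union>i<N. a i) \<subseteq> sets (PP x)" by auto
        show "incseq (\<lambda>N. \<Union>i<N. a i)" by (rule incseq_SucI) (rule UN_mono, auto)
      qed
      moreover have "(\<Union>N. \<Union>i<N. a i) = \<Union> (range a)" by auto
      ultimately have "(\<lambda>N. measure (PP x) (\<Union>i<N. a i)) \<longlonglongrightarrow> measure (PP x) (\<Union> (range a))" by simp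
      from LIMSEQ_D[OF this, of "\<epsilon> / 2"] e obtain N where "\<bar>measure (PP x) (\<Union>i<N. a i) - measure (PP x) (\<Union> (range a))\<bar> < \<epsilon> / 2"
        by auto
      then have "measure (PP x) (\<Union> (range a)) - measure (PP x) (\<Union>i<N. a i) < \<epsilon> / 2" by linarith
      moreover have "measure (PP x) (\<Union> (range a) - (\<Union>i<N. a i)) = measure (PP x) (\<Union> (range a)) - measure (PP x) (\<Union>i<N. a i)"
        by (rule PP.finite_measure_Diff) auto
      ultimately have d: "PR x (\<lambda>\<omega>. \<omega> \<in> \<Union> (range a) - (\<Union>i<N. a i)) < \<epsilon> / 2"
        unfolding Collect_mem_eq by linarith
      obtain n \<phi> where p: "PR x (\<lambda>\<omega>. (\<omega> \<in> (\<Union>i<N. a i)) \<noteq> \<phi> (stake n \<omega>)) < \<epsilon> / 2"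
        using fin[of N] e by (auto simp: approx_def dest!: spec[of _ "\<epsilon> / 2"])
      have "PR x (\<lambda>\<omega>. (\<omega> \<in> \<Union> (range a)) \<noteq> \<phi> (stake n \<omega>)) \<le> PR x (\<lambda>\<omega>. \<omega> \<in> \<Union> (range a) - (\<Union>i<N. a i)) + PR x (\<lambda>\<omega>. (\<omega> \<in> (\<Union>i<N. a i)) \<noteq> \<phi> (stake n \<omega>))"
        by (rule PR_Un_le, measurable) blast
      then show "\<exists>n \<phi>. PR x (\<lambda>\<omega>. (\<omega> \<in> \<Union> (range a)) \<noteq> \<phi> (stake n \<omega>)) < \<epsilon>"
        using d p by (intro exI[of _ n] exI[of _ \<phi>]) linarith
    qed
  qed
qed

text \<open>Replace \<open>E\<close> by an approximating prefix event and wait until the walk is far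
  away. If all far sites gave at most 1 - \<delta>, then P(E) \<le> (1 - \<delta>)(P(E) +
  \<epsilon>) + \<epsilon> in the limit, so \<delta> P(E) \<le> 2\<epsilon> for every
  \<epsilon>.\<close>

lemma invariant_near_one:
  assumes E: "Measurable.pred SS E" and inv: "\<And>n \<omega>. E (sdrop n \<omega>) \<longleftrightarrow> E \<omega>"
    and x: "x \<noteq> 0" "PR x E > 0" and \<delta>: "0 < \<delta>" "\<delta> < 1"
  shows "\<exists>y. y \<noteq> 0 \<and> enorm y > R \<and> PR y E > 1 - \<delta>"
proof (rule ccontr)
  assume "\<not> ?thesis"
  then have small: "PR y E \<le> 1 - \<delta>" if "y \<noteq> 0" "enorm y > R" for y using that not_less by blast
  have [measurable]: "Measurable.pred SS E" by fact
  have "\<delta> * PR x E \<le> 2 * \<epsilon>" if e: "\<epsilon> > 0" for \<epsilon>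
  proof -
    have "approx x {\<omega>. E \<omega>}" by (intro approx_sets sets_Collect_SS E)
    then obtain n\<^sub>0 \<phi> where ap: "PR x (\<lambda>\<omega>. E \<omega> \<noteq> \<phi> (stake n\<^sub>0 \<omega>)) < \<epsilon>"
      using e unfolding approx_def by auto
    have "PR x E \<le> (1 - \<delta>) * (PR x E + \<epsilon>) + PR x (\<lambda>\<omega>. \<forall>i\<le>n. enorm (\<omega> !! i) < \<bar>R\<bar> + 1) + \<epsilon> + (PR x (\<lambda>\<omega>. enorm (\<omega> !! n) \<le> \<bar>R\<bar> + 1))"
      if n: "n \<ge> n\<^sub>0" for n
    proof -
      define \<phi>' where "\<phi>' l = \<phi> (take n\<^sub>0 l)" for l
      have t: "\<phi>' (stake n \<omega>) = \<phi> (stake n\<^sub>0 \<omega>)" for \<omega> using n by (simp add: \<phi>'_def take_stake min_def)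
      have "PR x E \<le> PR x (\<lambda>\<omega>. \<phi>' (stake n \<omega>) \<and> E \<omega>) + PR x (\<lambda>\<omega>. E \<omega> \<noteq> \<phi> (stake n\<^sub>0 \<omega>))"
        by (rule PR_Un_le, measurable) (auto simp: t)
      moreover have "PR x (\<lambda>\<omega>. \<phi>' (stake n \<omega>) \<and> E \<omega>) \<le> PR x (\<lambda>\<omega>. \<phi>' (stake n \<omega>) \<and> \<omega> !! n \<in> {y. enorm y > R} \<and> E (sdrop n \<omega>)) + PR x (\<lambda>\<omega>. enorm (\<omega> !! n) \<le> \<bar>R\<bar> + 1)"
        by (rule PR_Un_le, simp only: inv, measurable) (auto simp: inv)
      moreover have "PR x (\<lambda>\<omega>. \<phi>' (stake n \<omega>) \<and> \<omega> !! n \<in> {y. enorm y > R} \<and> E (sdrop n \<omega>)) \<le> (1 - \<delta>) * PR x (\<lambda>\<omega>. \<phi>' (stake n \<omega>))"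
        by (rule PR_markov_prefix_le[OF E x(1)]) (use \<delta> small in auto)
      moreover have "PR x (\<lambda>\<omega>. \<phi>' (stake n \<omega>)) \<le> PR x E + PR x (\<lambda>\<omega>. E \<omega> \<noteq> \<phi> (stake n\<^sub>0 \<omega>))"
        by (rule PR_Un_le, measurable) (auto simp: t)
      then have "(1 - \<delta>) * PR x (\<lambda>\<omega>. \<phi>' (stake n \<omega>)) \<le> (1 - \<delta>) * (PR x E + \<epsilon>)"
        using ap \<delta> by (intro mult_left_mono) auto
      ultimately show ?thesis using ap measure_nonneg[of "PP x" "{\<omega>. \<forall>i\<le>n. enorm (\<omega> !! i) < \<bar>R\<bar> + 1}"] by linarith
    qed
    moreover have "(\<lambda>n. (1 - \<delta>) * (PR x E + \<epsilon>) + PR x (\<lambda>\<omega>. \<forall>i\<le>n. enorm (\<omega> !! i) < \<bar>R\<bar> + 1) + \<epsilon> + (PR x (\<lambda>\<omega>. enorm (\<omega> !! n) \<le> \<bar>R\<bar> + 1)))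
       \<longlonglongrightarrow> (1 - \<delta>) * (PR x E + \<epsilon>) + 0 + \<epsilon> + 0"
    proof (intro tendsto_add tendsto_const stay_tendsto[OF x(1)])
      let ?r = "\<bar>R\<bar> + 1"
      show "(\<lambda>n. PR x (\<lambda>\<omega>. enorm (\<omega> !! n) \<le> ?r)) \<longlonglongrightarrow> 0"
      proof (rule tendsto_sandwich[OF _ _ tendsto_const])
        have "(\<lambda>n. (kap * ln ?r + 6) / potential_kernel x * (36 * ?r\<^sup>2 / (real n + 1))) \<longlonglongrightarrow> (kap * ln ?r + 6) / potential_kernel x * 0"
          by (intro tendsto_mult tendsto_const) real_asymp
        then show "(\<lambda>n. (kap * ln ?r + 6) / potential_kernel x * (36 * ?r\<^sup>2 / (real n + 1))) \<longlonglongrightarrow> 0" by simp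
      qed (use marginal_ball_le[OF x(1), of ?r] in auto)
    qed
    ultimately have "PR x E \<le> (1 - \<delta>) * (PR x E + \<epsilon>) + 0 + \<epsilon> + 0"
      by (intro LIMSEQ_le_const) auto
    moreover have "(1 - \<delta>) * \<epsilon> \<le> 1 * \<epsilon>" using e \<delta> by (intro mult_right_mono) auto
    ultimately show ?thesis by (simp add: algebra_simps)
  qed
  from this[of "\<delta> * PR x E / 4"] show False using x \<delta> by simp
qed

text \<open>An invariant event that is non-null from one start has probability at least 1/32 from
  every start, by hitting a far site where it exceeds 1/2. Applied to the complement of
  \<open>E\<close>, this contradicts a site where \<open>E\<close> exceeds 1 - 1/64.\<close>

theorem invariant_zero_one:
  assumes E: "Measurable.pred SS E" and inv: "\<And>n \<omega>. E (sdrop n \<omega>) \<longleftrightarrow> E \<omega>"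
  shows "(\<forall>x. x \<noteq> 0 \<longrightarrow> PR x E = 0) \<or> (\<forall>x. x \<noteq> 0 \<longrightarrow> PR x E = 1)"
proof (rule ccontr)
  assume "\<not> ?thesis"
  then obtain x z where x: "x \<noteq> 0" "PR x E \<noteq> 0" and z: "z \<noteq> 0" "PR z E \<noteq> 1" by blast
  obtain Y where Y: "\<And>x y. x \<noteq> 0 \<Longrightarrow> enorm y \<ge> Y \<Longrightarrow> enorm y \<ge> 2 * enorm x \<Longrightarrow> PR x (\<lambda>\<omega>. \<exists>n. \<omega> !! n = y) \<ge> 1 / 16"
    using hit_far_site by blast
  have lower: "PR w F \<ge> 1 / 32"
    if F: "Measurable.pred SS F" and inv': "\<And>n \<omega>. F (sdrop n \<omega>) \<longleftrightarrow> F \<omega>" and v: "v \<noteq> 0" "PR v F > 0" and w: "w \<noteq> 0" for F v w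
  proof -
    obtain y where y: "enorm y > max Y (2 * enorm w)" "PR y F > 1 / 2"
      using invariant_near_one[OF F inv' v, of "1/2" "max Y (2 * enorm w)"] by auto
    have "1 / 16 * (1 / 2) \<le> PR w (\<lambda>\<omega>. \<exists>n. \<omega> !! n = y) * PR y F"
      using y Y[OF w, of y] by (intro mult_mono) auto
    also have "\<dots> \<le> PR w F" by (rule hit_then_ge[OF F w inv'])
    finally show ?thesis by simp
  qed
  have nE: "PR w (\<lambda>\<omega>. \<not> E \<omega>) = 1 - PR w E" for w by (rule PR_not[OF E])
  have "PR z (\<lambda>\<omega>. \<not> E \<omega>) > 0" using z(2) PR_le_1[of z E] unfolding nE by linarith
  moreover have "Measurable.pred SS (\<lambda>\<omega>. \<not> E \<omega>)" using E by measurable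
  ultimately have no: "PR w (\<lambda>\<omega>. \<not> E \<omega>) \<ge> 1 / 32" if "w \<noteq> 0" for w
    using lower[of "\<lambda>\<omega>. \<not> E \<omega>" z w] inv z(1) that by blast
  have "PR x E > 0" using x by (simp add: order_less_le)
  then obtain y where y: "y \<noteq> 0" "PR y E > 1 - 1 / 64"
    using invariant_near_one[OF E inv x(1), of "1/64" 0] by auto
  then show False using no[OF y(1)] unfolding nE by linarith
qed

subsection \<open>Upper bound on the future minima\<close>

lemma cosh_bound:
  fixes l :: real
  assumes "0 \<le> l" "l \<le> 1"
  shows "(exp l + exp (- l)) / 2 \<le> exp (l\<^sup>2)"
proof -
  have "exp l \<le> 1 + l + l\<^sup>2" by (rule exp_bound) (use assms in auto)
  moreover have "exp (- l) \<le> 1 - l + l\<^sup>2"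
  proof -
    have "(1 - l + l\<^sup>2) * (1 + l) = 1 + l ^ 3" by (simp add: power2_eq_square power3_eq_cube algebra_simps)
    then have "1 \<le> (1 - l + l\<^sup>2) * (1 + l)" using assms by simp
    also have "\<dots> \<le> (1 - l + l\<^sup>2) * exp l"
      using assms exp_ge_add_one_self[of l] by (intro mult_left_mono) (auto simp: power2_eq_square)
    finally show ?thesis by (simp add: exp_minus field_simps)
  qed
  ultimately have "(exp l + exp (- l)) / 2 \<le> 1 + l\<^sup>2" by simp
  also have "\<dots> \<le> exp (l\<^sup>2)" by (rule exp_ge_add_one_self)
  finally show ?thesis .
qed

lemma Sn_exp:
  assumes "\<And>z. avg h z = c * h z"
  shows "Sn n h z = c ^ n * h z"
proof (induction n arbitrary: z)
  case (Suc n)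
  have "Sn (Suc n) h z = avg (\<lambda>y. c ^ n * h y) z" unfolding Sn.simps by (rule avg_cong) (rule Suc)
  then show ?case by (simp add: avg_mult assms)
qed simp

text \<open>|w| is at most the sum of the absolute coordinates, and the exponential of that sum is
  dominated by four exponentials of linear forms with signs \<plusminus>1. Each is an eigenfunction
  of the average with eigenvalue cosh l \<le> exp (l^2).\<close>

lemma Sn_exp_norm:
  fixes l :: real
  assumes l: "0 \<le> l" "l \<le> 1"
  shows "Sn n (\<lambda>w. exp (l * enorm (w - z))) z \<le> 4 * exp (l\<^sup>2 * real n)"
proof -
  define H where "H s t w = exp (l * (s * real_of_int (fst (w - z)) + t * real_of_int (snd (w - z))))" for s t :: real and w :: site
  have av: "avg (H s t) w = (exp l + exp (- l)) / 2 * H s t w" if "s = 1 \<or> s = -1" "t = 1 \<or> t = -1" for s t w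
    using that by (auto simp: avg_def H_def algebra_simps exp_add exp_diff exp_minus field_simps)
  have SH: "Sn n (H s t) z \<le> exp (l\<^sup>2 * real n)" if "s = 1 \<or> s = -1" "t = 1 \<or> t = -1" for s t
  proof -
    have "Sn n (H s t) z = ((exp l + exp (- l)) / 2) ^ n * H s t z" by (rule Sn_exp) (rule av[OF that])
    also have "\<dots> = ((exp l + exp (- l)) / 2) ^ n" by (simp add: H_def)
    also have "\<dots> \<le> exp (l\<^sup>2) ^ n" by (rule power_mono[OF cosh_bound[OF l]]) (simp add: add_nonneg_nonneg)
    also have "\<dots> = exp (l\<^sup>2 * real n)" by (simp add: exp_of_nat_mult[symmetric] mult.commute)
    finally show ?thesis .
  qed
  have "Sn n (\<lambda>w. exp (l * enorm (w - z))) z \<le> Sn n (\<lambda>w. (H 1 1 w + H 1 (-1) w) + (H (-1) 1 w + H (-1) (-1) w)) z"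
  proof (rule Sn_mono)
    fix w
    define p q where "p = real_of_int (fst (w - z))" and "q = real_of_int (snd (w - z))"
    have "enorm (w - z) \<le> \<bar>p\<bar> + \<bar>q\<bar>"
      by (rule power2_le_imp_le) (auto simp: enorm_sq p_def q_def power2_sum)
    then have *: "exp (l * enorm (w - z)) \<le> exp (l * (\<bar>p\<bar> + \<bar>q\<bar>))" using l by (simp add: mult_left_mono)
    have pos: "H s t w > 0" for s t by (simp add: H_def)
    have Hpq: "H s t w = exp (l * (s * p + t * q))" for s t by (simp only: H_def p_def q_def)
    \<comment> \<open>The sign of each coordinate, with sign 1 for the value 0, selects one of the
      four exponentials.\<close>
    have "exp (l * (\<bar>p\<bar> + \<bar>q\<bar>)) = H (sgn p + of_bool (p = 0)) (sgn q + of_bool (q = 0)) w"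
      by (cases p "0::real" rule: linorder_cases; cases q "0::real" rule: linorder_cases) (auto simp: Hpq)
    also have "\<dots> \<le> (H 1 1 w + H 1 (-1) w) + (H (-1) 1 w + H (-1) (-1) w)"
      using pos[of 1 1] pos[of 1 "-1"] pos[of "-1" 1] pos[of "-1" "-1"]
      by (cases p "0::real" rule: linorder_cases; cases q "0::real" rule: linorder_cases) auto
    finally show "exp (l * enorm (w - z)) \<le> (H 1 1 w + H 1 (-1) w) + (H (-1) 1 w + H (-1) (-1) w)" using * by linarith
  qed
  also have "\<dots> = (Sn n (H 1 1) z + Sn n (H 1 (-1)) z) + (Sn n (H (-1) 1) z + Sn n (H (-1) (-1)) z)"
    by (simp add: Sn_add)
  also have "\<dots> \<le> 4 * exp (l\<^sup>2 * real n)"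
    using SH[of 1 1] SH[of 1 "-1"] SH[of "-1" 1] SH[of "-1" "-1"] by simp
  finally show ?thesis .
qed

text \<open>Chosen so that the kernel at w minus (kap ln (R - 1) - 6) is at most this constant times
  |w|/R, for |w| > R \<ge> 2.\<close>

definition esc_const :: real where "esc_const = kap + kap * ln 2 + 12"

lemma esc_const_pos: "esc_const > 0" using kap_pos by (simp add: esc_const_def add_pos_pos)

text \<open>The h-transform weights the position w by a(w)/a(z), and escape from w has probability
  at most (a(w) - \<alpha>)/a(w). The factor a(w) cancels and a(w) - \<alpha> depends on w/R only
  through a logarithm, so the small factor 1/a(z) survives next to the Gaussian tail.\<close>

lemma stay_far_le:
  assumes R: "R \<ge> 2" "kap * ln (R - 1) > 6" and z: "z \<noteq> 0" and l: "1 / R \<le> l" "l \<le> 1"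
  shows "PR z (\<lambda>\<omega>. \<forall>i\<ge>m. enorm (\<omega> !! i) > R)
    \<le> 4 * esc_const * exp (l * enorm z + l\<^sup>2 * real m - l * R) / potential_kernel z"
proof -
  let ?a = potential_kernel
  define \<alpha> where "\<alpha> = kap * ln (R - 1) - 6"
  define \<psi> where "\<psi> w = of_bool (enorm w > R) * max 0 ((?a w - \<alpha>) / ?a w)" for w
  have \<psi>0: "0 \<le> \<psi> w" for w by (simp add: \<psi>_def)
  have l0: "l > 0" using l R by (meson divide_pos_pos less_le_trans zero_less_one zero_less_numeral)
  define F where "F \<omega> \<longleftrightarrow> (\<forall>i. enorm (\<omega> !! i) > R)" for \<omega> :: "site stream"
  have Fm: "Measurable.pred SS F" unfolding F_def by measurable
  have PF: "PR w F \<le> \<psi> w" if w: "w \<noteq> 0" for w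
  proof (cases "enorm w > R")
    case True
    have "PR w F \<le> (?a w - \<alpha>) / ?a w" unfolding F_def
      by (rule never_return_le) (use R True kernel_ge_outside[of "R - 1"] in \<open>auto simp: \<alpha>_def less_imp_le\<close>)
    then show ?thesis using True by (simp add: \<psi>_def)
  next
    case False
    have "PR w F = PR w (\<lambda>_. False)"
      by (rule PR_cong_start[OF Fm _ _ w]) (use False in \<open>auto simp: F_def intro!: exI[of _ 0]\<close>)
    then show ?thesis using \<psi>0 by simp
  qed
  have ev: "(\<forall>i\<ge>m. enorm (\<omega> !! i) > R) \<longleftrightarrow> F (sdrop m \<omega>)" for \<omega>
    unfolding F_def by (auto simp: sdrop_snth) (metis le_Suc_ex add.commute)
  have "ennreal (PR z (\<lambda>\<omega>. \<forall>i\<ge>m. enorm (\<omega> !! i) > R)) = (\<integral>\<^sup>+\<omega>. of_bool ((\<lambda>_. True) (stake m \<omega>)) * ennreal (PR (\<omega> !! m) F) \<partial>PP z)"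
    using PR_markov_prefix[OF Fm z, of "\<lambda>_. True" m] unfolding ev by simp
  also have "\<dots> \<le> (\<integral>\<^sup>+\<omega>. ennreal (\<psi> (\<omega> !! m)) \<partial>PP z)"
    by (rule nn_integral_mono_AE) (use AE_PP_good[OF z] in \<open>auto elim!: eventually_mono simp: good_def intro!: ennreal_leI PF\<close>)
  also have "\<dots> \<le> ennreal (Sn m (\<lambda>w. ?a w * \<psi> w) z / ?a z)" by (rule nn_marginal_le[OF \<psi>0 z])
  also have "\<dots> \<le> ennreal (4 * esc_const * exp (l * enorm z + l\<^sup>2 * real m - l * R) / ?a z)"
  proof (intro ennreal_leI divide_right_mono kernel_nonneg)
    have "Sn m (\<lambda>w. ?a w * \<psi> w) z \<le> Sn m (\<lambda>w. (esc_const * exp (l * enorm z - l * R)) * exp (l * enorm (w - z))) z"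
    proof (rule Sn_mono)
      fix w
      show "?a w * \<psi> w \<le> (esc_const * exp (l * enorm z - l * R)) * exp (l * enorm (w - z))"
      proof (cases "enorm w > R")
        case True
        define t where "t = enorm w / R"
        have t: "t \<ge> 1" using True R by (simp add: t_def)
        have w0: "w \<noteq> 0" using True R by auto
        have aw: "?a w > 0" by (rule kernel_pos[OF w0])
        have "?a w * \<psi> w = max 0 (?a w - \<alpha>)" using True aw by (simp add: \<psi>_def max_mult_distrib_left)
        moreover have "?a w - \<alpha> \<le> esc_const * t"
        proof -
          have "ln (enorm w) = ln t + ln R" using w0 R by (simp add: t_def ln_div)
          moreover have "ln R \<le> ln 2 + ln (R - 1)"
          proof -
            have "ln R \<le> ln (2 * (R - 1))" using R by simp
            moreover have "ln (2 * (R - 1)) = ln 2 + ln (R - 1)" using R by (intro ln_mult_pos) auto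
            ultimately show ?thesis by linarith
          qed
          moreover have "ln t \<le> t" using ln_le_minus_one[of t] t by simp
          ultimately have "ln (enorm w) \<le> t + ln 2 + ln (R - 1)" by linarith
          then have "kap * ln (enorm w) \<le> kap * (t + ln 2 + ln (R - 1))" using kap_pos by simp
          then have "?a w - \<alpha> \<le> kap * t + (kap * ln 2 + 12)" using kernel_bounds(1)[OF w0]
            by (simp add: \<alpha>_def algebra_simps)
          also have "(kap * ln 2 + 12) * 1 \<le> (kap * ln 2 + 12) * t" using t kap_pos by (intro mult_left_mono) auto
          then have "kap * t + (kap * ln 2 + 12) \<le> kap * t + (kap * ln 2 + 12) * t" by simp
          finally show ?thesis by (simp add: esc_const_def algebra_simps)
        qed
        ultimately have "?a w * \<psi> w \<le> esc_const * t" using esc_const_pos t by simp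
        \<comment> \<open>The linear growth in |w|/R is absorbed into the exponential; this is where
          l \<ge> 1/R enters.\<close>
        also have "t \<le> exp (l * enorm w - l * R)"
        proof -
          have "t = 1 + (t - 1)" by simp
          also have "\<dots> \<le> exp (t - 1)" by (rule exp_ge_add_one_self)
          also have "t - 1 = 1 / R * (enorm w - R)" using R by (simp add: t_def field_simps)
          also have "1 / R * (enorm w - R) \<le> l * (enorm w - R)" using True l by (intro mult_right_mono) auto
          finally show ?thesis by (simp add: right_diff_distrib)
        qed
        also have "exp (l * enorm w - l * R) \<le> exp (l * enorm z - l * R) * exp (l * enorm (w - z))"
        proof -
          have "enorm w \<le> enorm z + enorm (w - z)" using enorm_triangle[of z "w - z"] by simp
          then have "l * enorm w \<le> l * (enorm z + enorm (w - z))" using l0 by simp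
          then show ?thesis by (simp add: distrib_left flip: exp_add)
        qed
        finally show ?thesis using esc_const_pos by (simp add: mult.assoc)
      next
        case False
        then show ?thesis using esc_const_pos by (simp add: \<psi>_def)
      qed
    qed
    also have "\<dots> = (esc_const * exp (l * enorm z - l * R)) * Sn m (\<lambda>w. exp (l * enorm (w - z))) z" by (rule Sn_mult)
    also have "\<dots> \<le> (esc_const * exp (l * enorm z - l * R)) * (4 * exp (l\<^sup>2 * real m))"
      using esc_const_pos l l0 by (intro mult_left_mono Sn_exp_norm) auto
    also have "\<dots> = 4 * esc_const * exp (l * enorm z + l\<^sup>2 * real m - l * R)"
      by (simp add: exp_add exp_diff field_simps)
    finally show "Sn m (\<lambda>w. ?a w * \<psi> w) z \<le> 4 * esc_const * exp (l * enorm z + l\<^sup>2 * real m - l * R)" .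
  qed
  finally show ?thesis
    by (subst (asm) ennreal_le_iff) (use esc_const_pos kernel_nonneg in \<open>auto intro!: divide_nonneg_nonneg\<close>)
qed

text \<open>At the starting point the kernel may be small, so \<open>stay_far_le\<close> is applied
  only when the walk reaches radius sqrt N, where the kernel is of order ln N; the remaining time is
  then at most N.\<close>

lemma stay_far_from_inside:
  assumes N: "N \<ge> 1" and s: "s \<ge> 3" "s \<le> sqrt (real N)" and k: "kap * ln (real N) \<ge> 24" and x: "x \<noteq> 0" "enorm x < sqrt (real N) + 1"
  shows "PR x (\<lambda>\<omega>. \<forall>i\<ge>N. enorm (\<omega> !! i) > s * sqrt (real N)) \<le> 4 * esc_const * exp (2 - s\<^sup>2 / 8) / (kap * ln (real N) / 4)"
proof -
  let ?q = "sqrt (real N)"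
  define R where "R = s * ?q"
  have q1: "?q \<ge> 3" using s by linarith
  have qq: "?q * ?q = real N" by simp
  have Rq: "R \<ge> ?q + 1"
  proof -
    have "3 * ?q \<le> s * ?q" using s q1 by (intro mult_right_mono) auto
    then show ?thesis using q1 by (simp add: R_def)
  qed
  define b where "b = 4 * esc_const * exp (2 - s\<^sup>2 / 8) / (kap * ln (real N) / 4)"
  have lnN: "kap * ln ?q = kap * ln (real N) / 2" using N by (simp add: ln_sqrt)
  have b0: "b \<ge> 0" using esc_const_pos k by (simp add: b_def)
  have lnR: "kap * ln (R - 1) > 6"
  proof -
    have "ln ?q \<le> ln (R - 1)" using Rq q1 by (subst ln_le_cancel_iff) linarith+
    then have "kap * ln ?q \<le> kap * ln (R - 1)" using kap_pos by simp
    then show ?thesis using k unfolding lnN by linarith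
  qed
  have out: "PR z (\<lambda>\<omega>. \<forall>i\<ge>m. enorm (\<omega> !! i) > R) \<le> b"
    if z: "?q \<le> enorm z" "enorm z < ?q + 1" and m: "m \<le> N" for z m
  proof -
    \<comment> \<open>Minimises l^2 N - l s sqrt N. The exponent becomes at most s + s^2/4 - s^2/2,
      and s \<le> s^2/8 + 2.\<close>
    define l where "l = s / (2 * ?q)"
    have z0: "z \<noteq> 0" using z q1 by auto
    have l: "1 / R \<le> l" "l \<le> 1"
    proof -
      have "2 \<le> s * s" using s mult_mono[of 3 s 3 s] by simp
      moreover have "s / (2 * ?q) * (s * ?q) = s * s / 2" using q1 N by simp
      moreover have "s * ?q > 0" using s q1 by (intro mult_pos_pos) linarith+
      ultimately show "1 / R \<le> l" unfolding l_def R_def by (subst pos_divide_le_eq) linarith+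
      show "l \<le> 1" unfolding l_def by (subst pos_divide_le_eq) (use s q1 in linarith)+
    qed
    have "l * enorm z + l\<^sup>2 * real m - l * R \<le> 2 - s\<^sup>2 / 8"
    proof -
      have l0: "l \<ge> 0" using s q1 by (simp add: l_def)
      have "l * enorm z \<le> l * (2 * ?q)" using l0 z q1 by (intro mult_left_mono) auto
      also have "\<dots> = s" using q1 N by (simp add: l_def)
      finally have 1: "l * enorm z \<le> s" .
      have "l\<^sup>2 * real m \<le> l\<^sup>2 * real N" using m by (intro mult_left_mono) auto
      also have "\<dots> = s\<^sup>2 / 4" using N by (simp add: l_def power_divide power_mult_distrib)
      finally have 2: "l\<^sup>2 * real m \<le> s\<^sup>2 / 4" .
      have 3: "l * R = s\<^sup>2 / 2" using q1 N by (simp add: l_def R_def power2_eq_square)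
      have "0 \<le> (s - 4)\<^sup>2 / 8" by simp
      then have "s \<le> s\<^sup>2 / 8 + 2" by (simp add: power2_eq_square field_simps)
      then show ?thesis using 1 2 3 by linarith
    qed
    then have e: "exp (l * enorm z + l\<^sup>2 * real m - l * R) \<le> exp (2 - s\<^sup>2 / 8)" by simp
    have az: "potential_kernel z \<ge> kap * ln (real N) / 4"
    proof -
      have "potential_kernel z \<ge> kap * ln ?q - 6" by (rule kernel_ge_outside) (use z q1 N in auto)
      then show ?thesis using k unfolding lnN by linarith
    qed
    have "PR z (\<lambda>\<omega>. \<forall>i\<ge>m. enorm (\<omega> !! i) > R) \<le> 4 * esc_const * exp (l * enorm z + l\<^sup>2 * real m - l * R) / potential_kernel z"
      by (rule stay_far_le[OF _ lnR z0 l]) (use Rq q1 N in auto)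
    also have "\<dots> \<le> b" unfolding b_def
      using e az k esc_const_pos by (intro frac_le mult_left_mono mult_nonneg_nonneg) auto
    finally show ?thesis .
  qed
  \<comment> \<open>Induction on the remaining time replaces the strong Markov property at the
    sphere. If the time runs out first, the walk is still below R and the event fails.\<close>
  have "PR z (\<lambda>\<omega>. \<forall>i\<ge>m. enorm (\<omega> !! i) > R) \<le> b"
    if "z \<noteq> 0" "enorm z < ?q + 1" "m \<le> N" for z m
    using that
  proof (induction m arbitrary: z)
    case (0 z)
    have "PR z (\<lambda>\<omega>. \<forall>i\<ge>0. enorm (\<omega> !! i) > R) = PR z (\<lambda>_. False)"
    proof (rule PR_cong_start[OF _ _ _ 0(1)])
      fix \<omega> :: "site stream" assume "\<omega> !! 0 = z"
      then have "\<not> enorm (\<omega> !! 0) > R" using 0 Rq by simp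
      then show "(\<forall>i\<ge>0. enorm (\<omega> !! i) > R) = False" by blast
    qed measurable
    then show ?case using b0 by simp
  next
    case (Suc m z)
    show ?case
    proof (cases "?q \<le> enorm z")
      case True
      then show ?thesis using out Suc.prems by blast
    next
      case False
      have sh: "(\<forall>i\<ge>Suc m. enorm ((z ## \<omega>) !! i) > R) \<longleftrightarrow> (\<forall>i\<ge>m. enorm (\<omega> !! i) > R)" for \<omega>
        by (auto simp: Stream_snth split: nat.splits)
      have "PR z (\<lambda>\<omega>. \<forall>i\<ge>Suc m. enorm (\<omega> !! i) > R) = (\<Sum>e\<in>steps. cond_trans z (z + e) * PR (z + e) (\<lambda>\<omega>. \<forall>i\<ge>m. enorm (\<omega> !! i) > R))"
        by (subst PR_step[OF _ Suc.prems(1)]) (measurable, simp only: sh)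
      also have "\<dots> \<le> (\<Sum>e\<in>steps. cond_trans z (z + e) * b)"
      proof (rule sum_mono)
        fix e assume e: "e \<in> steps"
        show "cond_trans z (z + e) * PR (z + e) (\<lambda>\<omega>. \<forall>i\<ge>m. enorm (\<omega> !! i) > R) \<le> cond_trans z (z + e) * b"
        proof (cases "z + e = 0")
          case nz: False
          show ?thesis by (rule mult_left_mono[OF Suc.IH[OF nz] cond_trans_nonneg])
              (use enorm_step_le[OF e, of z] False Suc.prems in auto)
        qed simp
      qed
      also have "\<dots> = b" using cond_trans_sum_1[OF Suc.prems(1)] by (simp flip: sum_distrib_right)
      finally show ?thesis .
    qed
  qed
  then show ?thesis using x by (simp add: b_def R_def)
qed

text \<open>Comparison with the telescoping differences of 1/ln k.\<close>

lemma summable_inverse_log_square: "summable (\<lambda>k. 1 / (real k * (ln (real k))\<^sup>2))"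
proof (rule summable_comparison_test_ev)
  let ?g = "\<lambda>k. 1 / ln (real k - 1) - 1 / ln (real k)"
  have "(\<lambda>k. 1 / ln (real k)) \<longlonglongrightarrow> 0" by real_asymp
  then have "(\<lambda>k. - (1 / ln (real k))) \<longlonglongrightarrow> - 0" by (rule tendsto_minus)
  from telescope_summable[OF this] have "summable (\<lambda>k. - (1 / ln (real (Suc k))) - - (1 / ln (real k)))" .
  then have "summable (\<lambda>k. ?g (Suc k))" by (simp add: algebra_simps)
  then show "summable ?g" by (subst (asm) summable_Suc_iff)
  have "1 / (real k * (ln (real k))\<^sup>2) \<le> ?g k" if k: "k \<ge> 4" for k
  proof -
    have l: "ln (real k - 1) > 0" "ln (real k) > 0" "ln (real k - 1) \<le> ln (real k)" using k by auto
    have "ln ((real k - 1) / real k) \<le> (real k - 1) / real k - 1" using k by (intro ln_le_minus_one) auto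
    then have d: "1 / real k \<le> ln (real k) - ln (real k - 1)" using k by (simp add: ln_div field_simps)
    have "1 / (real k * (ln (real k))\<^sup>2) = (1 / real k) / (ln (real k))\<^sup>2" by simp
    also have "\<dots> \<le> (ln (real k) - ln (real k - 1)) / (ln (real k) * ln (real k - 1))"
      using d l k by (intro frac_le) (auto simp: power2_eq_square)
    also have "\<dots> = ?g k" using l by (simp add: field_simps)
    finally show ?thesis .
  qed
  then have "norm (1 / (real k * (ln (real k))\<^sup>2)) \<le> ?g k" if "k \<ge> 4" for k using that by simp
  then show "\<forall>\<^sub>F k in sequentially. norm (1 / (real k * (ln (real k))\<^sup>2)) \<le> ?g k"
    by (rule eventually_sequentiallyI)
qed

theorem future_min_upper:
  assumes x: "x \<noteq> 0"
  shows "AE \<omega> in PP x. \<forall>\<^sub>F n in sequentially. fmin n \<omega> \<le> 8 * sqrt (real n * ln (ln (ln (real n))))"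
proof -
  define N :: "nat \<Rightarrow> nat" where "N k = 2 ^ Suc k" for k
  define T where "T k = ln (ln (ln (2 ^ k :: real)))" for k :: nat
  \<comment> \<open>Then exp (-s^2/8) is the fourth negative power of ln (k ln 2), which makes the
    bound with 1/ln (N k), of order 1/k, summable. For 2^k \<le> n < N k one gets 32 * 2 = 64 under
    the root, hence the constant 8.\<close>
  define s where "s k = sqrt (32 * T k)" for k
  define u where "u k = 16 * esc_const * exp 2 / (kap * ln 2) * 4 * (1 / (real k * (ln (real k))\<^sup>2))" for k
  have Tt: "T k = ln (ln (real k * ln 2))" for k by (simp add: T_def ln_realpow)
  have ev: "\<forall>\<^sub>F k in sequentially. PR x (\<lambda>\<omega>. \<forall>i\<ge>N k. enorm (\<omega> !! i) > s k * sqrt (real (N k))) \<le> u k"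
  proof -
    have "\<forall>\<^sub>F k in sequentially. T k \<ge> 1" unfolding Tt by real_asymp
    moreover have "\<forall>\<^sub>F k in sequentially. 32 * T k \<le> 2 ^ Suc k" unfolding Tt by real_asymp
    moreover have "\<forall>\<^sub>F k in sequentially. kap * (real (Suc k) * ln 2) \<ge> 24" using kap_pos by real_asymp
    moreover have "\<forall>\<^sub>F k in sequentially. enorm x < sqrt (2 ^ Suc k) + 1" by real_asymp
    moreover have "\<forall>\<^sub>F k in sequentially. ln (real k * ln 2) \<ge> ln (real k) / 2" by real_asymp
    moreover have "\<forall>\<^sub>F k in sequentially. real k \<ge> 2" by real_asymp
    ultimately show ?thesis
    proof eventually_elim
      case (elim k)
      have rN: "real (N k) = 2 ^ Suc k" by (simp add: N_def)
      have lnN: "ln (real (N k)) = real (Suc k) * ln 2" unfolding rN by (rule ln_realpow)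
      have s2: "(s k)\<^sup>2 = 32 * T k" using elim by (simp add: s_def)
      have s3: "s k \<ge> 3"
      proof (rule power2_le_imp_le)
        show "3\<^sup>2 \<le> (s k)\<^sup>2" unfolding s2 using elim by simp
      qed (use elim in \<open>simp add: s_def\<close>)
      have "PR x (\<lambda>\<omega>. \<forall>i\<ge>N k. enorm (\<omega> !! i) > s k * sqrt (real (N k))) \<le> 4 * esc_const * exp (2 - (s k)\<^sup>2 / 8) / (kap * ln (real (N k)) / 4)"
      proof (rule stay_far_from_inside[OF _ s3 _ _ x])
        show "s k \<le> sqrt (real (N k))" unfolding s_def rN using elim by (intro real_sqrt_le_mono) auto
        show "1 \<le> N k" by (simp add: N_def)
        show "24 \<le> kap * ln (real (N k))" unfolding lnN using elim by simp
        show "enorm x < sqrt (real (N k)) + 1" unfolding rN using elim by simp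
      qed
      also have "exp (2 - (s k)\<^sup>2 / 8) = exp 2 * (1 / (ln (real k * ln 2)) ^ 4)"
      proof -
        have "ln (real k) > 0" using elim by simp
        then have pos: "ln (real k * ln 2) > 0" using elim by linarith
        have "exp (- (4 * T k)) = 1 / exp (T k) ^ 4"
          by (simp add: exp_minus inverse_eq_divide flip: exp_of_nat_mult)
        also have "exp (T k) = ln (real k * ln 2)" unfolding Tt using pos by simp
        finally show ?thesis unfolding s2 by (simp add: exp_diff exp_minus field_simps)
      qed
      also have "4 * esc_const * (exp 2 * (1 / (ln (real k * ln 2)) ^ 4)) / (kap * ln (real (N k)) / 4)
        = 16 * esc_const * exp 2 / (kap * ln 2) * (1 / (real (Suc k) * (ln (real k * ln 2)) ^ 4))"
        by (simp add: lnN mult_ac)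
      also have "\<dots> \<le> 16 * esc_const * exp 2 / (kap * ln 2) * (4 * (1 / (real k * (ln (real k))\<^sup>2)))"
      proof (rule mult_left_mono)
        define y where "y = ln (real k * ln 2)"
        have y1: "y \<ge> 1"
        proof -
          have "ln (real k) > 0" using elim by simp
          then have pos: "y > 0" unfolding y_def using elim by linarith
          have "1 \<le> ln y" using elim by (simp add: Tt y_def)
          also have "\<dots> \<le> y - 1" by (rule ln_le_minus_one[OF pos])
          finally show ?thesis by simp
        qed
        have lk: "ln (real k) > 0" using elim by simp
        have "(ln (real k))\<^sup>2 \<le> (2 * y)\<^sup>2" using elim lk by (intro power_mono) (auto simp: y_def)
        then have "(ln (real k))\<^sup>2 \<le> 4 * y\<^sup>2" by (simp add: power_mult_distrib)
        also have "\<dots> \<le> 4 * y ^ 4" using y1 by (simp add: power_increasing)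
        finally have "(ln (real k))\<^sup>2 \<le> 4 * y ^ 4" .
        then have "real k * (ln (real k))\<^sup>2 \<le> real (Suc k) * (4 * y ^ 4)" using y1 by (intro mult_mono) auto
        then have le: "1 / (real (Suc k) * (4 * y ^ 4)) \<le> 1 / (real k * (ln (real k))\<^sup>2)"
          using elim lk y1 by (intro divide_left_mono) auto
        have eq: "1 / (real (Suc k) * y ^ 4) = 4 * (1 / (real (Suc k) * (4 * y ^ 4)))" by simp
        show "1 / (real (Suc k) * ln (real k * ln 2) ^ 4) \<le> 4 * (1 / (real k * (ln (real k))\<^sup>2))"
          unfolding y_def[symmetric] eq by (rule mult_left_mono[OF le]) simp
        show "0 \<le> 16 * esc_const * exp 2 / (kap * ln 2)" using esc_const_pos kap_pos by simp
      qed
      finally show ?case by (simp add: u_def)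
    qed
  qed
  have su: "summable u" unfolding u_def[abs_def] by (intro summable_mult summable_inverse_log_square)
  have "AE \<omega> in PP x. eventually (\<lambda>k. \<omega> \<in> space (PP x) - {\<omega>. \<forall>i\<ge>N k. enorm (\<omega> !! i) > s k * sqrt (real (N k))}) sequentially"
  proof (rule borel_cantelli_AE1)
    show "summable (\<lambda>k. PR x (\<lambda>\<omega>. \<forall>i\<ge>N k. enorm (\<omega> !! i) > s k * sqrt (real (N k))))"
      by (rule summable_comparison_test_ev[OF _ su]) (use ev in \<open>auto elim!: eventually_mono\<close>)
  qed (auto intro!: sets_Collect_SS simp: PP.emeasure_eq_measure)
  then show ?thesis
  proof eventually_elim
    case (elim \<omega>)
    have "\<forall>\<^sub>F k in sequentially. T k \<ge> 1" "\<forall>\<^sub>F k in sequentially. ln (real k * ln 2) > 0" "\<forall>\<^sub>F k in sequentially. real k * ln 2 > 0"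
      unfolding Tt by real_asymp+
    with elim have "\<forall>\<^sub>F k in sequentially. (\<exists>i\<ge>N k. enorm (\<omega> !! i) \<le> s k * sqrt (real (N k))) \<and> T k \<ge> 1 \<and> ln (real k * ln 2) > 0 \<and> real k * ln 2 > 0"
      by eventually_elim (auto simp: not_less)
    then obtain K where K: "\<And>k. k \<ge> K \<Longrightarrow> (\<exists>i\<ge>N k. enorm (\<omega> !! i) \<le> s k * sqrt (real (N k))) \<and> T k \<ge> 1 \<and> ln (real k * ln 2) > 0 \<and> real k * ln 2 > 0"
      unfolding eventually_sequentially by blast
    have "fmin n \<omega> \<le> 8 * sqrt (real n * ln (ln (ln (real n))))" if n: "n \<ge> 2 ^ K" for n
    proof -
      have n0: "n > 0" using n by (metis gr0I not_le zero_less_numeral zero_less_power)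
      obtain k where k: "2 ^ k \<le> n" "n < 2 ^ (k + 1)" using ex_power_ivl1[of 2 n] n0 by auto
      have "(2::nat) ^ K < 2 ^ (k + 1)" using n k by linarith
      then have "k \<ge> K" by (subst (asm) power_strict_increasing_iff) auto
      note kk = K[OF this]
      then obtain i where i: "i \<ge> N k" "enorm (\<omega> !! i) \<le> s k * sqrt (real (N k))" by blast
      have "n \<le> i" using i k by (simp add: N_def)
      then have "fmin n \<omega> \<le> s k * sqrt (real (N k))" using fmin_le[of n i \<omega>] i by linarith
      also have "\<dots> = sqrt (64 * (2 ^ k * T k))" by (simp add: s_def N_def real_sqrt_mult[symmetric])
      also have "\<dots> \<le> sqrt (64 * (real n * ln (ln (ln (real n)))))"
      proof (intro real_sqrt_le_mono mult_left_mono mult_mono)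
        show kn: "2 ^ k \<le> real n" using k(1) by (metis of_nat_le_iff of_nat_numeral of_nat_power)
        have "real k * ln 2 = ln (2 ^ k)" by (simp add: ln_realpow)
        also have "\<dots> \<le> ln (real n)" using kn n0 by (subst ln_le_cancel_iff) auto
        finally have 1: "real k * ln 2 \<le> ln (real n)" .
        then have "ln (real k * ln 2) \<le> ln (ln (real n))" using kk by (subst ln_le_cancel_iff) linarith+
        then show "T k \<le> ln (ln (ln (real n)))" unfolding Tt using kk by (subst ln_le_cancel_iff) linarith+
      qed (use kk in auto)
      also have "\<dots> = 8 * sqrt (real n * ln (ln (ln (real n))))"
        by (simp add: real_sqrt_mult)
      finally show ?thesis .
    qed
    then show ?case by (rule eventually_sequentiallyI)
  qed
qed

subsection \<open>Fast runs\<close>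

text \<open>The time limit is written as a condition on the prefix so that it matches the exit
  probability produced by \<open>at_exit\<close>.\<close>

definition esc :: "real \<Rightarrow> nat \<Rightarrow> site \<Rightarrow> real" where
  "esc R b z = PR z (\<lambda>\<omega>. \<exists>n. exits R n \<omega> \<and> length (stake n \<omega>) \<le> b)"

text \<open>\<open>n\<close> successive moves from radius \<open>R\<close> to \<open>R + d\<close>, each within \<open>b\<close> steps and each weighted by the inverse of its
  probability, so that the expectation is that of \<open>F\<close> after the run. The floor \<open>1/64\<close> keeps the weight
  bounded; it is inactive in the applications, by \<open>escape_ge\<close>.\<close>

primrec fast_run :: "real \<Rightarrow> nat \<Rightarrow> (site stream \<Rightarrow> ennreal) \<Rightarrow> nat \<Rightarrow> real \<Rightarrow> site stream \<Rightarrow> ennreal" where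
  "fast_run d b F 0 R \<omega> = F \<omega>"
| "fast_run d b F (Suc n) R \<omega> = ennreal (1 / max (esc (R + d) b (shd \<omega>)) (1 / 64))
     * at_exit (\<lambda>l. length l \<le> b) (R + d) (fast_run d b F n (R + d)) \<omega>"

lemma fast_run_0 [simp]: "fast_run d b F 0 R = F"
  by (rule ext) simp

lemma measurable_fast_run [measurable]: "F \<in> borel_measurable SS \<Longrightarrow> fast_run d b F n R \<in> borel_measurable SS"
proof (induction n arbitrary: R)
  case (Suc n)
  have "(\<lambda>\<omega>. ennreal (1 / max (esc (R + d) b (shd \<omega>)) (1 / 64))
     * at_exit (\<lambda>l. length l \<le> b) (R + d) (fast_run d b F n (R + d)) \<omega>) \<in> borel_measurable SS"
    by (intro borel_measurable_times_ennreal measurable_at_exit Suc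
        measurable_start[of "\<lambda>z. ennreal (1 / max (esc (R + d) b z) (1 / 64))"])
  then show ?case by (simp add: fun_eq_iff cong: measurable_cong)
qed (simp cong: measurable_cong)

lemma nn_integral_start_mult:
  assumes "F \<in> borel_measurable SS"
  shows "(\<integral>\<^sup>+\<omega>. h (shd \<omega>) * F \<omega> \<partial>PP z) = h z * (\<integral>\<^sup>+\<omega>. F \<omega> \<partial>PP z)"
proof -
  have "(\<integral>\<^sup>+\<omega>. h (shd \<omega>) * F \<omega> \<partial>PP z) = (\<integral>\<^sup>+\<omega>. h z * F \<omega> \<partial>PP z)"
    by (rule nn_integral_cong_AE) (use AE_PP_shd[of z] in \<open>auto elim!: eventually_mono\<close>)
  also have "\<dots> = h z * (\<integral>\<^sup>+\<omega>. F \<omega> \<partial>PP z)" by (rule nn_integral_cmult) (use assms in measurable)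
  finally show ?thesis .
qed

lemma fast_run_integral_le:
  assumes F: "F \<in> borel_measurable SS" and d: "d \<ge> 0"
  shows "(\<And>y. y \<noteq> 0 \<Longrightarrow> R + real n * d \<le> enorm y \<Longrightarrow> enorm y < R + real n * d + 1 \<Longrightarrow> (\<integral>\<^sup>+\<omega>. F \<omega> \<partial>PP y) \<le> c)
     \<Longrightarrow> z \<noteq> 0 \<Longrightarrow> R \<le> enorm z \<Longrightarrow> enorm z < R + 1 \<Longrightarrow> (\<integral>\<^sup>+\<omega>. fast_run d b F n R \<omega> \<partial>PP z) \<le> c"
proof (induction n arbitrary: R z)
  case (Suc n)
  have e: "R + real (Suc n) * d = (R + d) + real n * d" by (simp add: algebra_simps)
  let ?m = "max (esc (R + d) b z) (1 / 64)"
  have "(\<integral>\<^sup>+\<omega>. fast_run d b F (Suc n) R \<omega> \<partial>PP z) = ennreal (1 / ?m) * (\<integral>\<^sup>+\<omega>. at_exit (\<lambda>l. length l \<le> b) (R + d) (fast_run d b F n (R + d)) \<omega> \<partial>PP z)"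
    unfolding fast_run.simps
    by (rule nn_integral_start_mult[where h = "\<lambda>z. ennreal (1 / max (esc (R + d) b z) (1 / 64))"]) (use F in measurable)
  also have "\<dots> \<le> ennreal (1 / ?m) * (c * ennreal (esc (R + d) b z))"
    unfolding esc_def
  proof (rule mult_left_mono[OF at_exit_integral_le])
    show "fast_run d b F n (R + d) \<in> borel_measurable SS" using F by measurable
    show "z \<noteq> 0" "enorm z < R + d + 1" using Suc.prems d by auto
    fix y :: site assume "y \<noteq> 0" "R + d \<le> enorm y" "enorm y < R + d + 1"
    then show "(\<integral>\<^sup>+\<omega>. fast_run d b F n (R + d) \<omega> \<partial>PP y) \<le> c"
      using Suc.prems(1) unfolding e by (intro Suc.IH) auto
  qed simp
  also have "\<dots> = c * (ennreal (1 / ?m) * ennreal (esc (R + d) b z))" by (simp only: mult_ac)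
  also have "\<dots> \<le> c * 1"
  proof (rule mult_left_mono)
    have "ennreal (1 / ?m) * ennreal (esc (R + d) b z) = ennreal (1 / ?m * esc (R + d) b z)"
      by (rule ennreal_mult[symmetric]) (auto simp: esc_def)
    also have "\<dots> \<le> ennreal 1" by (rule ennreal_leI) (simp add: divide_le_eq_1 max_def)
    finally show "ennreal (1 / ?m) * ennreal (esc (R + d) b z) \<le> 1" by simp
  qed simp
  finally show ?case by (simp only: mult_1_right)
qed simp

text \<open>Where every move has probability at least 1/64 the floor is inactive, and each weight
  cancels the probability of its move exactly.\<close>

lemma fast_run_integral_ge:
  assumes F: "F \<in> borel_measurable SS" and d: "d \<ge> 0"
    and esc: "\<And>R' y. R\<^sub>0 \<le> R' \<Longrightarrow> R' \<le> enorm y \<Longrightarrow> enorm y < R' + 1 \<Longrightarrow> esc (R' + d) b y \<ge> 1 / 64"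
  shows "(\<And>y. y \<noteq> 0 \<Longrightarrow> R + real n * d \<le> enorm y \<Longrightarrow> enorm y < R + real n * d + 1 \<Longrightarrow> c \<le> (\<integral>\<^sup>+\<omega>. F \<omega> \<partial>PP y))
     \<Longrightarrow> z \<noteq> 0 \<Longrightarrow> R\<^sub>0 \<le> R \<Longrightarrow> R \<le> enorm z \<Longrightarrow> enorm z < R + 1 \<Longrightarrow> c \<le> (\<integral>\<^sup>+\<omega>. fast_run d b F n R \<omega> \<partial>PP z)"
proof (induction n arbitrary: R z)
  case (Suc n)
  have e: "R + real (Suc n) * d = (R + d) + real n * d" by (simp add: algebra_simps)
  let ?m = "max (esc (R + d) b z) (1 / 64)"
  have ez: "esc (R + d) b z \<ge> 1 / 64" using esc Suc.prems by blast
  have "c = c * (ennreal (1 / ?m) * ennreal (esc (R + d) b z))"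
  proof -
    have "ennreal (1 / ?m) * ennreal (esc (R + d) b z) = ennreal (1 / ?m * esc (R + d) b z)"
      by (rule ennreal_mult[symmetric]) (auto simp: esc_def)
    also have "1 / ?m * esc (R + d) b z = 1" using ez by (simp add: max_def)
    finally show ?thesis by simp
  qed
  also have "\<dots> = ennreal (1 / ?m) * (c * ennreal (esc (R + d) b z))" by (simp only: mult_ac)
  also have "\<dots> \<le> ennreal (1 / ?m) * (\<integral>\<^sup>+\<omega>. at_exit (\<lambda>l. length l \<le> b) (R + d) (fast_run d b F n (R + d)) \<omega> \<partial>PP z)"
    unfolding esc_def
  proof (rule mult_left_mono[OF at_exit_integral_ge])
    show "fast_run d b F n (R + d) \<in> borel_measurable SS" using F by measurable
    show "z \<noteq> 0" "enorm z < R + d + 1" using Suc.prems d by auto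
    fix y :: site assume "y \<noteq> 0" "R + d \<le> enorm y" "enorm y < R + d + 1"
    then show "c \<le> (\<integral>\<^sup>+\<omega>. fast_run d b F n (R + d) \<omega> \<partial>PP y)"
      using Suc.prems d unfolding e by (intro Suc.IH) auto
  qed simp
  also have "\<dots> = (\<integral>\<^sup>+\<omega>. fast_run d b F (Suc n) R \<omega> \<partial>PP z)"
    unfolding fast_run.simps
    by (rule nn_integral_start_mult[where h = "\<lambda>z. ennreal (1 / max (esc (R + d) b z) (1 / 64))", symmetric]) (use F in measurable)
  finally show ?case .
qed simp

lemma at_exit_mono: "(\<And>\<omega>. F \<omega> \<le> G \<omega>) \<Longrightarrow> (\<And>l. A l \<Longrightarrow> B l) \<Longrightarrow> at_exit A R F \<omega> \<le> at_exit B R G \<omega>"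
proof (cases "\<exists>n. exits R n \<omega>")
  case True
  assume a: "\<And>\<omega>. F \<omega> \<le> G \<omega>" "\<And>l. A l \<Longrightarrow> B l"
  obtain n where n: "exits R n \<omega>" using True by blast
  show ?thesis unfolding at_exit_eq[OF n] by (rule mult_mono) (auto simp: a of_bool_def)
qed (simp add: at_exit_eq_0)

lemma at_exit_bound: "(\<And>\<omega>. F \<omega> \<le> c) \<Longrightarrow> at_exit A R F \<omega> \<le> c"
proof (cases "\<exists>n. exits R n \<omega>")
  case True
  assume a: "\<And>\<omega>. F \<omega> \<le> c"
  obtain n where n: "exits R n \<omega>" using True by blast
  show ?thesis unfolding at_exit_eq[OF n] using a[of "sdrop n \<omega>"] by (simp add: of_bool_def)
qed (simp add: at_exit_eq_0)

text \<open>The purpose of the floor: a deterministic bound on the weight, which reduces the square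
  of a weight to its first moment.\<close>

lemma fast_run_bound: "(\<And>\<omega>. F \<omega> \<le> 1) \<Longrightarrow> fast_run d b F n R \<omega> \<le> ennreal (64 ^ n)"
proof (induction n arbitrary: R \<omega>)
  case (Suc n)
  have "fast_run d b F (Suc n) R \<omega> \<le> ennreal 64 * ennreal (64 ^ n)"
    unfolding fast_run.simps
  proof (rule mult_mono)
    show "ennreal (1 / max (esc (R + d) b (shd \<omega>)) (1 / 64)) \<le> ennreal 64"
      by (intro ennreal_leI) (simp add: divide_le_eq max_def)
    show "at_exit (\<lambda>l. length l \<le> b) (R + d) (fast_run d b F n (R + d)) \<omega> \<le> ennreal (64 ^ n)"
      by (rule at_exit_bound) (rule Suc.IH[OF Suc.prems])
  qed auto
  also have "\<dots> = ennreal (64 ^ Suc n)" unfolding power_Suc by (rule ennreal_mult[symmetric]) auto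
  finally show ?case .
qed simp

text \<open>\<open>H\<close> depends only on the path after its exit from the ball of radius \<open>R\<close>.\<close>

definition later :: "real \<Rightarrow> (site stream \<Rightarrow> ennreal) \<Rightarrow> bool" where
  "later R H \<longleftrightarrow> (\<forall>R' n \<omega>. R' \<le> R \<longrightarrow> exits R' n \<omega> \<longrightarrow> H (sdrop n \<omega>) = H \<omega>)"

lemma later_at_exit: "later R (at_exit (\<lambda>_. True) R F)"
  unfolding later_def
proof (intro allI impI)
  fix R' n \<omega> assume R': "R' \<le> R" "exits R' n \<omega>"
  show "at_exit (\<lambda>_. True) R F (sdrop n \<omega>) = at_exit (\<lambda>_. True) R F \<omega>"
  proof (cases "\<exists>m. exits R m \<omega>")
    case True
    then obtain m where m: "exits R m \<omega>" by blast
    note e = exits_sdrop[OF R'(2) m R'(1)]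
    show ?thesis using e(1) by (simp add: at_exit_eq[OF m] at_exit_eq[OF e(2)] sdrop_add)
  next
    case False
    then have "\<not> exits R m (sdrop n \<omega>)" for m using exits_sdrop_back[OF R'(2) _ R'(1)] by blast
    then show ?thesis using False by (simp add: at_exit_eq_0)
  qed
qed

lemma at_exit_times_later:
  assumes "later R'' H" "R \<le> R''"
  shows "at_exit A R F \<omega> * H \<omega> = at_exit A R (\<lambda>\<omega>. F \<omega> * H \<omega>) \<omega>"
proof (cases "\<exists>n. exits R n \<omega>")
  case True
  then obtain n where n: "exits R n \<omega>" by blast
  have "H (sdrop n \<omega>) = H \<omega>" using assms n unfolding later_def by blast
  then show ?thesis by (simp add: at_exit_eq[OF n] mult.assoc)
qed (simp add: at_exit_eq_0)

text \<open>A factor that looks only at the path beyond the end of the run can be moved into the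
  final functional, so that a product of two scales becomes a single run.\<close>

lemma fast_run_times_later:
  assumes H: "later R'' H" and d: "d \<ge> 0"
  shows "R + real n * d \<le> R'' \<Longrightarrow> fast_run d b F n R \<omega> * H \<omega> = fast_run d b (\<lambda>\<omega>. F \<omega> * H \<omega>) n R \<omega>"
proof (induction n arbitrary: R \<omega>)
  case (Suc n)
  have e: "R + real (Suc n) * d = (R + d) + real n * d" by (simp add: algebra_simps)
  have le: "R + d \<le> R''" using Suc.prems d unfolding e by (smt (verit) mult_nonneg_nonneg of_nat_0_le_iff)
  have "fast_run d b F n (R + d) \<omega> * H \<omega> = fast_run d b (\<lambda>\<omega>. F \<omega> * H \<omega>) n (R + d) \<omega>" for \<omega>
    using Suc.prems unfolding e by (rule Suc.IH)
  then show ?case by (simp add: mult.assoc at_exit_times_later[OF H le])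
qed simp

lemma fast_run_pos: "fast_run d b F n R \<omega> \<noteq> 0 \<Longrightarrow> \<exists>m\<le>n * b. F (sdrop m \<omega>) \<noteq> 0"
proof (induction n arbitrary: R \<omega>)
  case 0
  then show ?case by (auto intro!: exI[of _ 0])
next
  case (Suc n)
  then have nz: "at_exit (\<lambda>l. length l \<le> b) (R + d) (fast_run d b F n (R + d)) \<omega> \<noteq> 0" by auto
  then obtain i where i: "exits (R + d) i \<omega>" using at_exit_eq_0 by blast
  then have "i \<le> b" "fast_run d b F n (R + d) (sdrop i \<omega>) \<noteq> 0" using nz by (auto simp: at_exit_eq[OF i])
  with Suc.IH[OF this(2)] obtain m where m: "m \<le> n * b" "F (sdrop m (sdrop i \<omega>)) \<noteq> 0" by blast
  then show ?case using \<open>i \<le> b\<close> by (intro exI[of _ "m + i"]) (auto simp: sdrop_add add.commute)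
qed

lemma esc_ge:
  assumes y: "R \<le> enorm y" and R: "R > 0" "kap * ln R \<ge> 1100" and b: "b \<ge> 1" "real b \<le> R\<^sup>2"
  shows "esc (R + sqrt (real b) / 2) b y \<ge> 1 / 64"
proof -
  have y0: "y \<noteq> 0" using y R by auto
  have "ln R \<le> ln (enorm y)" using y R by simp
  then have "kap * ln R \<le> kap * ln (enorm y)" using kap_pos by simp
  then have k: "kap * ln (enorm y) \<ge> 1100" using R by linarith
  have "R\<^sup>2 \<le> (enorm y)\<^sup>2" using y R by (intro power_mono) auto
  then have b2: "real b \<le> (enorm y)\<^sup>2" using b by linarith
  have "1 / 64 \<le> PR y (\<lambda>\<omega>. enorm (\<omega> !! b) \<ge> enorm y + sqrt (real b) / 2)"
    by (rule escape_ge[OF k y0 b(1) b2])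
  also have "\<dots> \<le> esc (R + sqrt (real b) / 2) b y"
    unfolding esc_def
  proof (rule PR_mono)
    fix \<omega> assume "enorm (\<omega> !! b) \<ge> enorm y + sqrt (real b) / 2"
    then have "enorm (\<omega> !! b) \<ge> R + sqrt (real b) / 2" using y by linarith
    then show "\<exists>n. exits (R + sqrt (real b) / 2) n \<omega> \<and> length (stake n \<omega>) \<le> b"
      using exits_exists by fastforce
  qed measurable
  finally show ?thesis .
qed

section \<open>Never returning to a ball, and a second moment inequality\<close>

definition stays_out :: "real \<Rightarrow> site stream \<Rightarrow> ennreal" where
  "stays_out r \<omega> = indicator {\<omega>. \<forall>i. enorm (\<omega> !! i) > r} \<omega>"

lemma measurable_stays_out [measurable]: "stays_out r \<in> borel_measurable SS"
proof -
  have "{\<omega> :: site stream. \<forall>i. enorm (\<omega> !! i) > r} \<in> sets SS" by measurable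
  then show ?thesis unfolding stays_out_def[abs_def] by measurable
qed

lemma stays_out_integral: "(\<integral>\<^sup>+\<omega>. stays_out r \<omega> \<partial>PP y) = ennreal (PR y (\<lambda>\<omega>. \<forall>i. enorm (\<omega> !! i) > r))"
  unfolding stays_out_def by (rule PR_eq_nn_integral[symmetric]) measurable

text \<open>Avoidance of the ball is kept only up to the exit of radius R, as a condition on the
  prefix; after the exit the path is left to the strong Markov property.\<close>

lemma stays_out_times_at_exit: "stays_out r \<omega> * at_exit (\<lambda>_. True) R F \<omega> \<le> at_exit (\<lambda>l. \<forall>z\<in>set l. enorm z > r) R F \<omega>"
proof (cases "\<exists>n. exits R n \<omega>")
  case True
  then obtain n where n: "exits R n \<omega>" by blast
  show ?thesis
  proof (cases "\<forall>i. enorm (\<omega> !! i) > r")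
    case True
    then have "\<forall>z\<in>set (stake n \<omega>). enorm z > r" unfolding set_stake_conv by blast
    then show ?thesis by (simp add: at_exit_eq[OF n] stays_out_def indicator_def)
  qed (simp add: stays_out_def)
qed (simp add: at_exit_eq_0)

text \<open>Here 13 = 6 + 6 + 1: the two additive errors of the kernel bounds, and 1 so that the
  kernel at y exceeds kap ln r + 6 by at least 1.\<close>

lemma stays_out_ge:
  assumes r: "r \<ge> 1" and y: "y \<noteq> 0" "R \<le> enorm y" and R: "R > 0" "kap * ln R - kap * ln r \<ge> 13"
  shows "PR y (\<lambda>\<omega>. \<forall>i. enorm (\<omega> !! i) > r) \<ge> 1 / potential_kernel y"
proof -
  have ay: "potential_kernel y \<ge> kap * ln R - 6" using y R by (intro kernel_ge_outside) auto
  have "PR y (\<lambda>\<omega>. \<not> (\<exists>i. enorm (\<omega> !! i) \<le> r)) = 1 - PR y (\<lambda>\<omega>. \<exists>i. enorm (\<omega> !! i) \<le> r)"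
    by (rule PR_not) measurable
  moreover have "PR y (\<lambda>\<omega>. \<exists>i. enorm (\<omega> !! i) \<le> r) \<le> (kap * ln r + 6) / potential_kernel y"
    by (rule hit_ball_le[OF y(1) r])
  moreover have "1 - (kap * ln r + 6) / potential_kernel y \<ge> 1 / potential_kernel y"
    using ay R kernel_pos[OF y(1)] by (simp add: field_simps)
  moreover have "(\<forall>i. enorm (\<omega> !! i) > r) \<longleftrightarrow> \<not> (\<exists>i. enorm (\<omega> !! i) \<le> r)" for \<omega> :: "site stream"
    by (auto simp: not_le)
  ultimately show ?thesis by simp
qed

text \<open>From 2y \<le> t + y^2/t for y > 0. This linear form of the second moment method has no
  quotient of integrals; the value of t is chosen later.\<close>

lemma paley_zygmund_nn:
  assumes N: "N \<in> borel_measurable SS" and fin: "\<And>\<omega>. N \<omega> < \<infinity>" and t: "t > 0"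
  shows "2 * (\<integral>\<^sup>+\<omega>. N \<omega> \<partial>PP x) \<le> ennreal t * ennreal (PR x (\<lambda>\<omega>. N \<omega> \<noteq> 0)) + ennreal (1 / t) * (\<integral>\<^sup>+\<omega>. N \<omega> * N \<omega> \<partial>PP x)"
proof -
  have m: "Measurable.pred SS (\<lambda>\<omega>. N \<omega> \<noteq> 0)" using N by measurable
  have "2 * (\<integral>\<^sup>+\<omega>. N \<omega> \<partial>PP x) = (\<integral>\<^sup>+\<omega>. 2 * N \<omega> \<partial>PP x)"
    by (rule nn_integral_cmult[symmetric]) (use N in measurable)
  also have "\<dots> \<le> (\<integral>\<^sup>+\<omega>. ennreal t * indicator {\<omega>. N \<omega> \<noteq> 0} \<omega> + ennreal (1 / t) * (N \<omega> * N \<omega>) \<partial>PP x)"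
  proof (rule nn_integral_mono)
    fix \<omega>
    obtain y where y: "N \<omega> = ennreal y" "y \<ge> 0" using fin[of \<omega>] by (cases "N \<omega>") auto
    show "2 * N \<omega> \<le> ennreal t * indicator {\<omega>. N \<omega> \<noteq> 0} \<omega> + ennreal (1 / t) * (N \<omega> * N \<omega>)"
    proof (cases "y = 0")
      case False
      have "0 \<le> (t - y)\<^sup>2 / t" using t by simp
      also have "(t - y)\<^sup>2 / t = t + 1 / t * (y * y) - 2 * y" using t by (simp add: power2_eq_square field_simps)
      finally have "2 * y \<le> t + 1 / t * (y * y)" by simp
      then have "ennreal (2 * y) \<le> ennreal (t + 1 / t * (y * y))" by (rule ennreal_leI)
      also have "\<dots> = ennreal t + ennreal (1 / t * (y * y))" using t y by (intro ennreal_plus) auto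
      also have "ennreal (1 / t * (y * y)) = ennreal (1 / t) * ennreal (y * y)" using t y by (intro ennreal_mult) auto
      also have "ennreal (y * y) = ennreal y * ennreal y" using y by (intro ennreal_mult) auto
      finally show ?thesis using False y by (simp add: indicator_def ennreal_mult)
    qed (simp add: y)
  qed
  also have "\<dots> = ennreal t * ennreal (PR x (\<lambda>\<omega>. N \<omega> \<noteq> 0)) + ennreal (1 / t) * (\<integral>\<^sup>+\<omega>. N \<omega> * N \<omega> \<partial>PP x)"
  proof -
    have "{\<omega>. N \<omega> \<noteq> 0} \<in> sets SS" by (rule sets_Collect_SS[OF m])
    then show ?thesis using N
      by (subst nn_integral_add) (auto simp: nn_integral_cmult PR_eq_nn_integral[OF m])
  qed
  finally show ?thesis .
qed

subsection \<open>Lower bound on the future minima\<close>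

text \<open>Scale \<open>k\<close> at level \<open>J\<close>: from radius \<open>rho\<close> the walk makes \<open>J\<close> moves of length \<open>gain\<close> in at most \<open>blk\<close> steps
  each, which takes it to radius \<open>crest\<close> (of order \<open>rho * sqrt J\<close>) by a time of order \<open>rho\<^sup>2\<close>, and then never
  returns to the radius \<open>cut\<close>, which is smaller than \<open>crest\<close> by a constant factor.\<close>

definition base :: "nat \<Rightarrow> real" where "base J = (real J + 2)\<^sup>2"
definition rho :: "nat \<Rightarrow> nat \<Rightarrow> real" where "rho J k = base J ^ k"
definition blk :: "nat \<Rightarrow> nat \<Rightarrow> nat" where "blk J k = nat \<lfloor>(rho J k)\<^sup>2 / real J\<rfloor>"
definition gain :: "nat \<Rightarrow> nat \<Rightarrow> real" where "gain J k = sqrt (real (blk J k)) / 2"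
definition crest :: "nat \<Rightarrow> nat \<Rightarrow> real" where "crest J k = rho J k + real J * gain J k"
text \<open>Makes kap ln \<open>crest\<close> exceed kap ln \<open>cut\<close> by exactly the 13
  that \<open>stays_out_ge\<close> asks for.\<close>

definition cutc :: real where "cutc = exp (13 / kap)"
definition cut :: "nat \<Rightarrow> nat \<Rightarrow> real" where "cut J k = crest J k / cutc"
definition lbase :: "nat \<Rightarrow> real" where "lbase J = ln (base J)"
text \<open>From the crest, never returning to \<open>cut\<close> has probability at most (kap ln 4
  + 25) over a kernel of at least kap k \<open>lbase J\<close> / 2; this constant collects the
  quotient.\<close>

definition cutp :: real where "cutp = 2 * (kap * ln 4 + 25) / kap"

lemma cutc_gt_1: "cutc > 1" using kap_pos by (simp add: cutc_def)
lemma cutp_pos: "cutp > 0" using kap_pos by (simp add: cutp_def add_pos_pos)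

text \<open>The prefix condition \<open>A\<close> is a time limit for the first moment, avoidance of
  an earlier cut for mixed moments, and trivial where only upper bounds are sought.\<close>

definition weight :: "(site list \<Rightarrow> bool) \<Rightarrow> nat \<Rightarrow> nat \<Rightarrow> site stream \<Rightarrow> ennreal" where
  "weight A J k = at_exit A (rho J k) (fast_run (gain J k) (blk J k) (stays_out (cut J k)) J (rho J k))"

text \<open>\<open>Jc\<close> makes the crest at least 2 \<open>cutc\<close> times
  \<open>rho\<close>, so that the cut lies beyond twice the starting radius; \<open>Jk\<close> lets
  one unit of the logarithmic scale dominate all additive constants, including the 1100 of
  \<open>escape_ge\<close>.\<close>

locale level =
  fixes J :: nat
  assumes J4: "J \<ge> 4" and Jc: "sqrt (real J) \<ge> 8 * cutc" and Jk: "kap * lbase J \<ge> 2000"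
begin

lemma base_ge: "base J \<ge> real J + 2"
  using mult_mono[of 1 "real J + 2" "real J + 2" "real J + 2"] by (simp add: base_def power2_eq_square)

lemma lbase_pos: "lbase J > 0" using Jk kap_pos by (smt (verit) mult_nonneg_nonpos)

lemma lbase_half: "ln (real J + 2) = lbase J / 2"
  by (simp add: lbase_def base_def ln_realpow)

lemma rho_mono: "j \<le> k \<Longrightarrow> rho J j \<le> rho J k"
  unfolding rho_def using base_ge by (intro power_increasing) auto

lemma rho_ge_base: "k \<ge> 1 \<Longrightarrow> rho J k \<ge> base J"
  using rho_mono[of 1 k] by (simp add: rho_def)

lemma rho_ge_1: "rho J k \<ge> 1"
  using rho_mono[of 0 k] by (simp add: rho_def)

lemma ln_rho: "ln (rho J k) = real k * lbase J"
  by (simp add: rho_def lbase_def ln_realpow)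

lemma blk_facts:
  assumes "k \<ge> 1"
  shows "blk J k \<ge> 1" "real (blk J k) \<le> (rho J k)\<^sup>2 / real J" "real (blk J k) \<le> (rho J k)\<^sup>2"
    "gain J k \<le> rho J k / (2 * sqrt (real J))" "gain J k \<ge> rho J k / (4 * sqrt (real J))"
proof -
  have r: "rho J k \<ge> real J + 2" using rho_ge_base[OF assms] base_ge by linarith
  have "real J * 4 \<le> (real J + 2) * (real J + 2)" using J4 by (simp add: algebra_simps)
  also have "\<dots> \<le> (rho J k)\<^sup>2" using r unfolding power2_eq_square by (intro mult_mono) auto
  finally have big: "(rho J k)\<^sup>2 / real J \<ge> 4" using J4 by (simp add: pos_le_divide_eq mult.commute)
  have up: "real (blk J k) \<le> (rho J k)\<^sup>2 / real J" using big by (simp add: blk_def)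
  have low: "real (blk J k) \<ge> (rho J k)\<^sup>2 / real J - 1" unfolding blk_def using big by linarith
  show "blk J k \<ge> 1" using low big by linarith
  show "real (blk J k) \<le> (rho J k)\<^sup>2 / real J" by (rule up)
  also have "\<dots> \<le> (rho J k)\<^sup>2 / 1" using J4 by (intro divide_left_mono) auto
  finally show "real (blk J k) \<le> (rho J k)\<^sup>2" by simp
  have sq: "sqrt ((rho J k)\<^sup>2 / real J) = rho J k / sqrt (real J)"
    using rho_ge_1[of k] by (simp add: real_sqrt_divide)
  have "sqrt (real (blk J k)) \<le> sqrt ((rho J k)\<^sup>2 / real J)" using up by (rule real_sqrt_le_mono)
  then show "gain J k \<le> rho J k / (2 * sqrt (real J))" unfolding gain_def sq by simp
  have "t / 4 \<le> b" if "t - 1 \<le> b" "4 \<le> t" for t b :: real using that by linarith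
  from this[OF low big] have "(rho J k)\<^sup>2 / real J / 4 \<le> real (blk J k)" .
  then have "sqrt ((rho J k)\<^sup>2 / real J / 4) \<le> sqrt (real (blk J k))" by (rule real_sqrt_le_mono)
  moreover have "sqrt ((rho J k)\<^sup>2 / real J / 4) = rho J k / sqrt (real J) / 2"
    using rho_ge_1[of k] by (simp add: real_sqrt_divide real_sqrt_mult)
  ultimately have h: "rho J k / sqrt (real J) / 2 \<le> sqrt (real (blk J k))" by (rule ord_eq_le_trans[OF sym, rotated])
  have "rho J k / (4 * sqrt (real J)) = rho J k / sqrt (real J) / 2 / 2" by simp
  also have "\<dots> \<le> gain J k" unfolding gain_def by (rule divide_right_mono[OF h]) simp
  finally show "gain J k \<ge> rho J k / (4 * sqrt (real J))" .
qed

lemma gain_nonneg: "gain J k \<ge> 0" by (simp add: gain_def)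

text \<open>A run gains a factor at least sqrt J / 4 but, on the logarithmic scale, uses at most
  half of the way to the next \<open>rho\<close>, which is why \<open>base\<close> is a square. The
  free half separates the scales.\<close>

lemma crest_facts:
  assumes k: "k \<ge> 1"
  shows "crest J k \<ge> rho J k" "crest J k + 1 \<le> rho J k * (real J + 2)" "crest J k \<ge> rho J k * sqrt (real J) / 4"
    "ln (crest J k + 1) \<le> real k * lbase J + lbase J / 2"
proof -
  have sJ: "real J / sqrt (real J) = sqrt (real J)" by (rule real_div_sqrt) simp
  show t1: "crest J k \<ge> rho J k" using gain_nonneg by (simp add: crest_def)
  have "real J * gain J k \<le> real J * (rho J k / (2 * sqrt (real J)))"
    using blk_facts(4)[OF k] by (intro mult_left_mono) auto
  also have "\<dots> = rho J k * (real J / sqrt (real J)) / 2" by (simp add: mult.commute)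
  also have "\<dots> = rho J k * sqrt (real J) / 2" unfolding sJ ..
  also have "\<dots> \<le> rho J k * real J"
  proof -
    have "sqrt (real J) \<le> real J" using J4 by (intro real_le_lsqrt) (auto simp: power2_eq_square)
    then have "rho J k * sqrt (real J) \<le> rho J k * real J" using rho_ge_1[of k] by simp
    moreover have "0 \<le> rho J k * sqrt (real J)" using rho_ge_1[of k] by simp
    ultimately show ?thesis by linarith
  qed
  finally have "crest J k + 1 \<le> rho J k + rho J k * real J + rho J k" using rho_ge_1[of k] by (simp add: crest_def)
  then show t2: "crest J k + 1 \<le> rho J k * (real J + 2)" by (simp add: algebra_simps)
  have "rho J k * sqrt (real J) / 4 = rho J k * (real J / sqrt (real J)) / 4" unfolding sJ ..
  also have "\<dots> = real J * (rho J k / (4 * sqrt (real J)))" by (simp add: mult.commute)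
  also have "\<dots> \<le> real J * gain J k" using blk_facts(5)[OF k] by (intro mult_left_mono) auto
  also have "\<dots> \<le> crest J k" using rho_ge_1[of k] by (simp add: crest_def)
  finally show "crest J k \<ge> rho J k * sqrt (real J) / 4" .
  have "ln (crest J k + 1) \<le> ln (rho J k * (real J + 2))"
    using t1 t2 rho_ge_1[of k] by (subst ln_le_cancel_iff) auto
  also have "\<dots> = ln (rho J k) + ln (real J + 2)" using rho_ge_1[of k] by (intro ln_mult_pos) auto
  finally show "ln (crest J k + 1) \<le> real k * lbase J + lbase J / 2" by (simp add: ln_rho lbase_half)
qed

lemma cut_facts:
  assumes k: "k \<ge> 1"
  shows "cut J k \<ge> 2 * rho J k" "cut J k < crest J k" "kap * ln (crest J k) - kap * ln (cut J k) = 13"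
proof -
  have t: "crest J k > 0" using crest_facts(1)[OF k] rho_ge_1[of k] by linarith
  have "rho J k * (8 * cutc) \<le> rho J k * sqrt (real J)" using Jc rho_ge_1[of k] by (intro mult_left_mono) auto
  then have "2 * rho J k * cutc \<le> crest J k" using crest_facts(3)[OF k] by simp
  then show "cut J k \<ge> 2 * rho J k" using cutc_gt_1 by (simp add: cut_def pos_le_divide_eq)
  show "cut J k < crest J k" using t cutc_gt_1 by (simp add: cut_def divide_less_eq)
  have "ln (cut J k) = ln (crest J k) - 13 / kap"
    using t cutc_gt_1 by (simp add: cut_def ln_div cutc_def)
  then show "kap * ln (crest J k) - kap * ln (cut J k) = 13" using kap_pos by (simp add: right_diff_distrib)
qed

text \<open>The last bound does not grow with k: crest + 1 is at most 4 \<open>cutc\<close> times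
  cut - 1, and the constants add up to kap ln 4 + 13 + 6 + 6.\<close>

lemma shell_kernel:
  assumes k: "k \<ge> 1" and y: "crest J k \<le> enorm y" "enorm y < crest J k + 1"
  shows "y \<noteq> 0" "potential_kernel y \<le> 2 * kap * real k * lbase J"
    "potential_kernel y \<ge> kap * real k * lbase J / 2"
    "potential_kernel y - (kap * ln (cut J k - 1) - 6) \<le> kap * ln 4 + 25"
proof -
  have t1: "crest J k \<ge> 1" using crest_facts(1)[OF k] rho_ge_1[of k] by linarith
  show "y \<noteq> 0" using y t1 by auto
  have kk: "kap * lbase J \<le> kap * real k * lbase J"
    using k kap_pos lbase_pos by simp
  have up: "potential_kernel y \<le> kap * ln (crest J k + 1) + 6" using y t1 by (intro kernel_le_ball) auto
  have "kap * ln (crest J k + 1) \<le> kap * (real k * lbase J + lbase J / 2)"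
    using crest_facts(4)[OF k] kap_pos by (intro mult_left_mono) auto
  then have "kap * ln (crest J k + 1) \<le> kap * real k * lbase J + kap * lbase J / 2" by (simp add: algebra_simps)
  then show "potential_kernel y \<le> 2 * kap * real k * lbase J" using up kk Jk by linarith
  have "potential_kernel y \<ge> kap * ln (rho J k) - 6"
    using y crest_facts(1)[OF k] rho_ge_1[of k] by (intro kernel_ge_outside) linarith+
  then show "potential_kernel y \<ge> kap * real k * lbase J / 2" unfolding ln_rho using kk Jk by simp
  have c2: "cut J k \<ge> 2" using cut_facts(1)[OF k] rho_ge_1[of k] by linarith
  have "crest J k + 1 \<le> 4 * (crest J k / 2)" using t1 by linarith
  also have "crest J k / 2 \<le> cutc * (cut J k - 1)"
  proof -
    have "cutc * (cut J k - 1) = crest J k - cutc" using cutc_gt_1 by (simp add: cut_def right_diff_distrib)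
    moreover have "2 * cutc \<le> cut J k * cutc" using c2 cutc_gt_1 by (intro mult_right_mono) auto
    then have "2 * cutc \<le> crest J k" using cutc_gt_1 by (simp add: cut_def)
    ultimately show ?thesis by linarith
  qed
  finally have "ln (crest J k + 1) \<le> ln (4 * (cutc * (cut J k - 1)))"
    using t1 cutc_gt_1 c2 by (subst ln_le_cancel_iff) auto
  also have "\<dots> = ln 4 + (ln cutc + ln (cut J k - 1))"
    using cutc_gt_1 c2 by (simp add: ln_mult_pos)
  finally have "kap * ln (crest J k + 1) \<le> kap * (ln 4 + (ln cutc + ln (cut J k - 1)))"
    using kap_pos by simp
  also have "\<dots> = kap * ln 4 + 13 + kap * ln (cut J k - 1)" using kap_pos by (simp add: cutc_def algebra_simps)
  finally show "potential_kernel y - (kap * ln (cut J k - 1) - 6) \<le> kap * ln 4 + 25" using up by linarith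
qed

lemma cut_kernel:
  assumes k: "k \<ge> 1"
  shows "kap * ln (cut J k - 1) - 6 > 0" "kap * ln (cut J k - 1) \<le> kap * real k * lbase J + kap * lbase J / 2"
proof -
  have kk: "kap * lbase J \<le> kap * real k * lbase J" using k kap_pos lbase_pos by simp
  have c: "cut J k - 1 \<ge> rho J k" using cut_facts(1)[OF k] rho_ge_1[of k] by linarith
  have "ln (rho J k) \<le> ln (cut J k - 1)" using c rho_ge_1[of k] by (subst ln_le_cancel_iff) linarith+
  then have "kap * ln (rho J k) \<le> kap * ln (cut J k - 1)" using kap_pos by simp
  then show "kap * ln (cut J k - 1) - 6 > 0" unfolding ln_rho using kk Jk by simp
  have "ln (cut J k - 1) \<le> ln (crest J k + 1)" using c cut_facts(2)[OF k] rho_ge_1[of k] by (subst ln_le_cancel_iff) linarith+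
  also note crest_facts(4)[OF k]
  finally have "kap * ln (cut J k - 1) \<le> kap * (real k * lbase J + lbase J / 2)" using kap_pos by simp
  then show "kap * ln (cut J k - 1) \<le> kap * real k * lbase J + kap * lbase J / 2" by (simp add: algebra_simps)
qed

lemma stays_lower:
  assumes k: "k \<ge> 1" and y: "crest J k \<le> enorm y" "enorm y < crest J k + 1"
  shows "PR y (\<lambda>\<omega>. \<forall>i. enorm (\<omega> !! i) > cut J k) \<ge> 1 / (2 * kap * real k * lbase J)"
proof -
  note s = shell_kernel[OF assms]
  have "2 * kap * real k * lbase J > 0" using k kap_pos lbase_pos by simp
  then have "1 / (2 * kap * real k * lbase J) \<le> 1 / potential_kernel y"
    using s(2) kernel_pos[OF s(1)] k kap_pos lbase_pos by (intro divide_left_mono mult_pos_pos) auto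
  also have "\<dots> \<le> PR y (\<lambda>\<omega>. \<forall>i. enorm (\<omega> !! i) > cut J k)"
    by (rule stays_out_ge[OF _ s(1) y(1)])
      (use cut_facts[OF k] crest_facts(1)[OF k] rho_ge_1[of k] in linarith)+
  finally show ?thesis .
qed

lemma cut_factor:
  assumes k: "k \<ge> 1" and y: "crest J k \<le> enorm y" "enorm y < crest J k + 1"
  shows "(potential_kernel y - (kap * ln (cut J k - 1) - 6)) / potential_kernel y \<le> cutp / (real k * lbase J)"
proof -
  note s = shell_kernel[OF assms]
  have "(potential_kernel y - (kap * ln (cut J k - 1) - 6)) / potential_kernel y \<le> (kap * ln 4 + 25) / (kap * real k * lbase J / 2)"
    using s k kap_pos lbase_pos by (intro frac_le) auto
  also have "\<dots> = cutp / (real k * lbase J)" using kap_pos by (simp add: cutp_def mult_ac)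
  finally show ?thesis .
qed

lemma cut_low:
  assumes k: "k \<ge> 1" and z: "enorm z > cut J k - 1"
  shows "kap * ln (cut J k - 1) - 6 \<le> potential_kernel z"
proof (rule kernel_ge_outside)
  show "0 < cut J k - 1" using cut_facts(1)[OF k] rho_ge_1[of k] by linarith
qed (use z in simp)

lemma stays_upper:
  assumes k: "k \<ge> 1" and y: "crest J k \<le> enorm y" "enorm y < crest J k + 1"
  shows "PR y (\<lambda>\<omega>. \<forall>i. enorm (\<omega> !! i) > cut J k) \<le> cutp / (real k * lbase J)"
proof -
  have "PR y (\<lambda>\<omega>. \<forall>i. enorm (\<omega> !! i) > cut J k) \<le> (potential_kernel y - (kap * ln (cut J k - 1) - 6)) / potential_kernel y"
  proof (rule never_return_le[OF _ cut_kernel(1)[OF k]])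
    show "1 \<le> cut J k" using cut_facts(1)[OF k] rho_ge_1[of k] by linarith
    show "cut J k < enorm y" using cut_facts(2)[OF k] y by linarith
  qed (rule cut_low[OF k])
  also note cut_factor[OF assms]
  finally show ?thesis .
qed

lemma crest_lt_rho: "j \<ge> 1 \<Longrightarrow> j < k \<Longrightarrow> crest J j + 1 \<le> rho J k"
proof -
  assume j: "j \<ge> 1" "j < k"
  have "crest J j + 1 \<le> rho J j * (real J + 2)" by (rule crest_facts(2)[OF j(1)])
  also have "\<dots> \<le> rho J j * base J" using base_ge rho_ge_1[of j] by (intro mult_left_mono) auto
  also have "\<dots> = rho J (Suc j)" by (simp add: rho_def mult.commute)
  also have "\<dots> \<le> rho J k" using j by (intro rho_mono) auto
  finally show ?thesis .
qed

text \<open>Compared with escaping for ever, reaching only \<open>rho J k\<close> costs the factor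
  \<beta>/(\<beta> - \<alpha>). As the crest lies at most half a unit above scale j, \<beta> -
  \<alpha> is at least half of the k - j logarithmic units.\<close>

lemma between_upper:
  assumes j: "j \<ge> 1" "j < k" and y: "crest J j \<le> enorm y" "enorm y < crest J j + 1"
  shows "PR y (\<lambda>\<omega>. \<exists>n. exits (rho J k) n \<omega> \<and> (\<forall>z\<in>set (stake n \<omega>). enorm z > cut J j))
    \<le> cutp / (real j * lbase J) * (2 * real k / (real k - real j))"
proof -
  let ?\<alpha> = "kap * ln (cut J j - 1) - 6" and ?\<beta> = "kap * (real k * lbase J) - 6"
  have \<alpha>0: "?\<alpha> > 0" by (rule cut_kernel(1)[OF j(1)])
  have kj: "real k - real j \<ge> 1" using j by linarith
  have kl: "kap * lbase J > 0" using kap_pos lbase_pos by simp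
  have gap: "?\<beta> - ?\<alpha> \<ge> kap * lbase J * (real k - real j) / 2"
  proof -
    have "kap * lbase J * 1 \<le> kap * lbase J * (real k - real j)" using kj kl by (intro mult_left_mono) auto
    moreover have "kap * lbase J * (real k - real j) = kap * (real k * lbase J) - kap * real j * lbase J" by (simp add: algebra_simps)
    ultimately show ?thesis using cut_kernel(2)[OF j(1)] by linarith
  qed
  have gp: "kap * lbase J * (real k - real j) / 2 > 0" using kj kl by simp
  have "PR y (\<lambda>\<omega>. \<exists>n. exits (rho J k) n \<omega> \<and> (\<forall>z\<in>set (stake n \<omega>). enorm z > cut J j))
      \<le> PR y (\<lambda>\<omega>. \<exists>n. enorm (\<omega> !! n) \<ge> rho J k \<and> (\<forall>i<n. enorm (\<omega> !! i) > cut J j))"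
  proof (rule PR_mono)
    fix \<omega> assume "\<exists>n. exits (rho J k) n \<omega> \<and> (\<forall>z\<in>set (stake n \<omega>). enorm z > cut J j)"
    then obtain n where n: "exits (rho J k) n \<omega>" "\<forall>z\<in>set (stake n \<omega>). enorm z > cut J j" by blast
    have "enorm (\<omega> !! i) > cut J j" if "i < n" for i using n(2) that unfolding set_stake_conv by blast
    then show "\<exists>n. enorm (\<omega> !! n) \<ge> rho J k \<and> (\<forall>i<n. enorm (\<omega> !! i) > cut J j)"
      using n(1) by (auto simp: exits_def)
  qed measurable
  also have "\<dots> \<le> (potential_kernel y - ?\<alpha>) / potential_kernel y * (?\<beta> / (?\<beta> - ?\<alpha>))"
  proof (rule reach_before_le[OF _ _ \<alpha>0])
    show "1 \<le> cut J j" using cut_facts(1)[OF j(1)] rho_ge_1[of j] by linarith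
    show "cut J j < rho J k" using cut_facts(2)[OF j(1)] crest_lt_rho[OF j] by linarith
    show "?\<alpha> < ?\<beta>" using gap gp by linarith
    show "cut J j < enorm y" using cut_facts(2)[OF j(1)] y by linarith
    show "?\<beta> \<le> potential_kernel z" if "rho J k \<le> enorm z" for z
      using kernel_ge_outside[OF _ that] rho_ge_1[of k] by (simp add: ln_rho)
  qed (rule cut_low[OF j(1)])
  also have "\<dots> \<le> cutp / (real j * lbase J) * (2 * real k / (real k - real j))"
  proof (rule mult_mono[OF cut_factor[OF j(1) y]])
    have "?\<beta> / (?\<beta> - ?\<alpha>) \<le> (kap * (real k * lbase J)) / (kap * lbase J * (real k - real j) / 2)"
      using gap gp lbase_pos kap_pos by (intro frac_le) auto
    also have "\<dots> = 2 * real k / (real k - real j)" using kap_pos lbase_pos by simp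
    finally show "?\<beta> / (?\<beta> - ?\<alpha>) \<le> 2 * real k / (real k - real j)" .
    show "0 \<le> cutp / (real j * lbase J)" using cutp_pos lbase_pos by simp
    show "0 \<le> ?\<beta> / (?\<beta> - ?\<alpha>)" using gap gp \<alpha>0 by (intro divide_nonneg_nonneg) linarith+
  qed
  finally show ?thesis .
qed

lemma measurable_weight [measurable]: "weight A J k \<in> borel_measurable SS"
  unfolding weight_def by measurable

lemma run_upper:
  assumes k: "k \<ge> 1" and z: "z \<noteq> 0" "rho J k \<le> enorm z" "enorm z < rho J k + 1"
  shows "(\<integral>\<^sup>+\<omega>. fast_run (gain J k) (blk J k) (stays_out (cut J k)) J (rho J k) \<omega> \<partial>PP z) \<le> ennreal (cutp / (real k * lbase J))"
proof (rule fast_run_integral_le[OF _ gain_nonneg _ z])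
  fix y :: site assume "rho J k + real J * gain J k \<le> enorm y" "enorm y < rho J k + real J * gain J k + 1"
  then show "(\<integral>\<^sup>+\<omega>. stays_out (cut J k) \<omega> \<partial>PP y) \<le> ennreal (cutp / (real k * lbase J))"
    unfolding stays_out_integral by (intro ennreal_leI stays_upper[OF k]) (simp_all add: crest_def)
qed measurable

lemma weight_upper:
  assumes k: "k \<ge> 1" and x: "x \<noteq> 0" "enorm x < rho J k + 1"
  shows "(\<integral>\<^sup>+\<omega>. weight A J k \<omega> \<partial>PP x) \<le> ennreal (cutp / (real k * lbase J)) * ennreal (PR x (\<lambda>\<omega>. \<exists>n. exits (rho J k) n \<omega> \<and> A (stake n \<omega>)))"
  unfolding weight_def by (rule at_exit_integral_le[OF _ x]) (measurable, rule run_upper[OF k])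

lemma weight_lower:
  assumes k: "k \<ge> 1" and x: "x \<noteq> 0" "enorm x < rho J k + 1"
  shows "(\<integral>\<^sup>+\<omega>. weight A J k \<omega> \<partial>PP x) \<ge> ennreal (1 / (2 * kap * real k * lbase J)) * ennreal (PR x (\<lambda>\<omega>. \<exists>n. exits (rho J k) n \<omega> \<and> A (stake n \<omega>)))"
  unfolding weight_def
proof (rule at_exit_integral_ge[OF _ x])
  show "fast_run (gain J k) (blk J k) (stays_out (cut J k)) J (rho J k) \<in> borel_measurable SS" by measurable
  fix z :: site assume z: "z \<noteq> 0" "rho J k \<le> enorm z" "enorm z < rho J k + 1"
  show "ennreal (1 / (2 * kap * real k * lbase J)) \<le> (\<integral>\<^sup>+\<omega>. fast_run (gain J k) (blk J k) (stays_out (cut J k)) J (rho J k) \<omega> \<partial>PP z)"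
  proof (rule fast_run_integral_ge[OF _ gain_nonneg _ _ z(1) order_refl z(2,3)])
    fix R' y assume R': "rho J k \<le> R'" "R' \<le> enorm y"
    have r0: "R' > 0" using R' rho_ge_1[of k] by linarith
    have "ln (rho J k) \<le> ln R'" using R' rho_ge_1[of k] r0 by (subst ln_le_cancel_iff) auto
    then have "kap * ln (rho J k) \<le> kap * ln R'" using kap_pos by simp
    moreover have "kap * lbase J \<le> kap * real k * lbase J" using k kap_pos lbase_pos by simp
    ultimately have kR: "kap * ln R' \<ge> 1100" unfolding ln_rho using Jk by simp
    have "(rho J k)\<^sup>2 \<le> R'\<^sup>2" using R' rho_ge_1[of k] by (intro power_mono) auto
    then show "1 / 64 \<le> esc (R' + gain J k) (blk J k) y"
      unfolding gain_def using blk_facts[OF k] by (intro esc_ge[OF R'(2) r0 kR]) linarith+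
  next
    fix y :: site assume "rho J k + real J * gain J k \<le> enorm y" "enorm y < rho J k + real J * gain J k + 1"
    then show "ennreal (1 / (2 * kap * real k * lbase J)) \<le> (\<integral>\<^sup>+\<omega>. stays_out (cut J k) \<omega> \<partial>PP y)"
      unfolding stays_out_integral by (intro ennreal_leI stays_lower[OF k]) (simp_all add: crest_def)
  qed measurable
qed

lemma weight_bound: "weight A J k \<omega> \<le> ennreal (64 ^ J)"
  unfolding weight_def by (rule at_exit_bound, rule fast_run_bound) (simp add: stays_out_def indicator_def)

lemma weight_pos:
  assumes "weight A J k \<omega> \<noteq> 0"
  shows "\<exists>n m. exits (rho J k) n \<omega> \<and> A (stake n \<omega>) \<and> m \<le> J * blk J k \<and> (\<forall>i\<ge>n + m. enorm (\<omega> !! i) > cut J k)"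
proof -
  obtain n where n: "exits (rho J k) n \<omega>" using assms at_exit_eq_0 unfolding weight_def by blast
  then have A: "A (stake n \<omega>)" and f: "fast_run (gain J k) (blk J k) (stays_out (cut J k)) J (rho J k) (sdrop n \<omega>) \<noteq> 0"
    using assms unfolding weight_def by (auto simp: at_exit_eq[OF n])
  from fast_run_pos[OF f] obtain m where m: "m \<le> J * blk J k" "stays_out (cut J k) (sdrop m (sdrop n \<omega>)) \<noteq> 0" by blast
  have "enorm (\<omega> !! i) > cut J k" if "i \<ge> n + m" for i
  proof -
    have "\<forall>i. enorm (sdrop m (sdrop n \<omega>) !! i) > cut J k" using m(2) by (auto simp: stays_out_def indicator_def split: if_splits)
    from this[rule_format, of "i - (n + m)"] show ?thesis using that by (simp add: sdrop_snth add.commute)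
  qed
  then show ?thesis using n A m by blast
qed

text \<open>After the run at scale j the walk must avoid the cut up to scale k, and then the weight
  of scale k has mean at most \<open>cutp\<close> / (k \<open>lbase J\<close>). The k in this
  denominator cancels against the one in \<open>between_upper\<close>, leaving 1/(j (k -
  j)).\<close>

lemma weight_pair:
  assumes j: "j \<ge> 1" "j < k" and x: "x \<noteq> 0" "enorm x < rho J j + 1"
  shows "(\<integral>\<^sup>+\<omega>. weight (\<lambda>_. True) J j \<omega> * weight (\<lambda>_. True) J k \<omega> \<partial>PP x)
    \<le> ennreal (2 * cutp\<^sup>2 / (lbase J)\<^sup>2 * (1 / (real j * (real k - real j))))"
proof -
  let ?H = "weight (\<lambda>_. True) J k"
  let ?c = "cutp / (real j * lbase J) * (2 * real k / (real k - real j))"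
  let ?g = "cutp / (real k * lbase J)"
  have k1: "k \<ge> 1" using j by linarith
  have L: "later (rho J k) ?H" unfolding weight_def by (rule later_at_exit)
  have le: "rho J j + real J * gain J j \<le> rho J k" using crest_lt_rho[OF j] by (simp add: crest_def)
  have lj: "rho J j \<le> rho J k" using j by (intro rho_mono) auto
  have c0: "?c \<ge> 0" and g0: "?g \<ge> 0" using cutp_pos lbase_pos j by auto
  have m: "(\<lambda>\<omega>. stays_out (cut J j) \<omega> * ?H \<omega>) \<in> borel_measurable SS" by measurable
  have eq: "weight (\<lambda>_. True) J j \<omega> * ?H \<omega> = at_exit (\<lambda>_. True) (rho J j) (fast_run (gain J j) (blk J j) (\<lambda>\<omega>. stays_out (cut J j) \<omega> * ?H \<omega>) J (rho J j)) \<omega>" for \<omega>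
  proof -
    have "fast_run (gain J j) (blk J j) (stays_out (cut J j)) J (rho J j) \<omega> * ?H \<omega> = fast_run (gain J j) (blk J j) (\<lambda>\<omega>. stays_out (cut J j) \<omega> * ?H \<omega>) J (rho J j) \<omega>" for \<omega>
      by (rule fast_run_times_later[OF L gain_nonneg le])
    then show ?thesis unfolding weight_def[of _ J j] at_exit_times_later[OF L lj] by simp
  qed
  have "(\<integral>\<^sup>+\<omega>. weight (\<lambda>_. True) J j \<omega> * ?H \<omega> \<partial>PP x) \<le> ennreal (?g * ?c) * ennreal (PR x (\<lambda>\<omega>. \<exists>n. exits (rho J j) n \<omega> \<and> True))"
    unfolding eq
  proof (rule at_exit_integral_le[OF _ x])
    show "fast_run (gain J j) (blk J j) (\<lambda>\<omega>. stays_out (cut J j) \<omega> * ?H \<omega>) J (rho J j) \<in> borel_measurable SS"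
      using m by measurable
    fix z :: site assume z: "z \<noteq> 0" "rho J j \<le> enorm z" "enorm z < rho J j + 1"
    show "(\<integral>\<^sup>+\<omega>. fast_run (gain J j) (blk J j) (\<lambda>\<omega>. stays_out (cut J j) \<omega> * ?H \<omega>) J (rho J j) \<omega> \<partial>PP z) \<le> ennreal (?g * ?c)"
    proof (rule fast_run_integral_le[OF m gain_nonneg _ z])
      fix y :: site assume y0: "y \<noteq> 0" and "rho J j + real J * gain J j \<le> enorm y" "enorm y < rho J j + real J * gain J j + 1"
      then have y: "crest J j \<le> enorm y" "enorm y < crest J j + 1" by (simp_all add: crest_def)
      have yk: "enorm y < rho J k + 1" using y crest_lt_rho[OF j] by linarith
      have "(\<integral>\<^sup>+\<omega>. stays_out (cut J j) \<omega> * ?H \<omega> \<partial>PP y) \<le> (\<integral>\<^sup>+\<omega>. weight (\<lambda>l. \<forall>z\<in>set l. enorm z > cut J j) J k \<omega> \<partial>PP y)"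
        unfolding weight_def by (rule nn_integral_mono) (rule stays_out_times_at_exit)
      also have "\<dots> \<le> ennreal ?g * ennreal (PR y (\<lambda>\<omega>. \<exists>n. exits (rho J k) n \<omega> \<and> (\<forall>z\<in>set (stake n \<omega>). enorm z > cut J j)))"
        by (rule weight_upper[OF k1 y0 yk])
      also have "\<dots> \<le> ennreal ?g * ennreal ?c"
        by (intro mult_left_mono ennreal_leI between_upper[OF j y]) simp
      also have "\<dots> = ennreal (?g * ?c)" using g0 c0 by (intro ennreal_mult[symmetric])
      finally show "(\<integral>\<^sup>+\<omega>. stays_out (cut J j) \<omega> * ?H \<omega> \<partial>PP y) \<le> ennreal (?g * ?c)" .
    qed
  qed
  also have "\<dots> \<le> ennreal (?g * ?c) * 1" by (intro mult_left_mono) auto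
  also have "?g * ?c = 2 * cutp\<^sup>2 / (lbase J)\<^sup>2 * (1 / (real j * (real k - real j)))"
    using j lbase_pos by (simp add: power2_eq_square field_simps)
  finally show ?thesis by simp
qed

lemma weight_square:
  assumes k: "k \<ge> 1" and x: "x \<noteq> 0" "enorm x < rho J k + 1"
  shows "(\<integral>\<^sup>+\<omega>. weight (\<lambda>_. True) J k \<omega> * weight (\<lambda>_. True) J k \<omega> \<partial>PP x) \<le> ennreal (64 ^ J * (cutp / (real k * lbase J)))"
proof -
  have "(\<integral>\<^sup>+\<omega>. weight (\<lambda>_. True) J k \<omega> * weight (\<lambda>_. True) J k \<omega> \<partial>PP x) \<le> (\<integral>\<^sup>+\<omega>. ennreal (64 ^ J) * weight (\<lambda>_. True) J k \<omega> \<partial>PP x)"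
    by (intro nn_integral_mono mult_right_mono weight_bound) simp
  also have "\<dots> = ennreal (64 ^ J) * (\<integral>\<^sup>+\<omega>. weight (\<lambda>_. True) J k \<omega> \<partial>PP x)" by (rule nn_integral_cmult) measurable
  also have "\<dots> \<le> ennreal (64 ^ J) * (ennreal (cutp / (real k * lbase J)) * 1)"
    by (intro mult_left_mono order_trans[OF weight_upper[OF k x]]) auto
  also have "\<dots> = ennreal (64 ^ J * (cutp / (real k * lbase J)))"
    unfolding mult_1_right by (rule ennreal_mult[symmetric]) (use cutp_pos lbase_pos in auto)
  finally show ?thesis .
qed

end

text \<open>For fixed j the differences k - j run through an initial segment, so the inner sum is at
  most H m / j and the double sum is of order (H m)^2.\<close>

lemma sum_reciprocal_pairs:
  fixes d e :: real
  assumes "d \<ge> 0" "e \<ge> 0"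
  defines "H m \<equiv> (\<Sum>k\<in>{1..m}. 1 / real k)"
  shows "(\<Sum>j\<in>{1..m}. \<Sum>k\<in>{1..m}. if j = k then d * (1 / real k) else e * (1 / (real (min j k) * \<bar>real k - real j\<bar>)))
    \<le> d * H m + 2 * e * (H m)\<^sup>2"
proof -
  let ?I = "{1..m}"
  define f where "f j k = (if j < k then e * (1 / (real j * (real k - real j))) else 0)" for j k :: nat
  have H0: "H m \<ge> 0" unfolding H_def by (intro sum_nonneg) auto
  have inner: "(\<Sum>k\<in>?I. f j k) \<le> e * (1 / real j) * H m" if j: "j \<in> ?I" for j
  proof -
    have "(\<Sum>k\<in>?I. f j k) = (\<Sum>k\<in>{j<..m}. f j k)"
      using j by (intro sum.mono_neutral_right) (auto simp: f_def)
    also have "\<dots> = (\<Sum>k\<in>{j<..m}. e * (1 / real j) * (1 / real (k - j)))"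
      by (intro sum.cong) (auto simp: f_def of_nat_diff)
    also have "\<dots> = e * (1 / real j) * (\<Sum>k\<in>{j<..m}. 1 / real (k - j))" by (simp only: sum_distrib_left)
    also have "\<dots> \<le> e * (1 / real j) * H m"
    proof (rule mult_left_mono)
      have "(\<Sum>k\<in>{j<..m}. 1 / real (k - j)) = (\<Sum>i\<in>{1..m - j}. 1 / real i)"
        by (rule sum.reindex_bij_witness[of _ "\<lambda>i. i + j" "\<lambda>k. k - j"]) auto
      also have "\<dots> \<le> H m" unfolding H_def by (rule sum_mono2) auto
      finally show "(\<Sum>k\<in>{j<..m}. 1 / real (k - j)) \<le> H m" .
    qed (use assms in simp)
    finally show ?thesis .
  qed
  have "(\<Sum>j\<in>?I. \<Sum>k\<in>?I. f j k) \<le> (\<Sum>j\<in>?I. e * (1 / real j) * H m)" by (rule sum_mono) (rule inner)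
  also have "\<dots> = (\<Sum>j\<in>?I. e * (1 / real j)) * H m" by (rule sum_distrib_right[symmetric])
  also have "(\<Sum>j\<in>?I. e * (1 / real j)) = e * H m" unfolding H_def by (rule sum_distrib_left[symmetric])
  finally have half: "(\<Sum>j\<in>?I. \<Sum>k\<in>?I. f j k) \<le> e * (H m)\<^sup>2" by (simp add: power2_eq_square)
  have "(\<Sum>j\<in>?I. \<Sum>k\<in>?I. if j = k then d * (1 / real k) else e * (1 / (real (min j k) * \<bar>real k - real j\<bar>)))
     = (\<Sum>j\<in>?I. \<Sum>k\<in>?I. (if j = k then d * (1 / real k) else 0) + (f j k + f k j))"
    by (intro sum.cong refl) (auto simp: f_def min_def abs_if)
  also have "\<dots> = (\<Sum>j\<in>?I. \<Sum>k\<in>?I. if j = k then d * (1 / real k) else 0) + ((\<Sum>j\<in>?I. \<Sum>k\<in>?I. f j k) + (\<Sum>j\<in>?I. \<Sum>k\<in>?I. f k j))"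
    by (simp only: sum.distrib)
  also have "(\<Sum>j\<in>?I. \<Sum>k\<in>?I. f k j) = (\<Sum>j\<in>?I. \<Sum>k\<in>?I. f j k)" by (rule sum.swap)
  also have "(\<Sum>j\<in>?I. \<Sum>k\<in>?I. if j = k then d * (1 / real k) else 0) = d * H m"
    by (simp add: H_def sum_distrib_left)
  finally show ?thesis using half by linarith
qed

text \<open>Second moment method for the sum of the weights, with u = H / \<open>lbase J\<close> as
  common scale: the mean is at least u/(4 kap), the second moment at most B u^2. The hypothesis on
  \<open>m\<close> bounds the diagonal part, which carries the factor 64^J, by a multiple of
  u^2.\<close>

lemma (in level) cut_event_prob:
  fixes m :: nat
  assumes x: "x \<noteq> 0" "enorm x \<le> base J"
    and clock: "\<And>k. k \<ge> 1 \<Longrightarrow> PR x (\<lambda>\<omega>. \<exists>n\<le>nat \<lceil>1000 * (rho J k)\<^sup>2\<rceil>. enorm (\<omega> !! n) \<ge> rho J k) \<ge> 1 / 2"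
    and m: "64 ^ J * lbase J \<le> (\<Sum>k\<in>{1..m}. 1 / real k)"
  shows "PR x (\<lambda>\<omega>. \<exists>k\<in>{1..m}. weight (\<lambda>l. length l \<le> nat \<lceil>1000 * (rho J k)\<^sup>2\<rceil>) J k \<omega> \<noteq> 0)
    \<ge> 1 / (16 * kap\<^sup>2 * (cutp + 4 * cutp\<^sup>2))"
proof -
  let ?I = "{1..m}"
  define H where "H = (\<Sum>k\<in>?I. 1 / real k)"
  define A where "A k l \<longleftrightarrow> length l \<le> nat \<lceil>1000 * (rho J k)\<^sup>2\<rceil>" for k and l :: "site list"
  define N where "N \<omega> = (\<Sum>k\<in>?I. weight (A k) J k \<omega>)" for \<omega>
  define P where "P = PR x (\<lambda>\<omega>. N \<omega> \<noteq> 0)"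
  have q0: "lbase J > 0" by (rule lbase_pos)
  have H0: "H > 0"
  proof -
    have "0 < 64 ^ J * lbase J" using q0 by simp
    then show ?thesis using m unfolding H_def by linarith
  qed
  have xr: "enorm x < rho J k + 1" if "k \<ge> 1" for k using x rho_ge_base[OF that] by linarith
  define u where "u = H / lbase J"
  define a where "a = 1 / (4 * kap)"
  define B where "B = cutp + 4 * cutp\<^sup>2"
  have pos: "u > 0" "a > 0" "B > 0" using H0 q0 kap_pos cutp_pos by (auto simp: u_def a_def B_def add_pos_pos)
  have Nm[measurable]: "N \<in> borel_measurable SS" unfolding N_def[abs_def] by measurable
  have wfin: "weight (A k) J k \<omega> < \<infinity>" for k \<omega>
    by (rule le_less_trans[OF weight_bound]) simp
  have Nfin: "N \<omega> < \<infinity>" for \<omega> unfolding N_def using wfin by (simp add: less_top)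
  have low: "ennreal (a * u) \<le> (\<integral>\<^sup>+\<omega>. N \<omega> \<partial>PP x)"
  proof -
    have "ennreal (a * u) = (\<Sum>k\<in>?I. ennreal (1 / (2 * kap * real k * lbase J) * (1 / 2)))"
    proof -
      have "a * u = (\<Sum>k\<in>?I. 1 / (2 * kap * real k * lbase J) * (1 / 2))"
        by (simp add: a_def u_def H_def sum_divide_distrib sum_distrib_left field_simps)
      then show ?thesis using kap_pos q0 by (simp add: sum_ennreal)
    qed
    also have "\<dots> \<le> (\<Sum>k\<in>?I. \<integral>\<^sup>+\<omega>. weight (A k) J k \<omega> \<partial>PP x)"
    proof (rule sum_mono)
      fix k assume k: "k \<in> ?I"
      have half: "1 / 2 \<le> PR x (\<lambda>\<omega>. \<exists>n. exits (rho J k) n \<omega> \<and> A k (stake n \<omega>))"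
      proof (rule order_trans[OF clock[of k] PR_mono])
        fix \<omega> :: "site stream" assume "\<exists>n\<le>nat \<lceil>1000 * (rho J k)\<^sup>2\<rceil>. enorm (\<omega> !! n) \<ge> rho J k"
        then obtain n where n: "n \<le> nat \<lceil>1000 * (rho J k)\<^sup>2\<rceil>" "enorm (\<omega> !! n) \<ge> rho J k" by blast
        from exits_exists[OF n(2)] obtain n' where "n' \<le> n" "exits (rho J k) n' \<omega>" by blast
        then show "\<exists>n. exits (rho J k) n \<omega> \<and> A k (stake n \<omega>)" using n(1) by (intro exI[of _ n']) (simp add: A_def)
      qed (use k in simp, measurable)
      have "ennreal (1 / (2 * kap * real k * lbase J) * (1 / 2)) = ennreal (1 / (2 * kap * real k * lbase J)) * ennreal (1 / 2)"
        using kap_pos q0 by (intro ennreal_mult) auto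
      also have "\<dots> \<le> ennreal (1 / (2 * kap * real k * lbase J)) * ennreal (PR x (\<lambda>\<omega>. \<exists>n. exits (rho J k) n \<omega> \<and> A k (stake n \<omega>)))"
        by (intro mult_left_mono ennreal_leI half) simp
      also have "\<dots> \<le> (\<integral>\<^sup>+\<omega>. weight (A k) J k \<omega> \<partial>PP x)" using k by (intro weight_lower x xr) auto
      finally show "ennreal (1 / (2 * kap * real k * lbase J) * (1 / 2)) \<le> (\<integral>\<^sup>+\<omega>. weight (A k) J k \<omega> \<partial>PP x)" .
    qed
    also have "\<dots> = (\<integral>\<^sup>+\<omega>. N \<omega> \<partial>PP x)" unfolding N_def by (rule nn_integral_sum[symmetric]) measurable
    finally show ?thesis .
  qed
  have up: "(\<integral>\<^sup>+\<omega>. N \<omega> * N \<omega> \<partial>PP x) \<le> ennreal (B * u\<^sup>2)"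
  proof -
    let ?w = "\<lambda>k. weight (\<lambda>_. True) J k"
    define d e where "d = 64 ^ J * (cutp / lbase J)" and "e = 2 * cutp\<^sup>2 / (lbase J)\<^sup>2"
    define Mr where "Mr j k = (if j = k then d * (1 / real k) else e * (1 / (real (min j k) * \<bar>real k - real j\<bar>)))" for j k :: nat
    have de: "d \<ge> 0" "e \<ge> 0" using cutp_pos q0 by (auto simp: d_def e_def)
    have Mr0: "Mr j k \<ge> 0" for j k using de by (simp add: Mr_def)
    have pair: "(\<integral>\<^sup>+\<omega>. ?w j \<omega> * ?w k \<omega> \<partial>PP x) \<le> ennreal (Mr j k)" if jk: "j \<in> ?I" "k \<in> ?I" for j k
    proof -
      consider "j = k" | "j < k" | "k < j" by linarith
      then show ?thesis
      proof cases
        case 1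
        have "(\<integral>\<^sup>+\<omega>. ?w j \<omega> * ?w k \<omega> \<partial>PP x) \<le> ennreal (64 ^ J * (cutp / (real k * lbase J)))"
          unfolding 1 using jk by (intro weight_square x xr) auto
        then show ?thesis using 1 by (simp add: Mr_def d_def mult.commute)
      next
        case 2
        have "(\<integral>\<^sup>+\<omega>. ?w j \<omega> * ?w k \<omega> \<partial>PP x) \<le> ennreal (2 * cutp\<^sup>2 / (lbase J)\<^sup>2 * (1 / (real j * (real k - real j))))"
          using jk 2 by (intro weight_pair x xr) auto
        then show ?thesis using 2 by (simp add: Mr_def e_def)
      next
        case 3
        have "(\<integral>\<^sup>+\<omega>. ?w k \<omega> * ?w j \<omega> \<partial>PP x) \<le> ennreal (2 * cutp\<^sup>2 / (lbase J)\<^sup>2 * (1 / (real k * (real j - real k))))"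
          using jk 3 by (intro weight_pair x xr) auto
        then show ?thesis using 3 by (simp add: Mr_def e_def mult.commute)
      qed
    qed
    have "(\<integral>\<^sup>+\<omega>. N \<omega> * N \<omega> \<partial>PP x) \<le> (\<integral>\<^sup>+\<omega>. (\<Sum>j\<in>?I. \<Sum>k\<in>?I. ?w j \<omega> * ?w k \<omega>) \<partial>PP x)"
    proof (rule nn_integral_mono)
      fix \<omega>
      have "weight (A k) J k \<omega> \<le> ?w k \<omega>" for k unfolding weight_def by (rule at_exit_mono) auto
      then have "N \<omega> \<le> (\<Sum>k\<in>?I. ?w k \<omega>)" unfolding N_def by (intro sum_mono)
      then have "N \<omega> * N \<omega> \<le> (\<Sum>k\<in>?I. ?w k \<omega>) * (\<Sum>k\<in>?I. ?w k \<omega>)" by (intro mult_mono) auto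
      then show "N \<omega> * N \<omega> \<le> (\<Sum>j\<in>?I. \<Sum>k\<in>?I. ?w j \<omega> * ?w k \<omega>)" by (simp only: sum_product)
    qed
    also have "\<dots> = (\<Sum>j\<in>?I. \<Sum>k\<in>?I. \<integral>\<^sup>+\<omega>. ?w j \<omega> * ?w k \<omega> \<partial>PP x)"
      by (subst nn_integral_sum, measurable, intro sum.cong refl nn_integral_sum) measurable
    also have "\<dots> \<le> (\<Sum>j\<in>?I. \<Sum>k\<in>?I. ennreal (Mr j k))" by (intro sum_mono pair)
    also have "\<dots> = ennreal (\<Sum>j\<in>?I. \<Sum>k\<in>?I. Mr j k)" using Mr0 by (simp add: sum_ennreal sum_nonneg)
    also have "\<dots> \<le> ennreal (B * u\<^sup>2)"
    proof (rule ennreal_leI)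
      have "(\<Sum>j\<in>?I. \<Sum>k\<in>?I. Mr j k) \<le> d * H + 2 * e * H\<^sup>2"
        unfolding Mr_def H_def by (rule sum_reciprocal_pairs[OF de])
      also have "d * H \<le> cutp * u\<^sup>2"
      proof -
        have "d * H = (64 ^ J * lbase J) * (cutp * H / (lbase J)\<^sup>2)" using q0 by (simp add: d_def power2_eq_square)
        also have "\<dots> \<le> H * (cutp * H / (lbase J)\<^sup>2)" using m cutp_pos H0 by (intro mult_right_mono) (auto simp: H_def)
        also have "\<dots> = cutp * u\<^sup>2" by (simp add: u_def power2_eq_square)
        finally show ?thesis .
      qed
      also have "2 * e * H\<^sup>2 = 4 * cutp\<^sup>2 * u\<^sup>2" by (simp add: e_def u_def power_divide)
      finally show "(\<Sum>j\<in>?I. \<Sum>k\<in>?I. Mr j k) \<le> B * u\<^sup>2" by (simp add: B_def algebra_simps)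
    qed
    finally show ?thesis .
  qed
  \<comment> \<open>With this t the second moment term equals a u, half of the left side, and the
    probability is at least a^2/B, free of J.\<close>
  define t where "t = B / a * u"
  have t: "t > 0" using pos by (simp add: t_def)
  have "ennreal (2 * (a * u)) = 2 * ennreal (a * u)" using pos by (simp add: ennreal_mult)
  also have "\<dots> \<le> 2 * (\<integral>\<^sup>+\<omega>. N \<omega> \<partial>PP x)" by (intro mult_left_mono low) simp
  also have "\<dots> \<le> ennreal t * ennreal P + ennreal (1 / t) * (\<integral>\<^sup>+\<omega>. N \<omega> * N \<omega> \<partial>PP x)"
    unfolding P_def by (rule paley_zygmund_nn[OF Nm Nfin t])
  also have "\<dots> \<le> ennreal t * ennreal P + ennreal (1 / t) * ennreal (B * u\<^sup>2)" by (intro add_left_mono mult_left_mono up) simp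
  also have "\<dots> = ennreal (t * P + 1 / t * (B * u\<^sup>2))"
    using t pos by (simp add: P_def ennreal_plus ennreal_mult[symmetric] del: ennreal_plus[symmetric])
  finally have "2 * (a * u) \<le> t * P + 1 / t * (B * u\<^sup>2)"
    using t pos by (subst (asm) ennreal_le_iff) (auto simp: P_def intro!: add_nonneg_nonneg mult_nonneg_nonneg)
  also have "1 / t * (B * u\<^sup>2) = a * u" using pos by (simp add: t_def power2_eq_square)
  finally have "a * u \<le> (B / a * P) * u" by (simp add: t_def algebra_simps)
  then have "a \<le> B / a * P" using pos(1) by (rule mult_right_le_imp_le)
  then have "a * a / B \<le> P" using pos by (simp add: field_simps)
  moreover have "a * a / B = 1 / (16 * kap\<^sup>2 * (cutp + 4 * cutp\<^sup>2))"
    by (simp add: a_def B_def power2_eq_square)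
  moreover have "N \<omega> \<noteq> 0 \<longleftrightarrow> (\<exists>k\<in>?I. weight (A k) J k \<omega> \<noteq> 0)" for \<omega> unfolding N_def by (subst sum_eq_0_iff) auto
  ultimately show ?thesis unfolding P_def A_def by simp
qed

text \<open>The inner expression bounds ln n for times up to 1002 \<open>rho\<close>^2 at the last
  scale. Two further logarithms leave ln 3 + J ln 64 + ln \<open>lbase J\<close>, and ln 64 \<le> 6
  leaves room below 10 J.\<close>

lemma eventually_ln_ln_clock:
  "\<forall>\<^sub>F J in sequentially. ln (ln (ln 1002 + 2 * (exp (64 ^ J * lbase J) + 1) * lbase J)) \<le> 10 * real J"
proof -
  have "\<forall>\<^sub>F J in sequentially. lbase J \<ge> 11" unfolding lbase_def base_def by real_asymp
  moreover have "\<forall>\<^sub>F J in sequentially. ln 3 + real J * ln 64 + ln (lbase J) \<le> 10 * real J"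
  proof -
    have "ln (64::real) = 6 * ln 2" using ln_realpow[of 2 6] by simp
    then have l: "ln (64::real) \<le> 6" using ln_le_minus_one[of "2::real"] by simp
    have "\<forall>\<^sub>F J in sequentially. ln 3 + real J * 6 + ln (lbase J) \<le> 10 * real J"
      unfolding lbase_def base_def by real_asymp
    then show ?thesis
    proof eventually_elim
      case (elim J)
      have "real J * ln 64 \<le> real J * 6" using l by (rule mult_left_mono) simp
      then show ?case using elim by linarith
    qed
  qed
  ultimately show ?thesis
  proof eventually_elim
    case (elim J)
    let ?q = "lbase J"
    define E where "E = exp (64 ^ J * ?q)"
    have "1 * ?q \<le> 64 ^ J * ?q" using elim by (intro mult_right_mono) auto
    then have qE: "?q \<le> E" using exp_ge_add_one_self[of "64 ^ J * ?q"] unfolding E_def by linarith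
    have E: "E \<ge> 11" using qE elim by linarith
    have l1002: "ln (1002::real) \<le> 10"
    proof -
      have "ln (1002::real) \<le> ln (2 ^ 10)" by (subst ln_le_cancel_iff) auto
      also have "\<dots> = 10 * ln 2" by (simp only: ln_realpow)
      finally show ?thesis using ln_le_minus_one[of "2::real"] by simp
    qed
    have "(E + 1) * ?q \<le> (E + 1) * E" using qE E by (intro mult_left_mono) auto
    then have "2 * (E + 1) * ?q \<le> 2 * E\<^sup>2 + 2 * E" by (simp add: power2_eq_square algebra_simps)
    moreover have "11 * E \<le> E\<^sup>2" using E by (simp add: power2_eq_square)
    ultimately have "ln 1002 + 2 * (E + 1) * ?q \<le> 11 * E\<^sup>2" using l1002 E by linarith
    also have "\<dots> \<le> E * E\<^sup>2" using E by (intro mult_right_mono) auto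
    also have "\<dots> = E ^ 3" by (simp add: power2_eq_square power3_eq_cube)
    finally have up: "ln 1002 + 2 * (E + 1) * ?q \<le> E ^ 3" .
    have low: "exp 1 < ln 1002 + 2 * (E + 1) * ?q"
    proof -
      have "2 * (11 + 1) * 11 \<le> 2 * (E + 1) * ?q" using E elim by (intro mult_mono) auto
      then have "3 < 2 * (E + 1) * ?q" by simp
      moreover have "ln (1002::real) \<ge> 0" by simp
      moreover have "exp (1::real) \<le> 3" by (rule exp_le)
      moreover have "e < l + t" if "3 < t" "l \<ge> 0" "e \<le> 3" for e l t :: real using that by linarith
      ultimately show ?thesis by blast
    qed
    have pos: "ln 1002 + 2 * (E + 1) * ?q > 0" using low exp_gt_zero[of "1::real"] by linarith
    have "ln (exp 1) < ln (ln 1002 + 2 * (E + 1) * ?q)" using low pos by (subst ln_less_cancel_iff) auto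
    then have lpos: "ln (ln 1002 + 2 * (E + 1) * ?q) > 0" by simp
    have "ln (ln 1002 + 2 * (E + 1) * ?q) \<le> ln (E ^ 3)" using up pos E by (subst ln_le_cancel_iff) auto
    also have "\<dots> = 3 * (64 ^ J * ?q)" by (simp add: E_def ln_realpow)
    finally have "ln (ln (ln 1002 + 2 * (E + 1) * ?q)) \<le> ln (3 * (64 ^ J * ?q))"
      using lpos by (subst ln_le_cancel_iff) auto
    also have "\<dots> = ln 3 + real J * ln 64 + ln ?q" using elim by (simp add: ln_mult_pos ln_realpow)
    finally show ?case using elim by (simp add: E_def)
  qed
qed

text \<open>For each large J a success beyond time J has probability at least the same c. These
  events decrease in J, so their intersection still has probability at least c.\<close>

theorem future_min_lower:
  assumes x: "x \<noteq> 0"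
  shows "PR x (\<lambda>\<omega>. \<forall>J. \<exists>n\<ge>J. fmin n \<omega> \<ge> 1 / (404 * cutc) * sqrt (real n * ln (ln (ln (real n))))) > 0"
proof -
  \<comment> \<open>Here 404 = 4 * 101: the crest is at least \<open>rho\<close> sqrt J / 4, and
    1002 * 10 \<le> 101^2 bounds the product of n and the iterated logarithm.\<close>
  define S where "S n = 1 / (404 * cutc) * sqrt (real n * ln (ln (ln (real n))))" for n
  define F where "F J \<omega> \<longleftrightarrow> (\<exists>n\<ge>J. fmin n \<omega> \<ge> S n)" for J \<omega>
  have Fm[measurable]: "Measurable.pred SS (F J)" for J unfolding F_def by measurable
  define c where "c = 1 / (16 * kap\<^sup>2 * (cutp + 4 * cutp\<^sup>2))"
  have c0: "c > 0" using kap_pos cutp_pos by (simp add: c_def add_pos_pos)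
  obtain \<rho>\<^sub>0 where \<rho>0: "\<And>\<rho> n. \<rho> \<ge> \<rho>\<^sub>0 \<Longrightarrow> real n \<ge> 1000 * \<rho>\<^sup>2 \<Longrightarrow> PR x (\<lambda>\<omega>. \<exists>k\<le>n. enorm (\<omega> !! k) \<ge> \<rho>) \<ge> 1 / 2"
    using exit_time_le[OF x] by blast
  have "\<forall>\<^sub>F J in sequentially. J \<ge> 4" by (rule eventually_ge_at_top)
  moreover have "\<forall>\<^sub>F J in sequentially. sqrt (real J) \<ge> 8 * cutc" by real_asymp
  moreover have "\<forall>\<^sub>F J in sequentially. kap * lbase J \<ge> 2000" unfolding lbase_def base_def using kap_pos by real_asymp
  moreover have "\<forall>\<^sub>F J in sequentially. base J \<ge> max \<rho>\<^sub>0 (enorm x)" unfolding base_def by real_asymp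
  moreover note eventually_ln_ln_clock
  ultimately have "\<forall>\<^sub>F J in sequentially. PR x (F J) \<ge> c"
  proof eventually_elim
    case (elim J)
    interpret level J by unfold_locales (use elim in auto)
    define m where "m = nat \<lceil>exp (64 ^ J * lbase J)\<rceil>"
    let ?W = "\<lambda>k. weight (\<lambda>l. length l \<le> nat \<lceil>1000 * (rho J k)\<^sup>2\<rceil>) J k"
    have m1: "real m \<ge> exp (64 ^ J * lbase J)" by (simp add: m_def real_nat_ceiling_ge)
    have m2: "real m \<le> exp (64 ^ J * lbase J) + 1"
    proof -
      have "real m = of_int \<lceil>exp (64 ^ J * lbase J)\<rceil>" by (simp add: m_def)
      then show ?thesis by linarith
    qed
    have "64 ^ J * lbase J = ln (exp (64 ^ J * lbase J))" by simp
    also have "\<dots> \<le> ln (real m + 1)" using m1 by (subst ln_le_cancel_iff) (auto intro: add_pos_nonneg less_le_trans[OF exp_gt_zero])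
    also have "\<dots> \<le> harm m" by (rule ln_le_harm)
    also have "\<dots> = (\<Sum>k\<in>{1..m}. 1 / real k)" by (simp add: harm_def inverse_eq_divide)
    finally have mH: "64 ^ J * lbase J \<le> (\<Sum>k\<in>{1..m}. 1 / real k)" .
    have "c \<le> PR x (\<lambda>\<omega>. \<exists>k\<in>{1..m}. ?W k \<omega> \<noteq> 0)"
      unfolding c_def
    proof (rule cut_event_prob[OF x _ _ mH])
      show "enorm x \<le> base J" using elim by simp
      fix k :: nat assume k: "k \<ge> 1"
      show "1 / 2 \<le> PR x (\<lambda>\<omega>. \<exists>n\<le>nat \<lceil>1000 * (rho J k)\<^sup>2\<rceil>. enorm (\<omega> !! n) \<ge> rho J k)"
        by (rule \<rho>0) (use rho_ge_base[OF k] elim in \<open>auto simp: real_nat_ceiling_ge\<close>)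
    qed
    also have "\<dots> \<le> PR x (F J)"
    proof (rule PR_mono[OF Fm])
      fix \<omega> assume "\<exists>k\<in>{1..m}. ?W k \<omega> \<noteq> 0"
      then obtain k where k: "1 \<le> k" "k \<le> m" "?W k \<omega> \<noteq> 0" by auto
      let ?r = "rho J k"
      obtain n i where ni: "n \<le> nat \<lceil>1000 * ?r\<^sup>2\<rceil>" "i \<le> J * blk J k" "\<And>l. l \<ge> n + i \<Longrightarrow> enorm (\<omega> !! l) > cut J k"
        using weight_pos[OF k(3)] by auto
      have r: "?r \<ge> real J + 2" using rho_ge_base[OF k(1)] base_ge by linarith
      have r1: "?r\<^sup>2 \<ge> ?r" using rho_ge_1[of k] by (simp add: power2_eq_square)
      \<comment> \<open>1000 \<open>rho\<close>^2 for reaching the sphere, one \<open>rho\<close>^2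
        for the J blocks of the run, and one more for rounding.\<close>
      define n' where "n' = nat \<lfloor>1002 * ?r\<^sup>2\<rfloor>"
      have n'u: "real n' \<le> 1002 * ?r\<^sup>2" by (simp add: n'_def)
      have n'l: "real n' \<ge> 1002 * ?r\<^sup>2 - 1" unfolding n'_def by linarith
      have "real n \<le> 1000 * ?r\<^sup>2 + 1"
      proof -
        have "real n \<le> real (nat \<lceil>1000 * ?r\<^sup>2\<rceil>)" using ni(1) by (rule of_nat_mono)
        also have "\<dots> = of_int \<lceil>1000 * ?r\<^sup>2\<rceil>" using r1 by simp
        finally show ?thesis by linarith
      qed
      moreover have "real i \<le> ?r\<^sup>2"
      proof -
        have "real i \<le> real J * real (blk J k)" using ni(2) by (simp flip: of_nat_mult)
        also have "\<dots> \<le> real J * (?r\<^sup>2 / real J)" using blk_facts(2)[OF k(1)] by (intro mult_left_mono) auto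
        also have "\<dots> = ?r\<^sup>2" using J4 by simp
        finally show ?thesis .
      qed
      ultimately have "real (n + i) \<le> real n'" using n'l r r1 by simp
      then have nin: "n + i \<le> n'" by simp
      have "cut J k \<le> fmin n' \<omega>"
        by (rule fmin_ge) (use ni(3) nin in \<open>auto intro: less_imp_le\<close>)
      moreover have "S n' \<le> cut J k"
      proof -
        have n'1: "real n' \<ge> 1001" using n'l r r1 by simp
        have "exp 1 < real n'" using n'1 exp_le by linarith
        then have "ln (exp 1) < ln (real n')" using n'1 by (subst ln_less_cancel_iff) auto
        then have l1: "ln (real n') > 1" by simp
        then have l2: "ln (ln (real n')) > 0" by simp
        have "ln (real n') \<le> ln (1002 * ?r\<^sup>2)" using n'u n'1 by (subst ln_le_cancel_iff) auto
        also have "\<dots> = ln 1002 + 2 * ln ?r"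
          using rho_ge_1[of k] by (simp add: ln_mult_pos ln_realpow)
        also have "2 * ln ?r \<le> 2 * (exp (64 ^ J * lbase J) + 1) * lbase J"
        proof -
          have "real k * lbase J \<le> (exp (64 ^ J * lbase J) + 1) * lbase J"
            using k(2) m2 lbase_pos by (intro mult_right_mono) auto
          then show ?thesis unfolding ln_rho by linarith
        qed
        finally have "ln (real n') \<le> ln 1002 + 2 * (exp (64 ^ J * lbase J) + 1) * lbase J" by simp
        then have "ln (ln (real n')) \<le> ln (ln 1002 + 2 * (exp (64 ^ J * lbase J) + 1) * lbase J)"
          using l1 by (subst ln_le_cancel_iff) linarith+
        then have "ln (ln (ln (real n'))) \<le> ln (ln (ln 1002 + 2 * (exp (64 ^ J * lbase J) + 1) * lbase J))"
          using l2 by (subst ln_le_cancel_iff) linarith+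
        then have l3: "ln (ln (ln (real n'))) \<le> 10 * real J" using elim by linarith
        have "real n' * ln (ln (ln (real n'))) \<le> real n' * (10 * real J)" using l3 by (rule mult_left_mono) simp
        also have "\<dots> \<le> (1002 * ?r\<^sup>2) * (10 * real J)" using n'u by (intro mult_right_mono) auto
        also have "\<dots> \<le> (101 * ?r)\<^sup>2 * real J" by (simp add: power2_eq_square)
        finally have "sqrt (real n' * ln (ln (ln (real n')))) \<le> sqrt ((101 * ?r)\<^sup>2 * real J)" by (rule real_sqrt_le_mono)
        also have "\<dots> = 101 * ?r * sqrt (real J)" using rho_ge_1[of k] by (simp add: real_sqrt_mult)
        also have "\<dots> \<le> 404 * crest J k" using crest_facts(3)[OF k(1)] by (simp add: mult.commute)
        finally have "S n' \<le> 1 / (404 * cutc) * (404 * crest J k)"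
          unfolding S_def using cutc_gt_1 by (intro mult_left_mono) auto
        then show ?thesis by (simp add: cut_def)
      qed
      ultimately have "S n' \<le> fmin n' \<omega>" by linarith
      moreover have "n' \<ge> J" using n'l r r1 by simp
      ultimately show "F J \<omega>" unfolding F_def by blast
    qed
    finally show ?case .
  qed
  then obtain J\<^sub>1 where J1: "\<And>J. J \<ge> J\<^sub>1 \<Longrightarrow> PR x (F J) \<ge> c" unfolding eventually_sequentially by blast
  have "decseq (\<lambda>J. {\<omega>. F J \<omega>})" unfolding decseq_def F_def by (auto intro: order_trans)
  then have "(\<lambda>J. PR x (F J)) \<longlonglongrightarrow> measure (PP x) (\<Inter>J. {\<omega>. F J \<omega>})"
    by (intro PP.finite_Lim_measure_decseq) (auto intro: sets_Collect_SS)
  then have "c \<le> measure (PP x) (\<Inter>J. {\<omega>. F J \<omega>})" by (rule LIMSEQ_le_const) (use J1 in blast)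
  also have "(\<Inter>J. {\<omega>. F J \<omega>}) = {\<omega>. \<forall>J. F J \<omega>}" by auto
  finally show ?thesis using c0 unfolding F_def S_def by linarith
qed

subsection \<open>The limsup\<close>

lemma PR_eq_1: "Measurable.pred SS E \<Longrightarrow> PR x E = 1 \<longleftrightarrow> (AE \<omega> in PP x. E \<omega>)"
  using PP.prob_Collect_eq_1[where P = E and x = x] by (simp add: sets_Collect_SS)

lemma PR_eq_0: "Measurable.pred SS E \<Longrightarrow> PR x E = 0 \<longleftrightarrow> (AE \<omega> in PP x. \<not> E \<omega>)"
  using PP.prob_Collect_eq_0[where P = E and x = x] by (simp add: sets_Collect_SS)

text \<open>For small n the iterated logarithm gives junk values; only the eventual positivity in
  \<open>lnln_scale_pos\<close> is used.\<close>

definition lnln_scale :: "nat \<Rightarrow> real" where "lnln_scale n = sqrt (real n * ln (ln (ln (real n))))"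

definition future_ratio :: "site stream \<Rightarrow> ereal" where
  "future_ratio \<omega> = limsup (\<lambda>n. ereal (fmin n \<omega> / lnln_scale n))"

lemma measurable_future_ratio [measurable]: "future_ratio \<in> borel_measurable SS"
  unfolding future_ratio_def[abs_def] by measurable

lemma lnln_scale_pos: "\<forall>\<^sub>F n in sequentially. lnln_scale n > 0"
  unfolding lnln_scale_def by real_asymp

lemma lnln_scale_shift: "(\<lambda>n. lnln_scale (n + k) / lnln_scale n) \<longlonglongrightarrow> 1"
  unfolding lnln_scale_def of_nat_add by real_asymp

text \<open>A shift moves the index of the minimum from n to n + k but not that of the scale; the
  ratio of the two scales tends to 1.\<close>

lemma future_ratio_sdrop: "future_ratio (sdrop k \<omega>) = future_ratio \<omega>"
proof -
  let ?s = lnln_scale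
  have "\<forall>\<^sub>F n in sequentially. ?s (n + k) > 0"
    using eventually_all_ge_at_top[OF lnln_scale_pos] by eventually_elim simp
  then have "future_ratio (sdrop k \<omega>)
    = limsup (\<lambda>n. ereal (?s (n + k) / ?s n) * ereal (fmin (n + k) \<omega> / ?s (n + k)))"
    unfolding future_ratio_def fmin_sdrop by (intro Limsup_eq) (auto elim: eventually_mono)
  also have "\<dots> = 1 * limsup (\<lambda>n. ereal (fmin (n + k) \<omega> / ?s (n + k)))"
    by (rule ereal_limsup_lim_mult) (use lnln_scale_shift in \<open>auto simp: one_ereal_def\<close>)
  also have "\<dots> = future_ratio \<omega>"
    using limsup_shift_k[of "\<lambda>n. ereal (fmin n \<omega> / ?s n)" k] by (simp add: future_ratio_def)
  finally show ?thesis .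
qed

lemma future_ratio_le:
  assumes x: "x \<noteq> 0"
  shows "AE \<omega> in PP x. future_ratio \<omega> \<le> ereal 8"
  using future_min_upper[OF x]
proof eventually_elim
    case (elim \<omega>)
    then have "\<forall>\<^sub>F n in sequentially. ereal (fmin n \<omega> / lnln_scale n) \<le> ereal 8"
      using lnln_scale_pos by eventually_elim (simp add: lnln_scale_def pos_divide_le_eq)
    then show ?case unfolding future_ratio_def by (rule Limsup_bounded)
qed

lemma future_ratio_not_small:
  assumes x: "x \<noteq> 0" and c: "c < 1 / (404 * cutc)"
  shows "PR x (\<lambda>\<omega>. future_ratio \<omega> \<le> ereal c) \<noteq> 1"
proof
  assume one: "PR x (\<lambda>\<omega>. future_ratio \<omega> \<le> ereal c) = 1"
  let ?A = "\<lambda>\<omega>. \<forall>J. \<exists>n\<ge>J. fmin n \<omega> \<ge> 1 / (404 * cutc) * lnln_scale n"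
  have sub: "\<not> future_ratio \<omega> \<le> ereal c" if "?A \<omega>" for \<omega>
  proof
    assume le: "future_ratio \<omega> \<le> ereal c"
    also have "ereal c < ereal (1 / (404 * cutc))" using c by simp
    finally have "\<forall>\<^sub>F n in sequentially. ereal (fmin n \<omega> / lnln_scale n) < ereal (1 / (404 * cutc))"
      unfolding future_ratio_def by (rule Limsup_lessD)
    then have "\<forall>\<^sub>F n in sequentially. fmin n \<omega> < 1 / (404 * cutc) * lnln_scale n"
      using lnln_scale_pos by eventually_elim (simp add: pos_divide_less_eq)
    then show False using that unfolding eventually_sequentially by (meson not_le)
  qed
  have "AE \<omega> in PP x. future_ratio \<omega> \<le> ereal c"
    using one by (simp add: PR_eq_1)
  then have "AE \<omega> in PP x. \<not> ?A \<omega>" by eventually_elim (use sub in blast)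
  then have "PR x ?A = 0" by (subst PR_eq_0) measurable
  then show False using future_min_lower[OF x] by (simp add: lnln_scale_def)
qed

text \<open>K is the infimum of the levels that almost surely bound the limsup. The levels are
  tested at one starting site, and the zero-one law transfers each verdict to all others, so K does
  not depend on the start.\<close>

theorem future_ratio_constant:
  obtains K where "K > 0" "\<And>x. x \<noteq> 0 \<Longrightarrow> AE \<omega> in PP x. future_ratio \<omega> = ereal K"
proof -
  let ?E = "\<lambda>c \<omega>. future_ratio \<omega> \<le> ereal c"
  define o1 :: site where "o1 = (1, 0)"
  have o1: "o1 \<noteq> 0" by (simp add: o1_def zero_prod_def)
  define C where "C = {c. PR o1 (?E c) = 1}"
  have zero_one: "(\<forall>x. x \<noteq> 0 \<longrightarrow> PR x (?E c) = 0) \<or> (\<forall>x. x \<noteq> 0 \<longrightarrow> PR x (?E c) = 1)" for c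
    by (rule invariant_zero_one) (auto simp: future_ratio_sdrop)
  have C8: "8 \<in> C" using future_ratio_le[OF o1] unfolding C_def by (simp add: PR_eq_1)
  have Cl: "c \<ge> 1 / (404 * cutc)" if "c \<in> C" for c
    using future_ratio_not_small[OF o1, of c] that by (force simp: C_def)
  have bdd: "bdd_below C" using Cl by (rule bdd_belowI)
  define K where "K = Inf C"
  have "1 / (404 * cutc) \<le> K" unfolding K_def using C8 Cl by (intro cInf_greatest) auto
  then have "K > 0" using cutc_gt_1 by (smt (verit) divide_pos_pos)
  moreover have "AE \<omega> in PP x. future_ratio \<omega> = ereal K" if x: "x \<noteq> 0" for x
  proof -
    have "AE \<omega> in PP x. ?E (K + 1 / real (Suc n)) \<omega>" for n
    proof -
      have "Inf C < K + 1 / real (Suc n)" by (simp add: K_def)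
      then obtain c where c: "c \<in> C" "c < K + 1 / real (Suc n)" using C8 by (subst (asm) cInf_less_iff[OF _ bdd]) auto
      then have "PR x (?E c) = 1" using zero_one[of c] o1 x unfolding C_def mem_Collect_eq by (metis zero_neq_one)
      then have "AE \<omega> in PP x. ?E c \<omega>" by (simp add: PR_eq_1)
      then show ?thesis
      proof eventually_elim
        case (elim \<omega>)
        also have "ereal c \<le> ereal (K + 1 / real (Suc n))" using c(2) by simp
        finally show ?case .
      qed
    qed
    moreover have "AE \<omega> in PP x. \<not> ?E (K - 1 / real (Suc n)) \<omega>" for n
    proof -
      have "K - 1 / real (Suc n) \<notin> C"
      proof
        assume "K - 1 / real (Suc n) \<in> C"
        then have "K \<le> K - 1 / real (Suc n)" unfolding K_def by (rule cInf_lower[OF _ bdd])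
        moreover have "1 / real (Suc n) > 0" by simp
        ultimately show False by linarith
      qed
      then have "PR x (?E (K - 1 / real (Suc n))) = 0" using zero_one[of "K - 1 / real (Suc n)"] o1 x unfolding C_def mem_Collect_eq by metis
      then show ?thesis by (simp add: PR_eq_0)
    qed
    ultimately have "AE \<omega> in PP x. \<forall>n. ?E (K + 1 / real (Suc n)) \<omega> \<and> \<not> ?E (K - 1 / real (Suc n)) \<omega>"
      by (simp add: AE_all_countable)
    then show ?thesis
    proof eventually_elim
      case (elim \<omega>)
      obtain r where r: "future_ratio \<omega> = ereal r" using elim[rule_format, of 0] by (cases "future_ratio \<omega>") auto
      have "\<bar>r - K\<bar> \<le> 1 / real (Suc n)" for n using elim[rule_format, of n] unfolding r ereal_less_eq by linarith
      moreover have "(\<lambda>n. 1 / real (Suc n)) \<longlonglongrightarrow> 0" by real_asymp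
      ultimately have "\<bar>r - K\<bar> \<le> 0" by (intro LIMSEQ_le_const[of _ 0]) auto
      then show ?case by (simp add: r)
    qed
  qed
  ultimately show ?thesis by (rule that)
qed

lemma future_min_stream: "future_min S n \<omega> = fmin n (to_stream (\<lambda>n. S n \<omega>))"
  by (simp add: future_min_def fmin_def to_stream_def)

lemma walk_AE:
  assumes walk: "conditioned_walk_from x\<^sub>0 M S" and x0: "x\<^sub>0 \<noteq> 0" and E: "AE \<omega> in PP x\<^sub>0. E \<omega>"
  shows "AE \<omega> in M. E (to_stream (\<lambda>n. S n \<omega>))"
  using E unfolding walk_law(1)[OF walk x0, symmetric] by (rule AE_distrD[OF walk_law(2)[OF walk x0]])

text \<open>K is bound before the walk and its start, which expresses both constancy and
  independence of the starting point. The events concern only the path, whose law is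
  \<open>PP\<close>, so the path-space theorems transfer through \<open>walk_AE\<close>.\<close>

theorem theorem1:
  "(\<forall>x\<^sub>0 (M :: 'w measure) S. x\<^sub>0 \<noteq> 0 \<longrightarrow> conditioned_walk_from x\<^sub>0 M S \<longrightarrow>
      (\<forall>g :: real \<Rightarrow> real.
         (\<forall>u\<ge>0. g u \<ge> 0) \<longrightarrow>
         antimono_on {0..} g \<longrightarrow>
         mono_on {exp 1<..} (\<lambda>t. ln t * g (ln (ln t))) \<longrightarrow>
         (integral_converges_at_top g \<longrightarrow>
            \<P>(\<omega> in M. \<exists>\<^sub>\<infinity>n. future_min S n \<omega> \<le> exp (ln (real n) * g (ln (ln (real n))))) = 0) \<and>
         (integral_diverges_at_top g \<longrightarrow>
            \<P>(\<omega> in M. \<exists>\<^sub>\<infinity>n. future_min S n \<omega> \<le> exp (ln (real n) * g (ln (ln (real n))))) = 1))) \<and>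
   (\<exists>K :: real. 0 < K \<and>
      (\<forall>x\<^sub>0 (M :: 'w measure) S. x\<^sub>0 \<noteq> 0 \<longrightarrow> conditioned_walk_from x\<^sub>0 M S \<longrightarrow>
         (AE \<omega> in M.
            limsup (\<lambda>n. ereal (future_min S n \<omega> / sqrt (real n * ln (ln (ln (real n)))))) = ereal K)))"
proof (intro conjI allI impI)
  fix x\<^sub>0 and M :: "'w measure" and S and g :: "real \<Rightarrow> real"
  assume x0: "x\<^sub>0 \<noteq> 0" and walk: "conditioned_walk_from x\<^sub>0 M S"
    and g: "\<forall>u\<ge>0. g u \<ge> 0" "antimono_on {0..} g" "mono_on {exp 1<..} (\<lambda>t. ln t * g (ln (ln t)))"
  interpret M: prob_space M by (rule walk_law(3)[OF walk x0])
  note [measurable] = walk_law(2)[OF walk x0]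
  define E where "E \<omega> \<longleftrightarrow> (\<exists>\<^sub>\<infinity>n. fmin n \<omega> \<le> exp (ln (real n) * g (ln (ln (real n)))))" for \<omega>
  have [measurable]: "Measurable.pred SS E" unfolding E_def INFM_nat_le by measurable
  have sets: "{\<omega> \<in> space M. E (to_stream (\<lambda>n. S n \<omega>))} \<in> sets M" by measurable
  show "\<P>(\<omega> in M. \<exists>\<^sub>\<infinity>n. future_min S n \<omega> \<le> exp (ln (real n) * g (ln (ln (real n))))) = 0"
    if "integral_converges_at_top g"
  proof -
    have "AE \<omega> in PP x\<^sub>0. \<not> E \<omega>"
      unfolding E_def by (rule future_min_rarely_small[OF x0 _ g(2) that]) (use g(1) in auto)
    from walk_AE[OF walk x0 this] show ?thesis
      unfolding future_min_stream E_def[symmetric] by (simp add: M.prob_Collect_eq_0[OF sets])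
  qed
  show "\<P>(\<omega> in M. \<exists>\<^sub>\<infinity>n. future_min S n \<omega> \<le> exp (ln (real n) * g (ln (ln (real n))))) = 1"
    if "integral_diverges_at_top g"
  proof -
    have "AE \<omega> in PP x\<^sub>0. E \<omega>"
      unfolding E_def by (rule future_min_often_small[OF x0 _ g(2,3) that]) (use g(1) in auto)
    from walk_AE[OF walk x0 this] show ?thesis
      unfolding future_min_stream E_def[symmetric] by (simp add: M.prob_Collect_eq_1[OF sets])
  qed
next
  obtain K where K: "K > 0" "\<And>x. x \<noteq> 0 \<Longrightarrow> AE \<omega> in PP x. future_ratio \<omega> = ereal K"
    using future_ratio_constant by blast
  show "\<exists>K :: real. 0 < K \<and>
      (\<forall>x\<^sub>0 (M :: 'w measure) S. x\<^sub>0 \<noteq> 0 \<longrightarrow> conditioned_walk_from x\<^sub>0 M S \<longrightarrow>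
         (AE \<omega> in M.
            limsup (\<lambda>n. ereal (future_min S n \<omega> / sqrt (real n * ln (ln (ln (real n)))))) = ereal K))"
  proof (intro exI[of _ K] conjI allI impI K(1))
    fix x\<^sub>0 and M :: "'w measure" and S
    assume x0: "x\<^sub>0 \<noteq> 0" and walk: "conditioned_walk_from x\<^sub>0 M S"
    show "AE \<omega> in M. limsup (\<lambda>n. ereal (future_min S n \<omega> / sqrt (real n * ln (ln (ln (real n)))))) = ereal K"
      using walk_AE[OF walk x0 K(2)[OF x0]] by (simp add: future_min_stream future_ratio_def lnln_scale_def)
  qed
qed

end
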